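(* Let $F_2$ be the closed oriented surface of genus two. The $SU(2)$ character variety $\chi(F_2)=\operatorname{Hom}(\pi_1(F_2),SU(2))/\text{conjugation}$ is homeomorphic to $\mathbb{C}P^3$.
   Context: $\operatorname{Hom}(\pi_1(F_2),SU(2))$ is topologized as a subspace of $SU(2)^4$ via evaluation on the four standard generators of $\pi_1(F_2)$, and $\chi(F_2)$ carries the quotient topology. *)

theory Defs
  imports "HOL-Analysis.Analysis" "HOL-Algebra.Group"
begin

section \<open>Quotient spaces\<close>

definition quotient_topology :: "'a topology \<Rightarrow> ('a \<times> 'a) set \<Rightarrow> 'a set topology" where
  "quotient_topology X R =
     topology (\<lambda>U. U \<subseteq> topspace X // R \<and> openin X {x \<in> topspace X. R `` {x} \<in> U})"

lemma openin_quotient_topology: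
  "openin (quotient_topology X R) U \<longleftrightarrow>
     U \<subseteq> topspace X // R \<and> openin X {x \<in> topspace X. R `` {x} \<in> U}"
proof -
  have "istopology (\<lambda>U. U \<subseteq> topspace X // R \<and> openin X {x \<in> topspace X. R `` {x} \<in> U})"
    unfolding istopology_def
  proof (intro conjI allI impI, goal_cases)
    case (1 S T)
    then show ?case by auto
  next
    case (2 S T)
    have "{x \<in> topspace X. R `` {x} \<in> S \<inter> T} =
          {x \<in> topspace X. R `` {x} \<in> S} \<inter> {x \<in> topspace X. R `` {x} \<in> T}"
      by auto
    then show ?case using 2 by auto
  next
    case (3 K)
    then show ?case by blast
  next
    case (4 K)
    have "{x \<in> topspace X. R `` {x} \<in> \<Union> K} = (\<Union>U\<in>K. {x \<in> topspace X. R `` {x} \<in> U})"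
      by auto
    then show ?case using 4 by auto
  qed
  then show ?thesis
    unfolding quotient_topology_def by (simp add: topology_inverse')
qed

lemma topspace_quotient_topology: "topspace (quotient_topology X R) = topspace X // R"
proof
  show "topspace (quotient_topology X R) \<subseteq> topspace X // R"
    using openin_topspace[of "quotient_topology X R"] unfolding openin_quotient_topology by blast
  have "{x \<in> topspace X. R `` {x} \<in> topspace X // R} = topspace X"
    by (auto intro: quotientI)
  then have "openin (quotient_topology X R) (topspace X // R)"
    by (simp add: openin_quotient_topology)
  then show "topspace X // R \<subseteq> topspace (quotient_topology X R)"
    by (rule openin_subset)
qed

lemma quotient_map_quotient_topology:
  "quotient_map X (quotient_topology X R) (\<lambda>x. R `` {x})"
  unfolding quotient_map_def topspace_quotient_topology openin_quotient_topology
  by (auto simp: quotient_def)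


section \<open>The fundamental group\<close>

definition loops :: "'a topology \<Rightarrow> 'a \<Rightarrow> (real \<Rightarrow> 'a) set" where
  "loops X x0 = {p. pathin X p \<and> p 0 = x0 \<and> p 1 = x0}"

definition loop_homotopy :: "'a topology \<Rightarrow> 'a \<Rightarrow> ((real \<Rightarrow> 'a) \<times> (real \<Rightarrow> 'a)) set" where
  "loop_homotopy X x0 =
     {(p, q). p \<in> loops X x0 \<and> q \<in> loops X x0 \<and>
        homotopic_with (\<lambda>r. r 0 = x0 \<and> r 1 = x0) (top_of_set {0..1}) X p q}"

text \<open>The library's \<open>joinpaths\<close>, without its type class constraint, which \<open>complex set\<close> does not
  satisfy.\<close>

definition path_concat :: "(real \<Rightarrow> 'a) \<Rightarrow> (real \<Rightarrow> 'a) \<Rightarrow> real \<Rightarrow> 'a" where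
  "path_concat p q = (\<lambda>t. if t \<le> 1/2 then p (2 * t) else q (2 * t - 1))"

definition fundamental_group :: "'a topology \<Rightarrow> 'a \<Rightarrow> (real \<Rightarrow> 'a) set monoid" where
  "fundamental_group X x0 =
     \<lparr>carrier = loops X x0 // loop_homotopy X x0,
      mult = (\<lambda>A B. \<Union>p\<in>A. \<Union>q\<in>B. loop_homotopy X x0 `` {path_concat p q}),
      one = loop_homotopy X x0 `` {\<lambda>t. x0}\<rparr>"

lemma equiv_loop_homotopy: "equiv (loops X x0) (loop_homotopy X x0)"
proof (rule equivI)
  show "loop_homotopy X x0 \<subseteq> loops X x0 \<times> loops X x0"
    by (auto simp: loop_homotopy_def)
  show "refl_on (loops X x0) (loop_homotopy X x0)"
    by (auto simp: refl_on_def loop_homotopy_def loops_def pathin_def)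
  show "sym (loop_homotopy X x0)"
    unfolding sym_def loop_homotopy_def by (auto intro: homotopic_with_symD)
  show "trans (loop_homotopy X x0)"
    unfolding trans_def loop_homotopy_def by (auto intro: homotopic_with_trans)
qed


section \<open>The closed oriented surface of genus two\<close>

text \<open>The closed unit disc is regarded as an octagon whose edges, in counterclockwise order, are the
  eight arcs \<open>octagon_edge 0, \<dots>, octagon_edge 7\<close> of the unit circle, glued
  according to the boundary word
  \<open>a\<^sub>1 b\<^sub>1 a\<^sub>1\<inverse> b\<^sub>1\<inverse> a\<^sub>2 b\<^sub>2 a\<^sub>2\<inverse> b\<^sub>2\<inverse>\<close>.
  All eight vertices become one point, which serves as the base point.\<close>

definition octagon_edge :: "nat \<Rightarrow> real \<Rightarrow> complex" where
  "octagon_edge k t = cis (pi * (real k + t) / 4)"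

definition octagon_gluing :: "complex \<Rightarrow> complex \<Rightarrow> bool" where
  "octagon_gluing z w \<longleftrightarrow>
     (\<exists>k\<in>{0, 1, 4, 5}. \<exists>t\<in>{0..1}. z = octagon_edge k t \<and> w = octagon_edge (k + 2) (1 - t))"

definition octagon_rel :: "(complex \<times> complex) set" where
  "octagon_rel = {(z, w). z \<in> cball 0 1 \<and> w \<in> cball 0 1 \<and> equivclp octagon_gluing z w}"

lemma equiv_octagon_rel: "equiv (cball 0 1) octagon_rel"
  by (rule equivI)
    (auto simp: octagon_rel_def refl_on_def sym_def trans_def
      intro: equivclp_refl equivclp_sym equivclp_trans)

definition F2 :: "complex set topology" where
  "F2 = quotient_topology (top_of_set (cball 0 1)) octagon_rel"

definition F2_base :: "complex set" where
  "F2_base = octagon_rel `` {octagon_edge 0 0}"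

definition pi1_F2 :: "(real \<Rightarrow> complex set) set monoid" where
  "pi1_F2 = fundamental_group F2 F2_base"

definition edge_class :: "nat \<Rightarrow> (real \<Rightarrow> complex set) set" where
  "edge_class k = loop_homotopy F2 F2_base `` {\<lambda>t. octagon_rel `` {octagon_edge k t}}"

definition a1 where "a1 = edge_class 0"
definition b1 where "b1 = edge_class 1"
definition a2 where "a2 = edge_class 4"
definition b2 where "b2 = edge_class 5"

lemma octagon_vertices: "octagon_rel `` {octagon_edge k 0} = F2_base" if "k \<le> 8"
proof -
  have glue: "octagon_rel `` {octagon_edge k t} = octagon_rel `` {octagon_edge (k + 2) (1 - t)}"
    if "k \<in> {0, 1, 4, 5}" "t \<in> {0..1}" for k t
  proof -
    have "octagon_gluing (octagon_edge k t) (octagon_edge (k + 2) (1 - t))"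
      using that unfolding octagon_gluing_def by blast
    then have "(octagon_edge k t, octagon_edge (k + 2) (1 - t)) \<in> octagon_rel"
      by (auto simp: octagon_rel_def octagon_edge_def intro: r_into_equivclp)
    then show ?thesis by (rule equiv_class_eq[OF equiv_octagon_rel])
  qed
  have next_vertex: "octagon_edge k 1 = octagon_edge (Suc k) 0" for k
    by (simp add: octagon_edge_def add.commute)
  let ?v = "\<lambda>k. octagon_rel `` {octagon_edge k 0}"
  have "?v k = ?v (k + 3)" "?v (k + 1) = ?v (k + 2)" if "k \<in> {0, 1, 4, 5}" for k
    using glue[OF that, of 0] glue[OF that, of 1] next_vertex[of k] next_vertex[of "k + 2"]
    by (simp_all add: eval_nat_numeral)
  from this[of 0] this[of 1] this[of 4] this[of 5]
  have "?v 0 = ?v 3" "?v 1 = ?v 2" "?v 1 = ?v 4" "?v 2 = ?v 3"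
    "?v 4 = ?v 7" "?v 5 = ?v 6" "?v 5 = ?v 8" "?v 6 = ?v 7"
    by (simp_all add: eval_nat_numeral)
  moreover have "k \<in> {0, 1, 2, 3, 4, 5, 6, 7, 8}"
    using that by auto
  ultimately show ?thesis
    unfolding F2_base_def by auto
qed

lemma edge_class_in_carrier: "edge_class k \<in> carrier pi1_F2" if "k < 8"
proof -
  have "continuous_map (top_of_set {0..1}) (top_of_set (cball 0 1)) (octagon_edge k)"
    unfolding octagon_edge_def by (auto intro!: continuous_intros)
  from continuous_map_compose[OF this quotient_imp_continuous_map[OF quotient_map_quotient_topology]]
  have "pathin F2 (\<lambda>t. octagon_rel `` {octagon_edge k t})"
    by (simp add: pathin_def F2_def o_def)
  moreover have "octagon_edge k 1 = octagon_edge (Suc k) 0"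
    by (simp add: octagon_edge_def add.commute)
  ultimately have "(\<lambda>t. octagon_rel `` {octagon_edge k t}) \<in> loops F2 F2_base"
    using octagon_vertices[of k] octagon_vertices[of "Suc k"] that by (simp add: loops_def)
  then show ?thesis
    by (auto simp: edge_class_def pi1_F2_def fundamental_group_def intro: quotientI)
qed


section \<open>The group \<open>SU(2)\<close>\<close>

definition adjoint_matrix :: "complex^'n^'m \<Rightarrow> complex^'m^'n" where
  "adjoint_matrix A = (\<chi> i j. cnj (A $ j $ i))"

definition SU2 :: "(complex^2^2) monoid" where
  "SU2 = \<lparr>carrier = {A. A ** adjoint_matrix A = mat 1 \<and> adjoint_matrix A ** A = mat 1 \<and> det A = 1},
          mult = (**), one = mat 1\<rparr>"

definition SU2_top :: "(complex^2^2) topology" where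
  "SU2_top = top_of_set (carrier SU2)"

lemma adjoint_matrix_mult: "adjoint_matrix (A ** B) = adjoint_matrix B ** adjoint_matrix A"
  by (simp add: adjoint_matrix_def matrix_matrix_mult_def vec_eq_iff mult.commute)

lemma adjoint_matrix_adjoint_matrix: "adjoint_matrix (adjoint_matrix A) = A"
  by (simp add: adjoint_matrix_def vec_eq_iff)

lemma adjoint_matrix_mat_1: "adjoint_matrix (mat 1) = mat 1"
  by (simp add: adjoint_matrix_def mat_def vec_eq_iff)

lemma group_SU2: "group SU2"
proof (rule groupI)
  fix A B
  assume AB: "A \<in> carrier SU2" "B \<in> carrier SU2"
  have "(A ** B) ** (adjoint_matrix B ** adjoint_matrix A) =
        A ** (B ** adjoint_matrix B) ** adjoint_matrix A"
    "(adjoint_matrix B ** adjoint_matrix A) ** (A ** B) =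
        adjoint_matrix B ** (adjoint_matrix A ** A) ** B"
    by (simp_all add: matrix_mul_assoc)
  then show "A \<otimes>\<^bsub>SU2\<^esub> B \<in> carrier SU2"
    using AB by (simp add: SU2_def adjoint_matrix_mult det_mul)
next
  fix A
  assume A: "A \<in> carrier SU2"
  have "det A * det (adjoint_matrix A) = det (A ** adjoint_matrix A)"
    by (simp add: det_mul)
  then have "det (adjoint_matrix A) = 1"
    using A by (simp add: SU2_def)
  then show "\<exists>B\<in>carrier SU2. B \<otimes>\<^bsub>SU2\<^esub> A = \<one>\<^bsub>SU2\<^esub>"
    using A by (intro bexI[of _ "adjoint_matrix A"])
      (auto simp: SU2_def adjoint_matrix_adjoint_matrix)
qed (auto simp: SU2_def adjoint_matrix_mat_1 matrix_mul_assoc)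


section \<open>The character variety\<close>

text \<open>The library's \<open>hom\<close> leaves values outside the carrier unspecified, so homomorphisms are
  normalised by \<open>extensional\<close> there.\<close>

definition Rep_F2 :: "((real \<Rightarrow> complex set) set \<Rightarrow> complex^2^2) set" where
  "Rep_F2 = hom pi1_F2 SU2 \<inter> extensional (carrier pi1_F2)"

definition Rep_F2_top :: "((real \<Rightarrow> complex set) set \<Rightarrow> complex^2^2) topology" where
  "Rep_F2_top =
     pullback_topology Rep_F2 (\<lambda>\<rho>. (\<rho> a1, \<rho> b1, \<rho> a2, \<rho> b2))
       (prod_topology SU2_top (prod_topology SU2_top (prod_topology SU2_top SU2_top)))"

definition conjugation_rel ::
  "(((real \<Rightarrow> complex set) set \<Rightarrow> complex^2^2) \<times> ((real \<Rightarrow> complex set) set \<Rightarrow> complex^2^2)) set" where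
  "conjugation_rel =
     {(\<rho>, \<sigma>). \<rho> \<in> Rep_F2 \<and> \<sigma> \<in> Rep_F2 \<and>
        (\<exists>g\<in>carrier SU2. \<forall>x\<in>carrier pi1_F2. \<sigma> x = g \<otimes>\<^bsub>SU2\<^esub> \<rho> x \<otimes>\<^bsub>SU2\<^esub> inv\<^bsub>SU2\<^esub> g)}"

definition char_variety_F2 :: "((real \<Rightarrow> complex set) set \<Rightarrow> complex^2^2) set topology" where
  "char_variety_F2 = quotient_topology Rep_F2_top conjugation_rel"

lemma topspace_Rep_F2_top: "topspace Rep_F2_top = Rep_F2"
proof -
  have "a1 \<in> carrier pi1_F2" "b1 \<in> carrier pi1_F2" "a2 \<in> carrier pi1_F2" "b2 \<in> carrier pi1_F2"
    unfolding a1_def b1_def a2_def b2_def by (simp_all add: edge_class_in_carrier)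
  then have "Rep_F2 \<subseteq> (\<lambda>\<rho>. (\<rho> a1, \<rho> b1, \<rho> a2, \<rho> b2)) -`
      (carrier SU2 \<times> carrier SU2 \<times> carrier SU2 \<times> carrier SU2)"
    by (auto simp: Rep_F2_def hom_def)
  then show ?thesis
    unfolding Rep_F2_top_def topspace_pullback_topology by (auto simp: SU2_top_def)
qed

lemma equiv_conjugation_rel: "equiv Rep_F2 conjugation_rel"
proof -
  interpret SU2: group SU2 by (rule group_SU2)
  have in_SU2: "\<rho> x \<in> carrier SU2" if "\<rho> \<in> Rep_F2" "x \<in> carrier pi1_F2" for \<rho> x
    using that by (auto simp: Rep_F2_def hom_def)
  show ?thesis
  proof (rule equivI)
    show "conjugation_rel \<subseteq> Rep_F2 \<times> Rep_F2"
      by (auto simp: conjugation_rel_def)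
    show "refl_on Rep_F2 conjugation_rel"
      by (auto simp: refl_on_def conjugation_rel_def in_SU2 intro!: bexI[of _ "\<one>\<^bsub>SU2\<^esub>"])
    show "sym conjugation_rel"
    proof (rule symI)
      fix \<rho> \<sigma> assume "(\<rho>, \<sigma>) \<in> conjugation_rel"
      then obtain g where g: "\<rho> \<in> Rep_F2" "\<sigma> \<in> Rep_F2" "g \<in> carrier SU2"
        "\<And>x. x \<in> carrier pi1_F2 \<Longrightarrow> \<sigma> x = g \<otimes>\<^bsub>SU2\<^esub> \<rho> x \<otimes>\<^bsub>SU2\<^esub> inv\<^bsub>SU2\<^esub> g"
        by (auto simp: conjugation_rel_def)
      have "\<rho> x = inv\<^bsub>SU2\<^esub> g \<otimes>\<^bsub>SU2\<^esub> \<sigma> x \<otimes>\<^bsub>SU2\<^esub> inv\<^bsub>SU2\<^esub> (inv\<^bsub>SU2\<^esub> g)"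
        if "x \<in> carrier pi1_F2" for x
        using g in_SU2[OF g(1) that] that
        by (simp add: SU2.m_assoc SU2.inv_solve_left)
      then show "(\<sigma>, \<rho>) \<in> conjugation_rel"
        using g by (auto simp: conjugation_rel_def intro!: bexI[of _ "inv\<^bsub>SU2\<^esub> g"])
    qed
    show "trans conjugation_rel"
    proof (rule transI)
      fix \<rho> \<sigma> \<tau> assume "(\<rho>, \<sigma>) \<in> conjugation_rel" "(\<sigma>, \<tau>) \<in> conjugation_rel"
      then obtain g h where gh: "\<rho> \<in> Rep_F2" "\<tau> \<in> Rep_F2" "g \<in> carrier SU2" "h \<in> carrier SU2"
        "\<And>x. x \<in> carrier pi1_F2 \<Longrightarrow> \<sigma> x = g \<otimes>\<^bsub>SU2\<^esub> \<rho> x \<otimes>\<^bsub>SU2\<^esub> inv\<^bsub>SU2\<^esub> g"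
        "\<And>x. x \<in> carrier pi1_F2 \<Longrightarrow> \<tau> x = h \<otimes>\<^bsub>SU2\<^esub> \<sigma> x \<otimes>\<^bsub>SU2\<^esub> inv\<^bsub>SU2\<^esub> h"
        by (auto simp: conjugation_rel_def)
      have "\<tau> x = (h \<otimes>\<^bsub>SU2\<^esub> g) \<otimes>\<^bsub>SU2\<^esub> \<rho> x \<otimes>\<^bsub>SU2\<^esub> inv\<^bsub>SU2\<^esub> (h \<otimes>\<^bsub>SU2\<^esub> g)"
        if "x \<in> carrier pi1_F2" for x
        using gh in_SU2[OF gh(1) that] that by (simp add: SU2.m_assoc SU2.inv_mult_group)
      then show "(\<rho>, \<tau>) \<in> conjugation_rel"
        using gh by (auto simp: conjugation_rel_def intro!: bexI[of _ "h \<otimes>\<^bsub>SU2\<^esub> g"])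
    qed
  qed
qed


section \<open>Complex projective space\<close>

text \<open>The lines in \<open>complex^'n\<close>, of complex dimension \<open>CARD('n) - 1\<close>.\<close>

definition complex_projective_space :: "(complex^'n) set topology" where
  "complex_projective_space =
     quotient_topology (top_of_set (- {0})) {(z, w). z \<noteq> 0 \<and> w \<noteq> 0 \<and> (\<exists>c. c \<noteq> 0 \<and> w = c *s z)}"

definition CP3 :: "(complex^4) set topology" where
  "CP3 = complex_projective_space"

end

theory Submission
  imports Defs
begin

text \<open>A representation is a quadruple of unit quaternions with \<open>[A\<^sub>1, B\<^sub>1] = [B\<^sub>2, A\<^sub>2]\<close>: existence of a
  homomorphism with given values on the generators follows from the monodromy of a local system on the glued octagon,
  uniqueness from the fact that every loop is homotopic to a product of edges. After a conjugation the common
  commutator is diagonal with real part \<open>1 - 2 r\<^sup>2\<close>, and the pairs with this commutator correspond to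
  orthonormal frames, hence to unit spinors \<open>s\<close> and \<open>t\<close>. So the representations are parametrised by
  \<open>(r, s, t)\<close> and the conjugating quaternion, all ranging over a compact space. For \<open>0 < r < 1\<close> conjugacy only
  allows a common phase of \<open>s\<close> and \<open>t\<close> (up to signs), for \<open>r = 1\<close> a common left factor, and for
  \<open>r = 0\<close>, the abelian pairs, some further coincidences.

  By the singular value decomposition, a point of \<open>\<complex>P\<^sup>3\<close>, regarded as a matrix up to scaling, is also given by
  \<open>s\<close>, \<open>t\<close> and a number \<open>l\<close> in the unit disc, up to a common phase if \<open>|l| < 1\<close> and a common left factor if
  \<open>|l| = 1\<close>. Covering the disc by nested ellipses that degenerate to a segment at \<open>r = 0\<close> reproduces
  precisely the coincidences of the abelian case, so that both spaces are quotients of the same compact space with the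
  same fibres.\<close>

section \<open>Homotopy of paths in abstract topological spaces\<close>

text \<open>No inverse homeomorphism is written down: the maps from the parameter space are quotient
  maps by compactness and Hausdorffness, and the difficulty is to make their fibres agree.

  The ellipses are dictated by \<open>r = 0\<close>. There each of the two commuting pairs has its
  imaginary parts on a line in the plane orthogonal to i. Half-turns about axes in this plane
  reflect it, so besides the common phase they reverse the angle between the two lines: the circle
  of relative phases of \<open>s\<close> and \<open>t\<close> is folded into a segment. The quartic
  \<open>quart\<close> measures the direction of such a line, \<open>rel_quart\<close> compares the
  two directions and thus fixes the axis of the fold. Its modulus vanishes when one pair is central;
  then the relative phase disappears altogether, and the segment must shrink to a point. Hence a
  segment of length proportional to \<open>cmod (rel_quart s t)\<close>, thickened to ellipses that
  reach the unit circle at \<open>r = 1\<close>.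

  On the topological side no presentation of the fundamental group is formed: existence and
  uniqueness of homomorphisms are shown for an arbitrary target group.\<close>

definition path_homotopic :: "'a topology \<Rightarrow> (real \<Rightarrow> 'a) \<Rightarrow> (real \<Rightarrow> 'a) \<Rightarrow> bool" where
  "path_homotopic X p q \<longleftrightarrow> q 0 = p 0 \<and> q 1 = p 1 \<and>
     homotopic_with (\<lambda>r. r 0 = p 0 \<and> r 1 = p 1) (top_of_set {0..1}) X p q"

lemma path_homotopic_iff:
  "path_homotopic X p q \<longleftrightarrow>
     (\<exists>h. continuous_map (prod_topology (top_of_set {0..1::real}) (top_of_set {0..1})) X h \<and>
        (\<forall>x\<in>{0..1}. h (0, x) = p x) \<and> (\<forall>x\<in>{0..1}. h (1, x) = q x) \<and>
        (\<forall>t\<in>{0..1}. h (t, 0) = p 0 \<and> h (t, 1) = p 1))"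
  (is "?L \<longleftrightarrow> ?R")
proof -
  have "homotopic_with (\<lambda>r. r 0 = p 0 \<and> r 1 = p 1) (top_of_set {0..1}) X p q \<longleftrightarrow> ?R"
    by (subst homotopic_with) (auto simp del: prod_topology_subtopology_eu
      simp: Ball_def)
  moreover have "?R \<Longrightarrow> q 0 = p 0 \<and> q 1 = p 1"
    by (metis atLeastAtMost_iff order_refl zero_le_one)
  ultimately show ?thesis
    unfolding path_homotopic_def by blast
qed

lemma path_homotopic_imp_pathin:
  assumes "path_homotopic X p q" shows "pathin X p" "pathin X q"
  using assms homotopic_with_imp_continuous_maps unfolding path_homotopic_def pathin_def by blast+

lemma path_homotopic_ends:
  assumes "path_homotopic X p q" shows "q 0 = p 0" "q 1 = p 1"
  using assms unfolding path_homotopic_def by blast+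

lemma path_homotopic_refl: "pathin X p \<Longrightarrow> path_homotopic X p p"
  unfolding path_homotopic_def pathin_def by simp

lemma path_homotopic_sym: "path_homotopic X p q \<Longrightarrow> path_homotopic X q p"
  unfolding path_homotopic_def by (auto intro: homotopic_with_symD)

lemma path_homotopic_trans [trans]:
  "path_homotopic X p q \<Longrightarrow> path_homotopic X q r \<Longrightarrow> path_homotopic X p r"
  unfolding path_homotopic_def by (auto intro: homotopic_with_trans)

lemma path_homotopic_eq:
  assumes "pathin X p" "\<And>t. t \<in> {0..1} \<Longrightarrow> p t = q t"
  shows "path_homotopic X p q"
  using assms unfolding path_homotopic_def pathin_def
  by (auto intro!: homotopic_with_equal)

lemma loop_homotopy_iff:
  "(p, q) \<in> loop_homotopy X x0 \<longleftrightarrow> p \<in> loops X x0 \<and> path_homotopic X p q"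
  using path_homotopic_imp_pathin[of X p q]
  unfolding loop_homotopy_def path_homotopic_def loops_def by auto

text \<open>Straight-line homotopies in a convex set, pushed forward along \<open>h\<close>. With
  \<open>S\<close> the unit interval this gives all reparametrisations, with \<open>S\<close> a
  square the comparison of its sides, with \<open>S\<close> the disc the homotopies between paths of
  the octagon.\<close>

lemma path_homotopic_linear:
  fixes S :: "'b::real_normed_vector set"
  assumes h: "continuous_map (top_of_set S) X h" and "convex S"
    and a: "continuous_on {0..1} \<alpha>" "\<alpha> ` {0..1} \<subseteq> S"
    and b: "continuous_on {0..1} \<beta>" "\<beta> ` {0..1} \<subseteq> S"
    and "\<alpha> 0 = \<beta> 0" "\<alpha> 1 = \<beta> 1"
  shows "path_homotopic X (\<lambda>t. h (\<alpha> t)) (\<lambda>t. h (\<beta> t))"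
proof -
  have "homotopic_paths S \<alpha> \<beta>"
  proof (rule homotopic_paths_linear)
    show "closed_segment (\<alpha> t) (\<beta> t) \<subseteq> S" if "t \<in> {0..1}" for t
      using that a b by (intro closed_segment_subset \<open>convex S\<close>) auto
  qed (use assms in \<open>auto simp: path_def pathstart_def pathfinish_def\<close>)
  then have *: "homotopic_with (\<lambda>r. r 0 = \<alpha> 0 \<and> r 1 = \<alpha> 1) (top_of_set {0..1}) (top_of_set S) \<alpha> \<beta>"
    by (simp add: homotopic_paths_def pathstart_def pathfinish_def)
  have "homotopic_with (\<lambda>r. r 0 = h (\<alpha> 0) \<and> r 1 = h (\<alpha> 1)) (top_of_set {0..1}) X (h \<circ> \<alpha>) (h \<circ> \<beta>)"
    by (rule homotopic_with_compose_continuous_map_left[OF * h]) auto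
  then show ?thesis
    using assms by (simp add: path_homotopic_def o_def)
qed

lemma path_homotopic_reparam:
  assumes "pathin X p" "continuous_on {0..1} \<alpha>" "\<alpha> ` {0..1} \<subseteq> {0..1::real}"
    "continuous_on {0..1} \<beta>" "\<beta> ` {0..1} \<subseteq> {0..1}" "\<alpha> 0 = \<beta> 0" "\<alpha> 1 = \<beta> 1"
  shows "path_homotopic X (\<lambda>t. p (\<alpha> t)) (\<lambda>t. p (\<beta> t))"
  using path_homotopic_linear[of "{0..1}" X p \<alpha> \<beta>] assms by (simp add: pathin_def)

lemma pathin_path_concat:
  assumes "pathin X p" "pathin X q" "p 1 = q 0"
  shows "pathin X (path_concat p q)"
  unfolding pathin_def path_concat_def
proof (rule continuous_map_cases_le)
  have "continuous_map (top_of_set ({0..1} \<inter> {x. x \<in> {0..1} \<and> x \<le> 1/2})) (top_of_set {0..1}) (\<lambda>t::real. 2 * t)"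
    by (auto intro!: continuous_intros)
  from continuous_map_compose[OF this assms(1)[unfolded pathin_def]]
  show "continuous_map (subtopology (top_of_set {0..1}) {x \<in> topspace (top_of_set {0..1}). x \<le> 1 / 2}) X (\<lambda>x. p (2 * x))"
    by (simp add: o_def subtopology_subtopology)
  have "continuous_map (top_of_set ({0..1} \<inter> {x. x \<in> {0..1} \<and> 1/2 \<le> x})) (top_of_set {0..1}) (\<lambda>t::real. 2 * t - 1)"
    by (auto intro!: continuous_intros)
  from continuous_map_compose[OF this assms(2)[unfolded pathin_def]]
  show "continuous_map (subtopology (top_of_set {0..1}) {x \<in> topspace (top_of_set {0..1}). 1 / 2 \<le> x}) X (\<lambda>x. q (2 * x - 1))"
    by (simp add: o_def subtopology_subtopology)
  show "p (2 * t) = q (2 * t - 1)" if "t = 1/2" for t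
  proof -
    have "2 * t = 1" "2 * t - 1 = 0" using that by simp_all
    then show ?thesis using assms by simp
  qed
qed (auto intro!: continuous_intros)

lemma path_concat_0 [simp]: "path_concat p q 0 = p 0"
  and path_concat_1 [simp]: "path_concat p q 1 = q 1"
  by (simp_all add: path_concat_def)

lemma path_homotopic_concat:
  assumes "path_homotopic X p p'" "path_homotopic X q q'" "p 1 = q 0"
  shows "path_homotopic X (path_concat p q) (path_concat p' q')"
proof -
  let ?I = "top_of_set {0..1::real}"
  obtain h where h: "continuous_map (prod_topology ?I ?I) X h"
    "\<And>x. x \<in> {0..1} \<Longrightarrow> h (0, x) = p x" "\<And>x. x \<in> {0..1} \<Longrightarrow> h (1, x) = p' x"
    "\<And>t. t \<in> {0..1} \<Longrightarrow> h (t, 0) = p 0 \<and> h (t, 1) = p 1"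
    using assms(1)[unfolded path_homotopic_iff] by metis
  obtain k where k: "continuous_map (prod_topology ?I ?I) X k"
    "\<And>x. x \<in> {0..1} \<Longrightarrow> k (0, x) = q x" "\<And>x. x \<in> {0..1} \<Longrightarrow> k (1, x) = q' x"
    "\<And>t. t \<in> {0..1} \<Longrightarrow> k (t, 0) = q 0 \<and> k (t, 1) = q 1"
    using assms(2)[unfolded path_homotopic_iff] by metis
  let ?H = "\<lambda>z. if snd z \<le> 1/2 then h (fst z, 2 * snd z) else k (fst z, 2 * snd z - 1)"
  have "continuous_map (prod_topology ?I ?I) X ?H"
  proof (rule continuous_map_cases_le)
    have "continuous_map (top_of_set ({0..1} \<times> {0..1} \<inter> {z. z \<in> {0..1} \<times> {0..1} \<and> snd z \<le> 1/2}))
        (top_of_set ({0..1} \<times> {0..1})) (\<lambda>z::real\<times>real. (fst z, 2 * snd z))"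
      by (auto intro!: continuous_intros)
    from continuous_map_compose[OF this, of X h] h(1)
    show "continuous_map (subtopology (prod_topology ?I ?I) {z \<in> topspace (prod_topology ?I ?I). snd z \<le> 1/2})
        X (\<lambda>z. h (fst z, 2 * snd z))"
      by (simp add: o_def subtopology_subtopology prod_topology_subtopology_eu)
    have "continuous_map (top_of_set ({0..1} \<times> {0..1} \<inter> {z. z \<in> {0..1} \<times> {0..1} \<and> 1/2 \<le> snd z}))
        (top_of_set ({0..1} \<times> {0..1})) (\<lambda>z::real\<times>real. (fst z, 2 * snd z - 1))"
      by (auto intro!: continuous_intros)
    from continuous_map_compose[OF this, of X k] k(1)
    show "continuous_map (subtopology (prod_topology ?I ?I) {z \<in> topspace (prod_topology ?I ?I). 1/2 \<le> snd z})
        X (\<lambda>z. k (fst z, 2 * snd z - 1))"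
      by (simp add: o_def subtopology_subtopology prod_topology_subtopology_eu)
    show "h (fst z, 2 * snd z) = k (fst z, 2 * snd z - 1)"
      if "z \<in> topspace (prod_topology ?I ?I)" "snd z = 1/2" for z
    proof -
      have *: "2 * snd z = 1" "2 * snd z - 1 = 0" using that by simp_all
      show ?thesis unfolding * using that h(4)[of "fst z"] k(4)[of "fst z"] assms(3) by auto
    qed
  qed (auto simp: prod_topology_subtopology_eu intro!: continuous_intros)
  then show ?thesis
    unfolding path_homotopic_iff
    using h k by (intro exI[of _ ?H]) (auto simp: path_concat_def)
qed

definition rev_path :: "(real \<Rightarrow> 'a) \<Rightarrow> real \<Rightarrow> 'a" where
  "rev_path p = (\<lambda>t. p (1 - t))"

lemma rev_path_0 [simp]: "rev_path p 0 = p 1" and rev_path_1 [simp]: "rev_path p 1 = p 0"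
  by (simp_all add: rev_path_def)

lemma rev_path_rev_path [simp]: "rev_path (rev_path p) = p"
  by (simp add: rev_path_def)

lemma pathin_reparam:
  assumes "pathin X p" "continuous_on {0..1} \<alpha>" "\<alpha> ` {0..1} \<subseteq> {0..1::real}"
  shows "pathin X (\<lambda>t. p (\<alpha> t))"
  using path_homotopic_imp_pathin path_homotopic_reparam assms by blast

lemma pathin_rev_path: "pathin X p \<Longrightarrow> pathin X (rev_path p)"
  unfolding rev_path_def by (rule pathin_reparam) (auto intro!: continuous_intros)

lemma path_homotopic_rev_path:
  assumes "path_homotopic X p q" shows "path_homotopic X (rev_path p) (rev_path q)"
proof -
  have "continuous_map (top_of_set {0..1}) (top_of_set {0..1}) (\<lambda>t::real. 1 - t)"
    by (auto intro!: continuous_intros)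
  then have "homotopic_with (\<lambda>r. r 0 = p 1 \<and> r 1 = p 0) (top_of_set {0..1}) X
      (p \<circ> (\<lambda>t. 1 - t)) (q \<circ> (\<lambda>t. 1 - t))"
    using assms homotopic_with_compose_continuous_map_right[of "\<lambda>r. r 0 = p 0 \<and> r 1 = p 1"
        "top_of_set {0..1}" X p q "top_of_set {0..1}" "\<lambda>t. 1 - t" "\<lambda>r. r 0 = p 1 \<and> r 1 = p 0"]
    unfolding path_homotopic_def by simp
  then show ?thesis
    using assms by (simp add: path_homotopic_def rev_path_def o_def)
qed

lemma path_concat_assoc:
  assumes "pathin X p" "pathin X q" "pathin X r" "p 1 = q 0" "q 1 = r 0"
  shows "path_homotopic X (path_concat (path_concat p q) r) (path_concat p (path_concat q r))"
proof -
  let ?c = "path_concat (path_concat p q) r"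
  \<comment> \<open>The piecewise linear map sending 1/2 to 1/4 and 3/4 to 1/2, the places where the
    two bracketings pass from one path to the next. As a sum of clipped linear pieces it is visibly
    continuous.\<close>
  let ?a = "\<lambda>t. min (t / 2) (1/4) + min (max (t - 1/2) 0) (1/4) + 2 * max (t - 3/4) (0::real)"
  have c: "pathin X ?c"
    using assms by (intro pathin_path_concat) auto
  have "path_homotopic X (\<lambda>t. ?c t) (\<lambda>t. ?c (?a t))"
    by (rule path_homotopic_reparam[OF c]; (intro continuous_intros)?; auto simp: min_def max_def)
  also have "path_homotopic X (\<lambda>t. ?c (?a t)) (path_concat p (path_concat q r))"
  proof (rule path_homotopic_eq)
    show "pathin X (\<lambda>t. ?c (?a t))"
      by (rule pathin_reparam[OF c]; (intro continuous_intros)?; auto simp: min_def max_def)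
    fix t :: real assume t: "t \<in> {0..1}"
    consider "t \<le> 1/2" | "t > 1/2" "t \<le> 3/4" | "t > 3/4" by linarith
    then show "?c (?a t) = path_concat p (path_concat q r) t"
    proof cases
      case 1
      then have "?a t = t / 2" using t by (auto simp: min_def max_def)
      then show ?thesis using 1 t by (simp add: path_concat_def)
    next
      case 2
      then have "?a t = t - 1/4" using t by (auto simp: min_def max_def)
      then show ?thesis using 2 t by (simp add: path_concat_def algebra_simps)
    next
      case 3
      then have "?a t = 2 * t - 1" using t by (auto simp: min_def max_def)
      then show ?thesis using 3 t by (simp add: path_concat_def algebra_simps)
    qed
  qed
  finally show ?thesis .
qed

lemma path_concat_const_right:
  assumes "pathin X p" "y = p 1"
  shows "path_homotopic X (path_concat p (\<lambda>t. y)) p"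
proof -
  have "path_homotopic X (\<lambda>t. p (min (2 * t) 1)) (\<lambda>t. p t)"
    by (rule path_homotopic_reparam[OF assms(1)]; (intro continuous_intros)?; auto simp: min_def)
  moreover have "path_homotopic X (\<lambda>t. p (min (2 * t) 1)) (path_concat p (\<lambda>t. y))"
    by (rule path_homotopic_eq, rule pathin_reparam[OF assms(1)]; (intro continuous_intros)?;
      auto simp: min_def path_concat_def assms(2))
  ultimately show ?thesis
    using path_homotopic_sym path_homotopic_trans by blast
qed

lemma path_concat_const_left:
  assumes "pathin X p" "y = p 0"
  shows "path_homotopic X (path_concat (\<lambda>t. y) p) p"
proof -
  have "path_homotopic X (\<lambda>t. p (max (2 * t - 1) 0)) (\<lambda>t. p t)"
    by (rule path_homotopic_reparam[OF assms(1)]; (intro continuous_intros)?; auto simp: max_def)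
  moreover have "path_homotopic X (\<lambda>t. p (max (2 * t - 1) 0)) (path_concat (\<lambda>t. y) p)"
    by (rule path_homotopic_eq, rule pathin_reparam[OF assms(1)]; (intro continuous_intros)?;
      auto simp: max_def path_concat_def assms(2))
  ultimately show ?thesis
    using path_homotopic_sym path_homotopic_trans by blast
qed

lemma path_concat_rev_path:
  assumes "pathin X p"
  shows "path_homotopic X (path_concat p (rev_path p)) (\<lambda>t. p 0)"
proof -
  \<comment> \<open>The tent function runs from 0 up to 1 and back, so \<open>p\<close> followed by
    its reverse is \<open>p\<close> after a reparametrisation that can be shrunk to 0.\<close>
  have "path_homotopic X (\<lambda>t. p (1 - \<bar>2 * t - 1\<bar>)) (\<lambda>t. p 0)"
    by (rule path_homotopic_reparam[OF assms, of "\<lambda>t. 1 - \<bar>2 * t - 1\<bar>" "\<lambda>t. 0"];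
      (intro continuous_intros)?; auto simp: abs_if)
  moreover have "path_homotopic X (\<lambda>t. p (1 - \<bar>2 * t - 1\<bar>)) (path_concat p (rev_path p))"
    by (rule path_homotopic_eq, rule pathin_reparam[OF assms]; (intro continuous_intros)?;
      auto simp: path_concat_def rev_path_def abs_if intro!: arg_cong[where f = p])
  ultimately show ?thesis
    using path_homotopic_sym path_homotopic_trans by blast
qed

definition subpath :: "(real \<Rightarrow> 'a) \<Rightarrow> real \<Rightarrow> real \<Rightarrow> real \<Rightarrow> 'a" where
  "subpath p a b = (\<lambda>t. p (a + t * (b - a)))"

lemma subpath_01 [simp]: "subpath p 0 1 = p"
  by (simp add: subpath_def)

lemma subpath_0 [simp]: "subpath p a b 0 = p a" and subpath_1 [simp]: "subpath p a b 1 = p b"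
  by (simp_all add: subpath_def)

lemma affine_mem_Icc:
  fixes t :: real
  assumes "0 \<le> t" "t \<le> 1" "a \<le> b" shows "a \<le> a + t * (b - a)" "a + t * (b - a) \<le> b"
  using assms mult_left_le_one_le[of "b - a" t] by auto

lemma pathin_subpath:
  assumes "pathin X p" "0 \<le> a" "a \<le> b" "b \<le> 1"
  shows "pathin X (subpath p a b)"
  unfolding subpath_def
proof (rule pathin_reparam[OF assms(1)])
  show "(\<lambda>t. a + t * (b - a)) ` {0..1} \<subseteq> {0..1}"
    using assms affine_mem_Icc[of _ a b] by force
qed (auto intro!: continuous_intros)

lemma path_concat_subpath:
  assumes "pathin X p" "0 \<le> a" "a \<le> b" "b \<le> c" "c \<le> 1"
  shows "path_homotopic X (path_concat (subpath p a b) (subpath p b c)) (subpath p a c)"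
proof -
  let ?\<alpha> = "\<lambda>t. a + min (2 * t) 1 * (b - a) + max (2 * t - 1) 0 * (c - b)"
  have im: "?\<alpha> t \<in> {0..1}" if "t \<in> {0..1}" for t
  proof (cases "t \<le> 1/2")
    case True
    then show ?thesis using that assms affine_mem_Icc[of "2 * t" a b] by auto
  next
    case False
    then show ?thesis using that assms affine_mem_Icc[of "2 * t - 1" b c] by auto
  qed
  have cont: "continuous_on {0..1} ?\<alpha>"
    by (intro continuous_intros)
  have im': "?\<alpha> ` {0..1} \<subseteq> {0..1}"
    using im by blast
  have "path_homotopic X (\<lambda>t. p (?\<alpha> t)) (\<lambda>t. p (a + t * (c - a)))"
  proof (rule path_homotopic_reparam[OF assms(1) cont im'])
    show "continuous_on {0..1} (\<lambda>t. a + t * (c - a))"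
      by (intro continuous_intros)
    show "(\<lambda>t. a + t * (c - a)) ` {0..1} \<subseteq> {0..1}"
      using assms affine_mem_Icc[of _ a c] by force
  qed auto
  moreover have "path_homotopic X (\<lambda>t. p (?\<alpha> t)) (path_concat (subpath p a b) (subpath p b c))"
  proof (rule path_homotopic_eq)
    show "pathin X (\<lambda>t. p (?\<alpha> t))"
      by (rule pathin_reparam[OF assms(1) cont im'])
  qed (auto simp: path_concat_def subpath_def)
  ultimately show ?thesis
    using path_homotopic_sym path_homotopic_trans unfolding subpath_def by blast
qed

text \<open>The path \<open>?\<beta>\<close> runs along the other three sides and is homotopic to
  the side at 0 because the square is convex. The side at 1 is mapped to the point \<open>y\<close>,
  so its third of the time can be skipped. This turns the contraction of a chart into a homotopy
  from a path to the tracks of its end points.\<close>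

lemma path_homotopic_sides_of_square:
  assumes h: "continuous_map (prod_topology (top_of_set {0..1::real}) (top_of_set {0..1})) X h"
    and const: "\<And>t. t \<in> {0..1} \<Longrightarrow> h (1, t) = y"
  shows "path_homotopic X (\<lambda>t. h (0, t)) (path_concat (\<lambda>s. h (s, 0)) (rev_path (\<lambda>s. h (s, 1))))"
proof -
  let ?S = "{0..1::real} \<times> {0..1::real}"
  have h': "continuous_map (top_of_set ?S) X h"
    using h by (simp add: prod_topology_subtopology_eu)
  let ?\<beta> = "\<lambda>t::real. (min 1 (min (3 * t) (3 - 3 * t)), max 0 (min 1 (3 * t - 1)))"
  have "path_homotopic X (\<lambda>t. h (0, t)) (\<lambda>t. h (?\<beta> t))"
  proof (rule path_homotopic_linear[OF h'])
    show "convex ?S" by (intro convex_Times convex_real_interval)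
    show "continuous_on {0..1} ?\<beta>" by (intro continuous_intros)
    show "?\<beta> ` {0..1} \<subseteq> ?S" by (auto simp: min_def max_def)
  qed (auto intro!: continuous_intros)
  moreover have "path_homotopic X (\<lambda>t. h (?\<beta> t)) (path_concat (\<lambda>s. h (s, 0)) (rev_path (\<lambda>s. h (s, 1))))"
  proof -
    let ?q = "path_concat (\<lambda>s. h (s, 0)) (rev_path (\<lambda>s. h (s, 1)))"
    have q: "pathin X ?q"
    proof (intro pathin_path_concat pathin_rev_path)
      show "pathin X (\<lambda>s. h (s, 0))" "pathin X (\<lambda>s. h (s, 1))"
        unfolding pathin_def
        by (rule continuous_map_compose[OF _ h', unfolded o_def], force intro!: continuous_intros)+
    qed (use const[of 0] const[of 1] in simp)
    \<comment> \<open>Pauses at 1/2 during the middle third, while \<open>?\<beta>\<close> runs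
      along the constant side.\<close>
    let ?\<alpha> = "\<lambda>t::real. min (3 * t / 2) (1/2) + max 0 (3 * t / 2 - 1)"
    have "path_homotopic X (\<lambda>t. ?q (?\<alpha> t)) (\<lambda>t. ?q t)"
      by (rule path_homotopic_reparam[OF q]; (intro continuous_intros)?; auto simp: min_def max_def)
    moreover have "path_homotopic X (\<lambda>t. ?q (?\<alpha> t)) (\<lambda>t. h (?\<beta> t))"
    proof (rule path_homotopic_eq)
      show "pathin X (\<lambda>t. ?q (?\<alpha> t))"
        by (rule pathin_reparam[OF q]; (intro continuous_intros)?; auto simp: min_def max_def)
      fix t :: real assume t: "t \<in> {0..1}"
      consider "t \<le> 1/3" | "t > 1/3" "t < 2/3" | "t \<ge> 2/3" by linarith
      then show "?q (?\<alpha> t) = h (?\<beta> t)"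
      proof cases
        case 1
        then have "?\<alpha> t = 3 * t / 2" "?\<beta> t = (3 * t, 0)"
          using t by (auto simp: min_def max_def)
        then show ?thesis using 1 by (simp add: path_concat_def)
      next
        case 2
        then have "?\<alpha> t = 1/2" "?\<beta> t = (1, 3 * t - 1)"
          using t by (auto simp: min_def max_def)
        then show ?thesis using 2 const[of 0] const[of "3 * t - 1"]
          by (simp add: path_concat_def)
      next
        case 3
        then have *: "?\<alpha> t = (3 * t - 1) / 2" "?\<beta> t = (3 - 3 * t, 1)"
          using t by (auto simp: min_def max_def)
        show ?thesis
        proof (cases "t = 2/3")
          case True
          show ?thesis
            unfolding * True using const[of 0] const[of 1] by (simp add: path_concat_def)
        next
          case False
          then have "\<not> (3 * t - 1) / 2 \<le> 1 / 2" using 3 by simp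
          moreover have "1 - (2 * ((3 * t - 1) / 2) - 1) = 3 - 3 * t" by argo
          ultimately show ?thesis
            unfolding * path_concat_def rev_path_def by (simp only: if_False)
        qed
      qed
    qed
    ultimately show ?thesis
      using path_homotopic_sym path_homotopic_trans by blast
  qed
  ultimately show ?thesis
    using path_homotopic_trans by blast
qed

section \<open>Monodromy of local systems\<close>

lemma continuous_map_nbhd:
  fixes K :: "'k::metric_space set"
  assumes "continuous_map (top_of_set K) X H" "openin X N" "t \<in> K" "H t \<in> N"
  shows "\<exists>e>0. \<forall>u\<in>K. dist u t < e \<longrightarrow> H u \<in> N"
proof -
  let ?S = "{u \<in> K. H u \<in> N}"
  have "openin (top_of_set K) ?S"
    using openin_continuous_map_preimage[OF assms(1,2)] by simp
  then have "\<forall>x\<in>?S. \<exists>e>0. \<forall>u\<in>K. dist u x < e \<longrightarrow> u \<in> ?S"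
    unfolding openin_euclidean_subtopology_iff by (rule conjunct2)
  from bspec[OF this, of t] show ?thesis using assms(3,4) by simp
qed

text \<open>A local system of groups in terms of its transition functions \<open>\<tau> i j\<close> between charts \<open>U i\<close>, and its
  flat sections along maps \<open>H\<close> into the base, read off in the charts.\<close>

locale local_system = group G for G (structure) +
  fixes X :: "'x topology" and I :: "'i set" and U :: "'i \<Rightarrow> 'x set" and \<tau> :: "'i \<Rightarrow> 'i \<Rightarrow> 'x \<Rightarrow> 'a"
  assumes open_chart: "i \<in> I \<Longrightarrow> openin X (U i)"
    and cover: "x \<in> topspace X \<Longrightarrow> \<exists>i\<in>I. x \<in> U i"
    and transition_closed: "i \<in> I \<Longrightarrow> j \<in> I \<Longrightarrow> x \<in> U i \<Longrightarrow> x \<in> U j \<Longrightarrow> \<tau> i j x \<in> carrier G"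
    and cocycle: "i \<in> I \<Longrightarrow> j \<in> I \<Longrightarrow> k \<in> I \<Longrightarrow> x \<in> U i \<Longrightarrow> x \<in> U j \<Longrightarrow> x \<in> U k \<Longrightarrow>
      \<tau> i j x \<otimes> \<tau> j k x = \<tau> i k x"
    and loc_const: "i \<in> I \<Longrightarrow> j \<in> I \<Longrightarrow> x \<in> U i \<Longrightarrow> x \<in> U j \<Longrightarrow>
      \<exists>N. openin X N \<and> x \<in> N \<and> N \<subseteq> U i \<inter> U j \<and> (\<forall>y\<in>N. \<tau> i j y = \<tau> i j x)"
begin

definition flat_section :: "'k::metric_space set \<Rightarrow> ('k \<Rightarrow> 'x) \<Rightarrow> ('k \<Rightarrow> 'i \<Rightarrow> 'a) \<Rightarrow> bool" where
  "flat_section K H s \<longleftrightarrow>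
     (\<forall>t\<in>K. \<forall>i\<in>I. H t \<in> U i \<longrightarrow> s t i \<in> carrier G) \<and>
     (\<forall>t\<in>K. \<forall>i\<in>I. \<forall>j\<in>I. H t \<in> U i \<longrightarrow> H t \<in> U j \<longrightarrow> s t i = \<tau> i j (H t) \<otimes> s t j) \<and>
     (\<forall>t\<in>K. \<forall>i\<in>I. H t \<in> U i \<longrightarrow> (\<exists>e>0. \<forall>u\<in>K. dist u t < e \<longrightarrow> H u \<in> U i \<and> s u i = s t i))"

lemma flat_sectionD:
  assumes "flat_section K H s" "t \<in> K" "i \<in> I" "H t \<in> U i"
  shows "s t i \<in> carrier G"
    and "j \<in> I \<Longrightarrow> H t \<in> U j \<Longrightarrow> s t i = \<tau> i j (H t) \<otimes> s t j"
    and "\<exists>e>0. \<forall>u\<in>K. dist u t < e \<longrightarrow> H u \<in> U i \<and> s u i = s t i"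
  using assms unfolding flat_section_def by blast+

lemma flat_section_compose:
  assumes s: "flat_section K H s" and f: "continuous_on L f" "f ` L \<subseteq> K"
  shows "flat_section L (\<lambda>t. H (f t)) (\<lambda>t. s (f t))"
  unfolding flat_section_def
proof (intro conjI ballI impI)
  fix t i assume t: "t \<in> L" and i: "i \<in> I" "H (f t) \<in> U i"
  have ft: "f t \<in> K" using t f by blast
  show "s (f t) i \<in> carrier G" using flat_sectionD[OF s ft i] by blast
  obtain e where e: "e > 0" "\<And>u. u \<in> K \<Longrightarrow> dist u (f t) < e \<Longrightarrow> H u \<in> U i \<and> s u i = s (f t) i"
    using flat_sectionD(3)[OF s ft i] by blast
  then obtain d where "d > 0" "\<And>u. u \<in> L \<Longrightarrow> dist u t < d \<Longrightarrow> dist (f u) (f t) < e"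
    using f(1) t unfolding continuous_on_iff by metis
  then show "\<exists>d>0. \<forall>u\<in>L. dist u t < d \<longrightarrow> H (f u) \<in> U i \<and> s (f u) i = s (f t) i"
    using e f(2) by (meson image_subset_iff)
next
  fix t i j assume "t \<in> L" "i \<in> I" "j \<in> I" "H (f t) \<in> U i" "H (f t) \<in> U j"
  then show "s (f t) i = \<tau> i j (H (f t)) \<otimes> s (f t) j"
    using flat_sectionD(2)[OF s, of "f t" i j] f(2) by blast
qed

lemma flat_section_cong:
  assumes "flat_section K H s" "\<And>t. t \<in> K \<Longrightarrow> H t = H' t"
  shows "flat_section K H' s"
  unfolding flat_section_def
proof (intro conjI ballI impI)
  fix t i assume t: "t \<in> K" and i: "i \<in> I" "H' t \<in> U i"
  then have i': "H t \<in> U i" using assms(2) by metis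
  show "s t i \<in> carrier G" using flat_sectionD(1)[OF assms(1) t i(1) i'] .
  show "\<exists>e>0. \<forall>u\<in>K. dist u t < e \<longrightarrow> H' u \<in> U i \<and> s u i = s t i"
    using flat_sectionD(3)[OF assms(1) t i(1) i'] assms(2) by metis
  show "s t i = \<tau> i j (H' t) \<otimes> s t j" if "j \<in> I" "H' t \<in> U j" for j
    using flat_sectionD(2)[OF assms(1) t i(1) i', of j] that assms(2)[OF t] by metis
qed

text \<open>The quotient of \<open>s'\<close> by \<open>s\<close> does not depend on the chart, as
  the left factors \<open>\<tau> i j\<close> cancel, and it is locally constant, hence constant on a
  connected set.\<close>

lemma flat_section_unique:
  assumes s: "flat_section K H s" and s': "flat_section K H s'" and K: "connected K"
    and H: "H ` K \<subseteq> topspace X"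
  shows "\<exists>c\<in>carrier G. \<forall>t\<in>K. \<forall>i\<in>I. H t \<in> U i \<longrightarrow> s' t i = s t i \<otimes> c"
proof (cases "K = {}")
  case True
  then show ?thesis by auto
next
  case False
  define ch where "ch t = (SOME i. i \<in> I \<and> H t \<in> U i)" for t
  have ch: "ch t \<in> I" "H t \<in> U (ch t)" if "t \<in> K" for t
    using someI_ex[of "\<lambda>i. i \<in> I \<and> H t \<in> U i"] cover[of "H t"] that H unfolding ch_def by blast+
  define c where "c t = inv (s t (ch t)) \<otimes> s' t (ch t)" for t
  have c: "c t = inv (s t i) \<otimes> s' t i" "c t \<in> carrier G" if "t \<in> K" "i \<in> I" "H t \<in> U i" for t i
  proof -
    let ?j = "ch t"
    have j: "?j \<in> I" "H t \<in> U ?j" using ch that by auto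
    note cl = flat_sectionD(1)[OF s that] flat_sectionD(1)[OF s' that]
      flat_sectionD(1)[OF s \<open>t \<in> K\<close> j] flat_sectionD(1)[OF s' \<open>t \<in> K\<close> j]
      transition_closed[OF that(2) j(1) that(3) j(2)]
    show "c t \<in> carrier G" using cl by (simp add: c_def)
    have "inv (s t i) \<otimes> s' t i = inv (\<tau> i ?j (H t) \<otimes> s t ?j) \<otimes> (\<tau> i ?j (H t) \<otimes> s' t ?j)"
      using flat_sectionD(2)[OF s that j] flat_sectionD(2)[OF s' that j] by simp
    also have "\<dots> = inv (s t ?j) \<otimes> s' t ?j"
      using cl by (simp add: inv_mult_group m_assoc) (simp add: m_assoc[symmetric])
    finally show "c t = inv (s t i) \<otimes> s' t i" by (simp add: c_def)
  qed
  have "c constant_on K"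
  proof (rule locally_constant_imp_constant[OF K])
    fix t assume t: "t \<in> K"
    obtain e where e: "e > 0" "\<And>u. u \<in> K \<Longrightarrow> dist u t < e \<Longrightarrow> H u \<in> U (ch t) \<and> s u (ch t) = s t (ch t)"
      using flat_sectionD(3)[OF s t ch[OF t]] by blast
    obtain e' where e': "e' > 0" "\<And>u. u \<in> K \<Longrightarrow> dist u t < e' \<Longrightarrow> H u \<in> U (ch t) \<and> s' u (ch t) = s' t (ch t)"
      using flat_sectionD(3)[OF s' t ch[OF t]] by blast
    let ?T = "K \<inter> ball t (min e e')"
    have "c u = c t" if "u \<in> ?T" for u
      using that e(2)[of u] e'(2)[of u] c(1)[OF t ch[OF t]] c(1)[of u "ch t"] ch[OF t]
      by (auto simp: dist_commute)
    moreover have "openin (top_of_set K) ?T" "t \<in> ?T"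
      using t e(1) e'(1) by auto
    ultimately show "\<exists>T. openin (top_of_set K) T \<and> t \<in> T \<and> (\<forall>x\<in>T. c x = c t)"
      by blast
  qed
  then obtain c0 where c0: "\<And>t. t \<in> K \<Longrightarrow> c t = c0"
    unfolding constant_on_def by blast
  have "c0 \<in> carrier G"
    using False c0 c(2) ch by (metis all_not_in_conv)
  moreover have "s' t i = s t i \<otimes> c0" if "t \<in> K" "i \<in> I" "H t \<in> U i" for t i
    using c(1)[OF that] c0[OF that(1)] flat_sectionD(1)[OF s that] flat_sectionD(1)[OF s' that]
    by (simp add: m_assoc[symmetric])
  ultimately show ?thesis by blast
qed

lemma flat_section_mult_right:
  assumes s: "flat_section K H s" and c: "c \<in> carrier G"
  shows "flat_section K H (\<lambda>t i. s t i \<otimes> c)"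
proof -
  have "s t i \<otimes> c = \<tau> i j (H t) \<otimes> (s t j \<otimes> c)"
    if "t \<in> K" "i \<in> I" "j \<in> I" "H t \<in> U i" "H t \<in> U j" for t i j
    using that flat_sectionD(1)[OF s] transition_closed c flat_sectionD(2)[OF s that(1,2,4,3,5)]
    by (simp add: m_assoc)
  moreover have "\<exists>e>0. \<forall>u\<in>K. dist u t < e \<longrightarrow> H u \<in> U i \<and> s u i \<otimes> c = s t i \<otimes> c"
    if t: "t \<in> K" "i \<in> I" "H t \<in> U i" for t i
    using flat_sectionD(3)[OF s that] by metis
  ultimately show ?thesis
    using flat_sectionD(1)[OF s] c unfolding flat_section_def by blast
qed

text \<open>On the connected overlap the sections differ by a right factor, which is absorbed into
  the second one. Closedness gives local constancy at points of only one of the sets, since nearby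
  points avoid the other.\<close>

lemma flat_section_glue:
  assumes s1: "flat_section K1 H s1" and s2: "flat_section K2 H s2"
    and "closed K1" "closed K2" "connected (K1 \<inter> K2)"
    and H: "H ` (K1 \<union> K2) \<subseteq> topspace X"
  shows "\<exists>s. flat_section (K1 \<union> K2) H s"
proof -
  have "flat_section (K1 \<inter> K2) H s2" "flat_section (K1 \<inter> K2) H s1"
    using flat_section_compose[OF s2, of "K1 \<inter> K2" "\<lambda>t. t"]
      flat_section_compose[OF s1, of "K1 \<inter> K2" "\<lambda>t. t"] by auto
  moreover have "H ` (K1 \<inter> K2) \<subseteq> topspace X" using H by blast
  ultimately have "\<exists>c\<in>carrier G. \<forall>t\<in>K1 \<inter> K2. \<forall>i\<in>I. H t \<in> U i \<longrightarrow> s1 t i = s2 t i \<otimes> c"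
    using flat_section_unique assms(5) by blast
  then obtain c where c: "c \<in> carrier G"
    and eq: "\<And>t i. t \<in> K1 \<Longrightarrow> t \<in> K2 \<Longrightarrow> i \<in> I \<Longrightarrow> H t \<in> U i \<Longrightarrow> s1 t i = s2 t i \<otimes> c"
    by blast
  have s2': "flat_section K2 H (\<lambda>t i. s2 t i \<otimes> c)"
    using flat_section_mult_right[OF s2 c] .
  define s where "s t i = (if t \<in> K1 then s1 t i else s2 t i \<otimes> c)" for t i
  have sK1: "s t i = s1 t i" if "t \<in> K1" for t i using that by (simp add: s_def)
  have sK2: "s t i = s2 t i \<otimes> c" if "t \<in> K2" "i \<in> I" "H t \<in> U i" for t i
    using that eq by (simp add: s_def)
  have nbhd: "\<exists>e>0. \<forall>u\<in>K. dist u t < e \<longrightarrow> H u \<in> U i \<and> s u i = s t i"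
    if t: "t \<in> K1 \<union> K2" "i \<in> I" "H t \<in> U i" and K: "closed K" "flat_section K H r"
      and r: "\<And>t i. t \<in> K \<Longrightarrow> i \<in> I \<Longrightarrow> H t \<in> U i \<Longrightarrow> s t i = r t i" for t i K r
  proof (cases "t \<in> K")
    case True
    obtain e where e: "e > 0" "\<And>u. u \<in> K \<Longrightarrow> dist u t < e \<Longrightarrow> H u \<in> U i \<and> r u i = r t i"
      using flat_sectionD(3)[OF K(2) True t(2,3)] by blast
    have "H u \<in> U i \<and> s u i = s t i" if u: "u \<in> K" "dist u t < e" for u
      using e(2)[OF u] r[OF u(1) t(2)] r[OF True t(2,3)] by simp
    with e(1) show ?thesis by blast
  next
    case False
    then obtain e where "e > 0" "ball t e \<subseteq> - K"
      using K(1) by (metis Compl_iff open_Compl open_contains_ball)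
    then have "u \<notin> K" if "dist u t < e" for u
      using that by (metis ComplD dist_commute in_mono mem_ball)
    with \<open>e > 0\<close> show ?thesis by blast
  qed
  have "flat_section (K1 \<union> K2) H s"
    unfolding flat_section_def
  proof (intro conjI ballI impI)
    fix t i assume t: "t \<in> K1 \<union> K2" "i \<in> I" "H t \<in> U i"
    show "s t i \<in> carrier G"
      using t flat_sectionD(1)[OF s1] flat_sectionD(1)[OF s2'] sK1 sK2 by auto
    obtain e1 where e1: "e1 > 0" "\<forall>u\<in>K1. dist u t < e1 \<longrightarrow> H u \<in> U i \<and> s u i = s t i"
      using nbhd[OF t assms(3) s1 sK1] by blast
    obtain e2 where e2: "e2 > 0" "\<forall>u\<in>K2. dist u t < e2 \<longrightarrow> H u \<in> U i \<and> s u i = s t i"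
      using nbhd[OF t assms(4) s2' sK2] by blast
    show "\<exists>e>0. \<forall>u\<in>K1 \<union> K2. dist u t < e \<longrightarrow> H u \<in> U i \<and> s u i = s t i"
    proof (intro exI[of _ "min e1 e2"] conjI ballI impI)
      show "H u \<in> U i" "s u i = s t i" if "u \<in> K1 \<union> K2" "dist u t < min e1 e2" for u
        using that e1(2)[rule_format, of u] e2(2)[rule_format, of u] by auto
    qed (use e1(1) e2(1) in simp)
  next
    fix t i j assume t: "t \<in> K1 \<union> K2" "i \<in> I" "j \<in> I" "H t \<in> U i" "H t \<in> U j"
    show "s t i = \<tau> i j (H t) \<otimes> s t j"
    proof (cases "t \<in> K1")
      case True
      show ?thesis
        using flat_sectionD(2)[OF s1 True t(2,4,3,5)] by (simp only: sK1[OF True])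
    next
      case False
      then have "t \<in> K2" using t by blast
      then show ?thesis
        using flat_sectionD(2)[OF s2' _ t(2,4,3,5)] sK2 t by metis
    qed
  qed
  then show ?thesis by blast
qed

text \<open>The section that is the unit in chart \<open>i\<close>, read off in the other
  charts.\<close>

lemma flat_section_in_chart:
  assumes H: "continuous_map (top_of_set K) X H" and i: "i \<in> I" "H ` K \<subseteq> U i"
  shows "flat_section K H (\<lambda>t j. \<tau> j i (H t))"
  unfolding flat_section_def
proof (intro conjI ballI impI)
  fix t j assume t: "t \<in> K" and j: "j \<in> I" "H t \<in> U j"
  have ti: "H t \<in> U i" using t i by blast
  show "\<tau> j i (H t) \<in> carrier G" using transition_closed i j ti by blast
  obtain N where N: "openin X N" "H t \<in> N" "N \<subseteq> U j \<inter> U i" "\<And>y. y \<in> N \<Longrightarrow> \<tau> j i y = \<tau> j i (H t)"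
    using loc_const[OF j(1) i(1) j(2) ti] by blast
  obtain e where "e > 0" "\<And>u. u \<in> K \<Longrightarrow> dist u t < e \<Longrightarrow> H u \<in> N"
    using continuous_map_nbhd[OF H N(1) t N(2)] by metis
  then show "\<exists>e>0. \<forall>u\<in>K. dist u t < e \<longrightarrow> H u \<in> U j \<and> \<tau> j i (H u) = \<tau> j i (H t)"
    using N(3,4) by (meson IntD1 in_mono)
next
  fix t j k assume "t \<in> K" "j \<in> I" "k \<in> I" "H t \<in> U j" "H t \<in> U k"
  then show "\<tau> j i (H t) = \<tau> j k (H t) \<otimes> \<tau> k i (H t)"
    using cocycle[of j k i "H t"] i by auto
qed

text \<open>A subdivision argument by two nested bisections: strips of full height are joined in the
  first coordinate, and a thin strip around \<open>x\<close> is in turn assembled from small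
  rectangles lying in one chart. Adjacent rectangles meet in a segment, so that
  \<open>flat_section_glue\<close> applies.\<close>

lemma flat_section_square:
  fixes H :: "real \<times> real \<Rightarrow> 'x"
  assumes H: "continuous_map (top_of_set ({0..1} \<times> {0..1})) X H"
  shows "\<exists>s. flat_section ({0..1} \<times> {0..1}) H s"
proof -
  have HX: "H ` ({a..b} \<times> {c..e}) \<subseteq> topspace X" if "{a..b} \<subseteq> {0..1}" "{c..e} \<subseteq> {0..1}" for a b c e
    using continuous_map_image_subset_topspace[OF H] that by fastforce
  define P where "P a b c e \<longleftrightarrow> ({a..b} \<subseteq> {0..1} \<longrightarrow> {c..e} \<subseteq> {0..1} \<longrightarrow>
      (\<exists>s. flat_section ({a..b} \<times> {c..e}) H s))" for a b c e
  have "P 0 1 0 1"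
  proof (rule Bolzano[of 0 1 "\<lambda>a b. P a b 0 1"])
    fix a b c assume P: "P a b 0 1" "P b c 0 1" "a \<le> b" "b \<le> (c::real)"
    show "P a c 0 1"
      unfolding P_def
    proof (intro impI)
      assume *: "{a..c} \<subseteq> {0..1}"
      then have sub: "{a..b} \<subseteq> {0..1}" "{b..c} \<subseteq> {0..1}" using P by auto
      then obtain s1 s2 where s: "flat_section ({a..b} \<times> {0..1}) H s1" "flat_section ({b..c} \<times> {0..1}) H s2"
        using P unfolding P_def by blast
      have un: "{a..b} \<times> {0..1} \<union> {b..c} \<times> {0..1} = {a..c} \<times> {0..1::real}"
        using P by force
      have "({a..b} \<times> {0..1}) \<inter> ({b..c} \<times> {0..1}) = {b} \<times> {0..1::real}"
        using P by force
      then have "connected (({a..b} \<times> {0..1}) \<inter> ({b..c} \<times> {0..1::real}))"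
        by (simp add: connected_Times)
      with flat_section_glue[OF s] HX[OF *, of 0 1] un
      show "\<exists>s. flat_section ({a..c} \<times> {0..1}) H s"
        by (simp add: closed_Times)
    qed
  next
    fix x :: real assume x: "0 \<le> x" "x \<le> 1"
    \<comment> \<open>Concerns all sufficiently thin rectangles over \<open>x\<close> with vertical
      range from \<open>c\<close> to \<open>e\<close>. How thin depends on the range; joining two
      ranges takes the minimum.\<close>
    define Q where "Q c e \<longleftrightarrow> (\<exists>d>0. \<forall>a b. a \<le> x \<and> x \<le> b \<and> b - a < d \<longrightarrow> P a b c e)" for c e
    have "Q 0 1"
    proof (rule Bolzano[of 0 1 Q])
      fix c e f assume Q: "Q c e" "Q e f" "c \<le> e" "e \<le> (f::real)"
      then obtain d1 d2 where d: "d1 > 0" "d2 > 0"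
        "\<And>a b. a \<le> x \<and> x \<le> b \<and> b - a < d1 \<Longrightarrow> P a b c e"
        "\<And>a b. a \<le> x \<and> x \<le> b \<and> b - a < d2 \<Longrightarrow> P a b e f"
        unfolding Q_def by blast
      show "Q c f"
        unfolding Q_def
      proof (intro exI[of _ "min d1 d2"] conjI allI impI)
        fix a b assume ab: "a \<le> x \<and> x \<le> b \<and> b - a < min d1 d2"
        show "P a b c f"
          unfolding P_def
        proof (intro impI)
          assume *: "{a..b} \<subseteq> {0..1}" "{c..f} \<subseteq> {0..1}"
          then have sub: "{c..e} \<subseteq> {0..1}" "{e..f} \<subseteq> {0..1}" using Q by auto
          then obtain s1 s2 where s: "flat_section ({a..b} \<times> {c..e}) H s1" "flat_section ({a..b} \<times> {e..f}) H s2"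
            using d(3)[of a b] d(4)[of a b] ab * unfolding P_def by auto
          have un: "{a..b} \<times> {c..e} \<union> {a..b} \<times> {e..f} = {a..b} \<times> {c..f}"
            using Q by force
          have "({a..b} \<times> {c..e}) \<inter> ({a..b} \<times> {e..f}) = {a..b} \<times> {e}"
            using Q by force
          then have "connected (({a..b} \<times> {c..e}) \<inter> ({a..b} \<times> {e..f}))"
            by (simp add: connected_Times)
          with flat_section_glue[OF s] HX[OF *] un
          show "\<exists>s. flat_section ({a..b} \<times> {c..f}) H s"
            by (simp add: closed_Times)
        qed
      qed (use d in auto)
    next
      fix y :: real assume y: "0 \<le> y" "y \<le> 1"
      obtain i where i: "i \<in> I" "H (x, y) \<in> U i"
        using cover[of "H (x, y)"] HX[of 0 1 0 1] x y by (auto simp: image_subset_iff)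
      have "(x, y) \<in> {0..1} \<times> {0..1}"
        using x y by auto
      from continuous_map_nbhd[OF H open_chart[OF i(1)] this i(2)]
      obtain e where e: "e > 0"
        "\<And>z. z \<in> {0..1} \<times> {0..1} \<Longrightarrow> dist z (x, y) < e \<Longrightarrow> H z \<in> U i"
        by metis
      show "\<exists>d>0. \<forall>c e. c \<le> y \<and> y \<le> e \<and> e - c < d \<longrightarrow> Q c e"
      proof (intro exI[of _ "e / 2"] conjI allI impI)
        fix c f assume cf: "c \<le> y \<and> y \<le> f \<and> f - c < e / 2"
        show "Q c f"
          unfolding Q_def
        proof (intro exI[of _ "e / 2"] conjI allI impI)
          fix a b assume ab: "a \<le> x \<and> x \<le> b \<and> b - a < e / 2"
          show "P a b c f"
            unfolding P_def
          proof (intro impI)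
            assume *: "{a..b} \<subseteq> {0..1}" "{c..f} \<subseteq> {0..1}"
            have "H z \<in> U i" if "z \<in> {a..b} \<times> {c..f}" for z
            proof (rule e(2))
              show "z \<in> {0..1} \<times> {0..1}" using that * by auto
              have "dist z (x, y) \<le> dist (fst z) x + dist (snd z) y"
                by (simp add: dist_prod_def sqrt_sum_squares_le_sum)
              also have "\<dots> < e / 2 + e / 2"
                using that ab cf by (intro add_strict_mono) (auto simp: dist_real_def abs_if)
              finally show "dist z (x, y) < e" by simp
            qed
            then have "H ` ({a..b} \<times> {c..f}) \<subseteq> U i" by blast
            moreover have "continuous_map (top_of_set ({a..b} \<times> {c..f})) X H"
              using * by (intro continuous_map_from_subtopology_mono[OF H]) auto
            ultimately show "\<exists>s. flat_section ({a..b} \<times> {c..f}) H s"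
              using flat_section_in_chart[OF _ i(1)] by blast
          qed
        qed (use e in auto)
      qed (use e in auto)
    qed auto
    then show "\<exists>d>0. \<forall>a b. a \<le> x \<and> x \<le> b \<and> b - a < d \<longrightarrow> P a b 0 1"
      unfolding Q_def .
  qed auto
  then show ?thesis unfolding P_def by auto
qed

lemma flat_section_path:
  assumes "pathin X p"
  shows "\<exists>s. flat_section {0..1} p s"
proof -
  have "continuous_map (top_of_set ({0..1} \<times> {0..1})) (top_of_set {0..1}) (fst :: real \<times> real \<Rightarrow> real)"
    by (auto intro!: continuous_intros)
  from flat_section_square[OF continuous_map_compose[OF this assms[unfolded pathin_def]]]
  obtain s where s: "flat_section ({0..1} \<times> {0..1}) (\<lambda>z::real\<times>real. p (fst z)) s"
    by (auto simp: o_def)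
  have "continuous_on {0..1::real} (\<lambda>t. (t, 0::real))"
    by (intro continuous_intros)
  from flat_section_compose[OF s this] have "flat_section {0..1} p (\<lambda>t. s (t, 0))"
    by (simp add: image_subset_iff)
  then show ?thesis by blast
qed

text \<open>Another flat section multiplies both values on the right by the same element, which
  cancels. With the inverse on the value at 1, concatenation becomes multiplication in the same
  order, giving a homomorphism rather than an antihomomorphism.\<close>

definition monodromy :: "'i \<Rightarrow> (real \<Rightarrow> 'x) \<Rightarrow> 'a" where
  "monodromy i p = (let s = SOME s. flat_section {0..1} p s in s 0 i \<otimes> inv (s 1 i))"

lemma monodromy_eq:
  assumes p: "pathin X p" "i \<in> I" "p 0 \<in> U i" "p 1 \<in> U i" and s: "flat_section {0..1} p s"
  shows "monodromy i p = s 0 i \<otimes> inv (s 1 i)"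
proof -
  define s' where "s' = (SOME s. flat_section {0..1} p s)"
  have s': "flat_section {0..1} p s'"
    unfolding s'_def using someI_ex[OF flat_section_path[OF p(1)]] .
  have "p ` {0..1} \<subseteq> topspace X"
    using p(1) continuous_map_image_subset_topspace unfolding pathin_def by fastforce
  from flat_section_unique[OF s s' _ this]
  obtain c where c: "c \<in> carrier G" "s' 0 i = s 0 i \<otimes> c" "s' 1 i = s 1 i \<otimes> c"
    using p by force
  have "s 0 i \<in> carrier G" "s 1 i \<in> carrier G"
    using flat_sectionD(1)[OF s] p by auto
  then have "s' 0 i \<otimes> inv (s' 1 i) = s 0 i \<otimes> inv (s 1 i)"
    using c by (simp add: inv_mult_group m_assoc) (simp add: m_assoc[symmetric])
  then show ?thesis by (simp add: monodromy_def s'_def[symmetric] Let_def)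
qed

lemma monodromy_closed:
  assumes "pathin X p" "i \<in> I" "p 0 \<in> U i" "p 1 \<in> U i"
  shows "monodromy i p \<in> carrier G"
proof -
  obtain s where s: "flat_section {0..1} p s" using flat_section_path[OF assms(1)] by blast
  show ?thesis
    using monodromy_eq[OF assms s] flat_sectionD(1)[OF s] assms by simp
qed

lemma monodromy_concat:
  assumes pq: "pathin X p" "pathin X q" "pathin X (path_concat p q)" "p 1 = q 0"
    and i: "i \<in> I" "p 0 \<in> U i" "p 1 \<in> U i" "q 1 \<in> U i"
  shows "monodromy i (path_concat p q) = monodromy i p \<otimes> monodromy i q"
proof -
  obtain s where s: "flat_section {0..1} (path_concat p q) s" using flat_section_path[OF pq(3)] by blast
  have "flat_section {0..1} (\<lambda>t. path_concat p q (t / 2)) (\<lambda>t. s (t / 2))"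
    by (rule flat_section_compose[OF s]) (auto intro!: continuous_intros)
  then have s1: "flat_section {0..1} p (\<lambda>t. s (t / 2))"
    by (rule flat_section_cong) (auto simp: path_concat_def)
  have "flat_section {0..1} (\<lambda>t. path_concat p q ((t + 1) / 2)) (\<lambda>t. s ((t + 1) / 2))"
    by (rule flat_section_compose[OF s]) (auto intro!: continuous_intros)
  moreover have "path_concat p q ((t + 1) / 2) = q t" if "t \<in> {0..1}" for t
    using that pq(4) by (cases "t = 0") (auto simp: path_concat_def add_divide_distrib)
  ultimately have s2: "flat_section {0..1} q (\<lambda>t. s ((t + 1) / 2))"
    by (rule flat_section_cong)
  have cl: "s 0 i \<in> carrier G" "s (1/2) i \<in> carrier G" "s 1 i \<in> carrier G"
    using flat_sectionD(1)[OF s, of 0 i] flat_sectionD(1)[OF s, of "1/2" i]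
      flat_sectionD(1)[OF s, of 1 i] i pq(4) by (auto simp: path_concat_def)
  have "monodromy i p = s 0 i \<otimes> inv (s (1/2) i)"
    using monodromy_eq[OF pq(1) i(1-3) s1] by simp
  moreover have "monodromy i q = s (1/2) i \<otimes> inv (s 1 i)"
    using monodromy_eq[OF pq(2) i(1) _ i(4) s2] i pq(4) by simp
  moreover have "monodromy i (path_concat p q) = s 0 i \<otimes> inv (s 1 i)"
    using monodromy_eq[OF pq(3) i(1) _ _ s] i by (simp add: path_concat_def)
  ultimately show ?thesis
    using cl by (simp add: m_assoc) (simp add: m_assoc[symmetric])
qed

text \<open>A flat section over the homotopy square restricts to both loops. On the two sides where
  the homotopy stays at \<open>x0\<close>, its values in chart \<open>i\<close> are locally
  constant, hence equal at both ends.\<close>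

lemma monodromy_homotopic:
  assumes "(p, q) \<in> loop_homotopy X x0" and i: "i \<in> I" "x0 \<in> U i"
  shows "monodromy i p = monodromy i q"
proof -
  have pq: "pathin X p" "pathin X q" "p 0 = x0" "p 1 = x0" "q 0 = x0" "q 1 = x0"
    using assms(1) by (auto simp: loop_homotopy_def loops_def)
  obtain h where h: "continuous_map (prod_topology (top_of_set {0..1::real}) (top_of_set {0..1::real})) X h"
    "\<And>x. h (0, x) = p x" "\<And>x. h (1, x) = q x"
    "\<And>t. t \<in> {0..1} \<Longrightarrow> h (t, 0) = x0 \<and> h (t, 1) = x0"
    using assms(1) unfolding loop_homotopy_def homotopic_with_def by auto
  have h': "continuous_map (top_of_set ({0..1} \<times> {0..1})) X h"
    using h(1) by (simp add: prod_topology_subtopology_eu)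
  obtain s where s: "flat_section ({0..1} \<times> {0..1}) h s"
    using flat_section_square[OF h'] by blast
  have row: "flat_section {0..1} (\<lambda>t. h (a, t)) (\<lambda>t. s (a, t))" if "a \<in> {0..1}" for a
    using that by (intro flat_section_compose[OF s]) (auto intro!: continuous_intros)
  have col: "s (0, a) i = s (1, a) i" if "a = 0 \<or> a = 1" for a
  proof -
    have "(\<lambda>t. s (t, a) i) constant_on {0..1}"
    proof (rule locally_constant_imp_constant)
      fix t :: real assume t: "t \<in> {0..1}"
      then have "(t, a) \<in> {0..1} \<times> {0..1}" "h (t, a) \<in> U i"
        using h(4)[OF t] i that by auto
      then obtain e where e: "e > 0" "\<And>u. u \<in> {0..1} \<times> {0..1} \<Longrightarrow> dist u (t, a) < e \<Longrightarrow> s u i = s (t, a) i"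
        using flat_sectionD(3)[OF s _ i(1)] by blast
      let ?T = "{0..1} \<inter> ball t e"
      have "s (x, a) i = s (t, a) i" if "x \<in> ?T" for x
        using that \<open>a = 0 \<or> a = 1\<close> by (intro e(2)) (auto simp: dist_prod_def dist_commute)
      moreover have "openin (top_of_set {0..1}) ?T" "t \<in> ?T"
        using t e(1) by auto
      ultimately show "\<exists>T. openin (top_of_set {0..1}) T \<and> t \<in> T \<and> (\<forall>x\<in>T. s (x, a) i = s (t, a) i)"
        by blast
    qed auto
    then show ?thesis unfolding constant_on_def by force
  qed
  have "monodromy i p = s (0, 0) i \<otimes> inv (s (0, 1) i)"
    using monodromy_eq[OF pq(1) i(1) _ _ row[of 0, simplified h]] pq i by simp
  moreover have "monodromy i q = s (1, 0) i \<otimes> inv (s (1, 1) i)"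
    using monodromy_eq[OF pq(2) i(1) _ _ row[of 1, simplified h]] pq i by simp
  ultimately show ?thesis using col by simp
qed

end

section \<open>The octagon model\<close>

text \<open>The union in the definition ranges over all pairs of representatives, whose
  concatenations all lie in one class.\<close>

lemma pi1_mult:
  assumes "p \<in> loops X x0" "q \<in> loops X x0"
  shows "loop_homotopy X x0 `` {p} \<otimes>\<^bsub>fundamental_group X x0\<^esub> loop_homotopy X x0 `` {q} =
    loop_homotopy X x0 `` {path_concat p q}"
proof -
  let ?R = "loop_homotopy X x0"
  have *: "?R `` {path_concat p' q'} = ?R `` {path_concat p q}"
    if p': "p' \<in> ?R `` {p}" and q': "q' \<in> ?R `` {q}" for p' q'
  proof -
    have "(p, p') \<in> ?R" "(q, q') \<in> ?R" using p' q' by auto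
    then have *: "path_homotopic X p p'" "path_homotopic X q q'" by (auto simp: loop_homotopy_iff)
    have "path_homotopic X (path_concat p q) (path_concat p' q')"
      using * assms by (intro path_homotopic_concat) (auto simp: loops_def)
    moreover have "path_concat p q \<in> loops X x0"
      using assms by (auto simp: loops_def intro: pathin_path_concat)
    ultimately have "(path_concat p q, path_concat p' q') \<in> ?R" by (simp add: loop_homotopy_iff)
    from equiv_class_eq[OF equiv_loop_homotopy this] show ?thesis by simp
  qed
  have pq: "p \<in> ?R `` {p}" "q \<in> ?R `` {q}"
    by (rule equiv_class_self[OF equiv_loop_homotopy] assms)+
  have "(\<Union>p'\<in>?R `` {p}. \<Union>q'\<in>?R `` {q}. ?R `` {path_concat p' q'}) = ?R `` {path_concat p q}"
  proof (intro equalityI UN_least)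
    show "?R `` {path_concat p' q'} \<subseteq> ?R `` {path_concat p q}"
      if "p' \<in> ?R `` {p}" "q' \<in> ?R `` {q}" for p' q'
      using *[OF that] by simp
    show "?R `` {path_concat p q} \<subseteq> (\<Union>p'\<in>?R `` {p}. \<Union>q'\<in>?R `` {q}. ?R `` {path_concat p' q'})"
      by (rule order_trans[OF _ UN_upper[OF pq(1)]], rule UN_upper[OF pq(2)])
  qed
  then show ?thesis by (simp add: fundamental_group_def)
qed

lemma path_concat_in_loops:
  "p \<in> loops X x0 \<Longrightarrow> q \<in> loops X x0 \<Longrightarrow> path_concat p q \<in> loops X x0"
  by (auto simp: loops_def intro: pathin_path_concat)

section \<open>Points of the surface as classes of points of the disc\<close>

definition oct :: "complex \<Rightarrow> complex set" where
  "oct z = octagon_rel `` {z}"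

lemma quotient_map_oct: "quotient_map (top_of_set (cball 0 1)) F2 oct"
  unfolding F2_def using quotient_map_quotient_topology[of "top_of_set (cball 0 1)" octagon_rel]
  by (simp add: oct_def[abs_def])

lemma continuous_map_oct: "continuous_map (top_of_set (cball 0 1)) F2 oct"
  by (rule quotient_imp_continuous_map[OF quotient_map_oct])

lemma topspace_F2: "topspace F2 = oct ` cball 0 1"
  using quotient_imp_surjective_map[OF quotient_map_oct] by simp

lemma oct_eq_iff:
  assumes "z \<in> cball 0 1" "w \<in> cball 0 1"
  shows "oct z = oct w \<longleftrightarrow> equivclp octagon_gluing z w"
  using eq_equiv_class_iff[OF equiv_octagon_rel assms] assms by (simp add: oct_def octagon_rel_def)

lemma norm_octagon_edge [simp]: "norm (octagon_edge k t) = 1"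
  by (simp add: octagon_edge_def)

lemma octagon_edge_in_disc: "octagon_edge k t \<in> cball 0 1"
  by simp

lemma oct_edge_glue:
  assumes "k \<in> {0, 1, 4, 5}" "t \<in> {0..1}"
  shows "oct (octagon_edge k t) = oct (octagon_edge (k + 2) (1 - t))"
proof -
  have "octagon_gluing (octagon_edge k t) (octagon_edge (k + 2) (1 - t))"
    using assms unfolding octagon_gluing_def by blast
  then show ?thesis
    by (simp only: oct_eq_iff octagon_edge_in_disc r_into_equivclp)
qed

text \<open>Gluings join points of the unit circle, so a chain of gluings that starts in the disc
  stays there, and \<open>oct\<close> is constant along it.\<close>

lemma oct_eq_induct [consumes 3, case_names glue sym trans refl]:
  assumes "z \<in> cball 0 1" "w \<in> cball 0 1" "oct z = oct w"
    and glue: "\<And>k t. k \<in> {0, 1, 4, 5} \<Longrightarrow> t \<in> {0..1} \<Longrightarrow> P (octagon_edge k t) (octagon_edge (k + 2) (1 - t))"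
    and sym: "\<And>x y. x \<in> cball 0 1 \<Longrightarrow> y \<in> cball 0 1 \<Longrightarrow> oct x = oct y \<Longrightarrow> P x y \<Longrightarrow> P y x"
    and trans: "\<And>x y z. x \<in> cball 0 1 \<Longrightarrow> y \<in> cball 0 1 \<Longrightarrow> z \<in> cball 0 1 \<Longrightarrow>
        oct x = oct y \<Longrightarrow> oct y = oct z \<Longrightarrow> P x y \<Longrightarrow> P y z \<Longrightarrow> P x z"
    and refl: "P z z"
  shows "P z w"
proof -
  have step: "x \<in> cball 0 1 \<and> y \<in> cball 0 1 \<and> oct x = oct y \<and> P x y" if "octagon_gluing x y" for x y
  proof -
    obtain k t where "k \<in> {0, 1, 4, 5}" "t \<in> {0..1}" "x = octagon_edge k t" "y = octagon_edge (k + 2) (1 - t)"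
      using \<open>octagon_gluing x y\<close> unfolding octagon_gluing_def by blast
    then show ?thesis using oct_edge_glue glue octagon_edge_in_disc by metis
  qed
  have step': "x \<in> cball 0 1 \<and> y \<in> cball 0 1 \<and> oct x = oct y \<and> P x y"
    if "octagon_gluing x y \<or> octagon_gluing y x" for x y
    using that step[of x y] step[of y x] sym[of y x] by metis
  have "equivclp octagon_gluing z w" using oct_eq_iff[OF assms(1,2)] assms(3) by simp
  then have "w \<in> cball 0 1 \<and> P z w \<and> oct z = oct w"
  proof (induction rule: equivclp_induct)
    case base
    then show ?case using assms refl by blast
  next
    case (step y u)
    then have y: "y \<in> cball 0 1" "P z y" "oct z = oct y" by auto
    have u: "u \<in> cball 0 1" "P y u" "oct y = oct u" using step'[OF step(2)] by auto
    show ?case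
      using trans[OF assms(1) y(1) u(1) y(3) u(3) y(2) u(2)] y u by simp
  qed
  then show ?thesis by blast
qed

text \<open>The sectors of angular width \<open>\<pi>/4\<close> around the directions \<open>\<pi>c/4\<close>, so that integral \<open>c\<close> belong to the
  vertices and half-integral \<open>c\<close> to the midpoints of the edges of the octagon.\<close>

definition sector :: "real \<Rightarrow> complex set" where
  "sector c = {z \<in> cball 0 1. Re (z * cis (- (pi * c / 4))) > cos (pi / 8) * norm z}"

lemma openin_sector: "openin (top_of_set (cball 0 1)) (sector c)"
proof -
  have "open {z. Re (z * cis (- (pi * c / 4))) > cos (pi / 8) * norm z}"
    by (intro open_Collect_less continuous_intros)
  moreover have "sector c = cball 0 1 \<inter> {z. Re (z * cis (- (pi * c / 4))) > cos (pi / 8) * norm z}"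
    by (auto simp: sector_def)
  ultimately show ?thesis by auto
qed

lemma sector_subset: "sector c \<subseteq> cball 0 1"
  by (auto simp: sector_def)

lemma polar_in_sector:
  assumes "0 < r" "r \<le> 1"
  shows "of_real r * cis \<theta> \<in> sector c \<longleftrightarrow> cos (pi / 8) < cos (\<theta> - pi * c / 4)"
proof -
  have *: "of_real r * cis \<theta> * cis (- (pi * c / 4)) = of_real r * cis (\<theta> - pi * c / 4)"
    by (simp only: mult.assoc cis_mult) simp
  have "Re (of_real r * cis \<theta> * cis (- (pi * c / 4))) = r * cos (\<theta> - pi * c / 4)"
    unfolding * by simp
  then show ?thesis
    using assms unfolding sector_def by (simp add: norm_mult mult.commute del: times_complex.sel)
qed

lemma polar_cases:
  assumes "z \<in> cball 0 1" "z \<noteq> 0"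
  obtains r \<theta> where "0 < r" "r \<le> 1" "z = of_real r * cis \<theta>" "0 \<le> \<theta>" "\<theta> < 2 * pi"
  using that[of "norm z" "Arg2pi z"] Arg2pi_eq[of z] Arg2pi[of z] assms
  by (simp add: cis_conv_exp)

lemma zero_notin_sector: "0 \<notin> sector c"
  by (simp add: sector_def)

lemma sector_periodic: "sector (c + 8) = sector c"
proof -
  have "cos (\<theta> - pi * (c + 8) / 4) = cos (\<theta> - pi * c / 4)" for \<theta>
  proof -
    have "\<theta> - pi * c / 4 = (\<theta> - pi * (c + 8) / 4) + 2 * pi" by (simp add: algebra_simps add_divide_distrib)
    then show ?thesis by (metis cos_periodic)
  qed
  then have *: "z \<in> sector (c + 8) \<longleftrightarrow> z \<in> sector c" if "z \<in> cball 0 1" "z \<noteq> 0" for z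
    using polar_in_sector by (metis polar_cases[OF that])
  show ?thesis
  proof (rule Set.set_eqI)
    show "z \<in> sector (c + 8) \<longleftrightarrow> z \<in> sector c" for z
      using *[of z] zero_notin_sector[of c] zero_notin_sector[of "c + 8"]
        subsetD[OF sector_subset, of z c] subsetD[OF sector_subset, of z "c + 8"]
      by (cases "z \<in> cball 0 1 \<and> z \<noteq> 0") auto
  qed
qed

lemma octagon_edge_in_sector: "octagon_edge k t \<in> sector c \<longleftrightarrow> cos (pi / 8) < cos (pi * (k + t - c) / 4)"
  using polar_in_sector[of 1 "pi * (k + t) / 4" c]
  by (simp add: octagon_edge_def algebra_simps add_divide_distrib diff_divide_distrib)

lemma cos_gt_cos_pi8: "\<bar>d\<bar> < 1/2 \<Longrightarrow> cos (pi / 8) < cos (pi * d / 4)"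
proof -
  assume d: "\<bar>d\<bar> < 1/2"
  have "cos (pi / 8) < cos (pi * \<bar>d\<bar> / 4)"
    by (rule cos_monotone_0_pi) (use d mult_strict_left_mono[OF d, of pi] in auto)
  also have "\<dots> = cos (pi * d / 4)"
    by (cases "d \<ge> 0") auto
  finally show ?thesis .
qed

text \<open>A full turn is 8 units, so \<open>15/2\<close> is again half a unit short of the centre;
  angles beyond a half-turn are reflected.\<close>

lemma cos_le_cos_pi8: 
  assumes "1/2 \<le> \<bar>d\<bar>" "\<bar>d\<bar> \<le> 15/2"
  shows "cos (pi * d / 4) \<le> cos (pi / 8)"
proof -
  have "cos (pi * d / 4) = cos (pi * \<bar>d\<bar> / 4)"
    by (cases "d \<ge> 0") auto
  also have "\<dots> \<le> cos (pi / 8)"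
  proof (cases "\<bar>d\<bar> \<le> 4")
    case True
    have "pi * \<bar>d\<bar> \<le> pi * 4" "pi * (1/2) \<le> pi * \<bar>d\<bar>" using True assms by (intro mult_left_mono; simp)+
    then show ?thesis by (intro cos_monotone_0_pi_le) auto
  next
    case False
    have "pi * 4 \<le> pi * \<bar>d\<bar>" "pi * \<bar>d\<bar> \<le> pi * (15/2)" using False assms by (intro mult_left_mono; simp)+
    then have "cos (2 * pi - pi * \<bar>d\<bar> / 4) \<le> cos (pi / 8)" by (intro cos_monotone_0_pi_le) auto
    then show ?thesis by (simp add: cos_diff)
  qed
  finally show ?thesis .
qed

lemma octagon_edge_sectorI: "\<bar>k + t - c\<bar> < 1/2 \<Longrightarrow> octagon_edge k t \<in> sector c"
  using cos_gt_cos_pi8 octagon_edge_in_sector by blast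

lemma octagon_edge_not_sector:
  "1/2 \<le> \<bar>k + t - c\<bar> \<Longrightarrow> \<bar>k + t - c\<bar> \<le> 15/2 \<Longrightarrow> octagon_edge k t \<notin> sector c"
  using cos_le_cos_pi8 octagon_edge_in_sector by (meson not_le)

text \<open>The angles between a common point and the two centres are below \<open>pi / 8\<close>,
  so by the addition formula the centres are less than \<open>pi / 4\<close> apart. Indices whose
  distance is between 1 and 7 belong to directions at least \<open>pi / 4\<close> apart modulo full
  turns.\<close>

lemma sector_disjoint:
  assumes "z \<in> sector c" "z \<in> sector c'" shows "\<not> (1 \<le> \<bar>c - c'\<bar> \<and> \<bar>c - c'\<bar> \<le> 7)"
proof
  assume d: "1 \<le> \<bar>c - c'\<bar> \<and> \<bar>c - c'\<bar> \<le> 7"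
  obtain r \<theta> where z: "0 < r" "r \<le> 1" "z = of_real r * cis \<theta>"
    using polar_cases[of z] assms sector_subset zero_notin_sector by (metis subsetD)
  let ?a = "\<theta> - pi * c / 4" and ?b = "\<theta> - pi * c' / 4"
  have a: "cos ?a > cos (pi / 8)" and b: "cos ?b > cos (pi / 8)"
    using assms z polar_in_sector by auto
  have c0: "cos (pi / 8) > 0" by (intro cos_gt_zero) auto
  have "(cos (pi / 8))\<^sup>2 < (cos ?a)\<^sup>2" "(cos (pi / 8))\<^sup>2 < (cos ?b)\<^sup>2"
    using a b c0 by (intro power_strict_mono; simp)+
  then have s: "(sin ?a)\<^sup>2 < (sin (pi/8))\<^sup>2" "(sin ?b)\<^sup>2 < (sin (pi/8))\<^sup>2"
    by (simp_all add: sin_squared_eq)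
  have "\<bar>sin ?a\<bar> * \<bar>sin ?b\<bar> \<le> sin (pi/8) * sin (pi/8)"
    using s by (intro mult_mono) (auto simp: abs_le_square_iff sin_ge_zero intro: order.strict_implies_order
      abs_le_square_iff[THEN iffD2, THEN order_trans])
  moreover have "cos ?a * cos ?b > cos (pi/8) * cos (pi/8)"
    using a b c0 by (intro mult_strict_mono) auto
  ultimately have "cos (?a - ?b) > cos (pi/8) * cos (pi/8) - sin (pi/8) * sin (pi/8)"
    unfolding cos_diff using abs_mult[of "sin ?a" "sin ?b"] by linarith
  also have "cos (pi/8) * cos (pi/8) - sin (pi/8) * sin (pi/8) = cos (pi/8 + pi/8)"
    by (simp only: cos_add)
  also have "pi/8 + pi/8 = pi / 4" by simp
  finally have *: "cos (pi / 4) < cos (pi * (c' - c) / 4)"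
    by (simp add: algebra_simps diff_divide_distrib)
  have "cos (pi * (c' - c) / 4) = cos (pi * \<bar>c - c'\<bar> / 4)"
    by (cases "c \<ge> c'") (auto simp: abs_if, metis cos_minus minus_diff_eq minus_divide_left mult_minus_right)
  also have "\<dots> \<le> cos (pi / 4)"
  proof (cases "\<bar>c - c'\<bar> \<le> 4")
    case True
    have "pi * \<bar>c - c'\<bar> \<le> pi * 4" "pi * 1 \<le> pi * \<bar>c - c'\<bar>" using True d by (intro mult_left_mono; simp)+
    then show ?thesis by (intro cos_monotone_0_pi_le) auto
  next
    case False
    have "pi * 4 \<le> pi * \<bar>c - c'\<bar>" "pi * \<bar>c - c'\<bar> \<le> pi * 7" using False d by (intro mult_left_mono; simp)+
    then have "cos (2 * pi - pi * \<bar>c - c'\<bar> / 4) \<le> cos (pi / 4)" by (intro cos_monotone_0_pi_le) auto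
    then show ?thesis by (simp add: cos_diff)
  qed
  finally show False using * by simp
qed

lemma sector_cover:
  assumes "z \<in> cball 0 1" "z \<noteq> 0"
  shows "\<exists>j<16. z \<in> sector (real j / 2)"
proof -
  obtain r \<theta> where z: "0 < r" "r \<le> 1" "z = of_real r * cis \<theta>" "0 \<le> \<theta>" "\<theta> < 2 * pi"
    using polar_cases[OF assms] by metis
  \<comment> \<open>The angle in units of \<open>pi / 8\<close>, rounded down. Sectors have
    half-width \<open>pi / 8\<close>, so the one centred at the rounded angle contains the
    point.\<close>
  define m where "m = nat \<lfloor>8 * \<theta> / pi\<rfloor>"
  have "0 \<le> 8 * \<theta> / pi" "8 * \<theta> / pi < 16" using z by (auto simp: field_simps)
  then have m: "real m \<le> 8 * \<theta> / pi" "8 * \<theta> / pi < real m + 1" "m < 16"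
    unfolding m_def by linarith+
  have *: "\<theta> - pi * (real m / 2) / 4 = pi * ((8 * \<theta> / pi - real m) / 2) / 4" by (simp add: field_simps)
  have "cos (pi / 8) < cos (\<theta> - pi * (real m / 2) / 4)"
    unfolding * by (rule cos_gt_cos_pi8) (use m in auto)
  then have "z \<in> sector (real m / 2)"
    using polar_in_sector z by blast
  then show ?thesis using m by blast
qed

text \<open>A local system on the surface, described on the disc. The labels are locally constant on
  each chart, and a gluing changes them by a right factor common to all charts. Hence the quotients
  \<open>l i z \<otimes> inv (l j z)\<close> descend to the surface and serve as transition
  functions, while the labels themselves form a flat section over the disc.\<close>

locale octagon_labels = group G for G (structure) +
  fixes I :: "'i set" and V :: "'i \<Rightarrow> complex set" and l :: "'i \<Rightarrow> complex \<Rightarrow> 'a"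
  assumes subset_disc: "i \<in> I \<Longrightarrow> V i \<subseteq> cball 0 1"
    and open_level: "i \<in> I \<Longrightarrow> openin (top_of_set (cball 0 1)) {z \<in> V i. l i z = g}"
    and label_closed: "i \<in> I \<Longrightarrow> z \<in> V i \<Longrightarrow> l i z \<in> carrier G"
    and covers_disc: "z \<in> cball 0 1 \<Longrightarrow> \<exists>i\<in>I. z \<in> V i"
    and gluing: "k \<in> {0, 1, 4, 5} \<Longrightarrow> t \<in> {0..1} \<Longrightarrow>
      \<exists>x\<in>carrier G. \<forall>i\<in>I. (octagon_edge k t \<in> V i \<longleftrightarrow> octagon_edge (k + 2) (1 - t) \<in> V i) \<and>
        (octagon_edge k t \<in> V i \<longrightarrow> l i (octagon_edge (k + 2) (1 - t)) = l i (octagon_edge k t) \<otimes> x)"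
begin

lemma oct_eq_labels:
  assumes "z \<in> cball 0 1" "w \<in> cball 0 1" "oct z = oct w"
  shows "\<exists>x\<in>carrier G. \<forall>i\<in>I. (z \<in> V i \<longleftrightarrow> w \<in> V i) \<and> (z \<in> V i \<longrightarrow> l i w = l i z \<otimes> x)"
  using assms
proof (induction rule: oct_eq_induct)
  case (glue k t)
  then show ?case by (rule gluing)
next
  case (sym x y)
  then obtain a where a: "a \<in> carrier G" "\<And>i. i \<in> I \<Longrightarrow> (x \<in> V i \<longleftrightarrow> y \<in> V i)"
    "\<And>i. i \<in> I \<Longrightarrow> x \<in> V i \<Longrightarrow> l i y = l i x \<otimes> a" by blast
  have "l i x = l i y \<otimes> inv a" if "i \<in> I" "y \<in> V i" for i
    using a that label_closed[of i x] by (simp add: m_assoc)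
  then show ?case using a by (intro bexI[of _ "inv a"]) auto
next
  case (trans x y z)
  from trans(6) obtain a where a: "a \<in> carrier G" "\<And>i. i \<in> I \<Longrightarrow> (x \<in> V i \<longleftrightarrow> y \<in> V i)"
    "\<And>i. i \<in> I \<Longrightarrow> x \<in> V i \<Longrightarrow> l i y = l i x \<otimes> a" by blast
  from trans(7) obtain b where b: "b \<in> carrier G" "\<And>i. i \<in> I \<Longrightarrow> (y \<in> V i \<longleftrightarrow> z \<in> V i)"
    "\<And>i. i \<in> I \<Longrightarrow> y \<in> V i \<Longrightarrow> l i z = l i y \<otimes> b" by blast
  have "l i z = l i x \<otimes> (a \<otimes> b)" if "i \<in> I" "x \<in> V i" for i
    using a b that label_closed[of i x] by (simp add: m_assoc)
  then show ?case using a b by (intro bexI[of _ "a \<otimes> b"]) auto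
next
  case refl
  then show ?case using label_closed by (intro bexI[of _ \<one>]) auto
qed

lemma oct_in_chart_iff: "z \<in> cball 0 1 \<Longrightarrow> i \<in> I \<Longrightarrow> oct z \<in> oct ` V i \<longleftrightarrow> z \<in> V i"
  using oct_eq_labels subset_disc by (smt (verit, best) image_iff subsetD)

lemma chart_saturated:
  "i \<in> I \<Longrightarrow> z \<in> V i \<Longrightarrow> w \<in> cball 0 1 \<Longrightarrow> oct z = oct w \<Longrightarrow> w \<in> V i"
  using oct_in_chart_iff[of w i] by (simp add: image_iff) metis

definition \<tau> :: "'i \<Rightarrow> 'i \<Rightarrow> complex set \<Rightarrow> 'a" where
  "\<tau> i j Y = (let z = SOME z. z \<in> cball 0 1 \<and> oct z = Y in l i z \<otimes> inv (l j z))"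

lemma \<tau>_oct:
  assumes z: "z \<in> cball 0 1" "z \<in> V i" "z \<in> V j" "i \<in> I" "j \<in> I"
  shows "\<tau> i j (oct z) = l i z \<otimes> inv (l j z)"
proof -
  define w where "w = (SOME w. w \<in> cball 0 1 \<and> oct w = oct z)"
  have w: "w \<in> cball 0 1" "oct w = oct z"
    using someI[of "\<lambda>w. w \<in> cball 0 1 \<and> oct w = oct z" z] z unfolding w_def by auto
  obtain x where x: "x \<in> carrier G" "l i w = l i z \<otimes> x" "l j w = l j z \<otimes> x"
    using oct_eq_labels[OF z(1) w(1)] w z by metis
  have "l i w \<otimes> inv (l j w) = l i z \<otimes> inv (l j z)"
    using x label_closed z by (simp add: inv_mult_group m_assoc) (simp add: m_assoc[symmetric])
  then show ?thesis unfolding \<tau>_def w_def[symmetric] Let_def .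
qed

lemma openin_chart: "i \<in> I \<Longrightarrow> openin (top_of_set (cball 0 1)) (V i)"
proof -
  assume i: "i \<in> I"
  have "V i = (\<Union>g. {z \<in> V i. l i z = g})" by blast
  moreover have "openin (top_of_set (cball 0 1)) (\<Union>g. {z \<in> V i. l i z = g})"
    using open_level[OF i] by blast
  ultimately show ?thesis by simp
qed

lemma openin_oct_image:
  assumes "openin (top_of_set (cball 0 1)) S" "\<And>z w. z \<in> S \<Longrightarrow> w \<in> cball 0 1 \<Longrightarrow> oct z = oct w \<Longrightarrow> w \<in> S"
  shows "openin F2 (oct ` S)"
proof -
  have S: "S \<subseteq> cball 0 1" using openin_subset[OF assms(1)] by simp
  then have "{z \<in> cball 0 1. oct z \<in> oct ` S} = S"
    using assms(2) by blast
  moreover have "oct ` S \<subseteq> topspace F2" using S topspace_F2 by blast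
  ultimately show ?thesis
    using quotient_map_oct[unfolded quotient_map_def, THEN conjunct2, rule_format, of "oct ` S"] assms(1)
    by simp
qed

sublocale local_system G F2 I "\<lambda>i. oct ` V i" \<tau>
proof unfold_locales
  show "openin F2 (oct ` V i)" if "i \<in> I" for i
    using openin_chart[OF that] oct_in_chart_iff[OF _ that] subset_disc[OF that]
    by (intro openin_oct_image) (auto simp: image_iff)
  show "\<exists>i\<in>I. x \<in> oct ` V i" if "x \<in> topspace F2" for x
    using that covers_disc unfolding topspace_F2 by blast
  fix i j x assume ij: "i \<in> I" "j \<in> I" and x: "x \<in> oct ` V i" "x \<in> oct ` V j"
  obtain z where z': "x = oct z" "z \<in> V i" using x(1) by blast
  have z1: "z \<in> cball 0 1" using subsetD[OF subset_disc[OF ij(1)] z'(2)] .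
  have "z \<in> V j" using oct_in_chart_iff[OF z1 ij(2)] x(2) z'(1) by simp
  note z = z1 z' this
  show "\<tau> i j x \<in> carrier G"
    using z ij \<tau>_oct label_closed by simp
  show "\<tau> i j x \<otimes> \<tau> j k x = \<tau> i k x" if "k \<in> I" "x \<in> oct ` V k" for k
  proof -
    have "z \<in> V k" using that z oct_in_chart_iff by blast
    then show ?thesis
      using z ij that \<tau>_oct label_closed by (simp add: m_assoc) (simp add: m_assoc[symmetric])
  qed
  let ?c = "\<tau> i j x"
  let ?S = "{w \<in> cball 0 1. w \<in> V i \<and> w \<in> V j \<and> \<tau> i j (oct w) = ?c}"
  \<comment> \<open>The level sets of the labels are open, and the transition function depends on
    the labels only.\<close>
  have S: "?S = (\<Union>(g, h)\<in>{(g, h). g \<otimes> inv h = ?c}. {w \<in> V i. l i w = g} \<inter> {w \<in> V j. l j w = h})"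
    (is "_ = ?T")
  proof (rule Set.set_eqI)
    fix w
    have "w \<in> ?S \<longleftrightarrow> w \<in> cball 0 1 \<and> w \<in> V i \<and> w \<in> V j \<and> l i w \<otimes> inv (l j w) = ?c"
      using \<tau>_oct[of w i j] ij by auto
    also have "\<dots> \<longleftrightarrow> w \<in> ?T"
      using subsetD[OF subset_disc[OF ij(1)], of w] by auto
    finally show "w \<in> ?S \<longleftrightarrow> w \<in> ?T" .
  qed
  have "openin (top_of_set (cball 0 1)) ?S"
    unfolding S using open_level ij by (intro openin_Union) auto
  then have "openin F2 (oct ` ?S)"
    by (rule openin_oct_image) (use chart_saturated ij in auto)
  moreover have "x \<in> oct ` ?S" using z by blast
  moreover have "oct ` ?S \<subseteq> oct ` V i \<inter> oct ` V j" by blast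
  ultimately show "\<exists>N. openin F2 N \<and> x \<in> N \<and> N \<subseteq> oct ` V i \<inter> oct ` V j \<and> (\<forall>y\<in>N. \<tau> i j y = ?c)"
    by (intro exI[of _ "oct ` ?S"]) auto
qed

text \<open>The labels transform correctly since \<open>l i\<close> is
  \<open>(l i \<otimes> inv (l j)) \<otimes> l j\<close>. So the monodromy of a path coming from the
  disc can be read off from the labels at its ends.\<close>

lemma flat_section_oct:
  assumes \<delta>: "continuous_on {0..1} \<delta>" "\<delta> ` {0..1} \<subseteq> cball 0 1"
  shows "flat_section {0..1::real} (\<lambda>t. oct (\<delta> t)) (\<lambda>t i. l i (\<delta> t))"
  unfolding flat_section_def
proof (intro conjI ballI impI)
  fix t i assume t: "t \<in> {0..1::real}" and i: "i \<in> I" "oct (\<delta> t) \<in> oct ` V i"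
  have d: "\<delta> u \<in> cball 0 1" if "u \<in> {0..1}" for u using \<delta> that by blast
  have ti: "\<delta> t \<in> V i" using i oct_in_chart_iff d[OF t] by blast
  show "l i (\<delta> t) \<in> carrier G" using label_closed i ti by blast
  have "continuous_map (top_of_set {0..1}) (top_of_set (cball 0 1)) \<delta>" using \<delta> by auto
  from continuous_map_nbhd[OF this open_level[OF i(1), of "l i (\<delta> t)"] t] ti
  show "\<exists>e>0. \<forall>u\<in>{0..1}. dist u t < e \<longrightarrow> oct (\<delta> u) \<in> oct ` V i \<and> l i (\<delta> u) = l i (\<delta> t)"
    by (simp add: image_iff) blast
  show "l i (\<delta> t) = \<tau> i j (oct (\<delta> t)) \<otimes> l j (\<delta> t)" if j: "j \<in> I" "oct (\<delta> t) \<in> oct ` V j" for j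
  proof -
    have "\<delta> t \<in> V j" using j oct_in_chart_iff d[OF t] by blast
    then show ?thesis
      using \<tau>_oct[OF d[OF t] ti _ i(1) j(1)] label_closed i j ti by (simp add: m_assoc)
  qed
qed

end

section \<open>Behaviour of the vertex and edge sectors under the gluing\<close>

definition sector_label :: "real \<Rightarrow> complex \<Rightarrow> nat" where
  "sector_label e z = (THE j. j < 8 \<and> z \<in> sector (real j + e))"

lemma sector_label_eq:
  assumes "j < 8" "z \<in> sector (real j + e)"
  shows "sector_label e z = j"
  unfolding sector_label_def
proof (rule the_equality)
  fix i assume i: "i < 8 \<and> z \<in> sector (real i + e)"
  have "\<not> (1 \<le> \<bar>real i - real j\<bar> \<and> \<bar>real i - real j\<bar> \<le> 7)"
    using sector_disjoint[of z "real i + e" "real j + e"] i assms by simp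
  moreover have "\<bar>real i - real j\<bar> \<le> 7" using i assms by auto
  ultimately show "i = j" by linarith
qed (use assms in simp)

lemma openin_sector_label_level:
  "openin (top_of_set (cball 0 1)) {z \<in> (\<Union>j<8. sector (real j + e)). f (sector_label e z) = g}"
proof -
  have "{z \<in> (\<Union>j<8. sector (real j + e)). f (sector_label e z) = g} = (\<Union>j\<in>{j. j < 8 \<and> f j = g}. sector (real j + e))"
    using sector_label_eq by auto
  then show ?thesis using openin_sector by auto
qed

text \<open>Edge \<open>k\<close> runs from vertex \<open>k\<close> to vertex \<open>k + 1\<close>
  and is glued backwards to edge \<open>k + 2\<close>, so its start meets vertex
  \<open>k + 3\<close> and its end vertex \<open>k + 2\<close>. The reduction modulo 8 takes effect
  for \<open>k = 5\<close>. Midpoints of edges lie in no vertex sector.\<close>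

lemma glued_vertex_sectors:
  assumes k: "k \<in> {0, 1, 4, 5}" and t: "t \<in> {0..1}"
  defines "z \<equiv> octagon_edge k t" and "w \<equiv> octagon_edge (k + 2) (1 - t)"
  shows "t < 1/2 \<Longrightarrow> z \<in> sector (real k) \<and> w \<in> sector (real ((k + 3) mod 8))"
    and "t > 1/2 \<Longrightarrow> z \<in> sector (real (k + 1)) \<and> w \<in> sector (real (k + 2))"
    and "t = 1/2 \<Longrightarrow> z \<notin> (\<Union>j<8. sector (real j)) \<and> w \<notin> (\<Union>j<8. sector (real j))"
proof -
  assume t': "t < 1/2"
  have "w \<in> sector (real (k + 3))"
    unfolding w_def by (rule octagon_edge_sectorI) (use t t' in auto)
  moreover have "sector (real ((k + 3) mod 8)) = sector (real (k + 3))"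
    using k sector_periodic[of 0] by auto
  ultimately show "z \<in> sector (real k) \<and> w \<in> sector (real ((k + 3) mod 8))"
    unfolding z_def using octagon_edge_sectorI[of k t "real k"] t t' by auto
next
  assume t': "t > 1/2"
  show "z \<in> sector (real (k + 1)) \<and> w \<in> sector (real (k + 2))"
    unfolding z_def w_def by (intro conjI octagon_edge_sectorI) (use t t' in auto)
next
  assume t': "t = 1/2"
  have "octagon_edge k (1/2) \<notin> sector (real j)" if "j < 8" "k < 8" for j k
  proof (rule octagon_edge_not_sector)
    show "1 / 2 \<le> \<bar>real k + 1 / 2 - real j\<bar>" by (cases "j \<le> k") auto
    show "\<bar>real k + 1 / 2 - real j\<bar> \<le> 15 / 2" using that by linarith
  qed
  moreover have "z = octagon_edge k (1/2)" "w = octagon_edge (k + 2) (1/2)"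
    unfolding z_def w_def t' by simp_all
  moreover have "k < 8" "k + 2 < 8" using k by auto
  ultimately show "z \<notin> (\<Union>j<8. sector (real j)) \<and> w \<notin> (\<Union>j<8. sector (real j))"
    by blast
qed

lemma glued_edge_sectors:
  assumes k: "k \<in> {0, 1, 4, 5}" and t: "t \<in> {0..1}"
  defines "z \<equiv> octagon_edge k t" and "w \<equiv> octagon_edge (k + 2) (1 - t)"
  shows "0 < t \<Longrightarrow> t < 1 \<Longrightarrow> z \<in> sector (real k + 1/2) \<and> w \<in> sector (real (k + 2) + 1/2)"
    and "t = 0 \<or> t = 1 \<Longrightarrow> z \<notin> (\<Union>j<8. sector (real j + 1/2)) \<and> w \<notin> (\<Union>j<8. sector (real j + 1/2))"
proof -
  assume "0 < t" "t < 1"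
  then have "\<bar>t - 1/2\<bar> < 1/2" "\<bar>1/2 - t\<bar> < 1/2" by linarith+
  then show "z \<in> sector (real k + 1/2) \<and> w \<in> sector (real (k + 2) + 1/2)"
    unfolding z_def w_def by (intro conjI octagon_edge_sectorI) auto
next
  assume t': "t = 0 \<or> t = 1"
  have "octagon_edge k t \<notin> sector (real j + 1/2)" if "j < 8" "k < 8" "t = 0 \<or> t = 1" for j k t
  proof (rule octagon_edge_not_sector)
    show "1 / 2 \<le> \<bar>real k + t - (real j + 1/2)\<bar>"
      using that(3) by (cases "j \<le> k"; cases "j = k") auto
    show "\<bar>real k + t - (real j + 1/2)\<bar> \<le> 15 / 2" using that by linarith
  qed
  then show "z \<notin> (\<Union>j<8. sector (real j + 1/2)) \<and> w \<notin> (\<Union>j<8. sector (real j + 1/2))"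
    unfolding z_def w_def using t' k by auto
qed

definition vertex_chart :: "complex set" where "vertex_chart = (\<Union>j<8. sector (real j + 0))"
definition edge_chart :: "complex set" where "edge_chart = (\<Union>j<8. sector (real j + 1/2))"

lemma vertex_chartI: "j < 8 \<Longrightarrow> z \<in> sector (real j) \<Longrightarrow> z \<in> vertex_chart"
  by (auto simp: vertex_chart_def)

lemma charts_cover_disc: "z \<in> cball 0 1 \<Longrightarrow> z \<in> ball 0 1 \<or> z \<in> vertex_chart \<or> z \<in> edge_chart"
proof (cases "z = 0")
  case False
  assume "z \<in> cball 0 1"
  then obtain m where m: "m < 16" "z \<in> sector (real m / 2)" using sector_cover False by blast
  show ?thesis
  proof (cases "even m")
    case True
    then obtain j where "m = 2 * j" by blast
    then have "j < 8" "z \<in> sector (real j + 0)" using m by auto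
    then show ?thesis unfolding vertex_chart_def by blast
  next
    case False
    then obtain j where "m = 2 * j + 1" using oddE by blast
    then have "j < 8" "real m / 2 = real j + 1/2" using m by auto
    then have "z \<in> sector (real j + 1/2)" using m(2) by (simp only:)
    then show ?thesis unfolding edge_chart_def using \<open>j < 8\<close> by blast
  qed
qed auto

section \<open>Three charts of the surface, with labels realising prescribed values on the
  generators\<close>

datatype octagon_chart = Interior | Vertex | Edge

context group begin

definition boundary_label :: "'a \<Rightarrow> 'a \<Rightarrow> 'a \<Rightarrow> 'a \<Rightarrow> nat \<Rightarrow> 'a" where
  "boundary_label A B C D k = [A, B, inv A, inv B, C, D, inv C, inv D] ! k"

text \<open>The recursion makes the label of vertex \<open>k\<close> times the inverse label of
  vertex \<open>k + 1\<close> equal to the boundary letter of edge \<open>k\<close>, which thereby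
  becomes the monodromy along that edge. After eight steps the label is the inverse of the boundary
  word.\<close>

primrec vertex_label :: "'a \<Rightarrow> 'a \<Rightarrow> 'a \<Rightarrow> 'a \<Rightarrow> nat \<Rightarrow> 'a" where
  "vertex_label A B C D 0 = \<one>"
| "vertex_label A B C D (Suc k) = inv (boundary_label A B C D k) \<otimes> vertex_label A B C D k"

text \<open>The right factor by which labels change from edge \<open>k\<close> to its partner. It
  carries the label of vertex \<open>k\<close> to that of vertex \<open>k + 3\<close>, and has to
  carry the label of vertex \<open>k + 1\<close> to that of vertex \<open>k + 2\<close> as
  well.\<close>

definition edge_jump :: "'a \<Rightarrow> 'a \<Rightarrow> 'a \<Rightarrow> 'a \<Rightarrow> nat \<Rightarrow> 'a" where
  "edge_jump A B C D k = inv (vertex_label A B C D k) \<otimes> vertex_label A B C D (k + 3)"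

text \<open>The first edge of a glued pair is labelled by the unit, so its partner has to carry the
  jump.\<close>

definition edge_label :: "'a \<Rightarrow> 'a \<Rightarrow> 'a \<Rightarrow> 'a \<Rightarrow> nat \<Rightarrow> 'a" where
  "edge_label A B C D k = (if k \<in> {0, 1, 4, 5} then \<one> else edge_jump A B C D (k - 2))"

definition octagon_label :: "'a \<Rightarrow> 'a \<Rightarrow> 'a \<Rightarrow> 'a \<Rightarrow> octagon_chart \<Rightarrow> complex \<Rightarrow> 'a" where
  "octagon_label A B C D i z = (case i of Interior \<Rightarrow> \<one>
     | Vertex \<Rightarrow> vertex_label A B C D (sector_label 0 z)
     | Edge \<Rightarrow> edge_label A B C D (sector_label (1/2) z))"

lemma octagon_labels:
  assumes cl: "A \<in> carrier G" "B \<in> carrier G" "C \<in> carrier G" "D \<in> carrier G"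
    and rel: "A \<otimes> B \<otimes> inv A \<otimes> inv B \<otimes> C \<otimes> D \<otimes> inv C \<otimes> inv D = \<one>"
  shows "octagon_labels G UNIV (case_octagon_chart (ball 0 1) vertex_chart edge_chart) (octagon_label A B C D)"
proof -
  let ?L = "vertex_label A B C D" and ?y = "boundary_label A B C D" and ?x = "edge_jump A B C D"
  have y: "?y 0 = A" "?y 1 = B" "?y 2 = inv A" "?y 3 = inv B" "?y 4 = C" "?y 5 = D" "?y 6 = inv C" "?y 7 = inv D"
    by (simp_all add: boundary_label_def)
  have ycl: "?y k \<in> carrier G" if "k < 8" for k
  proof -
    have "k \<in> {0, 1, 2, 3, 4, 5, 6, 7}" using that by auto
    then show ?thesis using y cl by auto
  qed
  have Lcl: "?L k \<in> carrier G" if "k \<le> 8" for k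
    using that by (induction k) (auto simp: ycl)
  have L: "?L (Suc k) = inv (?y k) \<otimes> ?L k" for k by simp
  \<comment> \<open>Here the surface relation enters: it makes the labels close up around the
    octagon.\<close>
  have L8: "?L 8 = ?L 0"
  proof -
    have "?L 8 = inv (A \<otimes> B \<otimes> inv A \<otimes> inv B \<otimes> C \<otimes> D \<otimes> inv C \<otimes> inv D)"
      using cl by (simp add: numeral_eq_Suc boundary_label_def inv_mult_group m_assoc)
    then show ?thesis using rel by simp
  qed
  have xcl: "?x k \<in> carrier G" if "k \<le> 5" for k
    using that Lcl by (simp add: edge_jump_def)
  have x1: "?L (k + 3) = ?L k \<otimes> ?x k" if "k \<le> 5" for k
    using that Lcl[of k] Lcl[of "k + 3"] by (simp add: edge_jump_def m_assoc[symmetric] del: vertex_label.simps)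
  \<comment> \<open>Both ends of the edge admit the same jump because the letter of edge
    \<open>k + 2\<close> is the inverse of the letter of edge \<open>k\<close>.\<close>
  have x2: "?L (k + 2) = ?L (k + 1) \<otimes> ?x k" if "k \<in> {0, 1, 4, 5}" for k
  proof -
    have yk: "?y (k + 2) = inv (?y k)" using that by (auto simp: boundary_label_def)
    have "k < 8" "k + 1 < 8" "k \<le> 8" using that by auto
    note c = ycl[OF this(1)] ycl[OF this(2)] Lcl[OF this(3)]
    have "?L (k + 3) = ?y k \<otimes> (inv (?y (k + 1)) \<otimes> (inv (?y k) \<otimes> ?L k))"
      using yk c by (simp add: numeral_eq_Suc)
    then show ?thesis
      using c by (simp add: edge_jump_def numeral_eq_Suc m_assoc) (simp add: m_assoc[symmetric])
  qed
  have Lmod: "?L ((k + 3) mod 8) = ?L (k + 3)" if "k \<le> 5" for k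
  proof (cases "k = 5")
    case True
    then show ?thesis using L8 by simp
  next
    case False
    then have "k + 3 < 8" using that by simp
    then show ?thesis by (simp only: mod_less)
  qed
  show ?thesis
  proof unfold_locales
    fix i
    show "case_octagon_chart (ball 0 1) vertex_chart edge_chart i \<subseteq> cball (0::complex) 1"
      using sector_subset by (auto simp: vertex_chart_def edge_chart_def split: octagon_chart.split)
    show "openin (top_of_set (cball 0 1))
        {z \<in> case_octagon_chart (ball 0 1) vertex_chart edge_chart i. octagon_label A B C D i z = g}" for g
    proof (cases i)
      case Interior
      have "openin (top_of_set (cball 0 1)) (ball (0::complex) 1)"
        by (intro open_subset) auto
      then show ?thesis using Interior by (cases "g = \<one>") (auto simp: octagon_label_def ball_def)
    next
      case Vertex
      then show ?thesis using openin_sector_label_level[of 0 "vertex_label A B C D" g]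
        by (simp add: octagon_label_def vertex_chart_def)
    next
      case Edge
      then show ?thesis using openin_sector_label_level[of "1/2" "edge_label A B C D" g]
        by (simp add: octagon_label_def edge_chart_def)
    qed
    show "octagon_label A B C D i z \<in> carrier G"
      if zi: "z \<in> case_octagon_chart (ball 0 1) vertex_chart edge_chart i" for z
    proof (cases i)
      case Vertex
      then obtain j where "j < 8" "z \<in> sector (real j + 0)" using zi by (auto simp: vertex_chart_def)
      then show ?thesis using Vertex Lcl[of j] sector_label_eq[of j z 0] by (simp add: octagon_label_def)
    next
      case Edge
      then obtain j where j: "j < 8" "z \<in> sector (real j + 1/2)" using zi by (auto simp: edge_chart_def)
      then have "edge_label A B C D j \<in> carrier G" using xcl[of "j - 2"] by (auto simp: edge_label_def)
      then show ?thesis using Edge sector_label_eq[OF j] by (simp add: octagon_label_def)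
    qed (simp add: octagon_label_def)
    show "\<exists>i\<in>UNIV. z \<in> case_octagon_chart (ball 0 1) vertex_chart edge_chart i" if "z \<in> cball 0 1" for z
      using charts_cover_disc[OF that] by (metis UNIV_I octagon_chart.case)
  next
    fix k t assume k: "k \<in> {0, 1, 4, 5::nat}" and t: "t \<in> {0..1::real}"
    let ?z = "octagon_edge k t" and ?w = "octagon_edge (k + 2) (1 - t)"
    have k5: "k \<le> 5" "k < 8" "k + 1 < 8" "k + 2 < 8" "(k + 3) mod 8 < 8" using k by auto
    have int: "?z \<notin> ball 0 1" "?w \<notin> ball 0 1" by auto
    have ver: "(?z \<in> vertex_chart \<longleftrightarrow> ?w \<in> vertex_chart) \<and>
      (?z \<in> vertex_chart \<longrightarrow> ?L (sector_label 0 ?w) = ?L (sector_label 0 ?z) \<otimes> ?x k)"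
    proof -
      consider "t < 1/2" | "t > 1/2" | "t = 1/2" by linarith
      then show ?thesis
      proof cases
        case 1
        note * = glued_vertex_sectors(1)[OF k t 1]
        then have "sector_label 0 ?z = k" "sector_label 0 ?w = (k + 3) mod 8"
          using sector_label_eq[of k ?z 0] sector_label_eq[of "(k + 3) mod 8" ?w 0] k5 by auto
        moreover have "?z \<in> vertex_chart" "?w \<in> vertex_chart"
          using vertex_chartI[OF k5(2)] vertex_chartI[OF k5(5)] * by blast+
        ultimately show ?thesis using Lmod x1 k5 by metis
      next
        case 2
        note * = glued_vertex_sectors(2)[OF k t 2]
        then have "sector_label 0 ?z = k + 1" "sector_label 0 ?w = k + 2"
          using sector_label_eq[of "k + 1" ?z 0] sector_label_eq[of "k + 2" ?w 0] k5 by auto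
        moreover have "?z \<in> vertex_chart" "?w \<in> vertex_chart"
          using vertex_chartI[OF k5(3)] vertex_chartI[OF k5(4)] * by blast+
        ultimately show ?thesis using x2[OF k] by metis
      next
        case 3
        note * = glued_vertex_sectors(3)[OF k t 3]
        then show ?thesis by (auto simp: vertex_chart_def)
      qed
    qed
    have edge: "(?z \<in> edge_chart \<longleftrightarrow> ?w \<in> edge_chart) \<and> (?z \<in> edge_chart \<longrightarrow>
      edge_label A B C D (sector_label (1/2) ?w) = edge_label A B C D (sector_label (1/2) ?z) \<otimes> ?x k)"
    proof (cases "0 < t \<and> t < 1")
      case True
      then have *: "?z \<in> sector (real k + 1/2)" "?w \<in> sector (real (k + 2) + 1/2)"
        using glued_edge_sectors(1)[OF k t] by blast+
      then have "sector_label (1/2) ?z = k" "sector_label (1/2) ?w = k + 2"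
        using sector_label_eq[OF k5(2) *(1)] sector_label_eq[OF k5(4) *(2)] by auto
      moreover have "?z \<in> edge_chart" "?w \<in> edge_chart"
        unfolding edge_chart_def using * k5 by blast+
      moreover have "edge_label A B C D (k + 2) = edge_label A B C D k \<otimes> ?x k"
        using k xcl[OF k5(1)] by (auto simp: edge_label_def)
      ultimately show ?thesis by metis
    next
      case False
      then have "t = 0 \<or> t = 1" using t by auto
      then show ?thesis using glued_edge_sectors(2)[OF k t] by (auto simp: edge_chart_def)
    qed
    have "(?z \<in> case_octagon_chart (ball 0 1) vertex_chart edge_chart i \<longleftrightarrow>
           ?w \<in> case_octagon_chart (ball 0 1) vertex_chart edge_chart i) \<and>
        (?z \<in> case_octagon_chart (ball 0 1) vertex_chart edge_chart i \<longrightarrow>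
         octagon_label A B C D i ?w = octagon_label A B C D i ?z \<otimes> ?x k)" for i
    proof (cases i)
      case Interior
      then show ?thesis using int by simp
    next
      case Vertex
      show ?thesis unfolding Vertex octagon_label_def octagon_chart.case by (rule ver)
    next
      case Edge
      show ?thesis unfolding Edge octagon_label_def octagon_chart.case by (rule edge)
    qed
    then show "\<exists>x\<in>carrier G. \<forall>i\<in>UNIV. (?z \<in> case_octagon_chart (ball 0 1) vertex_chart edge_chart i \<longleftrightarrow>
           ?w \<in> case_octagon_chart (ball 0 1) vertex_chart edge_chart i) \<and>
        (?z \<in> case_octagon_chart (ball 0 1) vertex_chart edge_chart i \<longrightarrow>
         octagon_label A B C D i ?w = octagon_label A B C D i ?z \<otimes> x)"
      using xcl[OF k5(1)] by blast
  qed
qed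

text \<open>The homomorphism is the monodromy in the vertex chart, which contains the base point.
  Along an edge the labels form a flat section; at the ends they are the labels of consecutive
  vertices, whose quotient is the letter of the edge.\<close>

lemma hom_pi1_F2_exists:
  assumes cl: "A \<in> carrier G" "B \<in> carrier G" "C \<in> carrier G" "D \<in> carrier G"
    and rel: "A \<otimes> B \<otimes> inv A \<otimes> inv B \<otimes> C \<otimes> D \<otimes> inv C \<otimes> inv D = \<one>"
  shows "\<exists>\<rho>\<in>hom pi1_F2 G. \<rho> a1 = A \<and> \<rho> b1 = B \<and> \<rho> a2 = C \<and> \<rho> b2 = D"
proof -
  let ?V = "case_octagon_chart (ball 0 1) vertex_chart edge_chart :: octagon_chart \<Rightarrow> complex set"
  let ?L = "vertex_label A B C D" and ?y = "boundary_label A B C D"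
  interpret oct: octagon_labels G UNIV ?V "octagon_label A B C D"
    using octagon_labels[OF assms] .
  have edge_sector: "octagon_edge k 0 \<in> sector (real k + 0)" "octagon_edge k 1 \<in> sector (real (k + 1) + 0)" for k
    by (auto intro!: octagon_edge_sectorI)
  have base: "F2_base = oct (octagon_edge 0 0)" by (simp add: F2_base_def oct_def)
  have "octagon_edge 0 0 \<in> vertex_chart"
    unfolding vertex_chart_def by (rule UN_I[of 0]) (use edge_sector(1)[of 0] in simp_all)
  then have base_chart: "F2_base \<in> oct ` ?V Vertex"
    unfolding base by auto
  define \<rho> where "\<rho> c = oct.monodromy Vertex (SOME p. p \<in> c)" for c
  let ?cl = "\<lambda>p. loop_homotopy F2 F2_base `` {p}"
  have \<rho>: "\<rho> (?cl p) = oct.monodromy Vertex p" if p: "p \<in> loops F2 F2_base" for p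
  proof -
    have "p \<in> ?cl p" by (rule equiv_class_self[OF equiv_loop_homotopy p])
    then have "(SOME q. q \<in> ?cl p) \<in> ?cl p" by (rule someI[of "\<lambda>q. q \<in> ?cl p"])
    then have "(p, SOME q. q \<in> ?cl p) \<in> loop_homotopy F2 F2_base" by simp
    from oct.monodromy_homotopic[OF this UNIV_I base_chart] show ?thesis by (simp add: \<rho>_def)
  qed
  have carrier: "\<exists>p\<in>loops F2 F2_base. c = ?cl p" if "c \<in> carrier pi1_F2" for c
    using that unfolding pi1_F2_def fundamental_group_def quotient_def by auto
  have loopD: "pathin F2 p" "p 0 = F2_base" "p 1 = F2_base" if "p \<in> loops F2 F2_base" for p
    using that by (auto simp: loops_def)
  have hom: "\<rho> \<in> hom pi1_F2 G"
  proof (rule homI)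
    fix c assume "c \<in> carrier pi1_F2"
    then obtain p where p: "p \<in> loops F2 F2_base" "c = ?cl p" using carrier by blast
    show "\<rho> c \<in> carrier G"
      unfolding p(2) \<rho>[OF p(1)]
      by (rule oct.monodromy_closed[OF loopD(1)[OF p(1)] UNIV_I]) (simp_all only: loopD[OF p(1)] base_chart)
    fix d assume "d \<in> carrier pi1_F2"
    then obtain q where q: "q \<in> loops F2 F2_base" "d = ?cl q" using carrier by blast
    have pq: "path_concat p q \<in> loops F2 F2_base" using path_concat_in_loops[OF p(1) q(1)] .
    have "c \<otimes>\<^bsub>pi1_F2\<^esub> d = ?cl (path_concat p q)"
      unfolding p(2) q(2) pi1_F2_def by (rule pi1_mult[OF p(1) q(1)])
    moreover have "oct.monodromy Vertex (path_concat p q) = oct.monodromy Vertex p \<otimes> oct.monodromy Vertex q"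
      by (rule oct.monodromy_concat[OF loopD(1)[OF p(1)] loopD(1)[OF q(1)] loopD(1)[OF pq] _ UNIV_I])
        (simp_all only: loopD[OF p(1)] loopD[OF q(1)] base_chart)
    ultimately show "\<rho> (c \<otimes>\<^bsub>pi1_F2\<^esub> d) = \<rho> c \<otimes> \<rho> d"
      by (simp only: \<rho>[OF pq] p(2) q(2) \<rho>[OF p(1)] \<rho>[OF q(1)])
  qed
  \<comment> \<open>The bound \<open>k < 7\<close> keeps the index \<open>k + 1\<close> of the
    sector of the end point below 8; edge 7 would end in the sector of index 0.\<close>
  have edge: "\<rho> (edge_class k) = ?y k" if k: "k < 7" and y: "?y k \<in> carrier G" for k
  proof -
    let ?p = "\<lambda>t. oct (octagon_edge k t)"
    have ec: "edge_class k = ?cl ?p" by (simp add: edge_class_def oct_def)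
    have cont: "continuous_on {0..1} (octagon_edge k)"
      unfolding octagon_edge_def by (auto intro!: continuous_intros)
    have "continuous_map (top_of_set {0..1}) (top_of_set (cball 0 1)) (octagon_edge k)"
      using cont by auto
    from continuous_map_compose[OF this continuous_map_oct] have path: "pathin F2 ?p"
      by (simp add: pathin_def o_def)
    have ends: "?p 0 = F2_base" "?p 1 = F2_base"
    proof -
      have "octagon_edge k 1 = octagon_edge (Suc k) 0" by (simp add: octagon_edge_def add.commute)
      then show "?p 0 = F2_base" "?p 1 = F2_base"
        using octagon_vertices[of k] octagon_vertices[of "Suc k"] k by (simp_all add: oct_def)
    qed
    have loop: "?p \<in> loops F2 F2_base" using path ends by (simp add: loops_def)
    have lab: "octagon_label A B C D Vertex (octagon_edge k 0) = ?L k"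
      "octagon_label A B C D Vertex (octagon_edge k 1) = ?L (k + 1)"
      using sector_label_eq[OF _ edge_sector(1)[of k]] sector_label_eq[OF _ edge_sector(2)[of k]] k
      by (simp_all add: octagon_label_def)
    have "oct.monodromy Vertex ?p = octagon_label A B C D Vertex (octagon_edge k 0) \<otimes>
        inv (octagon_label A B C D Vertex (octagon_edge k 1))"
      by (rule oct.monodromy_eq[OF path UNIV_I _ _ oct.flat_section_oct[OF cont]])
        (simp_all only: ends base_chart, auto)
    also have "\<dots> = ?L k \<otimes> inv (inv (?y k) \<otimes> ?L k)" unfolding lab by simp
    also have "\<dots> = ?y k"
    proof -
      have "?L k = octagon_label A B C D Vertex (octagon_edge k 0)" using lab by simp
      also have "\<dots> \<in> carrier G"
        by (rule oct.label_closed[OF UNIV_I]) (use edge_sector(1)[of k] k in \<open>auto simp: vertex_chart_def intro!: bexI[of _ k]\<close>)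
      finally show ?thesis using y by (simp add: inv_mult_group m_assoc[symmetric])
    qed
    finally show ?thesis unfolding ec \<rho>[OF loop] .
  qed
  have "\<rho> a1 = A" "\<rho> b1 = B" "\<rho> a2 = C" "\<rho> b2 = D"
    unfolding a1_def b1_def a2_def b2_def using edge[of 0] edge[of 1] edge[of 4] edge[of 5] cl
    by (simp_all add: boundary_label_def)
  then show ?thesis using hom by blast
qed

end

section \<open>Generation of the fundamental group\<close>

text \<open>Used when two loops are composed: the way back \<open>b\<close> to the base point and
  the next way out \<open>b'\<close> cancel.\<close>

lemma path_concat_cancel:
  assumes "pathin X a" "pathin X p" "pathin X b" "pathin X b'" "pathin X q" "pathin X c"
    and ends: "a 1 = p 0" "p 1 = b 0" "b 1 = b' 0" "b' 1 = q 0" "q 1 = c 0"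
    and bb': "path_homotopic X (path_concat b b') (\<lambda>t. b 0)"
  shows "path_homotopic X (path_concat (path_concat a (path_concat p b)) (path_concat b' (path_concat q c)))
    (path_concat a (path_concat (path_concat p q) c))"
proof -
  have e: "p 1 = q 0"
    using path_homotopic_ends[OF bb'] ends by simp
  have r: "pathin X (path_concat q c)" "pathin X (path_concat b' (path_concat q c))"
    "pathin X (path_concat p b)" "pathin X (path_concat b b')"
    using assms by (auto intro!: pathin_path_concat)
  have "path_homotopic X (path_concat b (path_concat b' (path_concat q c)))
      (path_concat (path_concat b b') (path_concat q c))"
    by (rule path_homotopic_sym, rule path_concat_assoc) (use assms r in auto)
  also have "path_homotopic X \<dots> (path_concat (\<lambda>t. b 0) (path_concat q c))"
    by (rule path_homotopic_concat[OF bb' path_homotopic_refl[OF r(1)]]) (use ends in simp)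
  also have "path_homotopic X \<dots> (path_concat q c)"
    by (rule path_concat_const_left[OF r(1)]) (use ends e in simp)
  finally have 1: "path_homotopic X (path_concat b (path_concat b' (path_concat q c))) (path_concat q c)" .
  have "path_homotopic X (path_concat (path_concat p b) (path_concat b' (path_concat q c)))
      (path_concat p (path_concat b (path_concat b' (path_concat q c))))"
    by (rule path_concat_assoc) (use assms r in auto)
  also have "path_homotopic X \<dots> (path_concat p (path_concat q c))"
    by (rule path_homotopic_concat[OF path_homotopic_refl[OF assms(2)] 1]) (use ends in simp)
  also have "path_homotopic X \<dots> (path_concat (path_concat p q) c)"
    by (rule path_homotopic_sym, rule path_concat_assoc) (use assms e in auto)
  finally have 2: "path_homotopic X (path_concat (path_concat p b) (path_concat b' (path_concat q c)))
      (path_concat (path_concat p q) c)" .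
  have "path_homotopic X (path_concat (path_concat a (path_concat p b)) (path_concat b' (path_concat q c)))
    (path_concat a (path_concat (path_concat p b) (path_concat b' (path_concat q c))))"
    by (rule path_concat_assoc) (use assms r in auto)
  also have "path_homotopic X \<dots> (path_concat a (path_concat (path_concat p q) c))"
    by (rule path_homotopic_concat[OF path_homotopic_refl[OF assms(1)] 2]) (use ends in simp)
  finally show ?thesis .
qed

lemma rev_path_path_concat:
  assumes "pathin X p" "pathin X q" "p 1 = q 0"
  shows "path_homotopic X (rev_path (path_concat p q)) (path_concat (rev_path q) (rev_path p))"
proof (rule path_homotopic_eq)
  show "pathin X (rev_path (path_concat p q))"
    using assms by (intro pathin_rev_path pathin_path_concat)
  fix t :: real assume "t \<in> {0..1}"
  consider "t < 1/2" | "t = 1/2" | "t > 1/2" by linarith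
  then show "rev_path (path_concat p q) t = path_concat (rev_path q) (rev_path p) t"
  proof cases
    case 1
    have "2 * (1 - t) - 1 = 1 - 2 * t" by simp
    then show ?thesis using 1 unfolding rev_path_def path_concat_def by simp
  next
    case 2
    show ?thesis unfolding 2 rev_path_def path_concat_def using assms(3) by simp
  next
    case 3
    have "2 * (1 - t) = 1 - (2 * t - 1)" by simp
    then show ?thesis using 3 unfolding rev_path_def path_concat_def by simp
  qed
qed

section \<open>Paths in the surface that come from the disc, and contractions of sectors\<close>

lemma pathin_oct:
  assumes "path \<delta>" "path_image \<delta> \<subseteq> cball 0 1"
  shows "pathin F2 (\<lambda>t. oct (\<delta> t))"
proof -
  have "continuous_map (top_of_set {0..1}) (top_of_set (cball 0 1)) \<delta>"
    using assms by (auto simp: path_def path_image_def)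
  from continuous_map_compose[OF this continuous_map_oct] show ?thesis
    by (simp add: pathin_def o_def)
qed

lemma path_homotopic_oct:
  assumes "path \<delta>" "path_image \<delta> \<subseteq> cball 0 1" "path \<epsilon>" "path_image \<epsilon> \<subseteq> cball 0 1"
    "\<delta> 0 = \<epsilon> 0" "\<delta> 1 = \<epsilon> 1"
  shows "path_homotopic F2 (\<lambda>t. oct (\<delta> t)) (\<lambda>t. oct (\<epsilon> t))"
  using path_homotopic_linear[OF continuous_map_oct convex_cball, of \<delta> \<epsilon>] assms
  by (simp add: path_def path_image_def)

lemma path_concat_oct: "path_concat (\<lambda>t. oct (\<delta> t)) (\<lambda>t. oct (\<epsilon> t)) = (\<lambda>t. oct ((\<delta> +++ \<epsilon>) t))"
  by (rule ext) (simp add: path_concat_def joinpaths_def)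

abbreviation oct_seg :: "complex \<Rightarrow> complex \<Rightarrow> real \<Rightarrow> complex set" where
  "oct_seg z w \<equiv> \<lambda>t. oct (linepath z w t)"

lemma path_image_linepath_cball:
  fixes z w :: complex
  shows "z \<in> cball 0 1 \<Longrightarrow> w \<in> cball 0 1 \<Longrightarrow> path_image (linepath z w) \<subseteq> cball 0 1"
  by (simp only: path_image_linepath closed_segment_subset convex_cball)

lemma pathin_oct_seg: "z \<in> cball 0 1 \<Longrightarrow> w \<in> cball 0 1 \<Longrightarrow> pathin F2 (oct_seg z w)"
  by (rule pathin_oct[OF path_linepath path_image_linepath_cball])

lemma rev_path_oct_seg: "rev_path (oct_seg z w) = oct_seg w z"
  by (simp add: rev_path_def linepath_def algebra_simps)

lemma octagon_edge_Suc: "octagon_edge k 1 = octagon_edge (Suc k) 0"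
  by (simp add: octagon_edge_def add.commute)

lemma path_octagon_edge_affine: "path (\<lambda>t. octagon_edge k (a + b * t))"
  unfolding path_def octagon_edge_def by (auto intro!: continuous_intros)

lemma path_image_octagon_edge: "path_image (\<lambda>t. octagon_edge k (f t)) \<subseteq> cball 0 1"
  by (auto simp: path_image_def)

text \<open>In polar coordinates, the modulus moves affinely to 1 and the angle to the axis of the
  sector moves affinely to 0. The sector thus shrinks to its boundary point in direction
  \<open>pi * c / 4\<close>, and points of the unit circle stay on the circle.\<close>

definition sector_contraction :: "real \<Rightarrow> real \<Rightarrow> complex \<Rightarrow> complex" where
  "sector_contraction c s z =
     of_real (norm z + s * (1 - norm z)) * cis (pi * c / 4 + (1 - s) * Arg (z * cis (- (pi * c / 4))))"

lemma sector_contraction_0: "sector_contraction c 0 z = z"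
proof -
  define w where "w = z * cis (- (pi * c / 4))"
  have "norm w = norm z" by (simp add: w_def norm_mult)
  then have "w = of_real (norm z) * cis (Arg w)"
    using rcis_cmod_Arg[of w] by (simp add: rcis_def)
  then have "w * cis (pi * c / 4) = of_real (norm z) * cis (Arg w + pi * c / 4)"
    by (metis mult.assoc cis_mult)
  moreover have "w * cis (pi * c / 4) = z"
    by (simp add: w_def mult.assoc cis_mult)
  ultimately show ?thesis
    by (simp add: sector_contraction_def w_def[symmetric] add.commute)
qed

lemma sector_contraction_1: "sector_contraction c 1 z = cis (pi * c / 4)"
  by (simp add: sector_contraction_def)

lemma sector_contraction_in_disc:
  assumes "z \<in> cball 0 1" "s \<in> {0..1}" shows "sector_contraction c s z \<in> cball 0 1"
proof -
  have "norm z + s * (1 - norm z) \<le> 1" "0 \<le> norm z + s * (1 - norm z)"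
    using assms affine_mem_Icc[of s "norm z" 1] by (auto intro: order_trans[of 0 "norm z"])
  moreover have "norm (of_real r * cis y) = \<bar>r\<bar>" for r y by (simp add: norm_mult)
  ultimately show ?thesis by (simp only: sector_contraction_def mem_cball_0)
qed

lemma sector_contraction_periodic: "sector_contraction (c + 8) s z = sector_contraction c s z"
proof -
  have a: "pi * (c + 8) / 4 = pi * c / 4 + 2 * pi" by (simp add: algebra_simps add_divide_distrib)
  have b: "cis (x + 2 * pi) = cis x" "cis (x - 2 * pi) = cis x" for x
    by (simp_all add: complex_eq_iff cos_diff sin_diff)
  have "- (pi * (c + 8) / 4) = - (pi * c / 4) - 2 * pi" unfolding a by simp
  then have "cis (- (pi * (c + 8) / 4)) = cis (- (pi * c / 4))" by (simp only: b)
  moreover have "pi * (c + 8) / 4 + x = (pi * c / 4 + x) + 2 * pi" for x unfolding a by simp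
  then have "cis (pi * (c + 8) / 4 + x) = cis (pi * c / 4 + x)" for x by (simp only: b)
  ultimately show ?thesis by (simp only: sector_contraction_def)
qed

text \<open>The edge parameter moves affinely towards \<open>c - k\<close>. The parameter change
  \<open>1 - t\<close> of a gluing respects affine motions, so glued points remain glued during the
  contraction.\<close>

lemma sector_contraction_edge:
  assumes "\<bar>k + t - c\<bar> < 1/2"
  shows "sector_contraction c s (octagon_edge k t) = octagon_edge k (c + (1 - s) * (k + t - c) - k)"
proof -
  have "\<bar>pi * (k + t - c) / 4\<bar> < pi"
    using mult_strict_left_mono[OF assms, of pi] by (simp add: abs_mult)
  then have "Arg (cis (pi * (k + t - c) / 4)) = pi * (k + t - c) / 4"
    by (intro Arg_cis) (auto simp: abs_less_iff)
  moreover have "octagon_edge k t * cis (- (pi * c / 4)) = cis (pi * (k + t - c) / 4)"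
    unfolding octagon_edge_def cis_mult
    by (rule arg_cong[where f = cis]) (simp add: algebra_simps add_divide_distrib diff_divide_distrib)
  ultimately have *: "Arg (octagon_edge k t * cis (- (pi * c / 4))) = pi * (k + t - c) / 4"
    by simp
  have **: "pi * c / 4 + (1 - s) * (pi * (k + t - c) / 4) = pi * (k + (c + (1 - s) * (k + t - c) - k)) / 4"
    by (simp add: field_simps)
  have "norm (octagon_edge k t) + s * (1 - norm (octagon_edge k t)) = 1" by simp
  then show ?thesis
    by (simp only: sector_contraction_def * ** of_real_1 mult_1_left) (simp only: octagon_edge_def)
qed

text \<open>The rotated sector lies in the open right half-plane, where \<open>Arg\<close> is
  continuous.\<close>

lemma continuous_on_sector_contraction:
  "continuous_on ({0..1} \<times> sector c) (\<lambda>(s, z). sector_contraction c s z)"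
proof -
  have "z * cis (- (pi * c / 4)) \<notin> \<real>\<^sub>\<le>\<^sub>0" if "z \<in> sector c" for z
  proof -
    have "cos (pi / 8) > 0" by (intro cos_gt_zero) auto
    then have "Re (z * cis (- (pi * c / 4))) > 0"
      using that unfolding sector_def by (smt (verit) mem_Collect_eq mult_nonneg_nonneg norm_ge_zero)
    then show ?thesis by (auto simp: complex_nonpos_Reals_iff)
  qed
  then show ?thesis
    unfolding sector_contraction_def case_prod_unfold
    by (auto intro!: continuous_intros)
qed

section \<open>Contraction of whole charts, compatible with the gluing\<close>

definition label_contraction :: "real \<Rightarrow> real \<Rightarrow> complex \<Rightarrow> complex" where
  "label_contraction e s z = sector_contraction (real (sector_label e z) + e) s z"

lemma label_contraction_eq:
  assumes "j < 8" "z \<in> sector (real j + e)"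
  shows "label_contraction e s z = sector_contraction (real j + e) s z"
  using sector_label_eq[OF assms] by (simp add: label_contraction_def)

lemma continuous_on_label_contraction:
  "continuous_on ({0..1} \<times> (\<Union>j<8. sector (real j + e))) (\<lambda>(s, z). label_contraction e s z)"
proof -
  let ?X = "top_of_set ({0..1::real} \<times> (\<Union>j<8. sector (real j + e)))"
  have "continuous_map ?X euclidean (\<lambda>(s, z). label_contraction e s z)"
  proof (rule pasting_lemma[where I = "{..<8}" and T = "\<lambda>j. {0..1} \<times> sector (real j + e)"
        and f = "\<lambda>j (s, z). sector_contraction (real j + e) s z"])
    fix j :: nat assume j: "j \<in> {..<8}"
    have "openin (top_of_set ({0..1} \<times> cball 0 1)) ({0..1::real} \<times> sector (real j + e))"
      by (intro openin_Times openin_sector) auto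
    then show "openin ?X ({0..1} \<times> sector (real j + e))"
      by (rule openin_subset_trans) (use j sector_subset in auto)
    have "{0..1} \<times> sector (real j + e) \<subseteq> {0..1::real} \<times> (\<Union>j<8. sector (real j + e))"
      using j by auto
    then show "continuous_map (subtopology ?X ({0..1} \<times> sector (real j + e))) euclidean
        (\<lambda>(s, z). sector_contraction (real j + e) s z)"
      using continuous_on_sector_contraction[of "real j + e"]
      by (simp add: subtopology_subtopology Int_absorb1)
  next
    fix i j :: nat and x assume "i \<in> {..<8}" "j \<in> {..<8}"
      and "x \<in> topspace ?X \<inter> ({0..1} \<times> sector (real i + e)) \<inter> ({0..1} \<times> sector (real j + e))"
    then have "i = j" using sector_label_eq[of i "snd x" e] sector_label_eq[of j "snd x" e] by auto
    then show "(case x of (s, z) \<Rightarrow> sector_contraction (real i + e) s z) =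
        (case x of (s, z) \<Rightarrow> sector_contraction (real j + e) s z)" by simp
  next
    fix x assume "x \<in> topspace ?X"
    then show "\<exists>j. j \<in> {..<8} \<and> x \<in> {0..1} \<times> sector (real j + e) \<and>
        (case x of (s, z) \<Rightarrow> label_contraction e s z) = (case x of (s, z) \<Rightarrow> sector_contraction (real j + e) s z)"
      using label_contraction_eq by auto
  qed
  then show ?thesis by simp
qed


lemma edge_chart_contraction_glue:
  assumes k: "k \<in> {0, 1, 4, 5}" and t: "t \<in> {0..1}" and s: "s \<in> {0..1}"
  defines "z \<equiv> octagon_edge k t" and "w \<equiv> octagon_edge (k + 2) (1 - t)"
  assumes "z \<in> edge_chart \<or> w \<in> edge_chart"
  shows "sector_label (1/2) z = k \<and> sector_label (1/2) w = k + 2 \<and> z \<in> edge_chart \<and> w \<in> edge_chart \<and>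
    oct (label_contraction (1/2) s z) = oct (label_contraction (1/2) s w)"
proof -
  have t': "0 < t" "t < 1"
    using glued_edge_sectors(2)[OF k t] assms t unfolding edge_chart_def z_def w_def by fastforce+
  note * = glued_edge_sectors(1)[OF k t t', folded z_def w_def]
  have k8: "k < 8" "k + 2 < 8" using k by auto
  have abs_t: "\<bar>t - 1/2\<bar> < 1/2" "\<bar>1/2 - t\<bar> < 1/2" using t' by linarith+
  let ?t = "1/2 + (1 - s) * (t - 1/2)"
  have "label_contraction (1/2) s z = sector_contraction (real k + 1/2) s z"
    using label_contraction_eq[OF k8(1)] * by blast
  also have "\<dots> = octagon_edge k ?t"
    unfolding z_def using abs_t by (subst sector_contraction_edge) auto
  finally have 1: "label_contraction (1/2) s z = octagon_edge k ?t" .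
  have "label_contraction (1/2) s w = sector_contraction (real (k + 2) + 1/2) s w"
    using label_contraction_eq[OF k8(2)] * by blast
  also have "\<dots> = octagon_edge (k + 2) (1/2 + (1 - s) * (1/2 - t))"
    unfolding w_def using abs_t by (subst sector_contraction_edge) auto
  also have "1/2 + (1 - s) * (1/2 - t) = 1 - ?t" by (simp add: algebra_simps)
  finally have 2: "label_contraction (1/2) s w = octagon_edge (k + 2) (1 - ?t)" .
  have "\<bar>(1 - s) * (t - 1/2)\<bar> \<le> 1 * (1/2)"
    unfolding abs_mult using s abs_t by (intro mult_mono) auto
  then have "?t \<in> {0..1}" by (auto simp: abs_le_iff)
  moreover have "sector_label (1/2) z = k" "sector_label (1/2) w = k + 2"
    using sector_label_eq[OF k8(1)] sector_label_eq[OF k8(2)] * by blast+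
  moreover have "z \<in> edge_chart" "w \<in> edge_chart"
    unfolding edge_chart_def using * k8 by blast+
  ultimately show ?thesis unfolding 1 2 using oct_edge_glue[OF k] by blast
qed

lemma vertex_chart_contraction_glue:
  assumes k: "k \<in> {0, 1, 4, 5}" and t: "t \<in> {0..1}" and s: "s \<in> {0..1}"
  defines "z \<equiv> octagon_edge k t" and "w \<equiv> octagon_edge (k + 2) (1 - t)"
  assumes zw: "z \<in> vertex_chart \<or> w \<in> vertex_chart"
  shows "z \<in> vertex_chart \<and> w \<in> vertex_chart \<and>
    oct (label_contraction 0 s z) = oct (label_contraction 0 s w)"
proof -
  have k8: "k < 8" "k + 1 < 8" "k + 2 < 8" "(k + 3) mod 8 < 8" using k by auto
  have "t \<noteq> 1/2"
    using glued_vertex_sectors(3)[OF k t] zw unfolding vertex_chart_def z_def w_def by auto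
  then consider "t < 1/2" | "t > 1/2" by linarith
  then show ?thesis
  proof cases
    case 1
    note * = glued_vertex_sectors(1)[OF k t 1, folded z_def w_def]
    let ?t = "(1 - s) * t"
    have "label_contraction 0 s z = sector_contraction (real k) s z"
      using label_contraction_eq[OF k8(1), of z 0 s] * by simp
    also have "\<dots> = octagon_edge k ?t"
      unfolding z_def using 1 t by (subst sector_contraction_edge) (auto simp: abs_less_iff)
    finally have 1: "label_contraction 0 s z = octagon_edge k ?t" .
    have "label_contraction 0 s w = sector_contraction (real ((k + 3) mod 8)) s w"
      using label_contraction_eq[OF k8(4), of w 0 s] * by simp
    also have "\<dots> = sector_contraction (real (k + 3)) s w"
      using k sector_contraction_periodic[of 0] by auto
    also have "\<dots> = octagon_edge (k + 2) (1 - ?t)"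
      unfolding w_def using \<open>t < 1/2\<close> t
      by (subst sector_contraction_edge) (auto simp: abs_less_iff algebra_simps)
    finally have 2: "label_contraction 0 s w = octagon_edge (k + 2) (1 - ?t)" .
    have "?t \<in> {0..1}" using s t by (auto intro: mult_le_one)
    moreover have "z \<in> vertex_chart" "w \<in> vertex_chart"
      using vertex_chartI[OF k8(1)] vertex_chartI[OF k8(4)] * by blast+
    ultimately show ?thesis unfolding 1 2 using oct_edge_glue[OF k] by blast
  next
    case 2
    note * = glued_vertex_sectors(2)[OF k t 2, folded z_def w_def]
    let ?t = "1 - (1 - s) * (1 - t)"
    have "label_contraction 0 s z = sector_contraction (real (k + 1)) s z"
      using label_contraction_eq[OF k8(2), of z 0 s] * by simp
    also have "\<dots> = octagon_edge k ?t"
      unfolding z_def using 2 t by (subst sector_contraction_edge) (auto simp: abs_less_iff algebra_simps)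
    finally have 1: "label_contraction 0 s z = octagon_edge k ?t" .
    have "label_contraction 0 s w = sector_contraction (real (k + 2)) s w"
      using label_contraction_eq[OF k8(3), of w 0 s] * by simp
    also have "\<dots> = octagon_edge (k + 2) (1 - ?t)"
      unfolding w_def using 2 t by (subst sector_contraction_edge) (auto simp: abs_less_iff algebra_simps)
    finally have 2: "label_contraction 0 s w = octagon_edge (k + 2) (1 - ?t)" .
    have "(1 - s) * (1 - t) \<le> 1" "0 \<le> (1 - s) * (1 - t)" using s t by (auto intro: mult_le_one)
    then have "?t \<in> {0..1}" by auto
    moreover have "z \<in> vertex_chart" "w \<in> vertex_chart"
      using vertex_chartI[OF k8(2)] vertex_chartI[OF k8(3)] * by blast+
    ultimately show ?thesis unfolding 1 2 using oct_edge_glue[OF k] by blast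
  qed
qed

text \<open>Generation of the fundamental group by the edges, in the form of an induction principle
  for properties of loops instead of a statement about words. It applies directly to the property
  that two homomorphisms agree on the class of a loop.\<close>

locale edge_loops_closed =
  fixes E :: "(real \<Rightarrow> complex set) \<Rightarrow> bool"
  assumes E_homotopic: "p \<in> loops F2 F2_base \<Longrightarrow> path_homotopic F2 p q \<Longrightarrow> E p \<Longrightarrow> E q"
    and E_concat: "p \<in> loops F2 F2_base \<Longrightarrow> q \<in> loops F2 F2_base \<Longrightarrow> E p \<Longrightarrow> E q \<Longrightarrow> E (path_concat p q)"
    and E_rev: "p \<in> loops F2 F2_base \<Longrightarrow> E p \<Longrightarrow> E (rev_path p)"
    and E_edge: "k \<in> {0, 1, 4, 5} \<Longrightarrow> E (\<lambda>t. oct (octagon_edge k t))"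
begin

abbreviation (input) v where "v \<equiv> octagon_edge 0 0"

text \<open>Closes a path of the surface to a loop by segments of the disc from and to the base
  vertex. The representatives \<open>z\<close> and \<open>w\<close> of the end points are part of
  the data, since different ones give different segments; \<open>J_const\<close> allows them to be
  exchanged.\<close>

definition J :: "complex \<Rightarrow> (real \<Rightarrow> complex set) \<Rightarrow> complex \<Rightarrow> bool" where
  "J z p w \<longleftrightarrow> E (path_concat (oct_seg v z) (path_concat p (oct_seg w v)))"

lemma oct_v: "oct v = F2_base"
  by (simp add: oct_def F2_base_def)

lemma oct_vertex: "j \<le> 8 \<Longrightarrow> oct (octagon_edge j 0) = F2_base"
  using octagon_vertices[of j] by (simp add: oct_def)

lemma J_path:
  assumes "z \<in> cball 0 1" "w \<in> cball 0 1" "pathin F2 p" "p 0 = oct z" "p 1 = oct w"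
  shows "pathin F2 (path_concat p (oct_seg w v))"
    and "path_concat (oct_seg v z) (path_concat p (oct_seg w v)) \<in> loops F2 F2_base"
proof -
  show 1: "pathin F2 (path_concat p (oct_seg w v))"
    using assms by (intro pathin_path_concat pathin_oct_seg) (auto simp: linepath_0' linepath_1')
  show "path_concat (oct_seg v z) (path_concat p (oct_seg w v)) \<in> loops F2 F2_base"
    using assms 1 by (auto simp: loops_def oct_v linepath_0' linepath_1' intro!: pathin_path_concat pathin_oct_seg)
qed

lemma J_homotopic:
  assumes zw: "z \<in> cball 0 1" "w \<in> cball 0 1" and p: "p 0 = oct z" "p 1 = oct w"
    and pq: "path_homotopic F2 p q" and "J z p w"
  shows "J z q w"
  unfolding J_def
proof (rule E_homotopic[OF J_path(2)[OF zw path_homotopic_imp_pathin(1)[OF pq] p]])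
  show "E (path_concat (oct_seg v z) (path_concat p (oct_seg w v)))" using assms by (simp add: J_def)
  show "path_homotopic F2 (path_concat (oct_seg v z) (path_concat p (oct_seg w v)))
     (path_concat (oct_seg v z) (path_concat q (oct_seg w v)))"
    using zw p pq by (intro path_homotopic_concat path_homotopic_refl pathin_oct_seg) (auto simp: linepath_0' linepath_1')
qed

lemma J_trans:
  assumes z: "z \<in> cball 0 1" "y \<in> cball 0 1" "w \<in> cball 0 1"
    and p: "pathin F2 p" "p 0 = oct z" "p 1 = oct y" and q: "pathin F2 q" "q 0 = oct y" "q 1 = oct w"
    and J: "J z p y" "J y q w"
  shows "J z (path_concat p q) w"
  unfolding J_def
proof (rule E_homotopic)
  let ?l = "path_concat (path_concat (oct_seg v z) (path_concat p (oct_seg y v)))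
      (path_concat (oct_seg v y) (path_concat q (oct_seg w v)))"
  show "?l \<in> loops F2 F2_base"
    by (rule path_concat_in_loops[OF J_path(2)[OF z(1,2) p] J_path(2)[OF z(2,3) q]])
  show "E ?l"
    by (rule E_concat[OF J_path(2)[OF z(1,2) p] J_path(2)[OF z(2,3) q] J[unfolded J_def]])
  have "path_homotopic F2 (path_concat (oct_seg y v) (oct_seg v y)) (\<lambda>t. oct_seg y v 0)"
    using path_concat_rev_path[OF pathin_oct_seg[OF z(2), of v]] by (simp add: rev_path_oct_seg)
  then show "path_homotopic F2 ?l (path_concat (oct_seg v z) (path_concat (path_concat p q) (oct_seg w v)))"
    using z p q by (intro path_concat_cancel pathin_oct_seg) (auto simp: linepath_0' linepath_1')
qed

text \<open>An edge followed by its reverse satisfies \<open>E\<close> and is null-homotopic; so is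
  every loop that comes from a loop of the disc.\<close>

lemma E_null:
  assumes "path \<delta>" "path_image \<delta> \<subseteq> cball 0 1" "\<delta> 0 = v" "\<delta> 1 = v"
  shows "E (\<lambda>t. oct (\<delta> t))"
proof -
  let ?e = "\<lambda>t. oct (octagon_edge 0 t)"
  have p: "pathin F2 ?e"
    using pathin_oct[of "octagon_edge 0"] path_octagon_edge_affine[of 0 0 1] path_image_octagon_edge[of 0 "\<lambda>t. t"]
    by simp
  then have e: "?e \<in> loops F2 F2_base"
    using oct_vertex[of 0] oct_vertex[of 1] octagon_edge_Suc[of 0] by (simp add: loops_def)
  have re: "rev_path ?e \<in> loops F2 F2_base"
    using e pathin_rev_path by (auto simp: loops_def)
  have "path_homotopic F2 (path_concat ?e (rev_path ?e)) (\<lambda>t. oct v)"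
    using path_concat_rev_path[OF p] by simp
  moreover have "path_homotopic F2 (\<lambda>t. oct ((\<lambda>t. v) t)) (\<lambda>t. oct (\<delta> t))"
    by (rule path_homotopic_oct) (use assms in \<open>auto simp: path_def path_image_def\<close>)
  ultimately have "path_homotopic F2 (path_concat ?e (rev_path ?e)) (\<lambda>t. oct (\<delta> t))"
    using path_homotopic_trans by blast
  moreover have "E (path_concat ?e (rev_path ?e))"
    using E_concat[OF e re] E_edge[of 0] E_rev[OF e] by simp
  ultimately show ?thesis
    using E_homotopic path_concat_in_loops[OF e re] by blast
qed

lemma J_disc:
  assumes "path \<delta>" "path_image \<delta> \<subseteq> cball 0 1"
  shows "J (\<delta> 0) (\<lambda>t. oct (\<delta> t)) (\<delta> 1)"
proof -
  have ends: "\<delta> 0 \<in> cball 0 1" "\<delta> 1 \<in> cball 0 1"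
    using assms(2) by (auto simp: path_image_def image_subset_iff)
  have a: "path (\<delta> +++ linepath (\<delta> 1) v)" "path_image (\<delta> +++ linepath (\<delta> 1) v) \<subseteq> cball 0 1"
    using assms path_image_linepath_cball[OF ends(2) octagon_edge_in_disc[of 0 0]] path_image_join_subset[of \<delta> "linepath (\<delta> 1) v"]
    by (auto simp: pathfinish_def linepath_1' intro!: path_join_imp)
  let ?l = "linepath v (\<delta> 0) +++ (\<delta> +++ linepath (\<delta> 1) v)"
  have "pathstart (\<delta> +++ linepath (\<delta> 1) v) = \<delta> 0"
    by (simp add: pathstart_def joinpaths_def)
  then have "path ?l"
    using a by (intro path_join_imp) (auto simp: pathfinish_def linepath_1')
  moreover have "path_image ?l \<subseteq> cball 0 1"
    using a(2) path_image_linepath_cball[OF octagon_edge_in_disc[of 0 0] ends(1)] path_image_join_subset by blast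
  ultimately have "E (\<lambda>t. oct (?l t))"
    by (rule E_null) (simp_all add: joinpaths_def linepath_0' linepath_1')
  then show ?thesis by (simp add: J_def path_concat_oct)
qed

lemma E_all_edges:
  assumes "k < 8" shows "E (\<lambda>t. oct (octagon_edge k t))"
proof (cases "k \<in> {0, 1, 4, 5}")
  case False
  then have "k \<in> {2, 3, 6, 7}" using assms by auto
  then have "k - 2 \<in> {0, 1, 4, 5}" "k = (k - 2) + 2" by auto
  then obtain j where j: "j \<in> {0, 1, 4, 5}" "k = j + 2" by blast
  let ?e = "\<lambda>t. oct (octagon_edge j t)"
  have p: "pathin F2 ?e"
    using pathin_oct[of "octagon_edge j"] path_octagon_edge_affine[of j 0 1] path_image_octagon_edge[of j "\<lambda>t. t"]
    by simp
  then have e: "?e \<in> loops F2 F2_base"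
    using oct_vertex[of j] oct_vertex[of "Suc j"] octagon_edge_Suc[of j] j by (auto simp: loops_def)
  have "path_homotopic F2 (rev_path ?e) (\<lambda>t. oct (octagon_edge k t))"
  proof (rule path_homotopic_eq[OF pathin_rev_path[OF p]])
    show "rev_path ?e t = oct (octagon_edge k t)" if "t \<in> {0..1}" for t
      using oct_edge_glue[OF j(1), of "1 - t"] that j(2) by (simp add: rev_path_def)
  qed
  moreover have "rev_path ?e \<in> loops F2 F2_base"
    using e pathin_rev_path by (auto simp: loops_def)
  ultimately show ?thesis using E_homotopic E_rev[OF e] E_edge[OF j(1)] by blast
qed (rule E_edge)

text \<open>In the disc, the chord to a vertex is homotopic to the chord to the preceding vertex
  followed by the edge between them.\<close>

lemma E_vertex: "j \<le> 8 \<Longrightarrow> E (oct_seg v (octagon_edge j 0))"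
proof (induction j)
  case 0
  show ?case by (rule E_null) (simp_all add: linepath_0' linepath_1' path_def path_image_linepath)
next
  case (Suc j)
  let ?s = "linepath v (octagon_edge j 0)"
  have e: "path (octagon_edge j)" "path_image (octagon_edge j) \<subseteq> cball 0 1"
    using path_octagon_edge_affine[of j 0 1] path_image_octagon_edge[of j "\<lambda>t. t"] by simp_all
  have sp: "path_image ?s \<subseteq> cball 0 1"
    by (rule path_image_linepath_cball) simp_all
  have l1: "(\<lambda>t. oct (?s t)) \<in> loops F2 F2_base"
    using Suc.prems oct_vertex[of j] oct_v by (auto simp: loops_def linepath_0' linepath_1' intro!: pathin_oct_seg)
  have l2: "(\<lambda>t. oct (octagon_edge j t)) \<in> loops F2 F2_base"
    using Suc.prems oct_vertex[of j] oct_vertex[of "Suc j"] octagon_edge_Suc[of j] pathin_oct[OF e]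
    by (auto simp: loops_def)
  have "E (path_concat (\<lambda>t. oct (?s t)) (\<lambda>t. oct (octagon_edge j t)))"
    using E_concat[OF l1 l2] Suc E_all_edges[of j] by simp
  then have "E (\<lambda>t. oct ((?s +++ octagon_edge j) t))" by (simp add: path_concat_oct)
  moreover have "(\<lambda>t. oct ((?s +++ octagon_edge j) t)) \<in> loops F2 F2_base"
    using path_concat_in_loops[OF l1 l2] by (simp add: path_concat_oct)
  moreover have "path_homotopic F2 (\<lambda>t. oct ((?s +++ octagon_edge j) t)) (oct_seg v (octagon_edge (Suc j) 0))"
  proof (rule path_homotopic_oct)
    show "path (?s +++ octagon_edge j)"
      using e by (intro path_join_imp) (auto simp: pathstart_def)
    show "path_image (?s +++ octagon_edge j) \<subseteq> cball 0 1"
      using sp e path_image_join_subset by blast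
    show "path_image (linepath v (octagon_edge (Suc j) 0)) \<subseteq> cball 0 1"
      by (rule path_image_linepath_cball) simp_all
  qed (simp_all add: joinpaths_def linepath_0' linepath_1' octagon_edge_Suc)
  ultimately show ?case using E_homotopic by blast
qed

lemma J_const_iff:
  assumes "z \<in> cball 0 1" "w \<in> cball 0 1" "oct z = oct w"
  shows "J z (\<lambda>t. oct z) w \<longleftrightarrow> E (path_concat (oct_seg v z) (oct_seg w v))"
    and "path_concat (oct_seg v z) (oct_seg w v) \<in> loops F2 F2_base"
proof -
  have c: "pathin F2 (\<lambda>t. oct z)"
    using pathin_oct_seg[OF assms(1,1)] by (simp add: linepath_refl)
  have l: "path_concat (oct_seg v z) (oct_seg w v) \<in> loops F2 F2_base"
    using assms by (auto simp: loops_def oct_v linepath_0' linepath_1' intro!: pathin_path_concat pathin_oct_seg)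
  have h: "path_homotopic F2 (path_concat (oct_seg v z) (path_concat (\<lambda>t. oct z) (oct_seg w v)))
      (path_concat (oct_seg v z) (oct_seg w v))"
    using assms by (intro path_homotopic_concat path_homotopic_refl path_concat_const_left pathin_oct_seg)
      (auto simp: linepath_0' linepath_1')
  show "J z (\<lambda>t. oct z) w \<longleftrightarrow> E (path_concat (oct_seg v z) (oct_seg w v))"
    using E_homotopic[OF l path_homotopic_sym[OF h]] E_homotopic[OF J_path(2)[OF assms(1,2) c] h] assms(3)
    by (auto simp: J_def)
  show "path_concat (oct_seg v z) (oct_seg w v) \<in> loops F2 F2_base" by (rule l)
qed

lemma J_vertices:
  assumes "i \<le> 8" "j \<le> 8"
  shows "J (octagon_edge i 0) (\<lambda>t. F2_base) (octagon_edge j 0)"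
proof -
  have l: "oct_seg v (octagon_edge i 0) \<in> loops F2 F2_base" if "i \<le> 8" for i
    using that oct_vertex[of i] by (auto simp: loops_def oct_v linepath_0' linepath_1' intro!: pathin_oct_seg)
  have "E (oct_seg (octagon_edge j 0) v)"
    using E_rev[OF l[OF assms(2)] E_vertex[OF assms(2)]] by (simp add: rev_path_oct_seg)
  moreover have "oct_seg (octagon_edge j 0) v \<in> loops F2 F2_base"
    using l[OF assms(2)] pathin_rev_path rev_path_oct_seg[of v "octagon_edge j 0"]
    using oct_vertex[OF assms(2)] by (auto simp: loops_def oct_v linepath_0' linepath_1' intro!: pathin_oct_seg)
  ultimately have "E (path_concat (oct_seg v (octagon_edge i 0)) (oct_seg (octagon_edge j 0) v))"
    using E_concat[OF l[OF assms(1)]] E_vertex[OF assms(1)] by blast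
  then show ?thesis
    using J_const_iff(1)[of "octagon_edge i 0" "octagon_edge j 0"] oct_vertex assms by simp
qed

text \<open>One can go back along edge \<open>k\<close> to its start, change from vertex
  \<open>k\<close> to vertex \<open>k + 3\<close>, and run along the partner edge to the glued
  point. In the surface this is a path followed by its own reverse, hence homotopic to a constant
  path.\<close>

lemma J_glue:
  assumes k: "k \<in> {0, 1, 4, 5}" and t: "t \<in> {0..1}"
  shows "J (octagon_edge k t) (\<lambda>s. oct (octagon_edge k t)) (octagon_edge (k + 2) (1 - t))"
proof -
  let ?z = "octagon_edge k t" and ?w = "octagon_edge (k + 2) (1 - t)"
  let ?e = "\<lambda>s. oct (octagon_edge k (t + - t * s))"
  have e: "pathin F2 ?e"
    by (rule pathin_oct[OF path_octagon_edge_affine path_image_octagon_edge])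
  have f: "pathin F2 (\<lambda>s. oct (octagon_edge (k + 2) (1 + - t * s)))"
    by (rule pathin_oct[OF path_octagon_edge_affine path_image_octagon_edge])
  have e0: "?e 0 = oct ?z" "?e 1 = F2_base" using oct_vertex[of k] k by auto
  have v3: "octagon_edge (k + 2) 1 = octagon_edge (k + 3) 0"
    using octagon_edge_Suc[of "k + 2"] by (simp add: eval_nat_numeral)
  have k8: "k \<le> 8" "k + 3 \<le> 8" using k by auto
  have J1: "J ?z ?e (octagon_edge k 0)"
    using J_disc[OF path_octagon_edge_affine[of k t "- t"] path_image_octagon_edge] by simp
  have J2: "J (octagon_edge k 0) (\<lambda>t. F2_base) (octagon_edge (k + 3) 0)"
    by (rule J_vertices[OF k8])
  have J3': "J (octagon_edge (k + 3) 0) (\<lambda>s. oct (octagon_edge (k + 2) (1 + - t * s))) ?w"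
    using J_disc[OF path_octagon_edge_affine[of "k + 2" 1 "- t"] path_image_octagon_edge] v3 by simp
  have J3: "J (octagon_edge (k + 3) 0) (rev_path ?e) ?w"
  proof (rule J_homotopic[OF octagon_edge_in_disc octagon_edge_in_disc _ _ _ J3'])
    show "path_homotopic F2 (\<lambda>s. oct (octagon_edge (k + 2) (1 + - t * s))) (rev_path ?e)"
    proof (rule path_homotopic_eq[OF f])
      fix s :: real assume s: "s \<in> {0..1}"
      then have "t * s \<in> {0..1}" using t by (auto intro: mult_le_one)
      then show "oct (octagon_edge (k + 2) (1 + - t * s)) = rev_path ?e s"
        using oct_edge_glue[OF k, of "t * s"] by (simp add: rev_path_def algebra_simps)
    qed
  qed (use v3 in auto)
  have re: "pathin F2 (rev_path ?e)" by (rule pathin_rev_path[OF e])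
  have c: "pathin F2 (\<lambda>t. F2_base)"
    using pathin_oct_seg[OF octagon_edge_in_disc octagon_edge_in_disc, of 0 0 0 0] by (simp add: linepath_refl oct_v)
  have w: "oct ?w = oct ?z" using oct_edge_glue[OF k t] by simp
  have J4: "J (octagon_edge k 0) (path_concat (\<lambda>t. F2_base) (rev_path ?e)) ?w"
    by (rule J_trans[OF octagon_edge_in_disc octagon_edge_in_disc octagon_edge_in_disc c _ _ re _ _ J2 J3])
      (use oct_vertex k8 e0 w in auto)
  have cr: "pathin F2 (path_concat (\<lambda>t. F2_base) (rev_path ?e))"
    using c re e0 by (intro pathin_path_concat) auto
  have J5: "J ?z (path_concat ?e (path_concat (\<lambda>t. F2_base) (rev_path ?e))) ?w"
    by (rule J_trans[OF octagon_edge_in_disc octagon_edge_in_disc octagon_edge_in_disc e _ _ cr _ _ J1 J4])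
      (use oct_vertex k8 e0 w in auto)
  have "path_homotopic F2 (path_concat ?e (path_concat (\<lambda>t. F2_base) (rev_path ?e))) (path_concat ?e (rev_path ?e))"
    using e re e0 by (intro path_homotopic_concat path_homotopic_refl path_concat_const_left) auto
  also have "path_homotopic F2 \<dots> (\<lambda>s. oct ?z)"
    using path_concat_rev_path[OF e] by simp
  finally have h: "path_homotopic F2 (path_concat ?e (path_concat (\<lambda>t. F2_base) (rev_path ?e))) (\<lambda>s. oct ?z)" .
  show ?thesis
    by (rule J_homotopic[OF octagon_edge_in_disc octagon_edge_in_disc _ _ h J5]) (use e0 w in auto)
qed

lemma pathin_const_oct: "z \<in> cball 0 1 \<Longrightarrow> pathin F2 (\<lambda>t. oct z)"
  using pathin_oct_seg[of z z] by (simp add: linepath_refl)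

lemma J_const:
  assumes "z \<in> cball 0 1" "w \<in> cball 0 1" "oct z = oct w"
  shows "J z (\<lambda>t. oct z) w"
  using assms
proof (induction rule: oct_eq_induct)
  case (glue k t)
  then show ?case by (rule J_glue)
next
  case (sym x y)
  have xy: "pathin F2 (oct_seg v x)" "pathin F2 (oct_seg y v)"
    using sym by (auto intro!: pathin_oct_seg)
  have "E (path_concat (oct_seg v x) (oct_seg y v))"
    using J_const_iff[OF sym(1,2,3)] sym(4) by simp
  note 1 = E_rev[OF J_const_iff(2)[OF sym(1,2,3)] this]
  have "rev_path (path_concat (oct_seg v x) (oct_seg y v)) \<in> loops F2 F2_base"
    using J_const_iff(2)[OF sym(1,2,3)] pathin_rev_path by (auto simp: loops_def)
  moreover have "path_homotopic F2 (rev_path (path_concat (oct_seg v x) (oct_seg y v)))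
      (path_concat (oct_seg v y) (oct_seg x v))"
    using rev_path_path_concat[OF xy] sym(3) by (simp add: rev_path_oct_seg linepath_0' linepath_1')
  ultimately have "E (path_concat (oct_seg v y) (oct_seg x v))"
    using E_homotopic 1 by blast
  then show ?case using J_const_iff(1)[OF sym(2,1) sym(3)[symmetric]] by simp
next
  case (trans x y z)
  have "J x (path_concat (\<lambda>t. oct x) (\<lambda>t. oct y)) z"
    by (rule J_trans[OF trans(1,2,3) pathin_const_oct[OF trans(1)] _ _ pathin_const_oct[OF trans(2)] _ _ trans(6,7)])
      (use trans in simp_all)
  moreover have "path_concat (\<lambda>t. oct x) (\<lambda>t. oct y) = (\<lambda>t. oct x)"
    using trans by (auto simp: path_concat_def)
  ultimately show ?case by simp
next
  case refl
  show ?case using J_disc[of "linepath z z"] assms(1) by (simp add: linepath_refl path_def path_image_def)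
qed

lemma J_concat_disc:
  assumes "path \<delta>" "path_image \<delta> \<subseteq> cball 0 1" "path \<epsilon>" "path_image \<epsilon> \<subseteq> cball 0 1"
    and "oct (\<delta> 1) = oct (\<epsilon> 1)"
  shows "J (\<delta> 0) (path_concat (\<lambda>t. oct (\<delta> t)) (rev_path (\<lambda>t. oct (\<epsilon> t)))) (\<epsilon> 0)"
proof -
  have e: "\<delta> 0 \<in> cball 0 1" "\<delta> 1 \<in> cball 0 1" "\<epsilon> 0 \<in> cball 0 1" "\<epsilon> 1 \<in> cball 0 1"
    using assms(2,4) by (auto simp: path_image_def image_subset_iff)
  have r: "path (reversepath \<epsilon>)" "path_image (reversepath \<epsilon>) \<subseteq> cball 0 1" using assms by auto
  have rp: "rev_path (\<lambda>t. oct (\<epsilon> t)) = (\<lambda>t. oct (reversepath \<epsilon> t))"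
    by (simp add: rev_path_def reversepath_def)
  have pe: "pathin F2 (rev_path (\<lambda>t. oct (\<epsilon> t)))" unfolding rp by (rule pathin_oct[OF r])
  have c: "pathin F2 (\<lambda>t. oct (\<delta> 1))" by (rule pathin_const_oct[OF e(2)])
  have "J (\<epsilon> 1) (rev_path (\<lambda>t. oct (\<epsilon> t))) (\<epsilon> 0)"
    unfolding rp using J_disc[OF r] by (simp add: reversepath_def)
  with J_const[OF e(2,4) assms(5)]
  have 1: "J (\<delta> 1) (path_concat (\<lambda>t. oct (\<delta> 1)) (rev_path (\<lambda>t. oct (\<epsilon> t)))) (\<epsilon> 0)"
    using J_trans[OF e(2,4,3) c _ _ pe] assms(5) by simp
  have 2: "J (\<delta> 1) (rev_path (\<lambda>t. oct (\<epsilon> t))) (\<epsilon> 0)"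
    by (rule J_homotopic[OF e(2,3) _ _ path_concat_const_left[OF pe] 1]) (use assms(5) in auto)
  show ?thesis
    using J_trans[OF e(1,2,3) pathin_oct[OF assms(1,2)] _ _ pe _ _ J_disc[OF assms(1,2)] 2] assms(5) by simp
qed

text \<open>The contraction respects the gluing and descends to the image of \<open>V\<close>. The
  square swept out by \<open>p\<close> shows that \<open>p\<close> is homotopic to the track of its
  start followed by the reversed track of its end, and both tracks come from paths in the
  disc.\<close>

lemma J_contractible_chart:
  fixes k :: "real \<Rightarrow> complex \<Rightarrow> complex"
  assumes V: "openin (top_of_set (cball 0 1)) V"
    and sat: "\<And>z w. z \<in> V \<Longrightarrow> w \<in> cball 0 1 \<Longrightarrow> oct z = oct w \<Longrightarrow> w \<in> V"
    and cont: "continuous_on ({0..1} \<times> V) (\<lambda>(s, z). k s z)"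
    and range: "\<And>s z. s \<in> {0..1} \<Longrightarrow> z \<in> V \<Longrightarrow> k s z \<in> cball 0 1"
    and k0: "\<And>z. z \<in> V \<Longrightarrow> k 0 z = z"
    and k1: "\<And>z. z \<in> V \<Longrightarrow> oct (k 1 z) = y"
    and compat: "\<And>s z w. s \<in> {0..1} \<Longrightarrow> z \<in> V \<Longrightarrow> w \<in> V \<Longrightarrow> oct z = oct w \<Longrightarrow> oct (k s z) = oct (k s w)"
    and p: "pathin F2 p" "p ` {0..1} \<subseteq> oct ` V"
    and zw: "z \<in> cball 0 1" "w \<in> cball 0 1" "oct z = p 0" "oct w = p 1"
  shows "J z p w"
proof -
  let ?I = "top_of_set {0..1::real}" and ?Q = "subtopology F2 (oct ` V)"
  have VD: "V \<subseteq> cball 0 1" using openin_subset[OF V] by simp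
  have openV: "openin F2 (oct ` V)"
  proof -
    have "{z \<in> cball 0 1. oct z \<in> oct ` V} = V" using VD sat by blast
    moreover have "oct ` V \<subseteq> topspace F2" using VD topspace_F2 by blast
    ultimately show ?thesis
      using quotient_map_oct[unfolded quotient_map_def, THEN conjunct2, rule_format, of "oct ` V"] V by simp
  qed
  have "{z \<in> topspace (top_of_set (cball 0 1)). oct z \<in> oct ` V} = V" using VD sat by auto
  from quotient_map_restriction[OF quotient_map_oct this] openV
  have "quotient_map (top_of_set V) ?Q oct"
    using VD by (simp add: subtopology_subtopology Int_absorb1)
  \<comment> \<open>The interval is locally compact and Hausdorff, so its product with a quotient
    map is a quotient map. This is what makes the descended contraction jointly continuous.\<close>
  from quotient_map_prod_right[OF _ _ this, of ?I]
  have q: "quotient_map (prod_topology ?I (top_of_set V)) (prod_topology ?I ?Q) (\<lambda>(s, z). (s, oct z))"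
    by (simp add: locally_compact_space_closed_subset Hausdorff_space_subtopology
      compact_imp_locally_compact_space compact_space_subtopology)
  have "continuous_map (top_of_set ({0..1} \<times> V)) (top_of_set (cball 0 1)) (\<lambda>(s, z). k s z)"
    using cont range by auto
  from continuous_map_compose[OF this continuous_map_oct]
  have h: "continuous_map (prod_topology ?I (top_of_set V)) F2 (\<lambda>(s, z). oct (k s z))"
    by (simp add: o_def case_prod_unfold prod_topology_subtopology_eu)
  have factor: "(\<lambda>(s, z). oct (k s z)) a = (\<lambda>(s, z). oct (k s z)) b"
    if "a \<in> topspace (prod_topology ?I (top_of_set V))" "b \<in> topspace (prod_topology ?I (top_of_set V))"
      and "(\<lambda>(s, z). (s, oct z)) a = (\<lambda>(s, z). (s, oct z)) b" for a b
    using that compat[of "fst a" "snd a" "snd b"] by (cases a; cases b) simp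
  have "\<exists>K. continuous_map (prod_topology ?I ?Q) F2 K \<and>
      (\<forall>x\<in>topspace (prod_topology ?I (top_of_set V)). K ((\<lambda>(s, z). (s, oct z)) x) = (\<lambda>(s, z). oct (k s z)) x)"
    by (rule quotient_map_lift_exists[OF q h factor], assumption+, rule exI, rule conjI, assumption, rule ballI, assumption)
  then obtain K where K: "continuous_map (prod_topology ?I ?Q) F2 K"
    "\<And>x. x \<in> topspace (prod_topology ?I (top_of_set V)) \<Longrightarrow> K ((\<lambda>(s, z). (s, oct z)) x) = (\<lambda>(s, z). oct (k s z)) x"
    by blast
  have K': "K (s, oct z) = oct (k s z)" if "s \<in> {0..1}" "z \<in> V" for s z
    using K(2)[of "(s, z)"] that by simp
  have "continuous_map ?I ?Q p"
    using p by (auto simp: pathin_def continuous_map_in_subtopology)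
  then have "continuous_map (prod_topology ?I ?I) (prod_topology ?I ?Q) (\<lambda>x. (fst x, p (snd x)))"
    by (intro continuous_map_pairedI continuous_map_fst continuous_map_compose[OF continuous_map_snd, unfolded o_def])
  from continuous_map_compose[OF this K(1)]
  have H: "continuous_map (prod_topology ?I ?I) F2 (\<lambda>x. K (fst x, p (snd x)))"
    by (simp add: o_def)
  have Kp: "K (0, p t) = p t" "K (1, p t) = y" if t: "t \<in> {0..1}" for t
  proof -
    obtain u where "u \<in> V" "p t = oct u" using p(2) t by blast
    then show "K (0, p t) = p t" "K (1, p t) = y" using K'[of 0 u] K'[of 1 u] k0 k1 by auto
  qed
  have zV: "z \<in> V" "w \<in> V"
  proof -
    have "p 0 \<in> oct ` V" "p 1 \<in> oct ` V" using p(2) by auto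
    then show "z \<in> V" "w \<in> V" using sat zw by (metis imageE)+
  qed
  have path: "path (\<lambda>s. k s u)" "path_image (\<lambda>s. k s u) \<subseteq> cball 0 1" if "u \<in> V" for u
  proof -
    show "path (\<lambda>s. k s u)"
      unfolding path_def using that
      by (intro continuous_on_compose2[OF cont, of _ "\<lambda>s. (s, u)", simplified]) (auto intro!: continuous_intros)
    show "path_image (\<lambda>s. k s u) \<subseteq> cball 0 1" using range that by (auto simp: path_image_def)
  qed
  have "path_homotopic F2 (\<lambda>t. K (0, p t)) (path_concat (\<lambda>s. K (s, p 0)) (rev_path (\<lambda>s. K (s, p 1))))"
    using path_homotopic_sides_of_square[OF H] Kp(2) by simp
  from path_homotopic_sym[OF this]
  have h1: "path_homotopic F2 (path_concat (\<lambda>s. K (s, p 0)) (rev_path (\<lambda>s. K (s, p 1)))) (\<lambda>t. K (0, p t))" .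
  have h2: "path_homotopic F2 (\<lambda>t. K (0, p t)) p"
    using Kp(1) path_homotopic_sym[OF path_homotopic_eq[OF p(1)]] by simp
  have h3: "path_homotopic F2 (path_concat (\<lambda>s. K (s, p 0)) (rev_path (\<lambda>s. K (s, p 1))))
      (path_concat (\<lambda>s. oct (k s z)) (rev_path (\<lambda>s. oct (k s w))))"
  proof (rule path_homotopic_concat)
    show "path_homotopic F2 (\<lambda>s. K (s, p 0)) (\<lambda>s. oct (k s z))"
      by (rule path_homotopic_sym, rule path_homotopic_eq[OF pathin_oct[OF path[OF zV(1)]]])
        (simp add: K' zV zw(3)[symmetric])
    show "path_homotopic F2 (rev_path (\<lambda>s. K (s, p 1))) (rev_path (\<lambda>s. oct (k s w)))"
      by (rule path_homotopic_rev_path, rule path_homotopic_sym,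
          rule path_homotopic_eq[OF pathin_oct[OF path[OF zV(2)]]])
        (simp add: K' zV zw(4)[symmetric])
  qed (use Kp(2)[of 0] Kp(2)[of 1] in simp)
  have hom: "path_homotopic F2 (path_concat (\<lambda>s. oct (k s z)) (rev_path (\<lambda>s. oct (k s w)))) p"
    by (rule path_homotopic_trans[OF path_homotopic_sym[OF h3] path_homotopic_trans[OF h1 h2]])
  have "J (k 0 z) (path_concat (\<lambda>s. oct (k s z)) (rev_path (\<lambda>s. oct (k s w)))) (k 0 w)"
    by (rule J_concat_disc) (use path zV k1 in auto)
  then show ?thesis
    using J_homotopic[OF zw(1,2) _ _ hom] k0 zV by simp
qed

section \<open>A contractible neighbourhood for every point of the surface\<close>

lemma interior_injective:
  assumes "z \<in> cball 0 1" "w \<in> cball 0 1" "oct z = oct w"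
  shows "z \<in> ball 0 1 \<or> w \<in> ball 0 1 \<longrightarrow> z = w"
  using assms
proof (induction rule: oct_eq_induct)
  case (glue k t)
  show ?case by simp
next
  case (sym x y)
  show ?case using sym(4) by blast
next
  case (trans x y z)
  show ?case using trans(6,7) by blast
next
  case refl
  show ?case by simp
qed

lemma vertex_chart_compat:
  assumes "z \<in> cball 0 1" "w \<in> cball 0 1" "oct z = oct w"
  shows "(z \<in> vertex_chart \<longleftrightarrow> w \<in> vertex_chart) \<and>
    (z \<in> vertex_chart \<longrightarrow> (\<forall>s\<in>{0..1}. oct (label_contraction 0 s z) = oct (label_contraction 0 s w)))"
  using assms
proof (induction rule: oct_eq_induct)
  case (glue k t)
  show ?case
    using vertex_chart_contraction_glue[OF glue] vertex_chart_contraction_glue[OF glue, of 0] by auto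
next
  case (sym x y)
  show ?case using sym(4) by simp
next
  case (trans x y z)
  show ?case using trans(6,7) by simp
next
  case refl
  show ?case by simp
qed

text \<open>One pair of glued edges is taken at a time: different pairs contract to different
  midpoints, whereas \<open>J_contractible_chart\<close> asks for a single limit point.\<close>

lemma edge_chart_compat:
  assumes "z \<in> cball 0 1" "w \<in> cball 0 1" "oct z = oct w" and j: "j \<in> {0, 1, 4, 5}"
  defines "V \<equiv> {z \<in> edge_chart. sector_label (1/2) z \<in> {j, j + 2}}"
  shows "(z \<in> V \<longleftrightarrow> w \<in> V) \<and>
    (z \<in> V \<longrightarrow> (\<forall>s\<in>{0..1}. oct (label_contraction (1/2) s z) = oct (label_contraction (1/2) s w)))"
  using assms(1-3)
proof (induction rule: oct_eq_induct)
  case (glue k t)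
  have "k \<in> {j, j + 2} \<longleftrightarrow> k + 2 \<in> {j, j + 2}"
    using glue(1) j unfolding insert_iff empty_iff by presburger
  then show ?case
    using edge_chart_contraction_glue[OF glue] edge_chart_contraction_glue[OF glue, of 0]
    unfolding V_def by auto
next
  case (sym x y)
  show ?case using sym(4) by simp
next
  case (trans x y z)
  show ?case using trans(6,7) by simp
next
  case refl
  show ?case by simp
qed

text \<open>The interior contracts to the centre, the vertex chart to the base point, and a pair of
  glued edges to its midpoint.\<close>

lemma J_locally:
  assumes "x \<in> topspace F2"
  obtains N where "openin F2 N" "x \<in> N"
    "\<And>p z w. pathin F2 p \<Longrightarrow> p ` {0..1} \<subseteq> N \<Longrightarrow> z \<in> cball 0 1 \<Longrightarrow> w \<in> cball 0 1 \<Longrightarrow>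
      oct z = p 0 \<Longrightarrow> oct w = p 1 \<Longrightarrow> J z p w"
proof -
  note obtained = that
  have chart: thesis
    if V: "openin (top_of_set (cball 0 1)) V" "x \<in> oct ` V"
      and sat: "\<And>z w. z \<in> V \<Longrightarrow> w \<in> cball 0 1 \<Longrightarrow> oct z = oct w \<Longrightarrow> w \<in> V"
      and J: "\<And>p z w. pathin F2 p \<Longrightarrow> p ` {0..1} \<subseteq> oct ` V \<Longrightarrow> z \<in> cball 0 1 \<Longrightarrow> w \<in> cball 0 1 \<Longrightarrow>
        oct z = p 0 \<Longrightarrow> oct w = p 1 \<Longrightarrow> J z p w" for V
  proof (rule obtained[OF _ V(2) J])
    have VD: "V \<subseteq> cball 0 1" using openin_subset[OF V(1)] by simp
    have "{z \<in> cball 0 1. oct z \<in> oct ` V} = V" using VD sat by blast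
    moreover have "oct ` V \<subseteq> topspace F2" using VD topspace_F2 by blast
    ultimately show "openin F2 (oct ` V)"
      using quotient_map_oct[unfolded quotient_map_def, THEN conjunct2, rule_format, of "oct ` V"] V(1) by simp
  qed
  obtain u where u: "u \<in> cball 0 1" "x = oct u" using assms topspace_F2 by blast
  consider "u \<in> ball 0 1" | "u \<in> vertex_chart" | "u \<in> edge_chart" using charts_cover_disc[OF u(1)] by blast
  then show thesis
  proof cases
    case 1
    show thesis
    proof (rule chart)
      show V: "openin (top_of_set (cball 0 1)) (ball (0::complex) 1)" by (intro open_subset) auto
      show "x \<in> oct ` ball 0 1" using 1 u by blast
      show sat: "w \<in> ball 0 1" if "z \<in> ball 0 1" "w \<in> cball 0 1" "oct z = oct w" for z w
        using interior_injective[of z w] that by auto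
      fix p z w
      assume p: "pathin F2 p" "p ` {0..1} \<subseteq> oct ` ball 0 1" "z \<in> cball 0 1" "w \<in> cball 0 1" "oct z = p 0" "oct w = p 1"
      show "J z p w"
      proof (rule J_contractible_chart[OF V _ _ _ _ _ _ p, where k = "\<lambda>s z. (1 - of_real s) * z" and y = "oct 0"])
        show "w \<in> ball 0 1" if "z \<in> ball 0 1" "w \<in> cball 0 1" "oct z = oct w" for z w
          by (rule sat[OF that])
        show "continuous_on ({0..1} \<times> ball 0 1) (\<lambda>(s, z). (1 - complex_of_real s) * z)"
          unfolding case_prod_unfold by (intro continuous_intros)
        show "(1 - complex_of_real s) * z \<in> cball 0 1" if "s \<in> {0..1}" "z \<in> ball 0 1" for s z
        proof -
          have "norm (1 - complex_of_real s) = 1 - s"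
            using that by (metis abs_of_nonneg atLeastAtMost_iff diff_ge_0_iff_ge norm_of_real of_real_1 of_real_diff)
          then show ?thesis using that by (auto simp: norm_mult intro!: mult_le_one)
        qed
        show "oct ((1 - complex_of_real s) * z) = oct ((1 - complex_of_real s) * w)"
          if "z \<in> ball 0 1" "w \<in> ball 0 1" "oct z = oct w" for s z w
          using interior_injective[of z w] that by auto
      qed auto
    qed
  next
    case 2
    show thesis
    proof (rule chart)
      show V: "openin (top_of_set (cball 0 1)) vertex_chart"
        using openin_sector unfolding vertex_chart_def by (intro openin_Union) auto
      show "x \<in> oct ` vertex_chart" using 2 u by blast
      have VD: "vertex_chart \<subseteq> cball 0 1" using openin_subset[OF V] by simp
      show sat: "w \<in> vertex_chart" if "z \<in> vertex_chart" "w \<in> cball 0 1" "oct z = oct w" for z w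
        using vertex_chart_compat[of z w] that VD by blast
      fix p z w
      assume p: "pathin F2 p" "p ` {0..1} \<subseteq> oct ` vertex_chart" "z \<in> cball 0 1" "w \<in> cball 0 1" "oct z = p 0" "oct w = p 1"
      show "J z p w"
      proof (rule J_contractible_chart[OF V sat _ _ _ _ _ p, where k = "label_contraction 0" and y = F2_base])
        show "continuous_on ({0..1} \<times> vertex_chart) (\<lambda>(s, z). label_contraction 0 s z)"
          using continuous_on_label_contraction[of 0] by (simp add: vertex_chart_def)
        show "label_contraction 0 s z \<in> cball 0 1" if "s \<in> {0..1}" "z \<in> vertex_chart" for s z
          unfolding label_contraction_def using that VD by (intro sector_contraction_in_disc) auto
        show "label_contraction 0 0 z = z" for z
          by (simp add: label_contraction_def sector_contraction_0)
        show "oct (label_contraction 0 1 z) = F2_base" if zv: "z \<in> vertex_chart" for z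
        proof -
          obtain i where i: "i < 8" "z \<in> sector (real i + 0)" using zv by (auto simp: vertex_chart_def)
          then have "label_contraction 0 1 z = octagon_edge i 0"
            using label_contraction_eq[OF i] by (simp add: sector_contraction_1 octagon_edge_def)
          then show ?thesis using oct_vertex[of i] i by simp
        qed
        show "oct (label_contraction 0 s z) = oct (label_contraction 0 s w)"
          if "s \<in> {0..1}" "z \<in> vertex_chart" "w \<in> vertex_chart" "oct z = oct w" for s z w
          using vertex_chart_compat[of z w] that VD by blast
      qed
    qed
  next
    case 3
    then obtain i where i: "i < 8" "u \<in> sector (real i + 1/2)" by (auto simp: edge_chart_def)
    have iu: "sector_label (1/2) u = i" by (rule sector_label_eq[OF i])
    have "i \<in> {0, 1, 4, 5} \<or> i - 2 \<in> {0, 1, 4, 5} \<and> i = (i - 2) + 2" using i by auto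
    then obtain j where j: "j \<in> {0, 1, 4, 5}" "i \<in> {j, j + 2}" by blast
    define V where "V = {z \<in> edge_chart. sector_label (1/2) z \<in> {j, j + 2}}"
    have V: "openin (top_of_set (cball 0 1)) V"
      using openin_sector_label_level[of "1/2" "\<lambda>i. i \<in> {j, j + 2}" True] by (simp add: V_def edge_chart_def)
    have VD: "V \<subseteq> cball 0 1" using openin_subset[OF V] by simp
    have sat: "w \<in> V" if "z \<in> V" "w \<in> cball 0 1" "oct z = oct w" for z w
      using edge_chart_compat[of z w j, folded V_def] j(1) that VD by blast
    show thesis
    proof (rule chart[OF V _ sat])
      show "x \<in> oct ` V" using 3 u iu j unfolding V_def by blast
      fix p z w
      assume p: "pathin F2 p" "p ` {0..1} \<subseteq> oct ` V" "z \<in> cball 0 1" "w \<in> cball 0 1" "oct z = p 0" "oct w = p 1"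
      show "J z p w"
      proof (rule J_contractible_chart[OF V sat _ _ _ _ _ p,
            where k = "label_contraction (1/2)" and y = "oct (octagon_edge j (1/2))"])
        show "continuous_on ({0..1} \<times> V) (\<lambda>(s, z). label_contraction (1/2) s z)"
          by (rule continuous_on_subset[OF continuous_on_label_contraction[of "1/2"]])
            (auto simp: V_def edge_chart_def)
        show "label_contraction (1/2) s z \<in> cball 0 1" if "s \<in> {0..1}" "z \<in> V" for s z
          unfolding label_contraction_def using that VD by (intro sector_contraction_in_disc) auto
        show "label_contraction (1/2) 0 z = z" for z
          by (simp add: label_contraction_def sector_contraction_0)
        show "oct (label_contraction (1/2) 1 z) = oct (octagon_edge j (1/2))" if "z \<in> V" for z
        proof -
          have "label_contraction (1/2) 1 z = octagon_edge (sector_label (1/2) z) (1/2)"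
            by (simp add: label_contraction_def sector_contraction_1 octagon_edge_def)
          moreover have "sector_label (1/2) z = j \<or> sector_label (1/2) z = j + 2" using that by (simp add: V_def)
          moreover have "oct (octagon_edge (j + 2) (1/2)) = oct (octagon_edge j (1/2))"
            using oct_edge_glue[OF j(1), of "1/2"] by simp
          ultimately show ?thesis by metis
        qed
        show "oct (label_contraction (1/2) s z) = oct (label_contraction (1/2) s w)"
          if "s \<in> {0..1}" "z \<in> V" "w \<in> V" "oct z = oct w" for s z w
          using edge_chart_compat[of z w j, folded V_def] j(1) that VD by blast
      qed
    qed
  qed
qed

text \<open>Bisection of the loop into pieces inside the neighbourhoods of \<open>J_locally\<close>.
  The induction covers all representatives of the end points, so one representative of a subdivision
  point can be used on both sides.\<close>

theorem all_loops:
  assumes "p \<in> loops F2 F2_base"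
  shows "E p"
proof -
  have p: "pathin F2 p" "p 0 = F2_base" "p 1 = F2_base" using assms by (auto simp: loops_def)
  have pX: "p t \<in> topspace F2" if "t \<in> {0..1}" for t
    using continuous_map_image_subset_topspace[OF p(1)[unfolded pathin_def]] that by auto
  define P where "P a b \<longleftrightarrow> (0 \<le> a \<longrightarrow> a \<le> b \<longrightarrow> b \<le> 1 \<longrightarrow>
      (\<forall>z\<in>cball 0 1. \<forall>w\<in>cball 0 1. oct z = p a \<longrightarrow> oct w = p b \<longrightarrow> J z (subpath p a b) w))" for a b
  have "P 0 1"
  proof (rule Bolzano[of 0 1 P])
    fix a b c :: real assume P: "P a b" "P b c" "a \<le> b" "b \<le> c"
    show "P a c"
      unfolding P_def
    proof (intro impI ballI)
      fix z w assume ac: "0 \<le> a" "c \<le> 1" and z: "z \<in> cball 0 1" "w \<in> cball 0 1" "oct z = p a" "oct w = p c"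
      obtain y where y: "y \<in> cball 0 1" "p b = oct y"
        using pX[of b] P ac topspace_F2 by auto
      have J1: "J z (subpath p a b) y" and J2: "J y (subpath p b c) w"
        using P ac z y unfolding P_def by auto
      have sp: "pathin F2 (subpath p a b)" "pathin F2 (subpath p b c)"
        using P ac by (auto intro!: pathin_subpath[OF p(1)])
      have "J z (path_concat (subpath p a b) (subpath p b c)) w"
        by (rule J_trans[OF z(1) y(1) z(2) sp(1) _ _ sp(2) _ _ J1 J2]) (use z y in simp_all)
      then show "J z (subpath p a c) w"
        by (rule J_homotopic[OF z(1,2) _ _ path_concat_subpath[OF p(1)], rotated -1]) (use P ac z in auto)
    qed
  next
    fix x :: real assume "0 \<le> x" "x \<le> 1"
    then have x: "x \<in> {0..1}" by simp
    obtain N where N: "openin F2 N" "p x \<in> N"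
      "\<And>q z w. pathin F2 q \<Longrightarrow> q ` {0..1} \<subseteq> N \<Longrightarrow> z \<in> cball 0 1 \<Longrightarrow> w \<in> cball 0 1 \<Longrightarrow>
        oct z = q 0 \<Longrightarrow> oct w = q 1 \<Longrightarrow> J z q w"
      using J_locally[OF pX[OF x]] by metis
    obtain e where e: "e > 0" "\<forall>u\<in>{0..1}. dist u x < e \<longrightarrow> p u \<in> N"
      using continuous_map_nbhd[OF p(1)[unfolded pathin_def] N(1) x N(2)] by blast
    show "\<exists>d>0. \<forall>a b. a \<le> x \<and> x \<le> b \<and> b - a < d \<longrightarrow> P a b"
    proof (intro exI[of _ e] conjI allI impI e(1))
      fix a b assume ab: "a \<le> x \<and> x \<le> b \<and> b - a < e"
      show "P a b"
        unfolding P_def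
      proof (intro impI ballI)
        fix z w assume *: "0 \<le> a" "a \<le> b" "b \<le> 1" "z \<in> cball 0 1" "w \<in> cball 0 1" "oct z = p a" "oct w = p b"
        have "subpath p a b t \<in> N" if "t \<in> {0..1}" for t
        proof -
          have "a \<le> a + t * (b - a)" "a + t * (b - a) \<le> b"
            using affine_mem_Icc[of t a b] that * by auto
          then show ?thesis
            using e(2) ab * unfolding subpath_def by (auto simp: dist_real_def abs_if)
        qed
        then show "J z (subpath p a b) w"
          by (intro N(3)) (use * pathin_subpath[OF p(1)] in auto)
      qed
    qed
  qed auto
  then have "J v p v"
    using p oct_v unfolding P_def by auto
  then have "E (path_concat (\<lambda>t. F2_base) (path_concat p (\<lambda>t. F2_base)))"
    by (simp add: J_def linepath_refl oct_v)
  moreover have c: "(\<lambda>t. F2_base) \<in> loops F2 F2_base"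
    using pathin_const_oct[of v] by (simp add: loops_def oct_v)
  moreover have "path_homotopic F2 (path_concat (\<lambda>t. F2_base) (path_concat p (\<lambda>t. F2_base))) p"
  proof -
    have 1: "path_homotopic F2 (path_concat p (\<lambda>t. F2_base)) p"
      using path_concat_const_right[OF p(1)] p by simp
    have "path_homotopic F2 (path_concat (\<lambda>t. F2_base) (path_concat p (\<lambda>t. F2_base))) (path_concat p (\<lambda>t. F2_base))"
      using path_concat_const_left[OF path_homotopic_imp_pathin(1)[OF 1]] p by simp
    then show ?thesis using 1 path_homotopic_trans by blast
  qed
  ultimately show ?thesis
    using E_homotopic path_concat_in_loops[OF c path_concat_in_loops[OF assms c]] by blast
qed

end

section \<open>Homomorphisms from the fundamental group of the surface\<close>

abbreviation loop_class :: "(real \<Rightarrow> complex set) \<Rightarrow> (real \<Rightarrow> complex set) set" where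
  "loop_class p \<equiv> loop_homotopy F2 F2_base `` {p}"

lemma edge_class_eq: "edge_class k = loop_class (\<lambda>t. oct (octagon_edge k t))"
  by (simp add: edge_class_def oct_def)

lemma edge_in_loops:
  assumes "k < 8" shows "(\<lambda>t. oct (octagon_edge k t)) \<in> loops F2 F2_base"
proof -
  have "path (octagon_edge k)" using path_octagon_edge_affine[of k 0 1] by simp
  moreover have "path_image (octagon_edge k) \<subseteq> cball 0 1" using path_image_octagon_edge[of k "\<lambda>t. t"] by simp
  ultimately have "pathin F2 (\<lambda>t. oct (octagon_edge k t))" by (rule pathin_oct)
  then show ?thesis
    using octagon_vertices[of k] octagon_vertices[of "Suc k"] assms
    by (simp add: loops_def octagon_edge_Suc oct_def)
qed

lemma loop_class_in_carrier: "p \<in> loops F2 F2_base \<Longrightarrow> loop_class p \<in> carrier pi1_F2"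
  by (auto simp: pi1_F2_def fundamental_group_def intro: quotientI)

lemma loop_class_homotopic:
  "p \<in> loops F2 F2_base \<Longrightarrow> path_homotopic F2 p q \<Longrightarrow> loop_class q = loop_class p"
  by (rule equiv_class_eq[OF equiv_loop_homotopy, symmetric]) (simp add: loop_homotopy_iff)

lemma const_in_loops: "(\<lambda>t. F2_base) \<in> loops F2 F2_base"
proof -
  have "F2_base \<in> topspace F2"
    using octagon_edge_in_disc[of 0 0] by (auto simp: topspace_F2 oct_def F2_base_def)
  then show ?thesis by (simp add: loops_def pathin_const)
qed

lemma rev_path_in_loops: "p \<in> loops F2 F2_base \<Longrightarrow> rev_path p \<in> loops F2 F2_base"
  by (simp add: loops_def pathin_rev_path)

context group
begin

lemma hom_loop_class:
  assumes h: "\<rho> \<in> hom pi1_F2 G"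
  shows "p \<in> loops F2 F2_base \<Longrightarrow> \<rho> (loop_class p) \<in> carrier G"
    and "p \<in> loops F2 F2_base \<Longrightarrow> q \<in> loops F2 F2_base \<Longrightarrow>
      \<rho> (loop_class (path_concat p q)) = \<rho> (loop_class p) \<otimes> \<rho> (loop_class q)"
    and "\<rho> (loop_class (\<lambda>t. F2_base)) = \<one>"
    and "p \<in> loops F2 F2_base \<Longrightarrow> \<rho> (loop_class (rev_path p)) = inv \<rho> (loop_class p)"
proof -
  have cl: "\<rho> (loop_class p) \<in> carrier G" if "p \<in> loops F2 F2_base" for p
    using h loop_class_in_carrier[OF that] by (auto simp: hom_def)
  have con: "\<rho> (loop_class (path_concat p q)) = \<rho> (loop_class p) \<otimes> \<rho> (loop_class q)"
    if "p \<in> loops F2 F2_base" "q \<in> loops F2 F2_base" for p q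
    using hom_mult[OF h loop_class_in_carrier[OF that(1)] loop_class_in_carrier[OF that(2)]] pi1_mult[OF that]
    by (simp add: pi1_F2_def)
  have one: "\<rho> (loop_class (\<lambda>t. F2_base)) = \<one>"
  proof -
    let ?x = "\<rho> (loop_class (\<lambda>t. F2_base))"
    \<comment> \<open>The constant loop concatenated with itself is literally itself, so its image
      is an idempotent of the group.\<close>
    have "path_concat (\<lambda>t. F2_base) (\<lambda>t. F2_base) = (\<lambda>t. F2_base)" by (simp add: path_concat_def)
    then have "?x = ?x \<otimes> ?x" using con[OF const_in_loops const_in_loops] by simp
    then show ?thesis using cl[OF const_in_loops] by (metis r_cancel_one)
  qed
  show "p \<in> loops F2 F2_base \<Longrightarrow> \<rho> (loop_class p) \<in> carrier G"
    "p \<in> loops F2 F2_base \<Longrightarrow> q \<in> loops F2 F2_base \<Longrightarrow>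
      \<rho> (loop_class (path_concat p q)) = \<rho> (loop_class p) \<otimes> \<rho> (loop_class q)"
    "\<rho> (loop_class (\<lambda>t. F2_base)) = \<one>" using cl con one by blast+
  assume p: "p \<in> loops F2 F2_base"
  note rp = rev_path_in_loops[OF p]
  have "path_homotopic F2 (path_concat p (rev_path p)) (\<lambda>t. F2_base)"
    using path_concat_rev_path[of F2 p] p by (simp add: loops_def)
  then have "\<rho> (loop_class p) \<otimes> \<rho> (loop_class (rev_path p)) = \<one>"
    using loop_class_homotopic path_concat_in_loops[OF p rp] con[OF p rp] one by metis
  then show "\<rho> (loop_class (rev_path p)) = inv \<rho> (loop_class p)"
    using inv_equality[OF inv_comm] cl[OF p] cl[OF rp] by metis
qed

lemma hom_pi1_F2_eqI:
  assumes \<rho>: "\<rho> \<in> hom pi1_F2 G" and \<sigma>: "\<sigma> \<in> hom pi1_F2 G"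
    and eq: "\<rho> a1 = \<sigma> a1" "\<rho> b1 = \<sigma> b1" "\<rho> a2 = \<sigma> a2" "\<rho> b2 = \<sigma> b2" and x: "x \<in> carrier pi1_F2"
  shows "\<rho> x = \<sigma> x"
proof -
  define E where "E p \<longleftrightarrow> \<rho> (loop_class p) = \<sigma> (loop_class p)" for p
  interpret edge_loops_closed E
  proof
    show "E p \<Longrightarrow> E q" if "p \<in> loops F2 F2_base" "path_homotopic F2 p q" for p q
      unfolding E_def loop_class_homotopic[OF that] .
    show "E (path_concat p q)" if "p \<in> loops F2 F2_base" "q \<in> loops F2 F2_base" "E p" "E q" for p q
      using that by (simp add: E_def hom_loop_class[OF \<rho>] hom_loop_class[OF \<sigma>])
    show "E (rev_path p)" if "p \<in> loops F2 F2_base" "E p" for p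
      using that by (simp add: E_def hom_loop_class[OF \<rho>] hom_loop_class[OF \<sigma>])
    show "E (\<lambda>t. oct (octagon_edge k t))" if "k \<in> {0, 1, 4, 5}" for k
      using that eq unfolding E_def edge_class_eq[symmetric] a1_def b1_def a2_def b2_def by auto
  qed
  obtain p where p: "p \<in> loops F2 F2_base" "x = loop_class p"
    using x by (auto simp: pi1_F2_def fundamental_group_def elim!: quotientE)
  then show ?thesis using all_loops[OF p(1)] by (simp add: E_def)
qed

text \<open>The product over the eight edges is the value on the boundary loop of the octagon, which
  is contracted through the disc.\<close>

lemma hom_pi1_F2_relation:
  assumes h: "\<rho> \<in> hom pi1_F2 G"
  shows "\<rho> a1 \<otimes> \<rho> b1 \<otimes> inv \<rho> a1 \<otimes> inv \<rho> b1 \<otimes> \<rho> a2 \<otimes> \<rho> b2 \<otimes> inv \<rho> a2 \<otimes> inv \<rho> b2 = \<one>"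
proof -
  define e where "e k = (\<lambda>t. oct (octagon_edge k t))" for k
  have inv_edge: "\<rho> (loop_class (e (k + 2))) = inv \<rho> (loop_class (e k))" if k: "k \<in> {0, 1, 4, 5}" for k
  proof -
    have el: "e k \<in> loops F2 F2_base" unfolding e_def using k by (intro edge_in_loops) auto
    have "path_homotopic F2 (rev_path (e k)) (e (k + 2))"
    proof (rule path_homotopic_eq)
      show "pathin F2 (rev_path (e k))" using rev_path_in_loops[OF el] by (simp add: loops_def)
      show "rev_path (e k) t = e (k + 2) t" if "t \<in> {0..1}" for t
        using oct_edge_glue[OF k, of "1 - t"] that unfolding e_def rev_path_def by simp
    qed
    then show ?thesis
      using loop_class_homotopic[OF rev_path_in_loops[OF el]] hom_loop_class(4)[OF h el] by metis
  qed
  define P where "P n = rec_nat \<one> (\<lambda>k x. x \<otimes> \<rho> (loop_class (e k))) n" for n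
  have P: "P 0 = \<one>" "P (Suc k) = P k \<otimes> \<rho> (loop_class (e k))" for k by (simp_all add: P_def)
  \<comment> \<open>The partial boundary is kept as a path of the disc, because the final
    contraction is a straight-line homotopy there.\<close>
  have boundary: "\<exists>\<delta>. path \<delta> \<and> path_image \<delta> \<subseteq> cball 0 1 \<and> \<delta> 0 = octagon_edge 0 0 \<and> \<delta> 1 = octagon_edge n 0 \<and>
      \<rho> (loop_class (\<lambda>t. oct (\<delta> t))) = P n" if "n \<le> 8" for n
    using that
  proof (induction n)
    case 0
    have "oct (octagon_edge 0 0) = F2_base" by (simp add: oct_def F2_base_def)
    then show ?case
      using hom_loop_class(3)[OF h] octagon_edge_in_disc[of 0 0]
      by (intro exI[of _ "\<lambda>t. octagon_edge 0 0"]) (auto simp: path_def path_image_def P)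
  next
    case (Suc n)
    then obtain \<delta> where \<delta>: "path \<delta>" "path_image \<delta> \<subseteq> cball 0 1" "\<delta> 0 = octagon_edge 0 0"
      "\<delta> 1 = octagon_edge n 0" "\<rho> (loop_class (\<lambda>t. oct (\<delta> t))) = P n" by auto
    have pe: "path (octagon_edge n)" using path_octagon_edge_affine[of n 0 1] by simp
    have ie: "path_image (octagon_edge n) \<subseteq> cball 0 1" using path_image_octagon_edge[of n "\<lambda>t. t"] by simp
    have j: "pathfinish \<delta> = pathstart (octagon_edge n)" using \<delta> by (simp add: pathfinish_def pathstart_def)
    have dl: "(\<lambda>t. oct (\<delta> t)) \<in> loops F2 F2_base"
      using pathin_oct[OF \<delta>(1,2)] octagon_vertices[of 0] octagon_vertices[of n] Suc.prems \<delta>(3,4)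
      by (simp add: loops_def oct_def)
    have el: "e n \<in> loops F2 F2_base" unfolding e_def using Suc.prems by (intro edge_in_loops) auto
    have "\<rho> (loop_class (\<lambda>t. oct ((\<delta> +++ octagon_edge n) t))) = P (Suc n)"
      using hom_loop_class(2)[OF h dl el] \<delta>(5) unfolding e_def path_concat_oct P by simp
    moreover have "path (\<delta> +++ octagon_edge n)" using \<delta>(1) pe j by simp
    moreover have "path_image (\<delta> +++ octagon_edge n) \<subseteq> cball 0 1"
      using \<delta>(2) ie path_image_join_subset[of \<delta> "octagon_edge n"] by blast
    moreover have "(\<delta> +++ octagon_edge n) 0 = octagon_edge 0 0" "(\<delta> +++ octagon_edge n) 1 = octagon_edge (Suc n) 0"
      using \<delta>(3) by (simp_all add: joinpaths_def octagon_edge_Suc)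
    ultimately show ?case by blast
  qed
  from boundary[of 8] obtain \<delta> where \<delta>: "path \<delta>" "path_image \<delta> \<subseteq> cball 0 1" "\<delta> 0 = octagon_edge 0 0"
    "\<delta> 1 = octagon_edge 8 0" "\<rho> (loop_class (\<lambda>t. oct (\<delta> t))) = P 8" by auto
  have e8: "octagon_edge 8 0 = octagon_edge 0 0" by (simp add: octagon_edge_def)
  have base: "oct (octagon_edge 0 0) = F2_base" by (simp add: oct_def F2_base_def)
  have "path_homotopic F2 (\<lambda>t. oct (\<delta> t)) (\<lambda>t. oct (octagon_edge 0 0))"
    using \<delta> e8 octagon_edge_in_disc[of 0 0]
    by (intro path_homotopic_oct) (auto simp: path_def path_image_def)
  moreover have "(\<lambda>t. oct (\<delta> t)) \<in> loops F2 F2_base"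
    using pathin_oct[OF \<delta>(1,2)] \<delta>(3,4) e8 base by (simp add: loops_def)
  ultimately have "P 8 = \<one>"
    using loop_class_homotopic hom_loop_class(3)[OF h] \<delta>(5) base by metis
  moreover have "P 8 = \<one> \<otimes> \<rho> (loop_class (e 0)) \<otimes> \<rho> (loop_class (e 1)) \<otimes> \<rho> (loop_class (e 2)) \<otimes> \<rho> (loop_class (e 3))
      \<otimes> \<rho> (loop_class (e 4)) \<otimes> \<rho> (loop_class (e 5)) \<otimes> \<rho> (loop_class (e 6)) \<otimes> \<rho> (loop_class (e 7))"
    using P(2)[of 0] P(2)[of 1] P(2)[of 2] P(2)[of 3] P(2)[of 4] P(2)[of 5] P(2)[of 6] P(2)[of 7]
    by (simp add: P(1) eval_nat_numeral)
  moreover have "\<rho> (loop_class (e 2)) = inv \<rho> (loop_class (e 0))" "\<rho> (loop_class (e 3)) = inv \<rho> (loop_class (e 1))"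
    "\<rho> (loop_class (e 6)) = inv \<rho> (loop_class (e 4))" "\<rho> (loop_class (e 7)) = inv \<rho> (loop_class (e 5))"
    using inv_edge[of 0] inv_edge[of 1] inv_edge[of 4] inv_edge[of 5] by (simp_all add: numeral_eq_Suc)
  moreover have "\<rho> (loop_class (e 0)) \<in> carrier G"
    unfolding e_def by (intro hom_loop_class(1)[OF h] edge_in_loops) simp
  ultimately show ?thesis
    unfolding a1_def b1_def a2_def b2_def edge_class_eq e_def[symmetric] by simp
qed

end

section \<open>Unit quaternions\<close>

text \<open>The pair \<open>(a, b)\<close> stands for the quaternion \<open>a + bj\<close>, i.e. for the matrix with rows \<open>(a, b)\<close> and
  \<open>(-cnj b, cnj a)\<close>.\<close>

type_synonym quat = "complex \<times> complex"

definition qm :: "quat \<Rightarrow> quat \<Rightarrow> quat" where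
  "qm x y = (fst x * fst y - snd x * cnj (snd y), fst x * snd y + snd x * cnj (fst y))"

definition qi :: "quat \<Rightarrow> quat" where
  "qi x = (cnj (fst x), - snd x)"

definition qunit :: "quat \<Rightarrow> bool" where
  "qunit x \<longleftrightarrow> (cmod (fst x))\<^sup>2 + (cmod (snd x))\<^sup>2 = 1"

definition qconj :: "quat \<Rightarrow> quat \<Rightarrow> quat" where
  "qconj x y = qm x (qm y (qi x))"

text \<open>Polynomial form of the unit condition, in which \<open>algebra\<close> can treat
  \<open>a\<close> and \<open>cnj a\<close> as independent variables.\<close>

lemma qunit_iff: "qunit (a, b) \<longleftrightarrow> a * cnj a + b * cnj b = 1"
proof -
  have "a * cnj a + b * cnj b = complex_of_real ((cmod a)\<^sup>2 + (cmod b)\<^sup>2)"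
    by (simp add: complex_norm_square[symmetric])
  then show ?thesis by (simp add: qunit_def of_real_eq_1_iff del: of_real_add)
qed

lemma qm_assoc: "qm (qm x y) z = qm x (qm y z)"
  by (simp add: qm_def algebra_simps)

lemma qm_one [simp]: "qm (1, 0) x = x" "qm x (1, 0) = x"
  by (simp_all add: qm_def)

lemma qi_qi [simp]: "qi (qi x) = x"
  by (simp add: qi_def)

lemma qi_qm: "qi (qm x y) = qm (qi y) (qi x)"
  by (simp add: qm_def qi_def algebra_simps)

lemma qm_qi: "qunit x \<Longrightarrow> qm x (qi x) = (1, 0)" "qunit x \<Longrightarrow> qm (qi x) x = (1, 0)"
  by (cases x; simp add: qunit_iff qm_def qi_def algebra_simps)+

lemma qunit_qm: "qunit x \<Longrightarrow> qunit y \<Longrightarrow> qunit (qm x y)"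
proof (cases x; cases y)
  fix a b c d assume "qunit x" "qunit y" and xy: "x = (a, b)" "y = (c, d)"
  then have "a * cnj a + b * cnj b = 1" "c * cnj c + d * cnj d = 1" by (simp_all add: qunit_iff)
  then have "(a * c - b * cnj d) * (cnj a * cnj c - cnj b * d) + (a * d + b * cnj c) * (cnj a * cnj d + cnj b * c) = 1"
    by algebra
  then show ?thesis by (simp add: xy qm_def qunit_iff)
qed

lemma qunit_qi [simp]: "qunit (qi x) \<longleftrightarrow> qunit x"
  by (simp add: qunit_def qi_def)

lemma qunit_one [simp]: "qunit (1, 0)"
  by (simp add: qunit_def)

lemma qm_cancel: "qunit x \<Longrightarrow> qm (qi x) (qm x y) = y" "qunit x \<Longrightarrow> qm x (qm (qi x) y) = y"
  by (simp_all add: qm_assoc[symmetric] qm_qi)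

lemma qunit_qconj: "qunit x \<Longrightarrow> qunit y \<Longrightarrow> qunit (qconj x y)"
  by (simp add: qconj_def qunit_qm)

lemma qconj_qm: "qunit x \<Longrightarrow> qconj x (qm y z) = qm (qconj x y) (qconj x z)"
  by (simp add: qconj_def qm_assoc qm_cancel)

lemma qconj_qi: "qconj x (qi y) = qi (qconj x y)"
  by (simp add: qconj_def qi_qm qm_assoc)

lemma qconj_qconj: "qconj x (qconj y z) = qconj (qm x y) z"
  by (simp add: qconj_def qi_qm qm_assoc)

lemma qconj_cancel: "qunit x \<Longrightarrow> qconj (qi x) (qconj x y) = y" "qunit x \<Longrightarrow> qconj x (qconj (qi x) y) = y"
  by (simp_all add: qconj_qconj qm_qi) (simp_all add: qconj_def qi_def)

lemma qconj_diag: "cmod \<xi> = 1 \<Longrightarrow> qconj (\<xi>, 0) (a, b) = (a, \<xi>\<^sup>2 * b)"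
proof -
  assume "cmod \<xi> = 1"
  then have "\<xi> * cnj \<xi> = 1" by (simp add: complex_norm_square[symmetric])
  then show ?thesis
    by (simp add: qconj_def qm_def qi_def power2_eq_square algebra_simps)
qed

lemma qconj_Re: "qunit x \<Longrightarrow> Re (fst (qconj x y)) = Re (fst y)"
proof (cases x; cases y)
  fix a b c d assume "qunit x" and xy: "x = (a, b)" "y = (c, d)"
  then have "(cmod a)\<^sup>2 + (cmod b)\<^sup>2 = 1" by (simp add: qunit_def)
  then have *: "(Re a)\<^sup>2 + (Im a)\<^sup>2 + (Re b)\<^sup>2 + (Im b)\<^sup>2 = 1" by (simp add: cmod_power2)
  have "Re (fst (qconj x y)) = Re c * ((Re a)\<^sup>2 + (Im a)\<^sup>2 + (Re b)\<^sup>2 + (Im b)\<^sup>2)"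
    by (simp add: xy qconj_def qm_def qi_def power2_eq_square algebra_simps)
  then show ?thesis using * xy by simp
qed

lemma qm_Re_commute: "Re (fst (qm x y)) = Re (fst (qm y x))"
  by (simp add: qm_def algebra_simps)

text \<open>The rows of the conjugating matrix are eigenvectors of \<open>C\<close>.\<close>

lemma qconj_diagonalise:
  assumes C: "qunit C"
  obtains X where "qunit X" "snd (qconj X C) = 0" "Im (fst (qconj X C)) \<ge> 0"
proof -
  obtain a b where ab: "C = (a, b)" by (cases C)
  have *: "\<exists>X. qunit X \<and> snd (qconj X C) = 0"
  proof (cases "b = 0")
    case True
    then show ?thesis by (intro exI[of _ "(1, 0)"]) (simp add: ab qconj_def qm_def qi_def)
  next
    case False
    \<comment> \<open>The length of the imaginary part of \<open>C\<close>. The off-diagonal entry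
      of the conjugate vanishes if \<open>y\<close> solves
      \<open>y\<^sup>2 + (a - cnj a) y + b cnj b = 0\<close>, and \<open>\<i> (t - Im a)\<close> is
      a root.\<close>
    define t where "t = sqrt ((Im a)\<^sup>2 + (cmod b)\<^sup>2)"
    define y where "y = \<i> * of_real (t - Im a)"
    have t2: "t\<^sup>2 = (Im a)\<^sup>2 + (cmod b)\<^sup>2" by (simp add: t_def)
    have n: "(cmod b)\<^sup>2 + (cmod y)\<^sup>2 > 0" using False by (simp add: add_pos_nonneg)
    define N where "N = sqrt ((cmod b)\<^sup>2 + (cmod y)\<^sup>2)"
    have N: "N > 0" "N\<^sup>2 = (cmod b)\<^sup>2 + (cmod y)\<^sup>2" using n by (simp_all add: N_def)
    let ?X = "(cnj b / of_real N, - y / of_real N)"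
    have "qunit ?X" using N False by (simp add: qunit_def norm_divide power_divide add_divide_distrib[symmetric])
    moreover have "snd (qconj ?X C) = 0"
    proof -
      have bb: "b * cnj b = of_real (t\<^sup>2 - (Im a)\<^sup>2)"
        using complex_norm_square[of b] t2 by simp
      have aa: "a - cnj a = 2 * \<i> * of_real (Im a)" by (simp add: complex_eq_iff)
      have "snd (qconj (cnj b, - y) C) = cnj b * (a * y + b * cnj b - cnj a * y) - y * y * (- cnj b)"
        by (simp add: ab qconj_def qm_def qi_def algebra_simps y_def)
      also have "\<dots> = cnj b * ((a - cnj a) * y + b * cnj b + y * y)"
        by (simp add: algebra_simps)
      also have "(a - cnj a) * y + b * cnj b + y * y = 0"
        unfolding aa bb y_def by (simp add: complex_eq_iff power2_eq_square algebra_simps)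
      finally have "snd (qconj (cnj b, - y) C) = 0" by simp
      moreover have "snd (qconj ?X C) = snd (qconj (cnj b, - y) C) / (of_real N)\<^sup>2"
        using N(1) by (simp add: ab qconj_def qm_def qi_def field_simps power2_eq_square)
      ultimately show ?thesis by simp
    qed
    ultimately show ?thesis by blast
  qed
  then obtain X where X: "qunit X" "snd (qconj X C) = 0" by blast
  show thesis
  proof (cases "Im (fst (qconj X C)) \<ge> 0")
    case True
    then show ?thesis using that X by blast
  next
    case False
    \<comment> \<open>Conjugation by j exchanges the diagonal entries and so reverses the sign of
      the imaginary part.\<close>
    have j: "qunit (0, 1)" by (simp add: qunit_def)
    have "qconj (qm (0, 1) X) C = qconj (0, 1) (fst (qconj X C), 0)"
      using X(2) by (metis prod.collapse qconj_qconj)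
    also have "\<dots> = (cnj (fst (qconj X C)), 0)"
      by (simp add: qconj_def qm_def qi_def)
    finally have "qconj (qm (0, 1) X) C = (cnj (fst (qconj X C)), 0)" .
    then show ?thesis using that[of "qm (0, 1) X"] X(1) qunit_qm j False by simp
  qed
qed

section \<open>Spinors and frames\<close>

text \<open>A unit spinor \<open>s\<close> encodes the oriented orthonormal frame \<open>s i s\<^sup>-\<^sup>1, s j s\<^sup>-\<^sup>1, s k s\<^sup>-\<^sup>1\<close>, of which the last two
  vectors are \<open>(\<i> ht1 s, hz1 s)\<close> and \<open>(\<i> ht2 s, hz2 s)\<close>.\<close>

definition ht1 :: "quat \<Rightarrow> real" where "ht1 s = 2 * Im (fst s * cnj (snd s))"
definition ht2 :: "quat \<Rightarrow> real" where "ht2 s = 2 * Re (fst s * cnj (snd s))"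
text \<open>The i-component of the first frame vector \<open>s i s\<^sup>-\<^sup>1\<close>.\<close>

definition ht3 :: "quat \<Rightarrow> real" where "ht3 s = (cmod (fst s))\<^sup>2 - (cmod (snd s))\<^sup>2"
definition hz1 :: "quat \<Rightarrow> complex" where "hz1 s = (fst s)\<^sup>2 + (snd s)\<^sup>2"
definition hz2 :: "quat \<Rightarrow> complex" where "hz2 s = \<i> * ((fst s)\<^sup>2 - (snd s)\<^sup>2)"

text \<open>Unit length and orthogonality of the last two frame vectors; the fourth relation is the
  i-component of their cross product, and the fifth says that a row of a rotation matrix has length
  1.\<close>

lemma frame_relations:
  assumes "qunit s"
  shows "(cmod (hz1 s))\<^sup>2 = 1 - (ht1 s)\<^sup>2" "(cmod (hz2 s))\<^sup>2 = 1 - (ht2 s)\<^sup>2"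
    "Re (cnj (hz1 s) * hz2 s) = - ht1 s * ht2 s" "Im (cnj (hz1 s) * hz2 s) = ht3 s"
    "(ht1 s)\<^sup>2 + (ht2 s)\<^sup>2 + (ht3 s)\<^sup>2 = 1"
proof -
  obtain a b c d where s: "s = (Complex a b, Complex c d)" by (metis complex.exhaust prod.exhaust)
  have u: "a\<^sup>2 + b\<^sup>2 + c\<^sup>2 + d\<^sup>2 = 1" using assms by (simp add: qunit_def s cmod_power2)
  show "(cmod (hz1 s))\<^sup>2 = 1 - (ht1 s)\<^sup>2"
    using u by (simp add: s hz1_def ht1_def cmod_power2; (simp add: power2_eq_square)?; algebra)
  show "(cmod (hz2 s))\<^sup>2 = 1 - (ht2 s)\<^sup>2"
    using u by (simp add: s hz2_def ht2_def cmod_power2; (simp add: power2_eq_square)?; algebra)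
  show "Re (cnj (hz1 s) * hz2 s) = - ht1 s * ht2 s"
    by (simp add: s hz2_def ht2_def hz1_def ht1_def power2_eq_square algebra_simps)
  show "Im (cnj (hz1 s) * hz2 s) = ht3 s"
    using u by (simp add: s hz2_def ht3_def hz1_def cmod_power2; (simp add: power2_eq_square)?; algebra)
  show "(ht1 s)\<^sup>2 + (ht2 s)\<^sup>2 + (ht3 s)\<^sup>2 = 1"
    using u by (simp add: s ht1_def ht2_def ht3_def cmod_power2; (simp add: power2_eq_square)?; algebra)
qed

text \<open>Solves \<open>a\<^sup>2 + b\<^sup>2 = f\<close> and
  \<open>\<i> (a\<^sup>2 - b\<^sup>2) = g\<close> by square roots. Orthonormality fixes the square
  of \<open>2 a cnj b\<close>, so one of the two signs of \<open>b\<close> yields the required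
  heights.\<close>

lemma spinor_exists:
  assumes f: "(cmod f)\<^sup>2 + u\<^sup>2 = 1" and g: "(cmod g)\<^sup>2 + v\<^sup>2 = 1" and fg: "Re (cnj f * g) + u * v = 0"
  obtains s where "qunit s" "hz1 s = f" "hz2 s = g" "ht1 s = u" "ht2 s = v"
proof -
  define X where "X = (f - \<i> * g) / 2"
  define Y where "Y = (f + \<i> * g) / 2"
  define w where "w = Complex v u"
  have XY: "4 * (X * cnj Y) = w\<^sup>2"
  proof -
    have "(cmod f)\<^sup>2 = 1 - u\<^sup>2" "(cmod g)\<^sup>2 = 1 - v\<^sup>2" using f g by linarith+
    then have 1: "f * cnj f = of_real (1 - u\<^sup>2)" "g * cnj g = of_real (1 - v\<^sup>2)"
      unfolding complex_norm_square[symmetric] by (simp_all only:)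
    have 2: "cnj f * g + f * cnj g = of_real (- 2 * (u * v))"
      using fg by (simp add: complex_eq_iff)
    have "4 * (X * cnj Y) = (f - \<i> * g) * (cnj f - \<i> * cnj g)"
      by (simp add: X_def Y_def)
    also have "\<dots> = f * cnj f - g * cnj g - \<i> * (cnj f * g + f * cnj g)"
      by (simp add: algebra_simps)
    also have "\<dots> = w\<^sup>2"
      unfolding 1 2 w_def by (simp add: complex_eq_iff power2_eq_square)
    finally show ?thesis .
  qed
  define a where "a = csqrt X"
  define b' where "b' = csqrt Y"
  have "(2 * (a * cnj b'))\<^sup>2 = 4 * (a\<^sup>2 * cnj (b'\<^sup>2))" by (simp add: power2_eq_square)
  also have "\<dots> = w\<^sup>2" using XY by (simp add: a_def b'_def)
  finally have "2 * (a * cnj b') = w \<or> 2 * (a * cnj b') = - w" by (simp only: power2_eq_iff)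
  then obtain b where b: "b\<^sup>2 = Y" "2 * (a * cnj b) = w"
  proof
    assume "2 * (a * cnj b') = w" then show thesis using that[of b'] by (simp add: b'_def)
  next
    assume "2 * (a * cnj b') = - w" then show thesis using that[of "- b'"] by (simp add: b'_def)
  qed
  have a: "a\<^sup>2 = X" by (simp add: a_def)
  have w2: "(cmod w)\<^sup>2 = u\<^sup>2 + v\<^sup>2" by (simp add: w_def cmod_power2)
  have cX: "(cmod X)\<^sup>2 + (cmod Y)\<^sup>2 = ((cmod f)\<^sup>2 + (cmod g)\<^sup>2) / 2"
    by (simp add: X_def Y_def cmod_power2 power_divide) (simp add: field_simps power2_eq_square)
  have "((cmod a)\<^sup>2 + (cmod b)\<^sup>2)\<^sup>2 = (cmod X)\<^sup>2 + (cmod Y)\<^sup>2 + 2 * ((cmod a)\<^sup>2 * (cmod b)\<^sup>2)"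
    by (simp add: a[symmetric] b(1)[symmetric] norm_power power2_sum)
  also have "2 * ((cmod a)\<^sup>2 * (cmod b)\<^sup>2) = (cmod (2 * (a * cnj b)))\<^sup>2 / 2"
    by (simp add: norm_mult power_mult_distrib)
  also have "\<dots> = (u\<^sup>2 + v\<^sup>2) / 2" unfolding b(2) w2 ..
  finally have "((cmod a)\<^sup>2 + (cmod b)\<^sup>2)\<^sup>2 = ((cmod f)\<^sup>2 + (cmod g)\<^sup>2) / 2 + (u\<^sup>2 + v\<^sup>2) / 2"
    unfolding cX .
  also have "\<dots> = 1\<^sup>2" unfolding one_power2 using f g by argo
  finally have "(cmod a)\<^sup>2 + (cmod b)\<^sup>2 = 1"
    by (rule power2_eq_imp_eq) simp_all
  then have "qunit (a, b)" by (simp add: qunit_def)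
  moreover have "hz1 (a, b) = f" "hz2 (a, b) = g"
    by (simp_all add: hz1_def hz2_def a b X_def Y_def field_simps)
  moreover have "ht1 (a, b) = u" "ht2 (a, b) = v"
  proof -
    have "Re (2 * (a * cnj b)) = v" "Im (2 * (a * cnj b)) = u" unfolding b(2) w_def by simp_all
    then show "ht1 (a, b) = u" "ht2 (a, b) = v" by (simp_all add: ht1_def ht2_def)
  qed
  ultimately show thesis using that by blast
qed

definition qscale :: "complex \<Rightarrow> quat \<Rightarrow> quat" where
  "qscale c s = (c * fst s, c * snd s)"

lemma qunit_qscale: "cmod c = 1 \<Longrightarrow> qunit (qscale c s) \<longleftrightarrow> qunit s"
  by (simp add: qunit_def qscale_def norm_mult)

lemma frame_qscale:
  assumes "cmod c = 1"
  shows "ht1 (qscale c s) = ht1 s" "ht2 (qscale c s) = ht2 s" "ht3 (qscale c s) = ht3 s"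
    "hz1 (qscale c s) = c\<^sup>2 * hz1 s" "hz2 (qscale c s) = c\<^sup>2 * hz2 s"
proof -
  have c: "c * cnj c = 1" using assms by (simp add: complex_norm_square[symmetric])
  have *: "c * fst s * cnj (c * snd s) = fst s * cnj (snd s)"
    using c by (metis complex_cnj_mult mult.assoc mult.commute mult_1)
  show "ht1 (qscale c s) = ht1 s" "ht2 (qscale c s) = ht2 s"
    unfolding ht1_def ht2_def qscale_def fst_conv snd_conv * by simp_all
  show "ht3 (qscale c s) = ht3 s" using assms by (simp add: ht3_def qscale_def norm_mult)
  show "hz1 (qscale c s) = c\<^sup>2 * hz1 s" "hz2 (qscale c s) = c\<^sup>2 * hz2 s"
    by (simp_all add: hz1_def hz2_def qscale_def power_mult_distrib algebra_simps)
qed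

text \<open>The squares of the entries fix each entry up to sign, and the heights fix
  \<open>fst s * cnj (snd s)\<close>, so the two signs agree. For unit spinors this is the double
  cover of the rotation group.\<close>

lemma spinor_unique:
  assumes "hz1 s = hz1 t" "hz2 s = hz2 t" "ht1 s = ht1 t" "ht2 s = ht2 t"
  shows "\<exists>e. (e = 1 \<or> e = - 1) \<and> t = qscale e s"
proof -
  have sq: "(fst t)\<^sup>2 = (fst s)\<^sup>2" "(snd t)\<^sup>2 = (snd s)\<^sup>2"
    using assms(1,2) by (simp_all add: hz1_def hz2_def) algebra+
  have m: "fst t * cnj (snd t) = fst s * cnj (snd s)"
    using assms(3,4) by (simp add: ht1_def ht2_def complex_eq_iff)
  consider "fst t = fst s" | "fst t = - fst s" using sq(1) by (auto simp: power2_eq_iff)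
  then show ?thesis
  proof cases
    case 1
    show ?thesis
    proof (cases "fst s = 0")
      case True
      then show ?thesis using sq(2) 1 by (cases t) (auto simp: power2_eq_iff qscale_def)
    next
      case False
      then have "snd t = snd s" using m 1 by simp
      then show ?thesis using 1 by (intro exI[of _ 1]) (cases t, simp add: qscale_def)
    qed
  next
    case 2
    show ?thesis
    proof (cases "fst s = 0")
      case True
      then show ?thesis using sq(2) 2 by (cases t) (auto simp: power2_eq_iff qscale_def)
    next
      case False
      have "fst s * (- cnj (snd t)) = fst s * cnj (snd s)" using m 2 by simp
      then have "- cnj (snd t) = cnj (snd s)" using mult_left_cancel[OF False] by blast
      then have "cnj (- snd t) = cnj (snd s)" by simp
      then have "snd t = - snd s" by (metis complex_cnj_cancel_iff minus_minus)
      then show ?thesis using 2 by (intro exI[of _ "- 1"]) (cases t, simp add: qscale_def)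
    qed
  qed
qed

text \<open>The three heights form the Hopf map from unit spinors to the sphere, whose fibres are
  the circles of phases.\<close>

lemma spinor_phase:
  assumes s: "qunit s" and t: "qunit t" and "ht1 s = ht1 t" "ht2 s = ht2 t" "ht3 s = ht3 t"
  obtains c where "cmod c = 1" "t = qscale c s"
proof -
  have m: "fst t * cnj (snd t) = fst s * cnj (snd s)"
    using assms by (simp add: ht1_def ht2_def complex_eq_iff)
  have n: "(cmod (fst t))\<^sup>2 = (cmod (fst s))\<^sup>2" "(cmod (snd t))\<^sup>2 = (cmod (snd s))\<^sup>2"
    using assms unfolding ht3_def qunit_def by linarith+
  show thesis
  proof (cases "fst s = 0")
    case True
    then have "fst t = 0" using n by simp
    moreover have "(cmod (snd s))\<^sup>2 = 1\<^sup>2" "(cmod (snd t))\<^sup>2 = 1\<^sup>2"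
      using n s True by (simp_all add: qunit_def)
    then have "cmod (snd s) = 1" "cmod (snd t) = 1"
      using power2_eq_imp_eq norm_ge_zero zero_le_one by blast+
    ultimately have "fst t = 0" "cmod (snd s) = 1" "cmod (snd t) = 1" by blast+
    moreover from this have "snd s \<noteq> 0" by auto
    ultimately show thesis
      using that[of "snd t / snd s"] True by (cases t) (auto simp: qscale_def norm_divide)
  next
    case False
    define c where "c = fst t / fst s"
    have "cmod c = 1" using False n(1) by (simp add: c_def norm_divide)
    then have cc: "c * cnj c = 1" by (simp add: complex_norm_square[symmetric])
    have ft: "fst t = c * fst s" using False by (simp add: c_def)
    then have "c * cnj (snd t) = cnj (snd s)" using m False by simp
    then have "cnj c * (c * cnj (snd t)) = cnj c * cnj (snd s)" by simp
    then have "cnj (snd t) = cnj (c * snd s)" using cc by (simp add: mult.assoc[symmetric] mult.commute)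
    then have "snd t = c * snd s" by (metis complex_cnj_cnj)
    then show thesis using that[OF \<open>cmod c = 1\<close>] ft by (cases t) (simp add: qscale_def)
  qed
qed

section \<open>Normal forms of pairs with given commutator\<close>

text \<open>For a unit complex number \<open>\<gamma>\<close> with real part \<open>r \<ge> 0\<close>, the pairs \<open>A, B\<close> with
  \<open>A B = - \<gamma>\<^sup>-\<^sup>2 B A\<close> and \<open>r > 0\<close> are those of the form
  \<open>A = (\<i> h' \<gamma>\<^sup>-\<^sup>1, \<rho>)\<close>, \<open>B = (\<i> h \<gamma>, \<gamma> p)\<close> with unit vectors \<open>(p, h)\<close>, \<open>(\<rho>, h')\<close> satisfying
  \<open>Re (cnj p * \<rho>) = - r h h'\<close>. Then \<open>(p + \<rho>, h + h')\<close> and \<open>(p - \<rho>, h - h')\<close> are orthogonal, and normalising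
  them gives an orthonormal frame, hence a spinor; \<open>tilt\<close> recovers their lengths from the frame.\<close>

definition tilt :: "real \<Rightarrow> quat \<Rightarrow> real" where
  "tilt r s = (1 - r) / 2 * ((ht1 s)\<^sup>2 - (ht2 s)\<^sup>2) / (1 - (1 - r) / 2 * ((ht1 s)\<^sup>2 + (ht2 s)\<^sup>2))"

definition len1 :: "real \<Rightarrow> quat \<Rightarrow> real" where "len1 r s = sqrt ((1 + tilt r s) / 2)"
definition len2 :: "real \<Rightarrow> quat \<Rightarrow> real" where "len2 r s = sqrt ((1 - tilt r s) / 2)"

definition hB :: "real \<Rightarrow> quat \<Rightarrow> real" where "hB r s = len1 r s * ht1 s + len2 r s * ht2 s"
definition hA :: "real \<Rightarrow> quat \<Rightarrow> real" where "hA r s = len1 r s * ht1 s - len2 r s * ht2 s"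
definition pB :: "real \<Rightarrow> quat \<Rightarrow> complex" where
  "pB r s = of_real (len1 r s) * hz1 s + of_real (len2 r s) * hz2 s"
definition pA :: "real \<Rightarrow> quat \<Rightarrow> complex" where
  "pA r s = of_real (len1 r s) * hz1 s - of_real (len2 r s) * hz2 s"

definition gam :: "real \<Rightarrow> complex" where "gam r = Complex r (sqrt (1 - r\<^sup>2))"

definition sideA :: "real \<Rightarrow> quat \<Rightarrow> quat" where
  "sideA r s = (\<i> * of_real (hA r s) * cnj (gam r), pA r s)"
definition sideB :: "real \<Rightarrow> quat \<Rightarrow> quat" where
  "sideB r s = (\<i> * of_real (hB r s) * gam r, gam r * pB r s)"

lemma ht_sum_le:
  assumes "qunit s" shows "(ht1 s)\<^sup>2 + (ht2 s)\<^sup>2 \<le> 1"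
  using frame_relations(5)[OF assms] zero_le_power2[of "ht3 s"] by linarith

lemma tilt_denominator:
  assumes "qunit s" "0 \<le> r" "r \<le> 1"
  shows "1/2 \<le> 1 - (1 - r) / 2 * ((ht1 s)\<^sup>2 + (ht2 s)\<^sup>2)"
proof -
  have "(1 - r) / 2 * ((ht1 s)\<^sup>2 + (ht2 s)\<^sup>2) \<le> 1/2 * 1"
    using assms ht_sum_le[OF assms(1)] by (intro mult_mono) auto
  then show ?thesis by simp
qed

text \<open>The squared lengths are \<open>(1 + d) / 2\<close> and \<open>(1 - d) / 2\<close> with
  \<open>d = (1 - r) h h'\<close>. Since \<open>2 h h'\<close> is
  \<open>(1 + d) (ht1 s)\<^sup>2 - (1 - d) (ht2 s)\<^sup>2\<close>, this is a linear equation for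
  \<open>d\<close>, and \<open>tilt\<close> is its solution.\<close>

lemma tilt_equation:
  assumes "qunit s" "0 \<le> r" "r \<le> 1"
  shows "2 * tilt r s = (1 - r) * ((1 + tilt r s) * (ht1 s)\<^sup>2 - (1 - tilt r s) * (ht2 s)\<^sup>2)"
proof -
  let ?D = "1 - (1 - r) / 2 * ((ht1 s)\<^sup>2 + (ht2 s)\<^sup>2)"
  have "?D \<noteq> 0" using tilt_denominator[OF assms] by linarith
  then have "tilt r s * ?D = (1 - r) / 2 * ((ht1 s)\<^sup>2 - (ht2 s)\<^sup>2)"
    using nonzero_eq_divide_eq[THEN iffD1, OF _ tilt_def] by blast
  then show ?thesis by (simp add: field_simps)
qed

lemma tilt_unique:
  assumes "qunit s" "0 \<le> r" "r \<le> 1" and "2 * d = (1 - r) * ((1 + d) * (ht1 s)\<^sup>2 - (1 - d) * (ht2 s)\<^sup>2)"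
  shows "tilt r s = d"
proof -
  let ?D = "1 - (1 - r) / 2 * ((ht1 s)\<^sup>2 + (ht2 s)\<^sup>2)"
  have "?D \<noteq> 0" using tilt_denominator[OF assms(1-3)] by linarith
  moreover have "d * ?D = (1 - r) / 2 * ((ht1 s)\<^sup>2 - (ht2 s)\<^sup>2)"
    using assms(4) by (simp add: field_simps)
  ultimately show ?thesis
    unfolding tilt_def by (intro nonzero_divide_eq_eq[THEN iffD2]) simp_all
qed

text \<open>For \<open>r > 0\<close> both lengths are therefore positive and the frame can be
  recovered from the pair. At \<open>r = 0\<close> one of them may vanish, which is the source of
  degenerate cases below.\<close>

lemma tilt_bound:
  assumes "qunit s" "0 \<le> r" "r \<le> 1"
  shows "\<bar>tilt r s\<bar> \<le> 1" and "r > 0 \<Longrightarrow> \<bar>tilt r s\<bar> < 1"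
proof -
  let ?k = "(1 - r) / 2" and ?D = "1 - (1 - r) / 2 * ((ht1 s)\<^sup>2 + (ht2 s)\<^sup>2)"
  have D: "?D > 0" using tilt_denominator[OF assms] by linarith
  have U: "(ht1 s)\<^sup>2 \<le> 1" "(ht2 s)\<^sup>2 \<le> 1" "0 \<le> (ht1 s)\<^sup>2" "0 \<le> (ht2 s)\<^sup>2"
    using ht_sum_le[OF assms(1)] zero_le_power2[of "ht1 s"] zero_le_power2[of "ht2 s"] by linarith+
  have kU: "?k * (ht1 s)\<^sup>2 \<le> ?k * 1" "?k * (ht2 s)\<^sup>2 \<le> ?k * 1"
    using U assms by (intro mult_left_mono; simp)+
  have kD: "?k * ((ht1 s)\<^sup>2 - (ht2 s)\<^sup>2) = ?k * (ht1 s)\<^sup>2 - ?k * (ht2 s)\<^sup>2"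
    "?k * ((ht1 s)\<^sup>2 + (ht2 s)\<^sup>2) = ?k * (ht1 s)\<^sup>2 + ?k * (ht2 s)\<^sup>2"
    by (rule right_diff_distrib distrib_left)+
  have aux: "\<bar>x - y\<bar> \<le> 1 - (x + y)" if "x \<le> k * 1" "y \<le> k * 1" "k \<le> 1/2" for x y k :: real
    using that by linarith
  have aux': "\<bar>x - y\<bar> < 1 - (x + y)" if "x \<le> k * 1" "y \<le> k * 1" "k < 1/2" for x y k :: real
    using that by linarith
  have abs: "\<bar>tilt r s\<bar> * ?D = \<bar>?k * ((ht1 s)\<^sup>2 - (ht2 s)\<^sup>2)\<bar>"
  proof -
    have "?D \<noteq> 0" using D by linarith
    then have "tilt r s * ?D = ?k * ((ht1 s)\<^sup>2 - (ht2 s)\<^sup>2)"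
      using nonzero_eq_divide_eq[THEN iffD1, OF _ tilt_def] by blast
    then show ?thesis using abs_mult[of "tilt r s" ?D] abs_of_pos[OF D] by (simp only:)
  qed
  have "\<bar>?k * ((ht1 s)\<^sup>2 - (ht2 s)\<^sup>2)\<bar> \<le> ?D"
    unfolding kD by (rule aux[OF kU]) (use assms in simp)
  then have "\<bar>tilt r s\<bar> * ?D \<le> 1 * ?D" using abs by simp
  then show "\<bar>tilt r s\<bar> \<le> 1" using D by (rule mult_right_le_imp_le)
  assume "r > 0"
  have "\<bar>?k * ((ht1 s)\<^sup>2 - (ht2 s)\<^sup>2)\<bar> < ?D"
    unfolding kD by (rule aux'[OF kU]) (use assms \<open>r > 0\<close> in simp)
  then have "\<bar>tilt r s\<bar> * ?D < 1 * ?D" using abs by simp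
  then show "\<bar>tilt r s\<bar> < 1" using D by (simp add: mult_less_cancel_right)
qed

lemma len_squares:
  assumes "qunit s" "0 \<le> r" "r \<le> 1"
  shows "(len1 r s)\<^sup>2 = (1 + tilt r s) / 2" "(len2 r s)\<^sup>2 = (1 - tilt r s) / 2" "0 \<le> len1 r s" "0 \<le> len2 r s"
  using tilt_bound(1)[OF assms] by (auto simp: len1_def len2_def abs_le_iff)

lemma gam_unit: "0 \<le> r \<Longrightarrow> r \<le> 1 \<Longrightarrow> gam r * cnj (gam r) = 1"
  by (simp add: gam_def complex_eq_iff power2_eq_square[symmetric] abs_square_le_1)

lemma norm_gam: "0 \<le> r \<Longrightarrow> r \<le> 1 \<Longrightarrow> cmod (gam r) = 1"
  by (simp add: gam_def cmod_def abs_square_le_1)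

lemma cmod_add_sq: "(cmod (x + y))\<^sup>2 = (cmod x)\<^sup>2 + (cmod y)\<^sup>2 + 2 * Re (cnj x * y)"
  "(cmod (x - y))\<^sup>2 = (cmod x)\<^sup>2 + (cmod y)\<^sup>2 - 2 * Re (cnj x * y)"
  by (simp_all add: cmod_power2) (simp_all add: power2_eq_square algebra_simps)

text \<open>The first three relations are those of the normal form. The fifth recovers the tilt from
  the heights of the pair, and the fourth recovers \<open>ht3\<close> when neither length
  vanishes.\<close>

lemma side_relations:
  assumes s: "qunit s" and r: "0 \<le> r" "r \<le> 1"
  shows "(cmod (pB r s))\<^sup>2 + (hB r s)\<^sup>2 = 1" "(cmod (pA r s))\<^sup>2 + (hA r s)\<^sup>2 = 1"
    "Re (cnj (pB r s) * pA r s) = - r * hB r s * hA r s"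
    "Im (cnj (pB r s) * pA r s) = - 2 * len1 r s * len2 r s * ht3 s"
    "tilt r s = (1 - r) * hB r s * hA r s"
proof -
  note f = frame_relations[OF s] and l = len_squares[OF s r]
  have R: "Re (cnj (of_real (len1 r s) * hz1 s) * (of_real (len2 r s) * hz2 s)) = - len1 r s * len2 r s * ht1 s * ht2 s"
    using f(3) by (simp add: algebra_simps) algebra
  have n: "(cmod (of_real (len1 r s) * hz1 s))\<^sup>2 = (len1 r s)\<^sup>2 * (1 - (ht1 s)\<^sup>2)"
    "(cmod (of_real (len2 r s) * hz2 s))\<^sup>2 = (len2 r s)\<^sup>2 * (1 - (ht2 s)\<^sup>2)"
    using f(1,2) by (simp_all add: norm_mult power_mult_distrib)
  have l1: "(len1 r s)\<^sup>2 + (len2 r s)\<^sup>2 = 1" unfolding l by (simp add: field_simps)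
  show "(cmod (pB r s))\<^sup>2 + (hB r s)\<^sup>2 = 1"
    unfolding pB_def cmod_add_sq n R hB_def using l1 by algebra
  show "(cmod (pA r s))\<^sup>2 + (hA r s)\<^sup>2 = 1"
    unfolding pA_def cmod_add_sq n R hA_def using l1 by algebra
  have hh: "hB r s * hA r s = (len1 r s)\<^sup>2 * (ht1 s)\<^sup>2 - (len2 r s)\<^sup>2 * (ht2 s)\<^sup>2"
    by (simp add: hB_def hA_def power2_eq_square algebra_simps)
  show t: "tilt r s = (1 - r) * hB r s * hA r s"
    using tilt_equation[OF s r] unfolding mult.assoc hh l by (simp add: field_simps)
  have "Re (cnj (pB r s) * pA r s) = (len1 r s)\<^sup>2 * (cmod (hz1 s))\<^sup>2 - (len2 r s)\<^sup>2 * (cmod (hz2 s))\<^sup>2"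
    by (simp add: pB_def pA_def cmod_power2) (simp add: power2_eq_square algebra_simps)
  also have "\<dots> = tilt r s - hB r s * hA r s"
    unfolding f hh l by (simp add: field_simps)
  finally show "Re (cnj (pB r s) * pA r s) = - r * hB r s * hA r s"
    using t by (simp add: algebra_simps)
  show "Im (cnj (pB r s) * pA r s) = - 2 * len1 r s * len2 r s * ht3 s"
    using f(4) by (simp add: pB_def pA_def algebra_simps; algebra)
qed

lemma qunit_sides:
  assumes "qunit s" "0 \<le> r" "r \<le> 1"
  shows "qunit (sideA r s)" "qunit (sideB r s)"
  using side_relations[OF assms] norm_gam[OF assms(2,3)]
  by (simp_all add: qunit_def sideA_def sideB_def norm_mult add.commute)

text \<open>The second entries agree for every unit \<open>\<gamma>\<close>. The first entries agree
  since twice the real part in the hypothesis is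
  \<open>- (\<gamma> + cnj \<gamma>) h k\<close>.\<close>

lemma normal_form_commute:
  assumes g: "\<gamma> * cnj \<gamma> = 1" and R: "Re (cnj p * q) = - Re \<gamma> * h * k"
  shows "qm (\<i> * of_real k * cnj \<gamma>, q) (\<i> * of_real h * \<gamma>, \<gamma> * p) =
    qm (- (cnj \<gamma>)\<^sup>2, 0) (qm (\<i> * of_real h * \<gamma>, \<gamma> * p) (\<i> * of_real k * cnj \<gamma>, q))"
proof -
  have 1: "cnj p * q + p * cnj q = of_real (2 * (- Re \<gamma> * h * k))"
    unfolding R[symmetric] by (simp add: complex_eq_iff)
  also have "\<dots> = - (\<gamma> + cnj \<gamma>) * of_real h * of_real k"
    by (simp add: complex_eq_iff)
  finally have 1: "cnj p * q + p * cnj q = - (\<gamma> + cnj \<gamma>) * of_real h * of_real k" .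
  have "\<i> * of_real k * cnj \<gamma> * (\<i> * of_real h * \<gamma>) - q * cnj (\<gamma> * p) =
      - (cnj \<gamma>)\<^sup>2 * (\<i> * of_real h * \<gamma> * (\<i> * of_real k * cnj \<gamma>) - \<gamma> * p * cnj q)"
  proof -
    have ii: "\<i> * \<i> = -1" by simp
    show ?thesis using 1 g ii unfolding complex_cnj_mult by algebra
  qed
  moreover have "\<i> * of_real k * cnj \<gamma> * (\<gamma> * p) + q * cnj (\<i> * of_real h * \<gamma>) =
      - (cnj \<gamma>)\<^sup>2 * (\<i> * of_real h * \<gamma> * q + \<gamma> * p * cnj (\<i> * of_real k * cnj \<gamma>))"
    using g by (simp add: power2_eq_square) algebra
  ultimately show ?thesis unfolding qm_def by simp
qed

lemma sides_commute:
  assumes "qunit s" "0 \<le> r" "r \<le> 1"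
  shows "qm (sideA r s) (sideB r s) = qm (- (cnj (gam r))\<^sup>2, 0) (qm (sideB r s) (sideA r s))"
proof -
  have "Re (cnj (pB r s) * pA r s) = - Re (gam r) * hB r s * hA r s"
    using side_relations(3)[OF assms] by (simp add: gam_def)
  from normal_form_commute[OF gam_unit[OF assms(2,3)] this]
  show ?thesis by (simp add: sideA_def sideB_def)
qed

lemma side_qscale:
  assumes "cmod c = 1"
  shows "tilt r (qscale c s) = tilt r s" "len1 r (qscale c s) = len1 r s" "len2 r (qscale c s) = len2 r s"
    "hA r (qscale c s) = hA r s" "hB r (qscale c s) = hB r s"
    "pA r (qscale c s) = c\<^sup>2 * pA r s" "pB r (qscale c s) = c\<^sup>2 * pB r s"
    "sideA r (qscale c s) = qconj (c, 0) (sideA r s)" "sideB r (qscale c s) = qconj (c, 0) (sideB r s)"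
proof -
  note f = frame_qscale[OF assms]
  show t: "tilt r (qscale c s) = tilt r s" by (simp add: tilt_def f)
  then show l: "len1 r (qscale c s) = len1 r s" "len2 r (qscale c s) = len2 r s"
    by (simp_all add: len1_def len2_def)
  show h: "hA r (qscale c s) = hA r s" "hB r (qscale c s) = hB r s"
    by (simp_all add: hA_def hB_def l f)
  show p: "pA r (qscale c s) = c\<^sup>2 * pA r s" "pB r (qscale c s) = c\<^sup>2 * pB r s"
    by (simp_all add: pA_def pB_def l f algebra_simps)
  show "sideA r (qscale c s) = qconj (c, 0) (sideA r s)" "sideB r (qscale c s) = qconj (c, 0) (sideB r s)"
    unfolding sideA_def sideB_def qconj_diag[OF assms] h p by (simp_all add: algebra_simps)
qed

lemma side_unique:
  assumes s: "qunit s" and t: "qunit t" and r: "0 < r" "r \<le> 1"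
    and eq: "sideA r s = sideA r t" "sideB r s = sideB r t"
  shows "\<exists>e. (e = 1 \<or> e = - 1) \<and> t = qscale e s"
proof (rule spinor_unique)
  have r0: "0 \<le> r" using r by simp
  have g: "gam r \<noteq> 0" using norm_gam[OF r0 r(2)] by auto
  have h: "hA r s = hA r t" "hB r s = hB r t" and p: "pA r s = pA r t" "pB r s = pB r t"
    using eq g by (simp_all add: sideA_def sideB_def)
  have tl: "tilt r s = tilt r t"
    using side_relations(5)[OF s r0 r(2)] side_relations(5)[OF t r0 r(2)] h by simp
  then have l: "len1 r t = len1 r s" "len2 r t = len2 r s" by (simp_all add: len1_def len2_def)
  have pos: "len1 r s > 0" "len2 r s > 0"
    using tilt_bound(2)[OF s r0 r(2) r(1)] by (auto simp: len1_def len2_def abs_less_iff)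
  have "2 * (len1 r s * ht1 s) = 2 * (len1 r s * ht1 t)" "2 * (len2 r s * ht2 s) = 2 * (len2 r s * ht2 t)"
    using h unfolding hA_def hB_def l by linarith+
  then show "ht1 s = ht1 t" "ht2 s = ht2 t" using pos by auto
  have "2 * (of_real (len1 r s) * hz1 s) = 2 * (of_real (len1 r s) * hz1 t)"
    "2 * (of_real (len2 r s) * hz2 s) = 2 * (of_real (len2 r s) * hz2 t)"
    using p unfolding pA_def pB_def l by algebra+
  then show "hz1 s = hz1 t" "hz2 s = hz2 t" using pos by auto
qed

text \<open>Half the sum and half the difference of the two unit vectors are orthogonal, with
  squared lengths \<open>(1 + d) / 2\<close> and \<open>(1 - d) / 2\<close>. Normalised they give a
  frame, and \<open>tilt_unique\<close> identifies \<open>d\<close> as its tilt.\<close>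

lemma side_exists:
  assumes r: "0 \<le> r" "r \<le> 1" and P: "(cmod p)\<^sup>2 + h\<^sup>2 = 1" and R: "(cmod q)\<^sup>2 + k\<^sup>2 = 1"
    and PR: "Re (cnj p * q) = - r * h * k"
  obtains s where "qunit s" "pB r s = p" "pA r s = q" "hB r s = h" "hA r s = k"
proof -
  define d where "d = (1 - r) * h * k"
  have M: "(cmod ((p + q) / 2))\<^sup>2 + ((h + k) / 2)\<^sup>2 = (1 + d) / 2"
    using P R PR by (simp add: norm_divide power_divide cmod_add_sq d_def) (simp add: field_simps power2_eq_square)
  have N: "(cmod ((p - q) / 2))\<^sup>2 + ((h - k) / 2)\<^sup>2 = (1 - d) / 2"
    using P R PR by (simp add: norm_divide power_divide cmod_add_sq d_def) (simp add: field_simps power2_eq_square)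
  have MN: "Re (cnj ((p + q) / 2) * ((p - q) / 2)) + (h + k) / 2 * ((h - k) / 2) = 0"
  proof -
    have "Re (cnj (p + q) * (p - q)) = (cmod p)\<^sup>2 - (cmod q)\<^sup>2"
      by (simp add: cmod_power2) (simp add: power2_eq_square algebra_simps)
    moreover have "Re (cnj ((p + q) / 2) * ((p - q) / 2)) = Re (cnj (p + q) * (p - q)) / 4"
      by (simp add: field_simps)
    ultimately show ?thesis using P R by (simp add: field_simps power2_eq_square)
  qed
  have d1: "0 \<le> (1 + d) / 2" "0 \<le> (1 - d) / 2" using M N by (metis add_nonneg_nonneg zero_le_power2)+
  define a where "a = sqrt ((1 + d) / 2)"
  define b where "b = sqrt ((1 - d) / 2)"
  have ab: "a\<^sup>2 = (1 + d) / 2" "b\<^sup>2 = (1 - d) / 2" "0 \<le> a" "0 \<le> b"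
    using d1 by (simp_all add: a_def b_def)
  have scaled: "(cmod (z / of_real c))\<^sup>2 + (u / c)\<^sup>2 = ((cmod z)\<^sup>2 + u\<^sup>2) / c\<^sup>2" for z u c
    by (simp add: norm_divide power_divide add_divide_distrib)
  have ext: "\<exists>f u g v. (cmod f)\<^sup>2 + u\<^sup>2 = 1 \<and> (cmod g)\<^sup>2 + v\<^sup>2 = 1 \<and> Re (cnj f * g) + u * v = 0 \<and>
      of_real a * f = (p + q) / 2 \<and> a * u = (h + k) / 2 \<and> of_real b * g = (p - q) / 2 \<and> b * v = (h - k) / 2"
  proof -
    consider "a > 0" "b > 0" | "a = 0" | "b = 0" using ab by linarith
    then show ?thesis
    proof cases
      case 1
      let ?f = "(p + q) / 2 / of_real a" and ?g = "(p - q) / 2 / of_real b"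
      let ?u = "(h + k) / 2 / a" and ?v = "(h - k) / 2 / b"
      have "(cmod ?f)\<^sup>2 + ?u\<^sup>2 = ((cmod ((p + q) / 2))\<^sup>2 + ((h + k) / 2)\<^sup>2) / a\<^sup>2"
        by (rule scaled)
      also have "\<dots> = 1" unfolding M ab(1)[symmetric] using 1 by simp
      finally have f: "(cmod ?f)\<^sup>2 + ?u\<^sup>2 = 1" .
      have "(cmod ?g)\<^sup>2 + ?v\<^sup>2 = ((cmod ((p - q) / 2))\<^sup>2 + ((h - k) / 2)\<^sup>2) / b\<^sup>2"
        by (rule scaled)
      also have "\<dots> = 1" unfolding N ab(2)[symmetric] using 1 by simp
      finally have g: "(cmod ?g)\<^sup>2 + ?v\<^sup>2 = 1" .
      have "cnj ?f * ?g = cnj ((p + q) / 2) * ((p - q) / 2) / of_real (a * b)" by simp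
      then have "Re (cnj ?f * ?g) = Re (cnj ((p + q) / 2) * ((p - q) / 2)) / (a * b)"
        by (simp only: Re_divide_of_real)
      moreover have "?u * ?v = (h + k) / 2 * ((h - k) / 2) / (a * b)" by simp
      ultimately have "Re (cnj ?f * ?g) + ?u * ?v =
          (Re (cnj ((p + q) / 2) * ((p - q) / 2)) + (h + k) / 2 * ((h - k) / 2)) / (a * b)"
        by (simp only: add_divide_distrib)
      then have "Re (cnj ?f * ?g) + ?u * ?v = 0" unfolding MN by simp
      with f g show ?thesis
        using 1 by (intro exI[of _ ?f] exI[of _ ?u] exI[of _ ?g] exI[of _ ?v]) simp
    next
      \<comment> \<open>A vanishing first length means \<open>d = -1\<close>, so
        \<open>(1 - r) h\<^sup>2 = 1\<close>, which forces \<open>h\<^sup>2 = 1\<close> and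
        \<open>p = 0\<close>. The first frame vector is then free up to orthogonality to the second;
        the choice is \<open>f = 1\<close>, \<open>u = 0\<close>.\<close>
      case 2
      then have d: "d = -1" using ab by (simp add: field_simps)
      have "(cmod ((p + q) / 2))\<^sup>2 + ((h + k) / 2)\<^sup>2 = 0" unfolding M d by simp
      then have "cmod ((p + q) / 2) = 0 \<and> (h + k) / 2 = 0" by (simp only: sum_power2_eq_zero_iff)
      then have pq: "q = - p" "k = - h" by (simp_all add: add_eq_0_iff)
      have "(1 - r) * h\<^sup>2 = 1" using d by (simp add: d_def pq power2_eq_square algebra_simps)
      moreover have h1: "h\<^sup>2 \<le> 1" using P zero_le_power2[of "cmod p"] by linarith
      moreover have "(1 - r) * h\<^sup>2 \<le> 1 * h\<^sup>2" using r by (intro mult_right_mono) auto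
      ultimately have h2: "h\<^sup>2 = 1" by linarith
      then have "p = 0" using P by simp
      moreover have "b = 1" using ab(2,4) d by (simp add: power2_eq_1_iff)
      ultimately show ?thesis using 2 pq h2
        by (intro exI[of _ 1] exI[of _ 0] exI[of _ 0] exI[of _ h]) simp
    next
      case 3
      then have d: "d = 1" using ab by (simp add: field_simps)
      have "(cmod ((p - q) / 2))\<^sup>2 + ((h - k) / 2)\<^sup>2 = 0" unfolding N d by simp
      then have "cmod ((p - q) / 2) = 0 \<and> (h - k) / 2 = 0" by (simp only: sum_power2_eq_zero_iff)
      then have pq: "q = p" "k = h" by simp_all
      have "(1 - r) * h\<^sup>2 = 1" using d unfolding d_def pq by (simp only: power2_eq_square mult.assoc)
      moreover have h1: "h\<^sup>2 \<le> 1" using P zero_le_power2[of "cmod p"] by linarith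
      moreover have "(1 - r) * h\<^sup>2 \<le> 1 * h\<^sup>2" using r by (intro mult_right_mono) auto
      ultimately have h2: "h\<^sup>2 = 1" by linarith
      then have "p = 0" using P by simp
      moreover have "a = 1" using ab(1,3) d by (simp add: power2_eq_1_iff)
      ultimately show ?thesis using 3 pq h2
        by (intro exI[of _ 0] exI[of _ h] exI[of _ 1] exI[of _ 0]) simp
    qed
  qed
  then obtain f u g v where fg: "(cmod f)\<^sup>2 + u\<^sup>2 = 1" "(cmod g)\<^sup>2 + v\<^sup>2 = 1" "Re (cnj f * g) + u * v = 0"
    and M': "of_real a * f = (p + q) / 2" "a * u = (h + k) / 2"
    and N': "of_real b * g = (p - q) / 2" "b * v = (h - k) / 2" by blast
  obtain s where s: "qunit s" "hz1 s = f" "hz2 s = g" "ht1 s = u" "ht2 s = v"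
    using spinor_exists[OF fg] by metis
  have "a\<^sup>2 * u\<^sup>2 - b\<^sup>2 * v\<^sup>2 = ((h + k) / 2)\<^sup>2 - ((h - k) / 2)\<^sup>2"
    unfolding M'(2)[symmetric] N'(2)[symmetric] by (simp add: power_mult_distrib)
  also have "\<dots> = h * k" by (simp add: field_simps power2_eq_square)
  finally have *: "(1 + d) * u\<^sup>2 - (1 - d) * v\<^sup>2 = 2 * (h * k)" unfolding ab by (simp add: field_simps)
  have "tilt r s = d"
  proof (rule tilt_unique[OF s(1) r])
    have "2 * d = (1 - r) * (2 * (h * k))" by (simp add: d_def)
    then show "2 * d = (1 - r) * ((1 + d) * (ht1 s)\<^sup>2 - (1 - d) * (ht2 s)\<^sup>2)" by (simp only: s *)
  qed
  then have l: "len1 r s = a" "len2 r s = b" by (simp_all add: len1_def len2_def a_def b_def)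
  have "pB r s = p" "pA r s = q" unfolding pB_def pA_def l s M' N' by (simp_all add: field_simps)
  moreover have "hB r s = h" "hA r s = k" unfolding hB_def hA_def l s M' N' by (simp_all add: field_simps)
  ultimately show thesis using that s(1) by blast
qed

section \<open>Commutators and the normal form of a representation\<close>

definition qcomm :: "quat \<Rightarrow> quat \<Rightarrow> quat" where
  "qcomm x y = qm (qm x y) (qm (qi x) (qi y))"

lemma qcomm_eq_iff:
  assumes "qunit A" "qunit B"
  shows "qcomm A B = C \<longleftrightarrow> qm A B = qm C (qm B A)"
proof
  assume "qcomm A B = C"
  then have "qm C (qm B A) = qm (qm A B) (qm (qi A) (qm (qm (qi B) B) A))"
    by (auto simp: qcomm_def qm_assoc)
  then show "qm A B = qm C (qm B A)" using assms by (simp add: qm_qi)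
next
  assume "qm A B = qm C (qm B A)"
  then have "qcomm A B = qm C (qm B (qm (qm A (qi A)) (qi B)))"
    by (simp add: qcomm_def qm_assoc)
  then show "qcomm A B = C" using assms by (simp add: qm_qi)
qed

lemma qunit_qcomm: "qunit A \<Longrightarrow> qunit B \<Longrightarrow> qunit (qcomm A B)"
  by (simp add: qcomm_def qunit_qm)

lemma qconj_qcomm: "qunit X \<Longrightarrow> qconj X (qcomm A B) = qcomm (qconj X A) (qconj X B)"
  by (simp add: qcomm_def qconj_qm qconj_qi)

lemma qcomm_sides:
  assumes "qunit s" "0 \<le> r" "r \<le> 1"
  shows "qcomm (sideA r s) (sideB r s) = (- (cnj (gam r))\<^sup>2, 0)"
  using qcomm_eq_iff[OF qunit_sides[OF assms]] sides_commute[OF assms] by blast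

lemma neg_gam_square:
  assumes "0 \<le> r" "r \<le> 1"
  shows "- (cnj (gam r))\<^sup>2 = Complex (1 - 2 * r\<^sup>2) (2 * r * sqrt (1 - r\<^sup>2))"
proof -
  have "(sqrt (1 - r\<^sup>2))\<^sup>2 = 1 - r\<^sup>2" using assms by (simp add: abs_square_le_1)
  then show ?thesis by (simp add: gam_def complex_eq_iff power2_eq_square)
qed

text \<open>Let \<open>C\<close> be the commutator. Then \<open>A\<^sup>-\<^sup>1 C\<close> is
  conjugate to \<open>A\<^sup>-\<^sup>1\<close>, \<open>C B\<close> is conjugate to
  \<open>B\<close>, and \<open>A B = C (B A)\<close> has the same real part as \<open>B A\<close>.
  These three equations of real parts give the shape of the two first entries and the condition on
  the second ones.\<close>

lemma sideA_sideB_exist_pos: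
  assumes A: "qunit A" and B: "qunit B" and r: "0 < r" "r \<le> 1"
    and AB: "qm A B = qm (- (cnj (gam r))\<^sup>2, 0) (qm B A)"
  obtains s where "qunit s" "sideA r s = A" "sideB r s = B"
proof -
  obtain a b c d where ab: "A = (a, b)" "B = (c, d)" by (cases A; cases B)
  have r0: "0 \<le> r" using r by simp
  define \<gamma> where "\<gamma> = gam r"
  have g: "\<gamma> * cnj \<gamma> = 1" "\<gamma> + cnj \<gamma> = 2 * of_real r"
    using gam_unit[OF r0 r(2)] by (simp_all add: \<gamma>_def) (simp add: gam_def complex_eq_iff)
  \<comment> \<open>Uses that \<open>x + (cnj \<gamma>)\<^sup>2 x\<close> is \<open>2 r\<close>
    times \<open>cnj \<gamma> x\<close>, hence \<open>r > 0\<close>.\<close>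
  have key: "Re (cnj \<gamma> * x) = 0" if "Re (- (cnj \<gamma>)\<^sup>2 * x) = Re x" for x
  proof -
    have "x + (cnj \<gamma>)\<^sup>2 * x = cnj \<gamma> * x * (\<gamma> + cnj \<gamma>)"
      using g(1) by algebra
    then have "Re (x + (cnj \<gamma>)\<^sup>2 * x) = 2 * r * Re (cnj \<gamma> * x)"
      unfolding g(2) by (simp add: mult.commute)
    moreover have "Re (x + (cnj \<gamma>)\<^sup>2 * x) = 0" using that by simp
    ultimately show ?thesis using r by simp
  qed
  have "qm (qi A) (- (cnj \<gamma>)\<^sup>2, 0) = qconj B (qi A)"
  proof -
    have "qconj B (qi A) = qm (qi A) (qm (qm A B) (qm (qi A) (qi B)))"
      using A by (simp add: qconj_def qm_assoc qm_cancel)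
    also have "\<dots> = qm (qi A) (qm (- (cnj \<gamma>)\<^sup>2, 0) (qm B (qm (qm A (qi A)) (qi B))))"
      unfolding AB \<gamma>_def by (simp add: qm_assoc)
    also have "\<dots> = qm (qi A) (- (cnj \<gamma>)\<^sup>2, 0)" using A B by (simp add: qm_qi)
    finally show ?thesis by simp
  qed
  then have "Re (fst (qm (qi A) (- (cnj \<gamma>)\<^sup>2, 0))) = Re (fst (qi A))"
    using qconj_Re[OF B] by simp
  then have "Re (- (cnj \<gamma>)\<^sup>2 * cnj a) = Re (cnj a)" by (simp add: ab qm_def qi_def mult.commute)
  from key[OF this] have a0: "Re (\<gamma> * a) = 0" by simp
  have "qconj A B = qm (- (cnj \<gamma>)\<^sup>2, 0) B"
  proof -
    have "qconj A B = qm (qm A B) (qi A)" by (simp add: qconj_def qm_assoc)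
    also have "\<dots> = qm (- (cnj \<gamma>)\<^sup>2, 0) (qm B (qm A (qi A)))" unfolding AB \<gamma>_def by (simp add: qm_assoc)
    finally show ?thesis using A by (simp add: qm_qi)
  qed
  then have "Re (fst (qm (- (cnj \<gamma>)\<^sup>2, 0) B)) = Re (fst B)"
    using qconj_Re[OF A, of B] by simp
  then have c0: "Re (cnj \<gamma> * c) = 0" by (intro key) (simp add: ab qm_def)
  define y where "y = fst (qm B A)"
  have "Re (fst (qm (- (cnj \<gamma>)\<^sup>2, 0) (qm B A))) = Re y"
    using qm_Re_commute[of A B] AB by (simp add: y_def \<gamma>_def)
  then have y0: "Re (cnj \<gamma> * y) = 0" by (intro key) (simp add: y_def qm_def)
  define k where "k = Im (\<gamma> * a)"
  define h where "h = Im (cnj \<gamma> * c)"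
  have "\<gamma> * a = \<i> * of_real k" "cnj \<gamma> * c = \<i> * of_real h"
    using a0 c0 by (simp_all add: k_def h_def complex_eq_iff)
  then have a: "a = \<i> * of_real k * cnj \<gamma>" and c: "c = \<i> * of_real h * \<gamma>"
    using g(1) by algebra+
  have n: "cmod \<gamma> = 1" using norm_gam[OF r0 r(2)] by (simp add: \<gamma>_def)
  define p where "p = cnj \<gamma> * d"
  have d: "d = \<gamma> * p" unfolding p_def using g(1) by algebra
  have P: "(cmod p)\<^sup>2 + h\<^sup>2 = 1"
    using B n by (simp add: ab qunit_def c p_def norm_mult add.commute)
  have R: "(cmod b)\<^sup>2 + k\<^sup>2 = 1"
    using A n by (simp add: ab qunit_def a norm_mult add.commute)
  have "Re (cnj p * b) = - r * h * k"
  proof -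
    have y: "y = - (of_real h * of_real k) - \<gamma> * p * cnj b"
    proof -
      have ii: "\<i> * \<i> = -1" by simp
      have "y = \<i> * of_real h * \<gamma> * (\<i> * of_real k * cnj \<gamma>) - \<gamma> * p * cnj b"
        by (simp add: y_def qm_def ab a c d)
      also have "\<i> * of_real h * \<gamma> * (\<i> * of_real k * cnj \<gamma>) = - (of_real h * of_real k)"
        using g(1) ii by algebra
      finally show ?thesis .
    qed
    have "cnj \<gamma> * y = - (of_real h * of_real k) * cnj \<gamma> - p * cnj b"
      unfolding y using g(1) by algebra
    then have "Re (- (of_real h * of_real k) * cnj \<gamma> - p * cnj b) = 0" using y0 by simp
    moreover have "Re (p * cnj b) = Re (cnj p * b)" by simp
    moreover have "Re (- (of_real h * of_real k) * cnj \<gamma>) = - r * h * k"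
      by (simp add: \<gamma>_def gam_def)
    ultimately show ?thesis by simp
  qed
  from side_exists[OF r0 r(2) P R this]
  obtain s where s: "qunit s" "pB r s = p" "pA r s = b" "hB r s = h" "hA r s = k" by metis
  then have "sideA r s = A" "sideB r s = B"
    by (simp_all add: sideA_def sideB_def ab a c d \<gamma>_def)
  then show thesis using that s(1) by blast
qed

lemma gam_0: "gam 0 = \<i>" and gam_1: "gam 1 = 1"
  by (simp_all add: gam_def complex_eq_iff)

lemma sides_0: "sideA 0 s = (of_real (hA 0 s), pA 0 s)" "sideB 0 s = (- of_real (hB 0 s), \<i> * pB 0 s)"
  by (simp_all add: sideA_def sideB_def gam_0 complex_eq_iff)

text \<open>At \<open>r = 0\<close> the commutator relation says only that the pair commutes; the
  normal form demands in addition that no i-component is present.\<close>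

lemma sideA_sideB_exist_0:
  assumes A: "qunit A" and B: "qunit B" and AB: "qm A B = qm B A"
    and re: "Im (fst A) = 0" "Im (fst B) = 0"
  obtains s where "qunit s" "sideA 0 s = A" "sideB 0 s = B"
proof -
  obtain a b c d where ab: "A = (a, b)" "B = (c, d)" by (cases A; cases B)
  have P: "(cmod (- \<i> * d))\<^sup>2 + (- Re c)\<^sup>2 = 1"
    using B re by (simp add: ab qunit_def norm_mult cmod_power2)
  have R: "(cmod b)\<^sup>2 + (Re a)\<^sup>2 = 1"
    using A re by (simp add: ab qunit_def cmod_power2)
  have "b * cnj d = d * cnj b"
    using AB by (simp add: ab qm_def mult.commute)
  then have "Re (cnj (- \<i> * d) * b) = - 0 * - Re c * Re a"
    by (simp add: complex_eq_iff mult.commute)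
  from side_exists[OF _ _ P R this]
  obtain s where s: "qunit s" "pB 0 s = - \<i> * d" "pA 0 s = b" "hB 0 s = - Re c" "hA 0 s = Re a"
    by (metis order_refl zero_le_one)
  then have "sideA 0 s = A" "sideB 0 s = B"
    using re by (simp_all add: sides_0 ab complex_eq_iff)
  then show thesis using that s(1) by blast
qed

definition qvec :: "quat \<Rightarrow> real \<times> complex" where
  "qvec x = (Im (fst x), snd x)"

text \<open>The commutator \<open>A B - B A\<close> is twice the cross product of the imaginary
  parts.\<close>

lemma commuting_collinear:
  assumes "qm A B = qm B A"
  shows "\<exists>w. qvec A \<in> span {w} \<and> qvec B \<in> span {w}"
proof -
  obtain a b c d where ab: "A = (a, b)" "B = (c, d)" by (cases A; cases B)
  have 1: "Im (b * cnj d) = 0"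
    using assms by (simp add: ab qm_def complex_eq_iff algebra_simps)
  have 2: "of_real (Im a) * d = of_real (Im c) * b"
  proof -
    have "(a - cnj a) * d = (c - cnj c) * b"
      using assms by (simp add: ab qm_def algebra_simps)
    moreover have "a - cnj a = 2 * \<i> * of_real (Im a)" "c - cnj c = 2 * \<i> * of_real (Im c)"
      by (simp_all add: complex_eq_iff)
    ultimately show ?thesis by simp
  qed
  consider "Im a = 0" "b = 0" | "Im a \<noteq> 0" | "Im a = 0" "b \<noteq> 0" by blast
  then show ?thesis
  proof cases
    case 1
    then show ?thesis
      by (intro exI[of _ "qvec B"]) (auto simp: qvec_def ab span_base zero_prod_def[symmetric] span_zero)
  next
    case 2
    have "d = (Im c / Im a) *\<^sub>R b"
      using \<open>of_real (Im a) * d = of_real (Im c) * b\<close> 2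
      by (simp add: scaleR_conv_of_real field_simps)
    then have "qvec B = (Im c / Im a) *\<^sub>R qvec A" using 2 by (simp add: qvec_def ab)
    then show ?thesis by (metis span_base span_mul singletonI)
  next
    case 3
    then have c0: "Im c = 0" using 2 by simp
    have "d * (b * cnj b) = of_real (Re (d * cnj b)) * b"
    proof -
      have "Im (d * cnj b) = 0" using 1 by (simp add: algebra_simps)
      then have "of_real (Re (d * cnj b)) = d * cnj b" by (simp add: complex_eq_iff)
      then show ?thesis by simp
    qed
    then have "d * of_real ((cmod b)\<^sup>2) = of_real (Re (d * cnj b)) * b"
      by (simp only: complex_norm_square)
    then have "d = (Re (d * cnj b) / (cmod b)\<^sup>2) *\<^sub>R b"
      using 3 by (simp add: scaleR_conv_of_real field_simps)
    then have "qvec B = (Re (d * cnj b) / (cmod b)\<^sup>2) *\<^sub>R qvec A" using 3 c0 by (simp add: qvec_def ab)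
    then show ?thesis by (metis span_base span_mul singletonI)
  qed
qed

text \<open>The imaginary parts of two commuting pairs span at most a plane in three-space. A unit
  normal of it is rotated to the i-axis, after which no i-components remain.\<close>

lemma common_axis:
  assumes "qm A1 B1 = qm B1 A1" "qm A2 B2 = qm B2 A2"
  obtains X where "qunit X" "\<And>P. P \<in> {A1, B1, A2, B2} \<Longrightarrow> Im (fst (qconj X P)) = 0"
proof -
  obtain w1 w2 where w: "qvec A1 \<in> span {w1}" "qvec B1 \<in> span {w1}" "qvec A2 \<in> span {w2}" "qvec B2 \<in> span {w2}"
    using commuting_collinear assms by metis
  have "dim {w1, w2} \<le> card {w1, w2}" by (rule dim_le_card') simp
  also have "\<dots> < DIM(real \<times> complex)" by (simp add: card_insert_if)
  finally obtain u where u: "u \<noteq> 0" "\<And>y. y \<in> span {w1, w2} \<Longrightarrow> orthogonal u y"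
    using orthogonal_to_subspace_exists by metis
  have perp: "u \<bullet> qvec P = 0" if "P \<in> {A1, B1, A2, B2}" for P
  proof -
    have "span {w1} \<subseteq> span {w1, w2}" "span {w2} \<subseteq> span {w1, w2}" by (intro span_mono; blast)+
    then have "qvec P \<in> span {w1, w2}" using w that by blast
    then show ?thesis using u(2) by (simp add: orthogonal_def)
  qed
  define v where "v = u /\<^sub>R norm u"
  obtain x y where xy: "v = (x, y)" by (cases v)
  have "norm v = 1" using u(1) by (simp add: v_def)
  then have n: "x\<^sup>2 + (cmod y)\<^sup>2 = 1" by (simp add: xy norm_Pair)
  define U where "U = (\<i> * of_real x, y)"
  have U: "qunit U" using n by (simp add: U_def qunit_def norm_mult)
  obtain X where X: "qunit X" "snd (qconj X U) = 0"
    using qconj_diagonalise[OF U] by metis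
  define m where "m = Im (fst (qconj X U))"
  have "Re (fst (qconj X U)) = 0" using qconj_Re[OF X(1)] by (simp add: U_def)
  then have m: "qconj X U = (\<i> * of_real m, 0)"
    using X(2) by (simp add: prod_eq_iff complex_eq_iff m_def)
  have m0: "m \<noteq> 0"
    using qunit_qconj[OF X(1) U] unfolding m by (auto simp: qunit_def)
  have "Im (fst (qconj X P)) = 0" if "P \<in> {A1, B1, A2, B2}" for P
  proof -
    have "v \<bullet> qvec P = 0" using perp[OF that] by (simp add: v_def)
    \<comment> \<open>For imaginary \<open>U\<close> this real part is minus the inner product of
      the imaginary parts, and it is invariant under conjugation.\<close>
    then have "Re (fst (qm U P)) = 0"
      by (simp add: xy U_def qvec_def qm_def inner_prod_def inner_complex_def)
    then have "Re (fst (qm (qconj X U) (qconj X P))) = 0"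
      using qconj_Re[OF X(1)] by (simp add: qconj_qm[OF X(1), symmetric])
    then show ?thesis using m0 by (simp add: m qm_def)
  qed
  then show thesis using that X(1) by blast
qed

text \<open>The pairs with equal commutators are \<open>(A1, B1)\<close> and
  \<open>(B2, A2)\<close>, so \<open>A2\<close> and \<open>B2\<close> exchange roles, and both pairs
  receive the same \<open>r\<close> and \<open>X\<close>.\<close>

lemma rep_normal_form:
  assumes u: "qunit A1" "qunit B1" "qunit A2" "qunit B2" and rel: "qcomm A1 B1 = qcomm B2 A2"
  obtains X r s t where "qunit X" "0 \<le> r" "r \<le> 1" "qunit s" "qunit t"
    "qconj X (sideA r s) = A1" "qconj X (sideB r s) = B1" "qconj X (sideA r t) = B2" "qconj X (sideB r t) = A2"
proof -
  define C where "C = qcomm A1 B1"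
  have C: "qunit C" using u by (simp add: C_def qunit_qcomm)
  obtain X where X: "qunit X" "snd (qconj X C) = 0" "Im (fst (qconj X C)) \<ge> 0"
    using qconj_diagonalise[OF C] by metis
  define c where "c = fst (qconj X C)"
  have XC: "qconj X C = (c, 0)" using X(2) by (simp add: c_def prod_eq_iff)
  have "(cmod c)\<^sup>2 = 1" using qunit_qconj[OF X(1) C] by (simp add: XC qunit_def)
  then have c1: "(Re c)\<^sup>2 + (Im c)\<^sup>2 = 1" by (simp add: cmod_power2)
  then have "(Re c)\<^sup>2 \<le> 1" using zero_le_power2[of "Im c"] by linarith
  then have cb: "\<bar>Re c\<bar> \<le> 1" by (simp add: abs_square_le_1)
  \<comment> \<open>Makes the real part \<open>1 - 2 r\<^sup>2\<close> of the commutator of the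
    normal form equal to \<open>Re c\<close>. The imaginary parts then agree as well, because
    \<open>Im c \<ge> 0\<close> was arranged.\<close>
  define r where "r = sqrt ((1 - Re c) / 2)"
  have r2: "r\<^sup>2 = (1 - Re c) / 2" using cb by (simp add: r_def abs_le_iff)
  have r: "0 \<le> r" "r \<le> 1" using cb by (auto simp: r_def abs_le_iff)
  have "- (cnj (gam r))\<^sup>2 = c"
  proof -
    have "(2 * r * sqrt (1 - r\<^sup>2))\<^sup>2 = (Im c)\<^sup>2"
    proof -
      have "(2 * r * sqrt (1 - r\<^sup>2))\<^sup>2 = 4 * r\<^sup>2 * (1 - r\<^sup>2)"
        using r by (simp add: power_mult_distrib abs_square_le_1)
      also have "\<dots> = 1 - (Re c)\<^sup>2" unfolding r2 by (simp add: field_simps power2_eq_square)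
      finally show ?thesis using c1 by simp
    qed
    moreover have "0 \<le> 2 * r * sqrt (1 - r\<^sup>2)" using r by (simp add: abs_square_le_1)
    moreover have "0 \<le> Im c" using X(3) by (simp only: c_def)
    ultimately have "2 * r * sqrt (1 - r\<^sup>2) = Im c" by (rule power2_eq_imp_eq)
    moreover have "1 - 2 * r\<^sup>2 = Re c" using r2 by argo
    ultimately have "Complex (1 - 2 * r\<^sup>2) (2 * r * sqrt (1 - r\<^sup>2)) = Complex (Re c) (Im c)"
      by (rule arg_cong2[rotated])
    then show ?thesis unfolding neg_gam_square[OF r] complex_surj .
  qed
  note g = this
  show thesis
  proof (cases "r = 0")
    case False
    have "qcomm (qconj X A1) (qconj X B1) = (c, 0)" "qcomm (qconj X B2) (qconj X A2) = (c, 0)"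
      using XC rel by (simp_all add: qconj_qcomm[OF X(1), symmetric] C_def)
    then have cm: "qm (qconj X A1) (qconj X B1) = qm (- (cnj (gam r))\<^sup>2, 0) (qm (qconj X B1) (qconj X A1))"
      "qm (qconj X B2) (qconj X A2) = qm (- (cnj (gam r))\<^sup>2, 0) (qm (qconj X A2) (qconj X B2))"
      using qcomm_eq_iff u X(1) qunit_qconj unfolding g by blast+
    have r0: "0 < r" using False r by simp
    obtain s where s: "qunit s" "sideA r s = qconj X A1" "sideB r s = qconj X B1"
      using sideA_sideB_exist_pos[OF _ _ r0 r(2) cm(1)] u X(1) qunit_qconj by metis
    obtain t where t: "qunit t" "sideA r t = qconj X B2" "sideB r t = qconj X A2"
      using sideA_sideB_exist_pos[OF _ _ r0 r(2) cm(2)] u X(1) qunit_qconj by metis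
    show thesis
      using that[of "qi X" r s t] X(1) r s t by (simp add: qconj_cancel)
  next
    \<comment> \<open>The commutator is trivial and singles out no axis, so \<open>X\<close> is
      discarded in favour of a quaternion adapted to the two commuting pairs.\<close>
    case True
    then have "c = 1" using g by (simp add: gam_0)
    then have "qconj (qi X) (1, 0) = C" using XC qconj_cancel(1)[OF X(1), of C] by simp
    moreover have "qconj (qi X) (1, 0) = (1, 0)" using X(1) by (simp add: qconj_def qm_qi)
    ultimately have C1: "C = (1, 0)" by simp
    have cm: "qm A1 B1 = qm B1 A1"
      using C1 unfolding C_def qcomm_eq_iff[OF u(1,2)] by simp
    have cm2: "qm B2 A2 = qm A2 B2"
      using C1 unfolding C_def rel qcomm_eq_iff[OF u(4,3)] by simp
    obtain Y where Y: "qunit Y" "\<And>P. P \<in> {A1, B1, A2, B2} \<Longrightarrow> Im (fst (qconj Y P)) = 0"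
      using common_axis[OF cm cm2[symmetric]] by metis
    have cm': "qm (qconj Y A1) (qconj Y B1) = qm (qconj Y B1) (qconj Y A1)"
      "qm (qconj Y B2) (qconj Y A2) = qm (qconj Y A2) (qconj Y B2)"
      unfolding qconj_qm[OF Y(1), symmetric] cm cm2 by (rule refl)+
    obtain s where s: "qunit s" "sideA 0 s = qconj Y A1" "sideB 0 s = qconj Y B1"
      using sideA_sideB_exist_0[OF _ _ cm'(1)] u Y qunit_qconj by (metis insertCI)
    obtain t where t: "qunit t" "sideA 0 t = qconj Y B2" "sideB 0 t = qconj Y A2"
      using sideA_sideB_exist_0[OF _ _ cm'(2)] u Y qunit_qconj by (metis insertCI)
    show thesis
      using that[of "qi Y" 0 s t] Y(1) s t by (simp add: qconj_cancel)
  qed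
qed

section \<open>From pairs of spinors to projective space\<close>

text \<open>Of weight four under phases. At \<open>r = 0\<close> and when nonzero, it has the phase
  of minus the square of the common direction of \<open>pA 0 s\<close> and
  \<open>\<i> * pB 0 s\<close>.\<close>

definition quart :: "quat \<Rightarrow> complex" where
  "quart s = hz1 s * hz2 s"

definition rel_quart :: "quat \<Rightarrow> quat \<Rightarrow> complex" where
  "rel_quart s t = cnj (quart s) * quart t"

text \<open>For fixed \<open>r\<close>, \<open>c\<^sup>2 * lam r (qscale c s) t\<close> traverses an ellipse as \<open>c\<close> traverses the unit circle. As \<open>r\<close>
  decreases from 1 to 0, these ellipses shrink from the unit circle to a segment of half-length
  \<open>cmod (rel_quart s t) / 2\<close>, filling the unit disc.\<close>

definition lam :: "real \<Rightarrow> quat \<Rightarrow> quat \<Rightarrow> complex" where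
  "lam r s t = of_real r + of_real ((1 - r) / 4) * (of_real (cmod (rel_quart s t)) + rel_quart s t)"

text \<open>As a matrix with two rows, \<open>zvec l s t\<close> is \<open>t s\<^sup>* + l t' s'\<^sup>*\<close> with unit vectors \<open>s'\<close>, \<open>t'\<close> orthogonal to \<open>s\<close> and
  \<open>t\<close>, that is, a singular value decomposition up to scaling and phases when \<open>cmod l \<le> 1\<close>.\<close>

definition zvec :: "complex \<Rightarrow> quat \<Rightarrow> quat \<Rightarrow> complex^4" where
  "zvec l s t = vector
     [fst t * cnj (fst s) + l * cnj (snd t) * snd s, fst t * cnj (snd s) - l * cnj (snd t) * fst s,
      snd t * cnj (fst s) - l * cnj (fst t) * snd s, snd t * cnj (snd s) + l * cnj (fst t) * fst s]"

lemma vector_4: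
  "(vector [w, x, y, z] :: ('a::zero)^4) $ 1 = w" "(vector [w, x, y, z] :: 'a^4) $ 2 = x"
  "(vector [w, x, y, z] :: 'a^4) $ 3 = y" "(vector [w, x, y, z] :: 'a^4) $ 4 = z"
  by (simp_all add: vector_def)

lemma zvec_eq_iff:
  "zvec l s t = c *s zvec l' s' t' \<longleftrightarrow> (\<forall>i \<in> {1, 2, 3, 4}. zvec l s t $ i = c * zvec l' s' t' $ i)"
  by (simp add: vec_eq_iff forall_4)

lemma norm_quart_le: "qunit s \<Longrightarrow> cmod (quart s) \<le> 1"
proof -
  assume s: "qunit s"
  note f = frame_relations[OF s]
  have "(cmod (hz1 s))\<^sup>2 \<le> 1\<^sup>2" "(cmod (hz2 s))\<^sup>2 \<le> 1\<^sup>2" by (simp_all add: f)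
  then have "cmod (hz1 s) \<le> 1" "cmod (hz2 s) \<le> 1" using power2_le_imp_le zero_le_one by blast+
  then show ?thesis by (simp add: quart_def norm_mult mult_le_one)
qed

lemma norm_rel_quart_le: "qunit s \<Longrightarrow> qunit t \<Longrightarrow> cmod (rel_quart s t) \<le> 1"
  by (simp add: rel_quart_def norm_mult mult_le_one norm_quart_le)

text \<open>The factor 1/4 in \<open>lam\<close> leaves enough room for the bound to stay below 1
  when \<open>r < 1\<close>, so the unit circle is reached at \<open>r = 1\<close> only.\<close>

lemma norm_lam_le:
  assumes "qunit s" "qunit t" "0 \<le> r" "r \<le> 1"
  shows "cmod (lam r s t) \<le> (1 + r) / 2"
proof -
  let ?Q = "rel_quart s t"
  have "cmod (of_real (cmod ?Q) + ?Q) \<le> cmod (of_real (cmod ?Q)) + cmod ?Q" by (rule norm_triangle_ineq)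
  also have "\<dots> \<le> 2" using norm_rel_quart_le[OF assms(1,2)] by simp
  finally have "cmod (of_real ((1 - r) / 4) * (of_real (cmod ?Q) + ?Q)) \<le> (1 - r) / 4 * 2"
    unfolding norm_mult norm_of_real using assms by (intro mult_mono) auto
  moreover have "cmod (lam r s t) \<le> cmod (of_real r) + cmod (of_real ((1 - r) / 4) * (of_real (cmod ?Q) + ?Q))"
    unfolding lam_def by (rule norm_triangle_ineq)
  ultimately show ?thesis using assms(3) by (simp add: field_simps)
qed

lemma quart_qscale: "cmod c = 1 \<Longrightarrow> quart (qscale c s) = c ^ 4 * quart s"
  by (simp add: quart_def frame_qscale eval_nat_numeral)

lemma unit_complex: "cmod c = 1 \<longleftrightarrow> c * cnj c = 1"
proof -
  have "c * cnj c = of_real ((cmod c)\<^sup>2)" by (simp only: complex_norm_square)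
  then have "c * cnj c = 1 \<longleftrightarrow> (cmod c)\<^sup>2 = 1" by (simp only: of_real_eq_1_iff)
  also have "\<dots> \<longleftrightarrow> cmod c = 1" using norm_ge_zero[of c] by (auto simp: power2_eq_1_iff simp del: norm_ge_zero)
  finally show ?thesis by blast
qed

lemma zvec_qscale:
  assumes "cmod a = 1" "cmod b = 1"
  shows "zvec l (qscale a s) (qscale b t) = (cnj a * b) *s zvec ((a * cnj b)\<^sup>2 * l) s t"
proof -
  have "a * cnj a = 1" "b * cnj b = 1" using assms unit_complex by blast+
  then have "b * (cnj a * (a * cnj b)\<^sup>2) = a * cnj b" by algebra
  then show ?thesis
    unfolding zvec_eq_iff
    by (simp add: zvec_def vector_4 qscale_def distrib_left right_diff_distrib mult_ac)
qed

text \<open>The determinant and the squared Hilbert-Schmidt norm of the matrix, whose singular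
  values are 1 and \<open>cmod l\<close>.\<close>

lemma zvec_invariants:
  fixes l s t defines "z \<equiv> zvec l s t"
  assumes "qunit s" "qunit t"
  shows "z $ 1 * z $ 4 - z $ 2 * z $ 3 = l"
    and "(cmod (z $ 1))\<^sup>2 + (cmod (z $ 2))\<^sup>2 + (cmod (z $ 3))\<^sup>2 + (cmod (z $ 4))\<^sup>2 = 1 + (cmod l)\<^sup>2"
    and "z \<noteq> 0"
proof -
  obtain a b c d where st: "s = (a, b)" "t = (c, d)" by (cases s; cases t)
  have u: "a * cnj a + b * cnj b = 1" "c * cnj c + d * cnj d = 1"
    using assms by (simp_all add: st qunit_iff)
  have "z $ 1 * z $ 4 - z $ 2 * z $ 3 = l * ((a * cnj a + b * cnj b) * (c * cnj c + d * cnj d))"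
    by (simp add: z_def zvec_def vector_4 st algebra_simps)
  then show "z $ 1 * z $ 4 - z $ 2 * z $ 3 = l" by (simp add: u)
  have "z $ 1 * cnj (z $ 1) + z $ 2 * cnj (z $ 2) + z $ 3 * cnj (z $ 3) + z $ 4 * cnj (z $ 4) =
      (1 + l * cnj l) * ((a * cnj a + b * cnj b) * (c * cnj c + d * cnj d))"
    by (simp add: z_def zvec_def vector_4 st algebra_simps)
  also have "\<dots> = 1 + l * cnj l" by (simp add: u)
  finally have "of_real ((cmod (z $ 1))\<^sup>2 + (cmod (z $ 2))\<^sup>2 + (cmod (z $ 3))\<^sup>2 + (cmod (z $ 4))\<^sup>2)
      = complex_of_real (1 + (cmod l)\<^sup>2)"
    by (simp only: of_real_add complex_norm_square of_real_1)
  then show n: "(cmod (z $ 1))\<^sup>2 + (cmod (z $ 2))\<^sup>2 + (cmod (z $ 3))\<^sup>2 + (cmod (z $ 4))\<^sup>2 = 1 + (cmod l)\<^sup>2"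
    by (simp only: of_real_eq_iff)
  show "z \<noteq> 0"
  proof
    assume "z = 0"
    then have "(0::real) = 1 + (cmod l)\<^sup>2" using n by simp
    then show False using zero_le_power2[of "cmod l"] by linarith
  qed
qed

text \<open>The matrix applied to \<open>(x, y)\<close>: the component along \<open>s\<close> goes
  to a multiple of \<open>t\<close>, the component orthogonal to \<open>s\<close> to a multiple of
  \<open>l\<close> times a vector orthogonal to \<open>t\<close>.\<close>

lemma zvec_apply:
  fixes l s t defines "z \<equiv> zvec l s t"
  assumes "qunit s"
  shows "z $ 1 * x + z $ 2 * y = (cnj (fst s) * x + cnj (snd s) * y) * fst t + l * (snd s * x - fst s * y) * cnj (snd t)"
    "z $ 3 * x + z $ 4 * y = (cnj (fst s) * x + cnj (snd s) * y) * snd t - l * (snd s * x - fst s * y) * cnj (fst t)"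
  by (simp_all add: z_def zvec_def vector_4 algebra_simps)

text \<open>A common point of two ellipses, one with both semi-axes strictly larger. Each coordinate
  of the unit vector belonging to the larger ellipse would be zero or strictly smaller in absolute
  value than its counterpart.\<close>

lemma ellipse_strict:
  fixes a a' b b' u v x y :: real
  assumes "a' * u = a * x" "b' * v = b * y" "u\<^sup>2 + v\<^sup>2 = 1" "x\<^sup>2 + y\<^sup>2 = 1" "0 \<le> a" "a < a'" "0 \<le> b" "b < b'"
  shows False
proof -
  have *: "p = 0 \<or> p\<^sup>2 < q\<^sup>2" if "c' * p = c * q" "0 \<le> c" "c < c'" for p q c c' :: real
  proof (rule disjCI)
    assume "\<not> p\<^sup>2 < q\<^sup>2"
    then have pq: "\<bar>q\<bar> \<le> \<bar>p\<bar>" using power_strict_mono[of "\<bar>p\<bar>" "\<bar>q\<bar>" 2] by (cases "\<bar>p\<bar> < \<bar>q\<bar>") auto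
    have "c' * \<bar>p\<bar> = c * \<bar>q\<bar>" using that by (metis abs_mult abs_of_nonneg less_eq_real_def order_le_less_trans)
    also have "\<dots> \<le> c * \<bar>p\<bar>" using pq that by (intro mult_left_mono) auto
    finally have "(c' - c) * \<bar>p\<bar> \<le> 0" by (simp add: algebra_simps)
    then show "p = 0" using that by (simp add: mult_le_0_iff)
  qed
  have "u\<^sup>2 = 0 \<or> u\<^sup>2 < x\<^sup>2" "v\<^sup>2 = 0 \<or> v\<^sup>2 < y\<^sup>2" using *[OF assms(1,5,6)] *[OF assms(2,7,8)] by auto
  then show False using assms(3,4) zero_le_power2[of x] zero_le_power2[of y] by (elim disjE; linarith)
qed

text \<open>After division by a square root \<open>w\<close> of the phase of \<open>Q\<close>, both
  sides are points of ellipses aligned with the coordinate axes, with semi-axes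
  \<open>r + 2 k (1 - r)\<close> and \<open>r\<close>. Nested ellipses do not meet, so
  \<open>r' = r\<close>. A point determines its parameter unless \<open>r = 0\<close>, where the
  segment is traversed twice and \<open>J\<close> may be the fold.\<close>

lemma ellipse_unique:
  assumes J: "cmod J = 1" and Q: "cmod Q \<le> 1" and r: "0 \<le> r" "r \<le> 1" "0 \<le> r'" "r' \<le> 1"
    and eq: "J * of_real r' + of_real ((1 - r') / 4) * (J * of_real (cmod Q) + cnj J * Q) =
      of_real r + of_real ((1 - r) / 4) * (of_real (cmod Q) + Q)"
  shows "r' = r" "J = 1 \<or> (r = 0 \<and> J * of_real (cmod Q) = Q)"
proof -
  define k where "k = cmod Q / 4"
  have k: "0 \<le> k" "k \<le> 1/4" using Q by (simp_all add: k_def)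
  obtain w where w: "cmod w = 1" "Q = of_real (4 * k) * w\<^sup>2"
  proof (cases "Q = 0")
    case True
    then show thesis using that[of 1] by (simp add: k_def)
  next
    case False
    define w where "w = csqrt (Q / of_real (cmod Q))"
    have w2: "w\<^sup>2 = Q / of_real (cmod Q)" by (simp add: w_def)
    have "(cmod w)\<^sup>2 = cmod (w\<^sup>2)" by (simp add: norm_power)
    also have "\<dots> = 1" unfolding w2 using False by (simp add: norm_divide)
    finally have "(cmod w)\<^sup>2 = 1\<^sup>2" by simp
    then have "cmod w = 1" by (rule power2_eq_imp_eq) simp_all
    moreover have "Q = of_real (4 * k) * w\<^sup>2" unfolding w2 using False by (simp add: k_def)
    ultimately show thesis by (rule that)
  qed
  have ww: "w * cnj w = 1" using w(1) unit_complex by blast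
  have Qk: "of_real (cmod Q) = of_real (4 * k)" by (simp add: k_def)
  define u where "u = J * cnj w"
  define v where "v = cnj w"
  have uw: "J = u * w" unfolding u_def using ww by algebra
  have e: "of_real r' * u + of_real ((1 - r') * k) * (u + cnj u) = of_real r * v + of_real ((1 - r) * k) * (v + cnj v)"
  proof -
    have "cnj w * (J * of_real r' + of_real ((1 - r') / 4) * (J * of_real (cmod Q) + cnj J * Q)) =
      of_real r' * u + of_real ((1 - r') * k) * (u + cnj u)"
      unfolding Qk unfolding w(2) u_def using ww by (simp add: power2_eq_square field_simps) algebra
    moreover have "cnj w * (of_real r + of_real ((1 - r) / 4) * (of_real (cmod Q) + Q)) =
      of_real r * v + of_real ((1 - r) * k) * (v + cnj v)"
      unfolding Qk unfolding w(2) v_def using ww by (simp add: power2_eq_square field_simps) algebra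
    ultimately show ?thesis unfolding eq by (simp only:)
  qed
  have re: "(r' + 2 * k * (1 - r')) * Re u = (r + 2 * k * (1 - r)) * Re v"
    using arg_cong[OF e, of Re] by (simp add: algebra_simps)
  have im: "r' * Im u = r * Im v" using arg_cong[OF e, of Im] by (simp add: algebra_simps)
  have "cmod u = 1" "cmod v = 1" using J w(1) by (simp_all add: u_def v_def norm_mult)
  then have n: "(Re u)\<^sup>2 + (Im u)\<^sup>2 = 1" "(Re v)\<^sup>2 + (Im v)\<^sup>2 = 1" by (simp_all add: cmod_power2[symmetric])
  \<comment> \<open>From \<open>k \<le> 1/4\<close> one has \<open>1 - 2 k > 0\<close>, so this
    semi-axis grows strictly with its parameter.\<close>
  have mono: "x + 2 * k * (1 - x) < y + 2 * k * (1 - y)" if "x < y" for x y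
  proof -
    have "0 < (1 - 2 * k) * (y - x)" using that k by simp
    then show ?thesis by (simp add: algebra_simps)
  qed
  have pos: "0 \<le> x + 2 * k * (1 - x)" if "0 \<le> x" "x \<le> 1" for x
    using that k by simp
  have "\<not> r < r'"
    using ellipse_strict[OF re im n pos[OF r(1,2)] mono r(1)] by blast
  moreover have "\<not> r' < r"
    using ellipse_strict[OF re[symmetric] im[symmetric] n(2,1) pos[OF r(3,4)] mono r(3)] by blast
  ultimately show rr: "r' = r" by simp
  show "J = 1 \<or> (r = 0 \<and> J * of_real (cmod Q) = Q)"
  proof (cases "r = 0")
    case False
    then have "r + 2 * k * (1 - r) > 0" using r k by (simp add: add_pos_nonneg)
    then have "Re u = Re v" "Im u = Im v" using re im False unfolding rr by auto
    then have "u = v" by (rule complex_eqI)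
    then have "J = 1" unfolding uw v_def using ww by (simp add: mult.commute)
    then show ?thesis ..
  next
    case True
    then have "k = 0 \<or> Re u = Re v" using re unfolding rr by auto
    then consider "k = 0" | "u = v" | "u = cnj v"
    proof
      assume "Re u = Re v"
      then have "(Im u)\<^sup>2 = (Im v)\<^sup>2" using n by simp
      then have "Im u = Im v \<or> Im u = - Im v" by (simp only: power2_eq_iff)
      then show thesis using that(2,3) \<open>Re u = Re v\<close> by (auto simp: complex_eq_iff)
    qed
    then show ?thesis
    proof cases
      case 1
      then show ?thesis using True by (simp add: k_def)
    next
      case 2
      then have "J = 1" unfolding uw v_def using ww by (simp add: mult.commute)
      then show ?thesis ..
    next
      case 3
      then have "J = w\<^sup>2" unfolding uw v_def by (simp add: power2_eq_square)
      then have "J * of_real (cmod Q) = Q" unfolding Qk by (subst w(2)) (simp add: mult.commute)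
      then show ?thesis using True by blast
    qed
  qed
qed

text \<open>At \<open>r = 0\<close> the two weighted vectors have the same modulus, so their sum and
  difference are the perpendicular diagonals of a rhombus. Hence \<open>pA 0 s\<close> and
  \<open>\<i> * pB 0 s\<close> lie on one line; the equations express that its direction squares to
  minus the phase of \<open>quart s\<close>.\<close>

lemma side_0_axis:
  assumes s: "qunit s"
  shows "quart s * cnj (pA 0 s) = - of_real (cmod (quart s)) * pA 0 s"
    "quart s * cnj (\<i> * pB 0 s) = - of_real (cmod (quart s)) * (\<i> * pB 0 s)"
    "quart s = 0 \<longleftrightarrow> pA 0 s = 0 \<and> pB 0 s = 0"
proof -
  let ?d = "tilt 0 s"
  define m where "m = len1 0 s * cmod (hz1 s)"
  note f = frame_relations[OF s] and l = len_squares[OF s order_refl zero_le_one]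
  have "(len1 0 s * cmod (hz1 s))\<^sup>2 = (len2 0 s * cmod (hz2 s))\<^sup>2"
  proof -
    have "2 * ?d = (1 + ?d) * (ht1 s)\<^sup>2 - (1 - ?d) * (ht2 s)\<^sup>2"
      using tilt_equation[OF s, of 0] by simp
    moreover have "(1 + d) / 2 * (1 - x) = (1 - d) / 2 * (1 - y)" if "2 * d = (1 + d) * x - (1 - d) * y" for d x y :: real
      using that by argo
    ultimately show ?thesis unfolding power_mult_distrib l(1,2) f(1,2) by blast
  qed
  then have "len1 0 s * cmod (hz1 s) = len2 0 s * cmod (hz2 s)"
    by (rule power2_eq_imp_eq) (intro mult_nonneg_nonneg l norm_ge_zero)+
  then have m2: "len2 0 s * cmod (hz2 s) = m" unfolding m_def by (rule sym)
  have z: "hz1 s * cnj (hz1 s) = of_real (cmod (hz1 s)) * of_real (cmod (hz1 s))"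
    "hz2 s * cnj (hz2 s) = of_real (cmod (hz2 s)) * of_real (cmod (hz2 s))"
    by (simp_all add: complex_norm_square[symmetric] power2_eq_square)
  have mm: "of_real (len1 0 s) * of_real (cmod (hz1 s)) = complex_of_real m"
    "of_real (len2 0 s) * of_real (cmod (hz2 s)) = complex_of_real m"
    by (simp_all only: of_real_mult[symmetric] m2 m_def[symmetric])
  show "quart s * cnj (pA 0 s) = - of_real (cmod (quart s)) * pA 0 s"
    unfolding quart_def pA_def norm_mult of_real_mult complex_cnj_diff complex_cnj_mult complex_cnj_complex_of_real
    using z mm by algebra
  show "quart s * cnj (\<i> * pB 0 s) = - of_real (cmod (quart s)) * (\<i> * pB 0 s)"
    unfolding quart_def pB_def norm_mult of_real_mult complex_cnj_add complex_cnj_mult complex_cnj_complex_of_real complex_cnj_i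
    using z mm by algebra
  have ab: "pA 0 s + pB 0 s = 2 * (of_real (len1 0 s) * hz1 s)" "pB 0 s - pA 0 s = 2 * (of_real (len2 0 s) * hz2 s)"
    by (simp_all add: pA_def pB_def)
  have l12: "len1 0 s \<noteq> 0 \<or> len2 0 s \<noteq> 0" using l(1,2) by auto
  show "quart s = 0 \<longleftrightarrow> pA 0 s = 0 \<and> pB 0 s = 0"
  proof
    assume "quart s = 0"
    then have "m = 0" unfolding m_def quart_def using m2 m_def by auto
    then have "of_real (len1 0 s) * hz1 s = 0" "of_real (len2 0 s) * hz2 s = 0"
      using m2 m_def by auto
    then show "pA 0 s = 0 \<and> pB 0 s = 0" unfolding pA_def pB_def by (metis add_0_left diff_zero)
  next
    assume "pA 0 s = 0 \<and> pB 0 s = 0"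
    then have "of_real (len1 0 s) * hz1 s = 0" "of_real (len2 0 s) * hz2 s = 0"
      using ab by auto
    then show "quart s = 0" using l12 by (auto simp: quart_def)
  qed
qed

section \<open>Fibres of the map to projective space compared with conjugacy\<close>

definition side_conj :: "quat \<Rightarrow> real \<Rightarrow> quat \<Rightarrow> real \<Rightarrow> quat \<Rightarrow> bool" where
  "side_conj X r s r' s' \<longleftrightarrow> sideA r' s' = qconj X (sideA r s) \<and> sideB r' s' = qconj X (sideB r s)"

definition zpoint :: "real \<Rightarrow> quat \<Rightarrow> quat \<Rightarrow> complex^4" where
  "zpoint r s t = zvec (lam r s t) s t"

lemma side_conj_qscale: "cmod c = 1 \<Longrightarrow> side_conj (c, 0) r s r (qscale c s)"
  by (simp add: side_conj_def side_qscale)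

lemma qconj_diag_sign: "c = 1 \<or> c = - 1 \<Longrightarrow> qconj (c * d, 0) x = qconj (d, 0) x"
  by (auto simp: qconj_def qm_def qi_def)

lemma lam_1: "lam 1 s t = 1"
  by (simp add: lam_def)

text \<open>At \<open>r = 1\<close> the tilt vanishes and the commutator is -1: every pair is the
  conjugate by its spinor of one fixed anticommuting pair, so conjugation acts on the spinor by left
  multiplication.\<close>

lemma sides_1:
  assumes "qunit s"
  shows "sideA 1 s = qconj s (0, of_real (sqrt (1/2)) * (1 - \<i>))"
    "sideB 1 s = qconj s (0, of_real (sqrt (1/2)) * (1 + \<i>))"
proof -
  have l: "len1 1 s = sqrt (1/2)" "len2 1 s = sqrt (1/2)" by (simp_all add: len1_def len2_def tilt_def)
  obtain a b where s: "s = (a, b)" by (cases s)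
  show "sideA 1 s = qconj s (0, of_real (sqrt (1/2)) * (1 - \<i>))"
    unfolding sideA_def gam_1 hA_def pA_def l
    by (simp add: s qconj_def qm_def qi_def ht1_def ht2_def hz1_def hz2_def complex_eq_iff power2_eq_square algebra_simps)
  show "sideB 1 s = qconj s (0, of_real (sqrt (1/2)) * (1 + \<i>))"
    unfolding sideB_def gam_1 hB_def pB_def l
    by (simp add: s qconj_def qm_def qi_def ht1_def ht2_def hz1_def hz2_def complex_eq_iff power2_eq_square algebra_simps)
qed

lemma side_conj_1:
  assumes "qunit X" "qunit s"
  shows "side_conj X 1 s 1 (qm X s)"
  using assms by (simp add: side_conj_def sides_1 qunit_qm qconj_qconj)

lemma sides_qscale_sign:
  assumes "c = 1 \<or> c = - 1"
  shows "sideA r (qscale c s) = sideA r s" "sideB r (qscale c s) = sideB r s"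
proof -
  have "qconj (c, 0) x = x" for x
    using qconj_diag_sign[OF assms, of 1 x] by (simp add: qconj_def qi_def)
  then show "sideA r (qscale c s) = sideA r s" "sideB r (qscale c s) = sideB r s"
    using assms side_qscale(8,9)[of c r s] by auto
qed

text \<open>For \<open>l = 1\<close> the matrix depends on \<open>qm (qi t) s\<close> only, which a
  common left factor of \<open>s\<close> and \<open>t\<close> does not change.\<close>

lemma zvec_1:
  "zvec 1 s t $ 1 = cnj (fst (qm (qi t) s))" "zvec 1 s t $ 2 = cnj (snd (qm (qi t) s))"
  "zvec 1 s t $ 3 = - snd (qm (qi t) s)" "zvec 1 s t $ 4 = fst (qm (qi t) s)"
  by (simp_all add: zvec_def vector_4 qm_def qi_def)

lemma zvec_1_eq_iff:
  assumes "c = 1 \<or> c = - 1"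
  shows "zvec 1 s' t' = c *s zvec 1 s t \<longleftrightarrow> qm (qi t') s' = qscale c (qm (qi t) s)"
proof -
  have cc: "cnj c = c" using assms by auto
  have "cnj x = c * cnj y \<longleftrightarrow> x = c * y" for x y
  proof -
    have "cnj x = c * cnj y \<longleftrightarrow> cnj x = cnj (c * y)" by (simp add: cc)
    then show ?thesis by (simp only: complex_cnj_cancel_iff)
  qed
  moreover have "- x = c * - y \<longleftrightarrow> x = c * y" for x y :: complex by simp
  ultimately show ?thesis
    unfolding zvec_eq_iff zvec_1 qscale_def prod_eq_iff by (simp only: ball_simps) (auto simp: zvec_1)
qed

lemma qm_qscale_sign:
  assumes "c = 1 \<or> c = - 1"
  shows "qm x (qscale c y) = qscale c (qm x y)" "qi (qscale c y) = qscale c (qi y)"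
  using assms by (auto simp: qm_def qi_def qscale_def algebra_simps)

lemma rel_quart_qscale:
  assumes "cmod a = 1" "cmod b = 1"
  shows "rel_quart (qscale a s) (qscale b t) = (cnj a * b) ^ 4 * rel_quart s t"
  using assms by (simp add: rel_quart_def quart_qscale power_mult_distrib)

text \<open>Conjugation by \<open>(0, x)\<close> keeps a real first entry and reflects the second
  one in a line. The second entries of a commuting pair are collinear, and on a single line a
  reflection acts like a rotation, here multiplication by \<open>y\<^sup>2\<close>.\<close>

lemma side_0_flip:
  assumes s: "qunit s" and q: "quart s \<noteq> 0" and x: "cmod x = 1" and y: "cmod y = 1"
    and xy: "x\<^sup>2 * of_real (cmod (quart s)) = - quart s * y\<^sup>2"
  shows "side_conj (0, x) 0 s 0 (qscale y s)"
proof -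
  have conj: "qconj (0, x) (of_real h, b) = (of_real h, x\<^sup>2 * cnj b)" for h b
  proof -
    have "x * cnj x = 1" using x unit_complex by blast
    then show ?thesis by (simp add: qconj_def qm_def qi_def power2_eq_square algebra_simps)
  qed
  have *: "y\<^sup>2 * b = x\<^sup>2 * cnj b" if b: "quart s * cnj b = - of_real (cmod (quart s)) * b" for b
  proof -
    have "of_real (cmod (quart s)) * (y\<^sup>2 * b) = of_real (cmod (quart s)) * (x\<^sup>2 * cnj b)"
      using b xy by algebra
    then show ?thesis using q by simp
  qed
  have "\<i> * (y\<^sup>2 * pB 0 s) = y\<^sup>2 * (\<i> * pB 0 s)" by simp
  then show ?thesis
    unfolding side_conj_def sides_0 side_qscale[OF y] of_real_minus[symmetric] conj
    using *[OF side_0_axis(1)[OF s]] *[OF side_0_axis(2)[OF s]] by (simp add: qconj_diag[OF y])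
qed

lemma side_0_degenerate:
  assumes "qunit s" "quart s = 0" "cmod x = 1" "cmod y = 1"
  shows "side_conj (x, 0) 0 s 0 (qscale y s)"
  using side_0_axis(3)[OF assms(1)] assms
  by (simp add: side_conj_def sides_0 side_qscale qconj_diag)

text \<open>Determinant and norm force \<open>cmod c = 1\<close>. If \<open>cmod l < 1\<close>, the
  singular directions are unique, so \<open>s'\<close> and \<open>t'\<close> are \<open>s\<close>
  and \<open>t\<close> up to phases, and \<open>ellipse_unique\<close> reduces the relative phase to
  a sign or, at \<open>r = 0\<close>, to the fold, which a half-turn realises. If
  \<open>cmod l = 1\<close>, then \<open>r = 1\<close> and a common left factor remains.\<close>

lemma zpoint_fibre:
  assumes u: "qunit s" "qunit t" "qunit s'" "qunit t'" and r: "0 \<le> r" "r \<le> 1" "0 \<le> r'" "r' \<le> 1"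
    and z: "zpoint r' s' t' = c *s zpoint r s t"
  obtains X where "qunit X" "side_conj X r s r' s'" "side_conj X r t r' t'"
proof -
  define l where "l = lam r s t"
  define l' where "l' = lam r' s' t'"
  have zz: "zvec l' s' t' $ i = c * zvec l s t $ i" for i using z by (simp add: zpoint_def l_def l'_def)
  note inv = zvec_invariants[OF u(1,2), of l] and inv' = zvec_invariants[OF u(3,4), of l']
  have det: "l' = c\<^sup>2 * l"
  proof -
    have "c * p * (c * q) - c * v * (c * w) = c\<^sup>2 * (p * q - v * w)" for p q v w
      by (simp add: power2_eq_square algebra_simps)
    note gen = this
    show ?thesis using inv'(1) unfolding zz gen inv(1) by (rule sym)
  qed
  define L where "L = cmod l"
  define L' where "L' = cmod l'"
  define C where "C = (cmod c)\<^sup>2"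
  have LL: "L' = C * L" unfolding L_def L'_def C_def det by (simp add: norm_mult norm_power)
  have nn: "1 + L'\<^sup>2 = C * (1 + L\<^sup>2)"
    using inv'(2) unfolding zz norm_mult power_mult_distrib distrib_left[symmetric] inv(2) L_def L'_def C_def
    by (rule sym)
  have Lr: "L \<le> (1 + r) / 2" "L' \<le> (1 + r') / 2"
    unfolding L_def L'_def l_def l'_def using norm_lam_le u r by blast+
  then have L1: "0 \<le> L" "L \<le> 1" "0 \<le> L'" "L' \<le> 1" using r by (simp_all add: L_def L'_def)
  \<comment> \<open>Otherwise the two invariants give \<open>L' * L = 1\<close>; as neither number
    exceeds 1, \<open>L = L' = 1\<close>, and then \<open>C = 1\<close> after all.\<close>
  have "C = 1"
  proof (rule ccontr)
    assume "C \<noteq> 1"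
    have "(C - 1) * (C * L\<^sup>2 - 1) = 0" using nn unfolding LL by algebra
    then have "L' * L = 1" using \<open>C \<noteq> 1\<close> unfolding LL by (simp add: power2_eq_square)
    moreover have "L' * L \<le> 1 * L" using L1 by (intro mult_right_mono) auto
    ultimately have "L = 1" using L1 by linarith
    then show False using \<open>L' * L = 1\<close> LL \<open>C \<noteq> 1\<close> by simp
  qed
  then have c: "cmod c = 1" using norm_ge_zero[of c] unfolding C_def by (metis abs_norm_cancel power2_eq_1_iff abs_1 abs_minus)
  have cc: "c * cnj c = 1" using c unit_complex by blast
  show thesis
  proof (cases "L = 1")
    case True
    then have r1: "r = 1" "r' = 1" using Lr r LL \<open>C = 1\<close> by simp_all
    have ll: "l = 1" "l' = 1" by (simp_all add: l_def l'_def lam_1 r1)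
    have c1: "c = 1 \<or> c = - 1" using det unfolding ll by (metis mult.right_neutral power2_eq_1_iff)
    have w: "qm (qi t') s' = qscale c (qm (qi t) s)"
      using z unfolding zpoint_def l_def[symmetric] l'_def[symmetric] ll zvec_1_eq_iff[OF c1] .
    define X where "X = qm s' (qi s)"
    have X: "qunit X" using u by (simp add: X_def qunit_qm)
    have "qm X s = s'" using u(1) by (simp add: X_def qm_assoc qm_qi)
    then have "side_conj X r s r' s'" unfolding r1 using side_conj_1[OF X u(1)] by simp
    moreover have t': "t' = qscale c (qm X t)"
    proof -
      have "t' = qm s' (qi (qm (qi t') s'))" using u(3) by (simp add: qi_qm qm_cancel)
      also have "\<dots> = qscale c (qm X t)"
        unfolding w qm_qscale_sign[OF c1] by (simp add: qi_qm X_def qm_assoc)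
      finally show ?thesis .
    qed
    have "side_conj X r t r' t'"
      unfolding side_conj_def r1 unfolding t' sides_qscale_sign[OF c1]
      using side_conj_1[OF X u(2)] by (simp add: side_conj_def)
    ultimately show thesis using that X by blast
  next
    case False
    then have "L < 1" using L1 by simp
    obtain a b d e where st: "s = (a, b)" "t = (d, e)" by (cases s; cases t)
    obtain a' b' d' e' where st': "s' = (a', b')" "t' = (d', e')" by (cases s'; cases t')
    \<comment> \<open>The components of \<open>s'\<close> along \<open>s\<close> and along the unit
      vector orthogonal to it.\<close>
    define i where "i = cnj a * a' + cnj b * b'"
    define x where "x = b * a' - a * b'"
    have us: "a * cnj a + b * cnj b = 1" "d * cnj d + e * cnj e = 1" "a' * cnj a' + b' * cnj b' = 1" "d' * cnj d' + e' * cnj e' = 1"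
      using u by (simp_all add: st st' qunit_iff)
    have de: "d' = c * (i * d + l * x * cnj e)" "e' = c * (i * e - l * x * cnj d)"
    proof -
      have "d' = zvec l' s' t' $ 1 * a' + zvec l' s' t' $ 2 * b'" "e' = zvec l' s' t' $ 3 * a' + zvec l' s' t' $ 4 * b'"
        unfolding zvec_apply[OF u(3)] using us(3) by (simp_all add: st' mult.commute)
      then have "d' = c * (zvec l s t $ 1 * a' + zvec l s t $ 2 * b')" "e' = c * (zvec l s t $ 3 * a' + zvec l s t $ 4 * b')"
        unfolding zz by (simp_all add: algebra_simps)
      then show "d' = c * (i * d + l * x * cnj e)" "e' = c * (i * e - l * x * cnj d)"
        unfolding zvec_apply[OF u(1)] by (simp_all add: st i_def x_def)
    qed
    have ix: "i * cnj i + x * cnj x = 1" unfolding i_def x_def using us by simp algebra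
    \<comment> \<open>The unit length of \<open>t'\<close>, which is \<open>c\<close> times the
      image of \<open>s'\<close> under the matrix. Compared with the unit length of
      \<open>s'\<close>, it excludes a component \<open>x\<close> when
      \<open>cmod l < 1\<close>.\<close>
    have "i * cnj i + (l * cnj l) * (x * cnj x) = 1" using us(4,2) cc unfolding de by simp algebra
    then have "(1 - l * cnj l) * (x * cnj x) = 0" using ix by algebra
    moreover have "l * cnj l \<noteq> 1" using \<open>L < 1\<close> unit_complex[of l] by (simp add: L_def)
    ultimately have x0: "x = 0" by auto
    then have i1: "cmod i = 1" using ix unit_complex by simp
    have "a' = i * a + cnj b * x" "b' = i * b - cnj a * x" unfolding i_def x_def using us(1) by algebra+
    then have s': "s' = qscale i s" by (simp add: st st' qscale_def x0)
    have t': "t' = qscale (c * i) t" using de by (simp add: st st' qscale_def x0)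
    have ci: "cmod (c * i) = 1" using c i1 by (simp add: norm_mult)
    define Q where "Q = rel_quart s t"
    define J where "J = (cnj c)\<^sup>2"
    have J: "cmod J = 1" using c by (simp add: J_def norm_power)
    have ii: "i * cnj i = 1" using i1 unit_complex by blast
    have Q': "rel_quart s' t' = c ^ 4 * Q"
    proof -
      have "cnj i * (c * i) = c" using ii by algebra
      then show ?thesis unfolding s' t' rel_quart_qscale[OF i1 ci] Q_def by (simp only:)
    qed
    have "J * l' = l" unfolding det J_def using cc by algebra
    moreover have "J * l' = J * of_real r' + of_real ((1 - r') / 4) * (J * of_real (cmod Q) + cnj J * Q)"
    proof -
      have "J * c ^ 4 = cnj J" unfolding J_def using cc by simp algebra
      then have *: "J * (of_real m + c ^ 4 * Q) = J * of_real m + cnj J * Q" for m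
        by (simp add: distrib_left mult.assoc[symmetric])
      have "cmod (c ^ 4 * Q) = cmod Q" using c by (simp add: norm_mult norm_power)
      then show ?thesis unfolding l'_def lam_def Q' *[symmetric] by (simp add: algebra_simps)
    qed
    ultimately have "J * of_real r' + of_real ((1 - r') / 4) * (J * of_real (cmod Q) + cnj J * Q) =
        of_real r + of_real ((1 - r) / 4) * (of_real (cmod Q) + Q)"
      unfolding l_def lam_def Q_def by simp
    note el = ellipse_unique[OF J norm_rel_quart_le[OF u(1,2), folded Q_def] r this]
    have rr: "r' = r" by (rule el(1))
    have sc: "side_conj (i, 0) r s r' s'" unfolding rr s' by (rule side_conj_qscale[OF i1])
    have tc: "side_conj (c * i, 0) r t r' t'" unfolding rr t' by (rule side_conj_qscale[OF ci])
    have qi: "qunit (i, 0)" "qunit (c * i, 0)" using i1 ci by (simp_all add: qunit_def)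
    show thesis
    proof (cases "J = 1")
      case True
      then have "(cnj c - 1) * (cnj c + 1) = 0" unfolding J_def by algebra
      then have "cnj c = 1 \<or> cnj c = - 1" by (auto simp: add_eq_0_iff2)
      then have "c = 1 \<or> c = - 1" by (metis complex_cnj_cnj complex_cnj_minus complex_cnj_one)
      then have "side_conj (i, 0) r t r' t'" using tc unfolding side_conj_def by (simp only: qconj_diag_sign)
      then show thesis using that qi sc by blast
    next
      case False
      then have r0: "r = 0" and JQ: "J * of_real (cmod Q) = Q" using el(2) by auto
      have s0: "s' = qscale i s" "t' = qscale (c * i) t" "r' = 0" using s' t' rr r0 by simp_all
      consider "quart s = 0" | "quart t = 0" | "quart s \<noteq> 0" "quart t \<noteq> 0" by blast
      then show thesis
      proof cases
        case 1
        have "side_conj (c * i, 0) r s r' s'" unfolding r0 s0 by (rule side_0_degenerate[OF u(1) 1 ci i1])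
        then show thesis using that qi tc by blast
      next
        case 2
        have "side_conj (i, 0) r t r' t'" unfolding r0 s0 by (rule side_0_degenerate[OF u(2) 2 i1 ci])
        then show thesis using that qi sc by blast
      next
        case 3
        let ?S = "complex_of_real (cmod (quart s))" and ?T = "complex_of_real (cmod (quart t))"
        have nz: "?S \<noteq> 0" "?T \<noteq> 0" using 3 by simp_all
        have sS: "quart s * cnj (quart s) = ?S * ?S" "quart t * cnj (quart t) = ?T * ?T"
          by (simp_all add: complex_norm_square[symmetric] power2_eq_square)
        \<comment> \<open>Makes the half-turn \<open>(0, y)\<close> produce the phase
          \<open>i\<close> on \<open>s\<close>. The equation \<open>JQ\<close> is precisely what
          makes it produce the phase \<open>c * i\<close> on \<open>t\<close> too.\<close>
        define y where "y = i * csqrt (- quart s / ?S)"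
        have y2: "y\<^sup>2 = i\<^sup>2 * (- quart s / ?S)" by (simp add: y_def power_mult_distrib)
        have "(cmod y)\<^sup>2 = cmod (y\<^sup>2)" by (simp add: norm_power)
        also have "\<dots> = 1\<^sup>2" unfolding y2 using i1 3 by (simp add: norm_mult norm_power norm_divide)
        finally have y1: "cmod y = 1" by (rule power2_eq_imp_eq) simp_all
        have ys: "y\<^sup>2 * ?S = - quart s * i\<^sup>2" unfolding y2 using nz by simp
        have "J * (?S * ?T) = cnj (quart s) * quart t"
          using JQ unfolding Q_def rel_quart_def by (simp add: norm_mult)
        then have "cnj (J * (?S * ?T)) = cnj (cnj (quart s) * quart t)" by (rule arg_cong)
        then have "c\<^sup>2 * (?S * ?T) = quart s * cnj (quart t)" by (simp add: J_def)
        then have "(?S * ?T) * (y\<^sup>2 * ?T) = (?S * ?T) * (- quart t * (c * i)\<^sup>2)"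
          using ys sS(2) by algebra
        moreover have "?S * ?T \<noteq> 0" using nz by simp
        ultimately have yt: "y\<^sup>2 * ?T = - quart t * (c * i)\<^sup>2" using mult_left_cancel by blast
        have "qunit (0, y)" using y1 by (simp add: qunit_def)
        then show thesis
          using that side_0_flip[OF u(1) 3(1) y1 i1 ys] side_0_flip[OF u(2) 3(2) y1 ci yt] unfolding r0 s0 by blast
      qed
    qed
  qed
qed

text \<open>Simultaneous conjugation preserves the real parts of quaternions and of their products.
  At \<open>r = 0\<close> these amount to the heights and to the inner products of the second
  entries.\<close>

lemma fst_sides_invariant:
  assumes "qunit X" "side_conj X 0 s 0 s'" "side_conj X 0 t 0 t'"
  shows "hA 0 s' = hA 0 s" "hB 0 s' = hB 0 s"
    "Re (pA 0 s' * cnj (pA 0 t')) = Re (pA 0 s * cnj (pA 0 t))"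
    "Re (pA 0 s' * cnj (\<i> * pB 0 t')) = Re (pA 0 s * cnj (\<i> * pB 0 t))"
    "Re (\<i> * pB 0 s' * cnj (pA 0 t')) = Re (\<i> * pB 0 s * cnj (pA 0 t))"
    "Re (\<i> * pB 0 s' * cnj (\<i> * pB 0 t')) = Re (\<i> * pB 0 s * cnj (\<i> * pB 0 t))"
proof -
  have inv: "Re (fst (qm (qconj X P) (qconj X Q))) = Re (fst (qm P Q))" for P Q
    unfolding qconj_qm[OF assms(1), symmetric] by (rule qconj_Re[OF assms(1)])
  note sc = assms(2,3)[unfolded side_conj_def]
  have hs: "Re (fst (sideA 0 s')) = Re (fst (sideA 0 s))" "Re (fst (sideB 0 s')) = Re (fst (sideB 0 s))"
    "Re (fst (sideA 0 t')) = Re (fst (sideA 0 t))" "Re (fst (sideB 0 t')) = Re (fst (sideB 0 t))"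
    using sc qconj_Re[OF assms(1)] by simp_all
  then have h: "hA 0 s' = hA 0 s" "hB 0 s' = hB 0 s" "hA 0 t' = hA 0 t" "hB 0 t' = hB 0 t"
    by (simp_all add: sides_0)
  then show "hA 0 s' = hA 0 s" "hB 0 s' = hB 0 s" by blast+
  have "Re (fst (qm (sideA 0 s') (sideA 0 t'))) = Re (fst (qm (sideA 0 s) (sideA 0 t)))"
    "Re (fst (qm (sideA 0 s') (sideB 0 t'))) = Re (fst (qm (sideA 0 s) (sideB 0 t)))"
    "Re (fst (qm (sideB 0 s') (sideA 0 t'))) = Re (fst (qm (sideB 0 s) (sideA 0 t)))"
    "Re (fst (qm (sideB 0 s') (sideB 0 t'))) = Re (fst (qm (sideB 0 s) (sideB 0 t)))"
    using sc inv by simp_all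
  then show "Re (pA 0 s' * cnj (pA 0 t')) = Re (pA 0 s * cnj (pA 0 t))"
    "Re (pA 0 s' * cnj (\<i> * pB 0 t')) = Re (pA 0 s * cnj (\<i> * pB 0 t))"
    "Re (\<i> * pB 0 s' * cnj (pA 0 t')) = Re (\<i> * pB 0 s * cnj (pA 0 t))"
    "Re (\<i> * pB 0 s' * cnj (\<i> * pB 0 t')) = Re (\<i> * pB 0 s * cnj (\<i> * pB 0 t))"
    by (simp_all add: sides_0 qm_def h)
qed

text \<open>The invariants give the tilt, hence both lengths and all three heights, and the heights
  determine the spinor up to a phase. If one length vanishes, the tilt is 1 or -1 and two of the
  heights are zero.\<close>

lemma side_conj_0_phase:
  assumes s: "qunit s" and s': "qunit s'" and X: "qunit X" "side_conj X 0 s 0 s'"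
  obtains c where "cmod c = 1" "s' = qscale c s"
proof -
  note inv = fst_sides_invariant[OF X(1) X(2) X(2)]
  note sr = side_relations[OF s order_refl zero_le_one] and sr' = side_relations[OF s' order_refl zero_le_one]
  note l = len_squares[OF s order_refl zero_le_one]
  note f = frame_relations(5)[OF s] and f' = frame_relations(5)[OF s']
  have tl: "tilt 0 s' = tilt 0 s" unfolding sr(5) sr'(5) inv(1,2) ..
  then have ll: "len1 0 s' = len1 0 s" "len2 0 s' = len2 0 s" by (simp_all add: len1_def len2_def)
  have "len1 0 s * ht1 s' + len2 0 s * ht2 s' = len1 0 s * ht1 s + len2 0 s * ht2 s"
    "len1 0 s * ht1 s' - len2 0 s * ht2 s' = len1 0 s * ht1 s - len2 0 s * ht2 s"
    using inv(1,2) unfolding hA_def hB_def ll by blast+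
  then have lh: "len1 0 s * ht1 s' = len1 0 s * ht1 s" "len2 0 s * ht2 s' = len2 0 s * ht2 s" by linarith+
  have "Im (cnj (pB 0 s') * pA 0 s') = Im (cnj (pB 0 s) * pA 0 s)"
    using inv(4) by (simp add: algebra_simps)
  then have lh3: "len1 0 s * len2 0 s * ht3 s' = len1 0 s * len2 0 s * ht3 s"
    unfolding sr(4) sr'(4) ll by simp
  have "ht1 s = ht1 s' \<and> ht2 s = ht2 s' \<and> ht3 s = ht3 s'"
  proof (cases "len1 0 s = 0 \<or> len2 0 s = 0")
    case False
    then show ?thesis using lh lh3 by simp
  next
    case True
    then have t1: "tilt 0 s = - 1 \<or> tilt 0 s = 1" using l(1,2) by auto
    have te: "2 * tilt 0 x = (1 + tilt 0 x) * (ht1 x)\<^sup>2 - (1 - tilt 0 x) * (ht2 x)\<^sup>2" if "qunit x" for x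
      using tilt_equation[OF that order_refl zero_le_one] by simp
    note te = te[OF s] te[OF s', unfolded tl]
    from t1 show ?thesis
    proof
      assume d: "tilt 0 s = - 1"
      then have "(ht2 s)\<^sup>2 = 1" "(ht2 s')\<^sup>2 = 1" using te by simp_all
      then have "(ht1 s)\<^sup>2 + (ht3 s)\<^sup>2 = 0" "(ht1 s')\<^sup>2 + (ht3 s')\<^sup>2 = 0" using f f' by linarith+
      then have "ht1 s = 0 \<and> ht3 s = 0" "ht1 s' = 0 \<and> ht3 s' = 0" by (simp_all only: sum_power2_eq_zero_iff)
      moreover have "len2 0 s \<noteq> 0" using l(2) d by auto
      ultimately show ?thesis using lh(2) by simp
    next
      assume d: "tilt 0 s = 1"
      then have "(ht1 s)\<^sup>2 = 1" "(ht1 s')\<^sup>2 = 1" using te by simp_all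
      then have "(ht2 s)\<^sup>2 + (ht3 s)\<^sup>2 = 0" "(ht2 s')\<^sup>2 + (ht3 s')\<^sup>2 = 0" using f f' by linarith+
      then have "ht2 s = 0 \<and> ht3 s = 0" "ht2 s' = 0 \<and> ht3 s' = 0" by (simp_all only: sum_power2_eq_zero_iff)
      moreover have "len1 0 s \<noteq> 0" using l(1) d by auto
      ultimately show ?thesis using lh(1) by simp
    qed
  qed
  then show thesis using spinor_phase[OF s s'] that by metis
qed

text \<open>The real part of the commutator determines \<open>r\<close>. For \<open>r = 1\<close>
  any \<open>X\<close> acts by left multiplication; for \<open>0 < r < 1\<close> it commutes with a
  non-real diagonal commutator and is diagonal; for \<open>r = 0\<close> its effect is controlled
  through the invariants.\<close>

lemma zpoint_conj_invariant:
  assumes u: "qunit s" "qunit t" "qunit s'" "qunit t'" and r: "0 \<le> r" "r \<le> 1" "0 \<le> r'" "r' \<le> 1"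
    and X: "qunit X" and s: "side_conj X r s r' s'" and t: "side_conj X r t r' t'"
  shows "\<exists>c. zpoint r' s' t' = c *s zpoint r s t"
proof -
  have cm: "(- (cnj (gam r'))\<^sup>2, 0) = qconj X (- (cnj (gam r))\<^sup>2, 0)"
    using s qcomm_sides[OF u(1) r(1,2)] qcomm_sides[OF u(3) r(3,4)]
    unfolding side_conj_def by (metis X qconj_qcomm)
  then have "Re (- (cnj (gam r'))\<^sup>2) = Re (- (cnj (gam r))\<^sup>2)"
    using qconj_Re[OF X] by (metis fst_conv)
  then have "r'\<^sup>2 = r\<^sup>2" unfolding neg_gam_square[OF r(1,2)] neg_gam_square[OF r(3,4)] by simp
  then have rr: "r' = r" by (rule power2_eq_imp_eq[OF _ r(3) r(1)])
  note s = s[unfolded rr] and t = t[unfolded rr]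
  consider "r = 1" | "0 < r" "r < 1" | "r = 0" using r by linarith
  then show ?thesis
  proof cases
    case 1
    have *: "\<exists>e. (e = 1 \<or> e = - 1) \<and> y' = qscale e (qm X y)"
      if "qunit y" "qunit y'" "side_conj X 1 y 1 y'" for y y'
      using side_unique[of "qm X y" y' 1] side_conj_1[OF X that(1)] that qunit_qm[OF X that(1)]
      by (simp add: side_conj_def)
    obtain a where a: "a = 1 \<or> a = - 1" "s' = qscale a (qm X s)" using * u s unfolding 1 by metis
    obtain b where b: "b = 1 \<or> b = - 1" "t' = qscale b (qm X t)" using * u t unfolding 1 by metis
    have ab: "a * b = 1 \<or> a * b = - 1" using a(1) b(1) by auto
    have "qm (qi t') s' = qscale (a * b) (qm (qi (qm X t)) (qm X s))"
      unfolding a(2) b(2) using a(1) b(1) by (auto simp: qscale_def qm_def qi_def algebra_simps)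
    also have "qm (qi (qm X t)) (qm X s) = qm (qi t) s"
      using X by (simp add: qi_qm qm_assoc qm_cancel)
    finally show ?thesis
      unfolding zpoint_def rr 1 lam_1 using zvec_1_eq_iff[OF ab] by blast
  next
    case 2
    let ?c = "- (cnj (gam r))\<^sup>2"
    obtain x y where xy: "X = (x, y)" by (cases X)
    have "0 < 2 * r * sqrt (1 - r\<^sup>2)" using 2 by (simp add: abs_square_less_1)
    then have im: "Im ?c \<noteq> 0" unfolding neg_gam_square[OF r(1,2)] complex.sel by linarith
    have "qm X (?c, 0) = qm (qconj X (?c, 0)) X"
      using X by (simp add: qconj_def qm_assoc qm_qi)
    then have "qm X (?c, 0) = qm (?c, 0) X" using cm unfolding rr by simp
    then have "y * (cnj ?c - ?c) = 0" unfolding xy qm_def by (simp add: algebra_simps) (erule disj_forward, assumption, erule sym)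
    moreover have "cnj ?c - ?c \<noteq> 0"
    proof
      assume "cnj ?c - ?c = 0"
      then have "cnj ?c = ?c" by (simp only: right_minus_eq)
      then have "Im (cnj ?c) = Im ?c" by (rule arg_cong)
      then show False using im unfolding cnj.sel by linarith
    qed
    ultimately have y0: "y = 0" by simp
    then have x1: "cmod x = 1" using X by (simp add: xy qunit_def power2_eq_1_iff) (smt (verit) norm_ge_zero)
    have *: "\<exists>e. (e = 1 \<or> e = - 1) \<and> w' = qscale (e * x) w"
      if "qunit w" "qunit w'" "side_conj X r w r w'" for w w'
    proof -
      have "side_conj X r w r (qscale x w)" using side_conj_qscale[OF x1] by (simp add: xy y0)
      then have "\<exists>e. (e = 1 \<or> e = - 1) \<and> w' = qscale e (qscale x w)"
        using side_unique[of "qscale x w" w' r] that 2 x1 by (simp add: side_conj_def qunit_qscale)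
      then show ?thesis by (auto simp: qscale_def mult.assoc)
    qed
    obtain a where a: "a = 1 \<or> a = - 1" "s' = qscale (a * x) s" using * u s by metis
    obtain b where b: "b = 1 \<or> b = - 1" "t' = qscale (b * x) t" using * u t by metis
    have n: "cmod (a * x) = 1" "cmod (b * x) = 1" using a b x1 by (auto simp: norm_mult)
    have xx: "x * cnj x = 1" using x1 unit_complex by blast
    have "cnj (a * x) * (b * x) = a * b"
      using a(1) b(1) xx by (auto simp: mult.commute)
    then have "(cnj (a * x) * (b * x)) ^ 4 = 1" using a(1) b(1) by auto
    then have "rel_quart s' t' = rel_quart s t" unfolding a(2) b(2) rel_quart_qscale[OF n] by simp
    then have l: "lam r s' t' = lam r s t" by (simp add: lam_def)
    have "a * x * cnj (b * x) = a * b" using a(1) b(1) xx by (auto simp: mult.commute)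
    then have "(a * x * cnj (b * x))\<^sup>2 = 1" using a(1) b(1) by auto
    then have "zvec (lam r s t) s' t' = (cnj (a * x) * (b * x)) *s zvec (lam r s t) s t"
      unfolding a(2) b(2) zvec_qscale[OF n] by simp
    then show ?thesis unfolding zpoint_def rr l by blast
  next
    case 3
    note s = s[unfolded 3] and t = t[unfolded 3]
    obtain x where x: "cmod x = 1" "s' = qscale x s" using side_conj_0_phase[OF u(1,3) X s] by metis
    obtain z where z: "cmod z = 1" "t' = qscale z t" using side_conj_0_phase[OF u(2,4) X t] by metis
    have xz: "x * cnj x = 1" "z * cnj z = 1" using x z unit_complex by blast+
    define Q where "Q = rel_quart s t"
    define w where "w = cnj x * z"
    have ww: "w * cnj w = 1" unfolding w_def using xz by simp algebra
    have w1: "cmod w = 1" using ww unit_complex by blast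
    \<comment> \<open>The relative phase \<open>w\<close> is so constrained because one inner
      product between the lines of the two commuting pairs is preserved.\<close>
    have "(cnj w)\<^sup>2 * (of_real (cmod Q) + w ^ 4 * Q) = of_real (cmod Q) + Q"
    proof (cases "Q = 0")
      case False
      then have q: "quart s \<noteq> 0" "quart t \<noteq> 0" by (auto simp: Q_def rel_quart_def)
      note inv = fst_sides_invariant[OF X s t] and ax = side_0_axis[OF u(1)] and ay = side_0_axis[OF u(2)]
      note qs = side_qscale(6,7)[OF x(1), of 0 s, folded x(2)] and qt = side_qscale(6,7)[OF z(1), of 0 t, folded z(2)]
      \<comment> \<open>Either of \<open>pA 0 s\<close> and \<open>\<i> * pB 0 s\<close> can
        represent the line if it is nonzero, and \<open>quart s \<noteq> 0\<close> ensures that one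
        of them is.\<close>
      obtain a a' where a: "a \<noteq> 0" "quart s * cnj a = - of_real (cmod (quart s)) * a" "a' = x\<^sup>2 * a"
        "(a, a') = (pA 0 s, pA 0 s') \<or> (a, a') = (\<i> * pB 0 s, \<i> * pB 0 s')"
      proof (cases "pA 0 s = 0")
        case False then show thesis using that[of "pA 0 s" "pA 0 s'"] ax(1) qs(1) by blast
      next
        case True then show thesis using that[of "\<i> * pB 0 s" "\<i> * pB 0 s'"] ax(2,3) q(1) qs(2) by simp
      qed
      obtain b b' where b: "b \<noteq> 0" "quart t * cnj b = - of_real (cmod (quart t)) * b" "b' = z\<^sup>2 * b"
        "(b, b') = (pA 0 t, pA 0 t') \<or> (b, b') = (\<i> * pB 0 t, \<i> * pB 0 t')"
      proof (cases "pA 0 t = 0")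
        case False then show thesis using that[of "pA 0 t" "pA 0 t'"] ay(1) qt(1) by blast
      next
        case True then show thesis using that[of "\<i> * pB 0 t" "\<i> * pB 0 t'"] ay(2,3) q(2) qt(2) by simp
      qed
      have "Re (a' * cnj b') = Re (a * cnj b)"
        using a(4) b(4) inv(3-6) unfolding prod.inject by (elim disjE conjE) (simp_all only:)
      then have R: "a' * cnj b' + cnj a' * b' = a * cnj b + cnj a * b"
        by (simp add: complex_eq_iff)
      define y where "y = cnj a * b"
      have y0: "y \<noteq> 0" using a b by (simp add: y_def)
      have yw: "cnj a' * b' = w\<^sup>2 * y" "a' * cnj b' = (cnj w)\<^sup>2 * cnj y"
        unfolding a b w_def y_def by (simp_all add: power_mult_distrib)
      have R': "(cnj w)\<^sup>2 * cnj y + w\<^sup>2 * y = cnj y + y"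
        using R unfolding yw by (simp add: y_def)
      have qy: "Q * cnj y = of_real (cmod Q) * y"
      proof -
        have "cnj (quart s * cnj a) = cnj (- of_real (cmod (quart s)) * a)" using a(2) by simp
        then have "cnj (quart s) * a = - of_real (cmod (quart s)) * cnj a" by simp
        then show ?thesis using b(2) unfolding Q_def rel_quart_def y_def norm_mult by simp algebra
      qed
      have "cnj y * ((cnj w)\<^sup>2 * (of_real (cmod Q) + w ^ 4 * Q)) = cnj y * (of_real (cmod Q) + Q)"
        using qy R' ww by algebra
      then show ?thesis using y0 by simp
    qed simp
    then have e: "(cnj w)\<^sup>2 * lam 0 s' t' = lam 0 s t"
    proof -
      assume *: "(cnj w)\<^sup>2 * (of_real (cmod Q) + w ^ 4 * Q) = of_real (cmod Q) + Q"
      have "rel_quart s' t' = w ^ 4 * Q" unfolding x(2) z(2) rel_quart_qscale[OF x(1) z(1)] w_def Q_def ..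
      moreover have "cmod (w ^ 4 * Q) = cmod Q" using w1 by (simp add: norm_mult norm_power)
      ultimately show ?thesis
        unfolding lam_def using * by (simp add: Q_def[symmetric])
    qed
    have "(x * cnj z)\<^sup>2 * lam 0 s' t' = lam 0 s t" using e by (simp add: w_def)
    note e = this
    have "zvec (lam 0 s' t') s' t' = zvec (lam 0 s' t') (qscale x s) (qscale z t)"
      by (simp only: x(2)[symmetric] z(2)[symmetric])
    also have "\<dots> = w *s zvec (lam 0 s t) s t"
      unfolding zvec_qscale[OF x(1) z(1)] e w_def ..
    finally have "zvec (lam 0 s' t') s' t' = w *s zvec (lam 0 s t) s t" .
    then show ?thesis unfolding zpoint_def rr 3 by blast
  qed
qed

section \<open>Surjectivity: the ellipses fill the disc, and every matrix is reached\<close>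

lemma ellipse_exists:
  fixes k X Y :: real
  assumes k: "0 \<le> k" "k \<le> 1/4" and XY: "X\<^sup>2 + Y\<^sup>2 \<le> 1"
  obtains r p q where "0 \<le> r" "r \<le> 1" "p\<^sup>2 + q\<^sup>2 = 1" "(r + 2 * k * (1 - r)) * p = X" "r * q = Y"
proof -
  have "X\<^sup>2 \<le> 1" using XY zero_le_power2[of Y] by linarith
  then have X1: "\<bar>X\<bar> \<le> 1" by (simp only: abs_square_le_1)
  \<comment> \<open>Concentric circles; the degenerate segment, with \<open>r = 0\<close>; the rest
    of its line, where \<open>r\<close> solves a linear equation; and the generic points.\<close>
  consider "k = 0" | "k > 0" "Y = 0" "\<bar>X\<bar> \<le> 2 * k" | "Y = 0" "\<bar>X\<bar> > 2 * k" | "k > 0" "Y \<noteq> 0"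
    using k by linarith
  then show thesis
  proof cases
    case 1
    define r where "r = sqrt (X\<^sup>2 + Y\<^sup>2)"
    have r: "0 \<le> r" "r \<le> 1" "r\<^sup>2 = X\<^sup>2 + Y\<^sup>2" using XY by (simp_all add: r_def)
    show thesis
    proof (cases "r = 0")
      case True
      then have "X = 0" "Y = 0" using r(3) by (simp_all add: sum_power2_eq_zero_iff)
      then show thesis using that[of 0 1 0] 1 by simp
    next
      case False
      have "(X / r)\<^sup>2 + (Y / r)\<^sup>2 = 1"
        unfolding power_divide add_divide_distrib[symmetric] r(3)[symmetric] using False by simp
      then show thesis using that[of r "X / r" "Y / r"] r 1 False by simp
    qed
  next
    case 2
    have "\<bar>X / (2 * k)\<bar> \<le> 1" using 2 by (simp add: abs_divide field_simps)
    then have "(X / (2 * k))\<^sup>2 \<le> 1" by (simp only: abs_square_le_1)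
    then show thesis using that[of 0 "X / (2 * k)" "sqrt (1 - (X / (2 * k))\<^sup>2)"] 2 by simp
  next
    case 3
    define r where "r = (\<bar>X\<bar> - 2 * k) / (1 - 2 * k)"
    have "0 \<le> r" "r \<le> 1" using 3 X1 k by (simp_all add: r_def field_simps)
    moreover have "r + 2 * k * (1 - r) = r * (1 - 2 * k) + 2 * k" by (simp add: algebra_simps)
    moreover have "r * (1 - 2 * k) = \<bar>X\<bar> - 2 * k" unfolding r_def using k by simp
    moreover have "X \<noteq> 0" using 3 k by auto
    ultimately show thesis using that[of r "sgn X" 0] 3 by (simp add: abs_mult_sgn sgn_if)
  next
    case 4
    define a where "a r = r + 2 * k * (1 - r)" for r
    \<comment> \<open>The equation of the ellipse through \<open>(X, Y)\<close>, cleared of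
      denominators. It changes sign between 0 and 1, and \<open>Y \<noteq> 0\<close> keeps the root
      away from 0.\<close>
    define g where "g r = r\<^sup>2 * (a r)\<^sup>2 - X\<^sup>2 * r\<^sup>2 - Y\<^sup>2 * (a r)\<^sup>2" for r
    have "g 0 \<le> 0" "0 \<le> g 1" using XY by (simp_all add: g_def a_def)
    moreover have "continuous_on {0..1} g" unfolding g_def a_def by (intro continuous_intros)
    ultimately obtain r where r: "0 \<le> r" "r \<le> 1" "g r = 0"
      using IVT'[of g 0 0 1] by auto
    have "g 0 \<noteq> 0" using 4 by (simp add: g_def a_def)
    then have r0: "r > 0" using r by (cases "r = 0") auto
    then have a0: "a r > 0" using r k by (simp add: a_def add_pos_nonneg)
    have "(X / a r)\<^sup>2 + (Y / r)\<^sup>2 = (X\<^sup>2 * r\<^sup>2 + Y\<^sup>2 * (a r)\<^sup>2) / (r\<^sup>2 * (a r)\<^sup>2)"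
      using r0 a0 by (simp add: power_divide field_simps)
    also have "\<dots> = 1" using r(3) r0 a0 by (simp add: g_def)
    finally show thesis using that[of r "X / a r" "Y / r"] r r0 a0 by (simp add: a_def)
  qed
qed

lemma perp_spinor:
  assumes "d * cnj d + e * cnj e = 1" "cnj d * x + cnj e * y = 0"
  shows "x = (e * x - d * y) * cnj e" "y = - (e * x - d * y) * cnj d"
  using assms by algebra+

text \<open>A singular value decomposition: the unit eigenvectors of the Hermitian matrix \<open>Z\<^sup>* Z\<close> are found by
  diagonalising its traceless part as a quaternion.\<close>

lemma zvec_exists:
  assumes "z \<noteq> 0"
  obtains s t l c where "qunit s" "qunit t" "cmod l \<le> 1" "z = c *s zvec l s t"
proof -
  obtain z1 z2 z3 z4 where z: "z $ 1 = z1" "z $ 2 = z2" "z $ 3 = z3" "z $ 4 = z4" by blast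
  define p where "p = (cmod z1)\<^sup>2 + (cmod z3)\<^sup>2"
  define r where "r = (cmod z2)\<^sup>2 + (cmod z4)\<^sup>2"
  define q where "q = cnj z1 * z2 + cnj z3 * z4"
  have pr: "of_real p = z1 * cnj z1 + z3 * cnj z3" "of_real r = z2 * cnj z2 + z4 * cnj z4"
    by (simp_all only: p_def r_def of_real_add complex_norm_square)
  \<comment> \<open>The imaginary quaternion given by \<open>\<i>\<close> times the traceless part
    of \<open>Z\<^sup>* Z\<close>, whose diagonal entries are \<open>p\<close> and \<open>r\<close>
    and whose upper right entry is \<open>q\<close>.\<close>
  define D where "D = (\<i> * of_real ((p - r) / 2), \<i> * q)"
  have "\<exists>X. qunit X \<and> snd (qconj X D) = 0 \<and> Im (fst (qconj X D)) \<ge> 0"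
  proof (cases "D = (0, 0)")
    case True
    then show ?thesis by (intro exI[of _ "(1, 0)"]) (simp add: qconj_def qm_def)
  next
    case False
    define N where "N = sqrt ((cmod (fst D))\<^sup>2 + (cmod (snd D))\<^sup>2)"
    have N2: "N\<^sup>2 = (cmod (fst D))\<^sup>2 + (cmod (snd D))\<^sup>2" by (simp add: N_def)
    have N0: "N > 0"
      using False unfolding N_def by (cases D) (auto simp: add_nonneg_pos add_pos_nonneg)
    have qs: "qconj X (qscale (of_real u) Y) = qscale (of_real u) (qconj X Y)" for X Y u
      by (simp add: qconj_def qm_def qi_def qscale_def algebra_simps)
    have "qunit (qscale (of_real (1 / N)) D)"
    proof -
      have "(cmod (fst D))\<^sup>2 / N\<^sup>2 + (cmod (snd D))\<^sup>2 / N\<^sup>2 = 1"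
        unfolding add_divide_distrib[symmetric] N2[symmetric] using N0 by simp
      then show ?thesis using N0 by (simp add: qunit_def qscale_def norm_divide power_divide)
    qed
    then obtain X where X: "qunit X" "snd (qconj X (qscale (of_real (1 / N)) D)) = 0"
      "Im (fst (qconj X (qscale (of_real (1 / N)) D))) \<ge> 0" using qconj_diagonalise by blast
    then show ?thesis using N0 unfolding qs by (intro exI[of _ X]) (auto simp: qscale_def zero_le_divide_iff)
  qed
  then obtain X where X: "qunit X" "snd (qconj X D) = 0" "Im (fst (qconj X D)) \<ge> 0" by blast
  obtain x y where xy: "X = (x, y)" by (cases X)
  have u: "x * cnj x + y * cnj y = 1" using X(1) by (simp add: xy qunit_iff)
  have Dq: "fst D = \<i> * ((of_real p - of_real r) / 2)" by (simp add: D_def)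
  \<comment> \<open>The images under \<open>Z\<close> of the orthonormal basis
    \<open>(cnj x, cnj y)\<close>, \<open>(- y, x)\<close>, the conjugated rows of \<open>X\<close>.
    The vanishing off-diagonal entry makes them orthogonal, and the sign of the diagonal entry makes
    the first image at least as long as the second.\<close>
  define f1 f2 g1 g2 where "f1 = z1 * cnj x + z2 * cnj y" and "f2 = z3 * cnj x + z4 * cnj y"
    and "g1 = - z1 * y + z2 * x" and "g2 = - z3 * y + z4 * x"
  note fg = f1_def f2_def g1_def g2_def
  have perp: "cnj f1 * g1 + cnj f2 * g2 = 0"
  proof -
    have "snd (qconj X D) = \<i> * (cnj f1 * g1 + cnj f2 * g2)"
    proof -
      have "snd (qconj X D) = - (x * fst D * y) + y * cnj (snd D) * y + x * snd D * x + y * cnj (fst D) * x"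
        by (simp add: xy qconj_def qm_def qi_def algebra_simps)
      also have "\<dots> = \<i> * (x * x * q - y * y * cnj q - x * y * (of_real p - of_real r))"
        by (simp add: D_def field_simps)
      also have "x * x * q - y * y * cnj q - x * y * (of_real p - of_real r) = cnj f1 * g1 + cnj f2 * g2"
        unfolding pr by (simp add: q_def fg algebra_simps)
      finally show ?thesis .
    qed
    then show ?thesis using X(2) by simp
  qed
  have "of_real ((cmod f1)\<^sup>2 + (cmod f2)\<^sup>2 - ((cmod g1)\<^sup>2 + (cmod g2)\<^sup>2)) = - 2 * \<i> * fst (qconj X D)"
  proof -
    have "fst (qconj X D) = x * fst D * cnj x + y * cnj (fst D) * cnj y + x * snd D * cnj y - y * cnj (snd D) * cnj x"
      by (simp add: xy qconj_def qm_def qi_def algebra_simps)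
    also have "\<dots> = \<i> * ((x * cnj x - y * cnj y) * ((of_real p - of_real r) / 2) + x * cnj y * q + y * cnj x * cnj q)"
      by (simp add: D_def field_simps)
    finally have F: "fst (qconj X D) = \<i> * ((x * cnj x - y * cnj y) * ((of_real p - of_real r) / 2) + x * cnj y * q + y * cnj x * cnj q)" .
    have "- 2 * \<i> * fst (qconj X D) = (x * cnj x - y * cnj y) * (of_real p - of_real r) + 2 * (x * cnj y * q + y * cnj x * cnj q)"
    proof -
      have "- 2 * \<i> * (\<i> * (m * (e / 2) + n + k)) = m * e + 2 * (n + k)" for m e n k :: complex
      proof -
        have "- 2 * \<i> * (\<i> * (m * (e / 2) + n + k)) = 2 * (m * (e / 2) + n + k)" by (simp add: algebra_simps)
        then show ?thesis by (simp add: algebra_simps)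
      qed
      then show ?thesis unfolding F .
    qed
    also have "\<dots> = f1 * cnj f1 + f2 * cnj f2 - (g1 * cnj g1 + g2 * cnj g2)"
      unfolding pr by (simp add: q_def fg algebra_simps)
    finally show ?thesis by (simp only: of_real_add of_real_diff complex_norm_square)
  qed
  then have "Re (of_real ((cmod f1)\<^sup>2 + (cmod f2)\<^sup>2 - ((cmod g1)\<^sup>2 + (cmod g2)\<^sup>2))) = 2 * Im (fst (qconj X D))"
    by (simp only:) simp
  then have fg_le: "(cmod g1)\<^sup>2 + (cmod g2)\<^sup>2 \<le> (cmod f1)\<^sup>2 + (cmod f2)\<^sup>2" using X(3) by simp
  have zz: "z1 = f1 * x - g1 * cnj y" "z2 = f1 * y + g1 * cnj x" "z3 = f2 * x - g2 * cnj y" "z4 = f2 * y + g2 * cnj x"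
    unfolding fg using u by algebra+
  define F where "F = sqrt ((cmod f1)\<^sup>2 + (cmod f2)\<^sup>2)"
  have F2: "F\<^sup>2 = (cmod f1)\<^sup>2 + (cmod f2)\<^sup>2" by (simp add: F_def)
  have F0: "F > 0"
  proof (rule ccontr)
    assume "\<not> F > 0"
    moreover have "0 \<le> F" by (simp add: F_def)
    ultimately have "F = 0" by linarith
    then have 0: "(cmod f1)\<^sup>2 + (cmod f2)\<^sup>2 = 0" using F2 by simp
    then have "(cmod g1)\<^sup>2 + (cmod g2)\<^sup>2 = 0"
      using fg_le zero_le_power2[of "cmod g1"] zero_le_power2[of "cmod g2"] by linarith
    then have "f1 = 0" "f2 = 0" "g1 = 0" "g2 = 0" using 0 by (simp_all add: sum_power2_eq_zero_iff)
    then have "z = 0" using zz z by (simp add: vec_eq_iff forall_4)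
    then show False using assms by simp
  qed
  define d where "d = f1 / of_real F"
  define e where "e = f2 / of_real F"
  have f: "f1 = of_real F * d" "f2 = of_real F * e" using F0 by (simp_all add: d_def e_def)
  have "qunit (d, e)" unfolding qunit_def d_def e_def fst_conv snd_conv norm_divide power_divide
      add_divide_distrib[symmetric] F2[symmetric] using F0 by simp
  then have de: "d * cnj d + e * cnj e = 1" by (simp add: qunit_iff)
  have "of_real F * (cnj d * g1 + cnj e * g2) = 0" using perp unfolding f by (simp add: algebra_simps)
  then have "cnj d * g1 + cnj e * g2 = 0" using F0 by simp
  note g = perp_spinor[OF de this]
  \<comment> \<open>The second image is orthogonal to \<open>(d, e)\<close>, hence \<open>m\<close>
    times \<open>(cnj e, - cnj d)\<close>.\<close>
  define m where "m = e * g1 - d * g2"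
  have g': "g1 = m * cnj e" "g2 = - m * cnj d" using g by (simp_all add: m_def)
  define l where "l = - m / of_real F"
  have lm: "of_real F * l = - m" using F0 by (simp add: l_def)
  have "(cmod m)\<^sup>2 = (cmod m)\<^sup>2 * ((cmod e)\<^sup>2 + (cmod d)\<^sup>2)"
    using \<open>qunit (d, e)\<close> by (simp add: qunit_def add.commute)
  also have "\<dots> = (cmod g1)\<^sup>2 + (cmod g2)\<^sup>2" unfolding g' by (simp add: norm_mult power_mult_distrib algebra_simps)
  also have "\<dots> \<le> F\<^sup>2" using fg_le F2 by simp
  finally have "cmod m \<le> F" using F0 by (simp add: power2_le_iff_abs_le)
  then have "cmod l \<le> 1" using F0 by (simp add: l_def norm_divide)
  moreover have "qunit (cnj x, cnj y)" using X(1) by (simp add: xy qunit_def)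
  moreover have "z = of_real F *s zvec l (cnj x, cnj y) (d, e)"
  proof -
    have "z1 = of_real F * (d * x + l * cnj e * cnj y)" "z2 = of_real F * (d * y - l * cnj e * cnj x)"
      "z3 = of_real F * (e * x - l * cnj d * cnj y)" "z4 = of_real F * (e * y + l * cnj d * cnj x)"
      unfolding zz f g' using lm by algebra+
    then show ?thesis using z by (simp add: vec_eq_iff forall_4 zvec_def vector_4)
  qed
  ultimately show thesis using that \<open>qunit (d, e)\<close> by blast
qed

text \<open>\<open>ellipse_exists\<close> in coordinates rotated by \<open>w\<close>; the parameter
  \<open>u\<close> of the point on the ellipse gives the phase through
  \<open>c\<^sup>2 = u w\<close>.\<close>

lemma lam_exists:
  assumes s: "qunit s" "qunit t" and l: "cmod l \<le> 1"
  obtains r c where "0 \<le> r" "r \<le> 1" "cmod c = 1" "c\<^sup>2 * lam r (qscale c s) t = l"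
proof -
  define Q where "Q = rel_quart s t"
  define k where "k = cmod Q / 4"
  have k: "0 \<le> k" "k \<le> 1/4" using norm_rel_quart_le[OF s] by (simp_all add: k_def Q_def)
  obtain w where w: "w * cnj w = 1" "Q = of_real (4 * k) * w\<^sup>2"
  proof (cases "Q = 0")
    case True
    then show thesis using that[of 1] by (simp add: k_def)
  next
    case False
    define w where "w = csqrt (Q / of_real (cmod Q))"
    have w2: "w\<^sup>2 = Q / of_real (cmod Q)" by (simp add: w_def)
    have "(cmod w)\<^sup>2 = cmod (w\<^sup>2)" by (simp add: norm_power)
    also have "\<dots> = 1\<^sup>2" unfolding w2 using False by (simp add: norm_divide)
    finally have "cmod w = 1" by (rule power2_eq_imp_eq) simp_all
    moreover have "Q = of_real (4 * k) * w\<^sup>2" unfolding w2 using False by (simp add: k_def)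
    ultimately show thesis using that unit_complex by blast
  qed
  have "cmod (l * cnj w) \<le> 1" using l w(1) unit_complex[of w] by (simp add: norm_mult)
  then have "(cmod (l * cnj w))\<^sup>2 \<le> 1" by (simp add: power_le_one)
  then have "(Re (l * cnj w))\<^sup>2 + (Im (l * cnj w))\<^sup>2 \<le> 1" unfolding cmod_power2 .
  from ellipse_exists[OF k this] obtain r p q where r: "0 \<le> r" "r \<le> 1" "p\<^sup>2 + q\<^sup>2 = 1"
    "(r + 2 * k * (1 - r)) * p = Re (l * cnj w)" "r * q = Im (l * cnj w)" by metis
  define u where "u = Complex p q"
  have u: "of_real r * u + of_real ((1 - r) * k) * (u + cnj u) = l * cnj w"
    using r(4,5) by (simp add: u_def complex_eq_iff algebra_simps)
  define c where "c = csqrt (u * w)"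
  have c2: "c\<^sup>2 = u * w" by (simp add: c_def)
  have "(cmod c)\<^sup>2 = cmod (c\<^sup>2)" by (simp add: norm_power)
  also have "\<dots> = 1\<^sup>2" unfolding c2 using r(3) w(1) unit_complex[of w] by (simp add: norm_mult u_def complex_norm)
  finally have c1: "cmod c = 1" by (rule power2_eq_imp_eq) simp_all
  have cc: "c * cnj c = 1" using c1 unit_complex by blast
  have "rel_quart (qscale c s) t = cnj c ^ 4 * Q"
    using c1 by (simp add: rel_quart_def quart_qscale Q_def)
  moreover have "cmod (cnj c ^ 4 * Q) = cmod Q" using c1 by (simp add: norm_mult norm_power)
  ultimately have "lam r (qscale c s) t = of_real r + of_real ((1 - r) / 4) * (of_real (4 * k) + cnj c ^ 4 * Q)"
    by (simp add: lam_def k_def)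
  then have "c\<^sup>2 * lam r (qscale c s) t = c\<^sup>2 * of_real r + of_real ((1 - r) / 4) * (c\<^sup>2 * of_real (4 * k) + (cnj c)\<^sup>2 * Q)"
    using cc by algebra
  also have "(cnj c)\<^sup>2 = cnj u * cnj w" using c2 by (metis complex_cnj_mult complex_cnj_power)
  also have "c\<^sup>2 * of_real r + of_real ((1 - r) / 4) * (c\<^sup>2 * of_real (4 * k) + cnj u * cnj w * Q) =
      w * (of_real r * u + of_real ((1 - r) * k) * (u + cnj u))"
    unfolding w(2) c2 using w(1) by (simp add: power2_eq_square field_simps) algebra
  also have "\<dots> = l" unfolding u using w(1) by (simp add: mult.commute)
  finally show thesis using that[OF r(1,2) c1] by blast
qed

section \<open>Unit quaternions as special unitary matrices\<close>

definition su :: "quat \<Rightarrow> complex^2^2" where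
  "su x = vector [vector [fst x, snd x], vector [- cnj (snd x), cnj (fst x)]]"

lemma su_nth [simp]:
  "su x $ 1 $ 1 = fst x" "su x $ 1 $ 2 = snd x" "su x $ 2 $ 1 = - cnj (snd x)" "su x $ 2 $ 2 = cnj (fst x)"
  by (simp_all add: su_def vector_2)

lemma su_qm: "su (qm x y) = su x ** su y"
  by (simp add: vec_eq_iff forall_2 matrix_matrix_mult_def sum_2 qm_def algebra_simps)

lemma su_one: "su (1, 0) = mat 1"
  by (simp add: vec_eq_iff forall_2 mat_def)

lemma su_eq_iff [simp]: "su x = su y \<longleftrightarrow> x = y"
  by (auto simp: vec_eq_iff forall_2 prod_eq_iff)

lemma adjoint_su: "adjoint_matrix (su x) = su (qi x)"
  by (simp add: vec_eq_iff forall_2 adjoint_matrix_def qi_def)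

lemma carrier_SU2: "carrier SU2 = su ` {x. qunit x}"
proof
  show "su ` {x. qunit x} \<subseteq> carrier SU2"
  proof
    fix A assume "A \<in> su ` {x. qunit x}"
    then obtain a b where A: "A = su (a, b)" "qunit (a, b)" by auto
    have "det A = 1" using A(2) by (simp add: A(1) det_2 qunit_iff)
    then show "A \<in> carrier SU2"
      using A(2) by (simp add: SU2_def A(1) adjoint_su su_qm[symmetric] qm_qi su_one)
  qed
  show "carrier SU2 \<subseteq> su ` {x. qunit x}"
  proof
    fix A assume "A \<in> carrier SU2"
    then have A: "adjoint_matrix A ** A = mat 1" "det A = 1" by (simp_all add: SU2_def)
    define a b c d where "a = A $ 1 $ 1" and "b = A $ 1 $ 2" and "c = A $ 2 $ 1" and "d = A $ 2 $ 2"
    note abcd = this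
    have e: "(adjoint_matrix A ** A) $ i $ j = mat 1 $ i $ j" for i j using A(1) by simp
    have "cnj a * a + cnj c * c = 1" "cnj a * b + cnj c * d = 0"
      using e[of 1 1] e[of 1 2] by (simp_all add: matrix_matrix_mult_def sum_2 adjoint_matrix_def mat_def abcd)
    moreover have "a * d - b * c = 1" using A(2) by (simp add: det_2 abcd)
    ultimately have "cnj a = d" and "cnj c = - b" by algebra+
    from arg_cong[OF this(1), of cnj] arg_cong[OF this(2), of cnj]
    have dc: "a = cnj d" "c = - cnj b" by simp_all
    have "cnj a * a + b * cnj b = 1"
      using \<open>cnj a * a + cnj c * c = 1\<close> unfolding \<open>cnj c = - b\<close> \<open>c = - cnj b\<close> by simp
    then have "qunit (a, b)" unfolding qunit_iff by (simp only: mult.commute)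
    moreover have "A = su (a, b)" using dc(2) \<open>cnj a = d\<close> unfolding vec_eq_iff forall_2 su_nth abcd by simp
    ultimately show "A \<in> su ` {x. qunit x}" by blast
  qed
qed

lemma su_mult_SU2: "su x \<otimes>\<^bsub>SU2\<^esub> su y = su (qm x y)"
  by (simp add: SU2_def su_qm)

lemma inv_SU2:
  assumes "qunit x" shows "inv\<^bsub>SU2\<^esub> su x = su (qi x)"
proof -
  interpret SU2: group SU2 by (rule group_SU2)
  have "su (qi x) \<otimes>\<^bsub>SU2\<^esub> su x = \<one>\<^bsub>SU2\<^esub>"
    using assms by (simp add: su_mult_SU2 qm_qi su_one) (simp add: SU2_def)
  then show ?thesis using assms by (intro SU2.inv_equality) (auto simp: carrier_SU2)
qed

lemma continuous_on_vec:
  fixes f :: "'a::topological_space \<Rightarrow> ('b::topological_space)^'n"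
  assumes "\<And>i. continuous_on S (\<lambda>x. f x $ i)" shows "continuous_on S f"
  using continuous_on_vec_lambda[of S "\<lambda>i x. f x $ i", OF assms] by simp

lemma continuous_on_su [continuous_intros]:
  assumes "continuous_on S f" shows "continuous_on S (\<lambda>x. su (f x))"
proof (intro continuous_on_vec)
  fix i j :: 2
  have "i = 1 \<or> i = 2" "j = 1 \<or> j = 2" using exhaust_2 by blast+
  then show "continuous_on S (\<lambda>x. su (f x) $ i $ j)"
    using assms by (elim disjE) (auto intro!: continuous_intros)
qed

section \<open>Continuity of the parametrisations\<close>

lemma compact_qunit: "compact {x. qunit x}"
proof -
  have "{x. qunit x} = sphere 0 1" by (auto simp: qunit_def norm_prod_def)
  then show ?thesis by simp
qed

lemma continuous_on_qm [continuous_intros]: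
  "continuous_on S f \<Longrightarrow> continuous_on S g \<Longrightarrow> continuous_on S (\<lambda>x. qm (f x) (g x))"
  unfolding qm_def by (intro continuous_intros)

lemma continuous_on_qi [continuous_intros]: "continuous_on S f \<Longrightarrow> continuous_on S (\<lambda>x. qi (f x))"
  unfolding qi_def by (intro continuous_intros)

lemma continuous_on_qconj [continuous_intros]:
  "continuous_on S f \<Longrightarrow> continuous_on S g \<Longrightarrow> continuous_on S (\<lambda>x. qconj (f x) (g x))"
  unfolding qconj_def by (intro continuous_intros)

lemma continuous_on_frame [continuous_intros]:
  assumes "continuous_on S f"
  shows "continuous_on S (\<lambda>x. ht1 (f x))" "continuous_on S (\<lambda>x. ht2 (f x))"
    "continuous_on S (\<lambda>x. hz1 (f x))" "continuous_on S (\<lambda>x. hz2 (f x))"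
  unfolding ht1_def ht2_def hz1_def hz2_def using assms by (intro continuous_intros; assumption)+

lemma continuous_on_sides:
  assumes r: "continuous_on S r" and s: "continuous_on S s" and "\<And>x. x \<in> S \<Longrightarrow> qunit (s x) \<and> 0 \<le> r x \<and> r x \<le> 1"
  shows "continuous_on S (\<lambda>x. sideA (r x) (s x))" "continuous_on S (\<lambda>x. sideB (r x) (s x))"
proof -
  have "\<forall>x\<in>S. 1 - (1 - r x) / 2 * ((ht1 (s x))\<^sup>2 + (ht2 (s x))\<^sup>2) \<noteq> 0"
  proof
    fix x assume "x \<in> S"
    then have "1/2 \<le> 1 - (1 - r x) / 2 * ((ht1 (s x))\<^sup>2 + (ht2 (s x))\<^sup>2)"
      using tilt_denominator assms(3) by blast
    then show "1 - (1 - r x) / 2 * ((ht1 (s x))\<^sup>2 + (ht2 (s x))\<^sup>2) \<noteq> 0" by linarith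
  qed
  then have t: "continuous_on S (\<lambda>x. tilt (r x) (s x))"
    unfolding tilt_def using r s
    by (intro continuous_on_divide continuous_on_mult continuous_on_diff continuous_on_add
        continuous_on_power continuous_on_frame continuous_on_const) simp_all
  have l: "continuous_on S (\<lambda>x. len1 (r x) (s x))" "continuous_on S (\<lambda>x. len2 (r x) (s x))"
    unfolding len1_def len2_def by (intro continuous_intros t; simp)+
  have h: "continuous_on S (\<lambda>x. hA (r x) (s x))" "continuous_on S (\<lambda>x. hB (r x) (s x))"
    "continuous_on S (\<lambda>x. pA (r x) (s x))" "continuous_on S (\<lambda>x. pB (r x) (s x))"
    unfolding hA_def hB_def pA_def pB_def by (intro continuous_intros l s)+
  have g: "continuous_on S (\<lambda>x. gam (r x))"
    unfolding gam_def by (intro continuous_intros r)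
  show "continuous_on S (\<lambda>x. sideA (r x) (s x))" "continuous_on S (\<lambda>x. sideB (r x) (s x))"
    unfolding sideA_def sideB_def by (intro continuous_intros h g)+
qed

lemma continuous_on_zpoint:
  assumes r: "continuous_on S r" and s: "continuous_on S s" and t: "continuous_on S t"
  shows "continuous_on S (\<lambda>x. zpoint (r x) (s x) (t x))"
proof (rule continuous_on_vec)
  fix i :: 4
  have q: "continuous_on S (\<lambda>x. rel_quart (s x) (t x))"
    unfolding rel_quart_def quart_def by (intro continuous_intros s t)
  have l: "continuous_on S (\<lambda>x. lam (r x) (s x) (t x))"
    unfolding lam_def by (intro continuous_intros r q; simp)
  have "i = 1 \<or> i = 2 \<or> i = 3 \<or> i = 4" using exhaust_4 by blast
  then show "continuous_on S (\<lambda>x. zpoint (r x) (s x) (t x) $ i)"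
    unfolding zpoint_def zvec_def
    by (elim disjE; simp only: vector_4; intro continuous_intros l s t)
qed

section \<open>Complex projective space is Hausdorff\<close>

abbreviation proportional :: "((complex^'n) \<times> (complex^'n)) set" where
  "proportional \<equiv> {(z, w). z \<noteq> 0 \<and> w \<noteq> 0 \<and> (\<exists>c. c \<noteq> 0 \<and> w = c *s z)}"

lemma equiv_proportional: "equiv (- {0}) (proportional :: ((complex^'n) \<times> (complex^'n)) set)"
proof (rule equivI)
  show "refl_on (- {0}) (proportional :: ((complex^'n) \<times> (complex^'n)) set)"
    by (auto simp: refl_on_def intro!: exI[of _ 1])
  show "sym (proportional :: ((complex^'n) \<times> (complex^'n)) set)"
  proof (rule symI)
    fix z w :: "complex^'n" assume "(z, w) \<in> proportional"
    then obtain c where "z \<noteq> 0" "w \<noteq> 0" "c \<noteq> 0" "w = c *s z" by auto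
    then have "z = inverse c *s w" by (simp add: vector_smult_assoc)
    then show "(w, z) \<in> proportional" using \<open>z \<noteq> 0\<close> \<open>w \<noteq> 0\<close> \<open>c \<noteq> 0\<close>
      by (auto intro!: exI[of _ "inverse c"])
  qed
  show "trans (proportional :: ((complex^'n) \<times> (complex^'n)) set)"
  proof (rule transI)
    fix x y z :: "complex^'n" assume "(x, y) \<in> proportional" "(y, z) \<in> proportional"
    then obtain c d where "x \<noteq> 0" "z \<noteq> 0" "c \<noteq> 0" "d \<noteq> 0" "y = c *s x" "z = d *s y" by auto
    then show "(x, z) \<in> proportional" by (auto simp: vector_smult_assoc intro!: exI[of _ "d * c"])
  qed
qed auto

text \<open>The matrix of the orthogonal projection onto the line of \<open>z\<close>. It is
  continuous away from 0 and separates lines, so the Hausdorff property can be pulled back from the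
  space of matrices.\<close>

definition line_projection :: "complex^'n \<Rightarrow> complex^'n^'n" where
  "line_projection z = (\<chi> i j. z $ i * cnj (z $ j) / of_real ((norm z)\<^sup>2))"

lemma norm_smult_complex: "norm (c *s (z :: complex^'n)) = cmod c * norm z"
  by (simp add: norm_vec_def L2_set_def norm_mult power_mult_distrib sum_distrib_left[symmetric] real_sqrt_mult)

lemma line_projection_eq_iff:
  assumes "z \<noteq> 0" "w \<noteq> 0"
  shows "line_projection z = line_projection w \<longleftrightarrow> (\<exists>c. c \<noteq> 0 \<and> w = c *s z)"
proof
  assume eq: "line_projection z = line_projection w"
  obtain j where j: "w $ j \<noteq> 0" using assms(2) by (auto simp: vec_eq_iff)
  have nz: "norm z \<noteq> 0" "norm w \<noteq> 0" using assms by simp_all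
  have e: "z $ i * cnj (z $ j) / of_real ((norm z)\<^sup>2) = w $ i * cnj (w $ j) / of_real ((norm w)\<^sup>2)" for i
    using eq by (simp add: line_projection_def vec_eq_iff)
  define c where "c = cnj (z $ j) / of_real ((norm z)\<^sup>2) * of_real ((norm w)\<^sup>2) / cnj (w $ j)"
  have "w $ i = c * z $ i" for i
    using e[of i] j nz by (simp add: c_def field_simps)
  then have w: "w = c *s z" by (simp add: vec_eq_iff)
  then have "c \<noteq> 0" using assms(2) by auto
  then show "\<exists>c. c \<noteq> 0 \<and> w = c *s z" using w by blast
next
  assume "\<exists>c. c \<noteq> 0 \<and> w = c *s z"
  then obtain c where c: "c \<noteq> 0" "w = c *s z" by blast
  have "c * x * (cnj c * y) / of_real ((cmod c * n)\<^sup>2) = x * y / of_real (n\<^sup>2)" for x y n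
  proof -
    have "of_real ((cmod c * n)\<^sup>2) = (c * cnj c) * of_real (n\<^sup>2)"
      by (simp only: power_mult_distrib of_real_mult complex_norm_square)
    moreover have "c * x * (cnj c * y) = (c * cnj c) * (x * y)" by (simp only: mult_ac)
    ultimately show ?thesis using c(1) by (simp only: mult_divide_mult_cancel_left) simp
  qed
  then show "line_projection z = line_projection w"
    by (simp add: line_projection_def vec_eq_iff c(2) norm_smult_complex del: of_real_power of_real_mult)
qed

lemma Hausdorff_complex_projective_space:
  "Hausdorff_space (complex_projective_space :: (complex^'n) set topology)"
proof -
  let ?R = "proportional :: ((complex^'n) \<times> (complex^'n)) set"
  have q: "quotient_map (top_of_set (- {0})) complex_projective_space (\<lambda>z. ?R `` {z})"
    unfolding complex_projective_space_def by (rule quotient_map_quotient_topology)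
  have eq: "?R `` {z} = ?R `` {w} \<longleftrightarrow> line_projection z = line_projection w" if "z \<noteq> 0" "w \<noteq> 0" for z w
    using eq_equiv_class_iff[OF equiv_proportional, of z w] line_projection_eq_iff[OF that] that by auto
  have "continuous_on (- {0}) (line_projection :: complex^'n \<Rightarrow> _)"
    unfolding line_projection_def by (intro continuous_intros) auto
  then have c: "continuous_map (top_of_set (- {0})) euclidean (line_projection :: complex^'n \<Rightarrow> _)" by simp
  have lift: "line_projection z = line_projection w"
    if "z \<in> topspace (top_of_set (- {0}))" "w \<in> topspace (top_of_set (- {0}))" "?R `` {z} = ?R `` {w}" for z w
    using eq[THEN iffD1, OF _ _ that(3)] that(1,2) by simp
  obtain g where g: "continuous_map complex_projective_space euclidean g"
    "g ` topspace complex_projective_space = line_projection ` topspace (top_of_set (- {0}))"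
    "\<And>z. z \<in> topspace (top_of_set (- {0})) \<Longrightarrow> g (?R `` {z}) = line_projection z"
    by (rule quotient_map_lift_exists[OF q c lift]) (assumption | rule that)+
  have "topspace complex_projective_space = (\<lambda>z. ?R `` {z}) ` (- {0})"
    using q by (simp add: quotient_map_def)
  note top = this
  have "inj_on g (topspace complex_projective_space)"
  proof (rule inj_onI)
    fix C D assume "C \<in> topspace complex_projective_space" "D \<in> topspace complex_projective_space" and CD: "g C = g D"
    then obtain z w where z: "z \<noteq> 0" "C = ?R `` {z}" and w: "w \<noteq> 0" "D = ?R `` {w}"
      unfolding top by blast
    have "g (?R `` {z}) = line_projection z" "g (?R `` {w}) = line_projection w"
      by (rule g(3), use z w in simp)+
    then have "line_projection z = line_projection w" using CD unfolding z(2) w(2) by metis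
    then show "C = D" unfolding z(2) w(2) by (rule eq[OF z(1) w(1), THEN iffD2])
  qed
  then show ?thesis using Hausdorff_space_injective_preimage[OF _ g(1)] by simp
qed

section \<open>Representations as quadruples of unit quaternions\<close>

definition generator_values where
  "generator_values \<rho> = (\<rho> a1, \<rho> b1, \<rho> a2, \<rho> b2)"

lemma generators_in_carrier:
  "a1 \<in> carrier pi1_F2" "b1 \<in> carrier pi1_F2" "a2 \<in> carrier pi1_F2" "b2 \<in> carrier pi1_F2"
  unfolding a1_def b1_def a2_def b2_def by (simp_all add: edge_class_in_carrier)

lemma pi1_F2_m_closed:
  assumes "x \<in> carrier pi1_F2" "y \<in> carrier pi1_F2" shows "x \<otimes>\<^bsub>pi1_F2\<^esub> y \<in> carrier pi1_F2"
proof -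
  obtain p q where "p \<in> loops F2 F2_base" "x = loop_class p" "q \<in> loops F2 F2_base" "y = loop_class q"
    using assms by (auto simp: pi1_F2_def fundamental_group_def elim!: quotientE)
  then show ?thesis
    using pi1_mult[of p F2 F2_base q] path_concat_in_loops loop_class_in_carrier by (metis pi1_F2_def)
qed

lemma inj_generator_values: "inj_on generator_values Rep_F2"
proof (rule inj_onI)
  fix \<rho> \<sigma> assume "\<rho> \<in> Rep_F2" "\<sigma> \<in> Rep_F2" "generator_values \<rho> = generator_values \<sigma>"
  then show "\<rho> = \<sigma>"
    using group.hom_pi1_F2_eqI[OF group_SU2, of \<rho> \<sigma>]
    by (auto simp: Rep_F2_def generator_values_def intro: extensionalityI)
qed

lemma qi_qcomm: "qi (qcomm x y) = qcomm y x"
  by (simp add: qcomm_def qi_qm qm_assoc)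

lemma surface_relation_iff:
  assumes u: "qunit A1" "qunit B1" "qunit A2" "qunit B2"
  shows "su A1 \<otimes>\<^bsub>SU2\<^esub> su B1 \<otimes>\<^bsub>SU2\<^esub> inv\<^bsub>SU2\<^esub> su A1 \<otimes>\<^bsub>SU2\<^esub> inv\<^bsub>SU2\<^esub> su B1 \<otimes>\<^bsub>SU2\<^esub> su A2 \<otimes>\<^bsub>SU2\<^esub> su B2
      \<otimes>\<^bsub>SU2\<^esub> inv\<^bsub>SU2\<^esub> su A2 \<otimes>\<^bsub>SU2\<^esub> inv\<^bsub>SU2\<^esub> su B2 = \<one>\<^bsub>SU2\<^esub> \<longleftrightarrow> qcomm A1 B1 = qcomm B2 A2"
proof -
  have one: "\<one>\<^bsub>SU2\<^esub> = su (1, 0)" by (simp add: SU2_def su_one)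
  have "qm (qcomm A1 B1) (qcomm A2 B2) = (1, 0) \<longleftrightarrow> qcomm A1 B1 = qi (qcomm A2 B2)"
  proof
    assume "qm (qcomm A1 B1) (qcomm A2 B2) = (1, 0)"
    then have "qm (qm (qcomm A1 B1) (qcomm A2 B2)) (qi (qcomm A2 B2)) = qi (qcomm A2 B2)" by simp
    then show "qcomm A1 B1 = qi (qcomm A2 B2)" using u by (simp add: qm_assoc qm_qi qunit_qcomm)
  next
    assume "qcomm A1 B1 = qi (qcomm A2 B2)"
    then show "qm (qcomm A1 B1) (qcomm A2 B2) = (1, 0)" using u by (simp add: qm_qi qunit_qcomm)
  qed
  then show ?thesis
    unfolding one inv_SU2[OF u(1)] inv_SU2[OF u(2)] inv_SU2[OF u(3)] inv_SU2[OF u(4)] su_mult_SU2 su_eq_iff qi_qcomm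
    by (simp add: qcomm_def qm_assoc)
qed

lemma Rep_F2_quaternions:
  assumes "\<rho> \<in> Rep_F2"
  obtains A1 B1 A2 B2 where "qunit A1" "qunit B1" "qunit A2" "qunit B2" "qcomm A1 B1 = qcomm B2 A2"
    "generator_values \<rho> = (su A1, su B1, su A2, su B2)"
proof -
  have h: "\<rho> \<in> hom pi1_F2 SU2" using assms by (simp add: Rep_F2_def)
  then have "\<rho> x \<in> su ` {x. qunit x}" if "x \<in> carrier pi1_F2" for x
    using that unfolding carrier_SU2[symmetric] by (auto simp: hom_def)
  from this[OF generators_in_carrier(1)] this[OF generators_in_carrier(2)]
    this[OF generators_in_carrier(3)] this[OF generators_in_carrier(4)]
  obtain A1 B1 A2 B2 where u: "qunit A1" "qunit B1" "qunit A2" "qunit B2"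
    and eq: "\<rho> a1 = su A1" "\<rho> b1 = su B1" "\<rho> a2 = su A2" "\<rho> b2 = su B2" by auto
  have "qcomm A1 B1 = qcomm B2 A2"
    using group.hom_pi1_F2_relation[OF group_SU2 h] unfolding eq surface_relation_iff[OF u] .
  then show thesis using that u eq by (simp add: generator_values_def)
qed

lemma Rep_F2_exists:
  assumes u: "qunit A1" "qunit B1" "qunit A2" "qunit B2" and rel: "qcomm A1 B1 = qcomm B2 A2"
  shows "(su A1, su B1, su A2, su B2) \<in> generator_values ` Rep_F2"
proof -
  have "su A1 \<in> carrier SU2" "su B1 \<in> carrier SU2" "su A2 \<in> carrier SU2" "su B2 \<in> carrier SU2"
    using u by (auto simp: carrier_SU2)
  from group.hom_pi1_F2_exists[OF group_SU2 this] surface_relation_iff[OF u] rel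
  obtain \<rho> where \<rho>: "\<rho> \<in> hom pi1_F2 SU2" "\<rho> a1 = su A1" "\<rho> b1 = su B1" "\<rho> a2 = su A2" "\<rho> b2 = su B2"
    by blast
  have "restrict \<rho> (carrier pi1_F2) \<in> Rep_F2"
    using \<rho>(1) pi1_F2_m_closed by (auto simp: Rep_F2_def hom_def)
  then show ?thesis
    using \<rho> generators_in_carrier by (intro image_eqI) (auto simp: generator_values_def)
qed

text \<open>A conjugate of a representation is a homomorphism, and homomorphisms that agree on the
  generators agree everywhere; so conjugacy can be tested on four values.\<close>

lemma conjugation_rel_iff:
  assumes \<rho>: "\<rho> \<in> Rep_F2" "generator_values \<rho> = (su A1, su B1, su A2, su B2)"
    and \<sigma>: "\<sigma> \<in> Rep_F2" "generator_values \<sigma> = (su A1', su B1', su A2', su B2')"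
  shows "(\<rho>, \<sigma>) \<in> conjugation_rel \<longleftrightarrow>
    (\<exists>X. qunit X \<and> A1' = qconj X A1 \<and> B1' = qconj X B1 \<and> A2' = qconj X A2 \<and> B2' = qconj X B2)"
proof -
  interpret SU2: group SU2 by (rule group_SU2)
  have h: "\<rho> \<in> hom pi1_F2 SU2" "\<sigma> \<in> hom pi1_F2 SU2" using \<rho>(1) \<sigma>(1) by (simp_all add: Rep_F2_def)
  have conj: "su X \<otimes>\<^bsub>SU2\<^esub> su A \<otimes>\<^bsub>SU2\<^esub> inv\<^bsub>SU2\<^esub> su X = su (qconj X A)" if "qunit X" for X A
    using that by (simp add: inv_SU2 su_mult_SU2 qconj_def qm_assoc)
  have v: "\<rho> a1 = su A1" "\<rho> b1 = su B1" "\<rho> a2 = su A2" "\<rho> b2 = su B2"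
    "\<sigma> a1 = su A1'" "\<sigma> b1 = su B1'" "\<sigma> a2 = su A2'" "\<sigma> b2 = su B2'"
    using \<rho>(2) \<sigma>(2) by (simp_all add: generator_values_def)
  show ?thesis
  proof
    assume "(\<rho>, \<sigma>) \<in> conjugation_rel"
    then obtain g where g: "g \<in> carrier SU2"
      "\<And>x. x \<in> carrier pi1_F2 \<Longrightarrow> \<sigma> x = g \<otimes>\<^bsub>SU2\<^esub> \<rho> x \<otimes>\<^bsub>SU2\<^esub> inv\<^bsub>SU2\<^esub> g"
      by (auto simp: conjugation_rel_def)
    then obtain X where X: "qunit X" "g = su X" by (auto simp: carrier_SU2)
    have "\<sigma> a1 = su (qconj X A1)" "\<sigma> b1 = su (qconj X B1)" "\<sigma> a2 = su (qconj X A2)" "\<sigma> b2 = su (qconj X B2)"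
      using g(2) generators_in_carrier v(1-4) conj[OF X(1)] unfolding X(2) by auto
    then show "\<exists>X. qunit X \<and> A1' = qconj X A1 \<and> B1' = qconj X B1 \<and> A2' = qconj X A2 \<and> B2' = qconj X B2"
      using X(1) unfolding v su_eq_iff by blast
  next
    assume "\<exists>X. qunit X \<and> A1' = qconj X A1 \<and> B1' = qconj X B1 \<and> A2' = qconj X A2 \<and> B2' = qconj X B2"
    then obtain X where X: "qunit X" "A1' = qconj X A1" "B1' = qconj X B1" "A2' = qconj X A2" "B2' = qconj X B2"
      by blast
    have g: "su X \<in> carrier SU2" using X(1) by (auto simp: carrier_SU2)
    define \<tau> where "\<tau> x = su X \<otimes>\<^bsub>SU2\<^esub> \<rho> x \<otimes>\<^bsub>SU2\<^esub> inv\<^bsub>SU2\<^esub> su X" for x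
    have cl: "\<rho> x \<in> carrier SU2" if "x \<in> carrier pi1_F2" for x using h(1) that by (auto simp: hom_def)
    have "\<tau> \<in> hom pi1_F2 SU2"
    proof (rule homI)
      show "\<tau> x \<in> carrier SU2" if "x \<in> carrier pi1_F2" for x
        using g cl[OF that] by (simp add: \<tau>_def)
      show "\<tau> (x \<otimes>\<^bsub>pi1_F2\<^esub> y) = \<tau> x \<otimes>\<^bsub>SU2\<^esub> \<tau> y" if xy: "x \<in> carrier pi1_F2" "y \<in> carrier pi1_F2" for x y
      proof -
        obtain A B where AB: "\<rho> x = su A" "\<rho> y = su B"
          using cl[OF xy(1)] cl[OF xy(2)] unfolding carrier_SU2 by blast
        have "\<rho> (x \<otimes>\<^bsub>pi1_F2\<^esub> y) = su (qm A B)"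
          using hom_mult[OF h(1) xy] by (simp only: AB su_mult_SU2)
        then show ?thesis by (simp only: \<tau>_def AB conj[OF X(1)]) (simp only: su_mult_SU2 qconj_qm[OF X(1)])
      qed
    qed
    moreover have "\<tau> a1 = \<sigma> a1" "\<tau> b1 = \<sigma> b1" "\<tau> a2 = \<sigma> a2" "\<tau> b2 = \<sigma> b2"
      unfolding \<tau>_def v conj[OF X(1)] X(2-5) by (rule refl)+
    ultimately have "\<tau> x = \<sigma> x" if "x \<in> carrier pi1_F2" for x
      using group.hom_pi1_F2_eqI[OF group_SU2 _ h(2)] that by blast
    then show "(\<rho>, \<sigma>) \<in> conjugation_rel"
      using \<rho>(1) \<sigma>(1) g by (auto simp: conjugation_rel_def \<tau>_def intro!: bexI[of _ "su X"])
  qed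
qed

section \<open>The homeomorphism\<close>

text \<open>Each map is constant on the fibres of the other and factors through it; the two
  factorisations are mutually inverse.\<close>

lemma quotient_maps_homeomorphic:
  assumes f: "quotient_map X Y f" and g: "quotient_map X Z g"
    and fib: "\<And>x y. x \<in> topspace X \<Longrightarrow> y \<in> topspace X \<Longrightarrow> f x = f y \<longleftrightarrow> g x = g y"
  shows "Y homeomorphic_space Z"
proof -
  obtain a where a: "continuous_map Y Z a" "a ` topspace Y = g ` topspace X" "\<And>x. x \<in> topspace X \<Longrightarrow> a (f x) = g x"
    by (rule quotient_map_lift_exists[OF f quotient_imp_continuous_map[OF g] fib[THEN iffD1]]) (assumption | rule that)+
  obtain b where b: "continuous_map Z Y b" "b ` topspace Z = f ` topspace X" "\<And>x. x \<in> topspace X \<Longrightarrow> b (g x) = f x"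
    by (rule quotient_map_lift_exists[OF g quotient_imp_continuous_map[OF f] fib[THEN iffD2]]) (assumption | rule that)+
  have "topspace Y = f ` topspace X" "topspace Z = g ` topspace X"
    using f g by (simp_all add: quotient_map_def)
  then have "homeomorphic_maps Y Z a b" using a b by (auto simp: homeomorphic_maps_def)
  then show ?thesis by (rule homeomorphic_maps_imp_homeomorphic_space)
qed

lemma compact_Hausdorff_quotient_map:
  assumes "compact_space X" "Hausdorff_space Y" "continuous_map X Y f" "f ` topspace X = topspace Y"
  shows "quotient_map X Y f"
  using assms continuous_closed_imp_quotient_map continuous_imp_closed_map_gen Hausdorff_imp_kc_space by blast

lemma Hausdorff_Rep_F2: "Hausdorff_space Rep_F2_top"
proof (rule Hausdorff_space_injective_preimage)
  show "Hausdorff_space (prod_topology SU2_top (prod_topology SU2_top (prod_topology SU2_top SU2_top)))"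
    by (simp add: Hausdorff_space_prod_topology SU2_top_def Hausdorff_space_subtopology)
  have "continuous_map Rep_F2_top (prod_topology SU2_top (prod_topology SU2_top (prod_topology SU2_top SU2_top)))
      (id \<circ> (\<lambda>\<rho>. (\<rho> a1, \<rho> b1, \<rho> a2, \<rho> b2)))"
    unfolding Rep_F2_top_def by (rule continuous_map_pullback) (rule continuous_map_id)
  then show "continuous_map Rep_F2_top (prod_topology SU2_top (prod_topology SU2_top (prod_topology SU2_top SU2_top)))
      generator_values" by (simp add: generator_values_def[abs_def] o_def)
  show "inj_on generator_values (topspace Rep_F2_top)"
    unfolding topspace_Rep_F2_top by (rule inj_generator_values)
qed

section \<open>The common compact parameter space and its two quotients\<close>

definition params :: "(real \<times> quat \<times> quat \<times> quat) set" where
  "params = {0..1} \<times> {x. qunit x} \<times> {x. qunit x} \<times> {x. qunit x}"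

text \<open>The second pair is entered in exchanged order, matching the relation
  \<open>qcomm A1 B1 = qcomm B2 A2\<close>.\<close>

definition rep_values where
  "rep_values k = (case k of (r, s, t, X) \<Rightarrow>
     (su (qconj X (sideA r s)), su (qconj X (sideB r s)), su (qconj X (sideB r t)), su (qconj X (sideA r t))))"

definition rep_point :: "real \<times> quat \<times> quat \<times> quat \<Rightarrow> (real \<Rightarrow> complex set) set \<Rightarrow> complex^2^2" where
  "rep_point k = inv_into Rep_F2 generator_values (rep_values k)"

lemma rep_values_in_image:
  assumes "k \<in> params" shows "rep_values k \<in> generator_values ` Rep_F2"
proof -
  obtain r s t X where k: "k = (r, s, t, X)" by (cases k)
  then have *: "0 \<le> r" "r \<le> 1" "qunit s" "qunit t" "qunit X" using assms by (auto simp: params_def)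
  have "qcomm (qconj X (sideA r s)) (qconj X (sideB r s)) = qcomm (qconj X (sideA r t)) (qconj X (sideB r t))"
    using * by (simp add: qconj_qcomm[symmetric] qcomm_sides)
  then show ?thesis
    unfolding rep_values_def k prod.case using * by (intro Rep_F2_exists qunit_qconj qunit_sides)
qed

lemma rep_point: 
  assumes "k \<in> params" shows "rep_point k \<in> Rep_F2" "generator_values (rep_point k) = rep_values k"
  unfolding rep_point_def
  using inv_into_into[OF rep_values_in_image[OF assms]] f_inv_into_f[OF rep_values_in_image[OF assms]] by blast+

lemma compact_params: "compact params"
  unfolding params_def by (intro compact_Times compact_qunit compact_Icc)

lemma rep_point_quotient_map: "quotient_map (top_of_set params) Rep_F2_top rep_point"
proof (rule compact_Hausdorff_quotient_map)
  show "compact_space (top_of_set params)" using compact_params by (simp add: compact_space_subtopology)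
  show "Hausdorff_space Rep_F2_top" by (rule Hausdorff_Rep_F2)
  show "continuous_map (top_of_set params) Rep_F2_top rep_point"
    unfolding Rep_F2_top_def
  proof (rule continuous_map_pullback')
    let ?T = "prod_topology SU2_top (prod_topology SU2_top (prod_topology SU2_top SU2_top))"
    have T: "?T = top_of_set (carrier SU2 \<times> carrier SU2 \<times> carrier SU2 \<times> carrier SU2)"
      by (simp add: SU2_top_def prod_topology_subtopology_eu)
    have "continuous_on params rep_values"
      unfolding rep_values_def case_prod_unfold
      by (intro continuous_intros continuous_on_sides) (auto simp: params_def)
    moreover have "rep_values ` params \<subseteq> carrier SU2 \<times> carrier SU2 \<times> carrier SU2 \<times> carrier SU2"
      by (auto simp: rep_values_def params_def carrier_SU2 intro!: qunit_qconj qunit_sides)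
    ultimately have "continuous_map (top_of_set params) ?T rep_values"
      unfolding T by (auto simp: continuous_map_in_subtopology)
    then show "continuous_map (top_of_set params) ?T ((\<lambda>\<rho>. (\<rho> a1, \<rho> b1, \<rho> a2, \<rho> b2)) \<circ> rep_point)"
      by (rule continuous_map_eq) (use rep_point(2) in \<open>simp add: generator_values_def\<close>)
    show "topspace (top_of_set params) \<subseteq> rep_point -` Rep_F2" using rep_point(1) by auto
  qed
  show "rep_point ` topspace (top_of_set params) = topspace Rep_F2_top"
    unfolding topspace_Rep_F2_top
  proof
    show "rep_point ` topspace (top_of_set params) \<subseteq> Rep_F2" using rep_point(1) by auto
    show "Rep_F2 \<subseteq> rep_point ` topspace (top_of_set params)"
    proof
      fix \<rho> assume \<rho>: "\<rho> \<in> Rep_F2"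
      from Rep_F2_quaternions[OF \<rho>] obtain A1 B1 A2 B2 where
        q: "qunit A1" "qunit B1" "qunit A2" "qunit B2" "qcomm A1 B1 = qcomm B2 A2"
        and v: "generator_values \<rho> = (su A1, su B1, su A2, su B2)" by metis
      from rep_normal_form[OF q] obtain X r s t where x: "qunit X" "0 \<le> r" "r \<le> 1" "qunit s" "qunit t"
        "qconj X (sideA r s) = A1" "qconj X (sideB r s) = B1" "qconj X (sideA r t) = B2" "qconj X (sideB r t) = A2"
        by metis
      have k: "(r, s, t, X) \<in> params" using x by (simp add: params_def)
      have "generator_values (rep_point (r, s, t, X)) = generator_values \<rho>"
        unfolding rep_point(2)[OF k] v rep_values_def prod.case x ..
      then have "rep_point (r, s, t, X) = \<rho>"
        using inj_generator_values rep_point(1)[OF k] \<rho> by (simp add: inj_on_def)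
      then show "\<rho> \<in> rep_point ` topspace (top_of_set params)" using k by force
    qed
  qed
qed

definition proj_point :: "real \<times> quat \<times> quat \<times> quat \<Rightarrow> (complex^4) set" where
  "proj_point k = (case k of (r, s, t, X) \<Rightarrow> proportional `` {zpoint r s t})"

lemma proj_point_quotient_map: "quotient_map (top_of_set params) CP3 proj_point"
proof (rule compact_Hausdorff_quotient_map)
  show "compact_space (top_of_set params)" using compact_params by (simp add: compact_space_subtopology)
  show "Hausdorff_space CP3" unfolding CP3_def by (rule Hausdorff_complex_projective_space)
  have q: "quotient_map (top_of_set (- {0})) CP3 (\<lambda>z. proportional `` {z})"
    unfolding CP3_def complex_projective_space_def by (rule quotient_map_quotient_topology)
  define z where "z k = zpoint (fst k) (fst (snd k)) (fst (snd (snd k)))" for k :: "real \<times> quat \<times> quat \<times> quat"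
  have pz: "proj_point = (\<lambda>z. proportional `` {z}) \<circ> z"
    by (auto simp: proj_point_def z_def fun_eq_iff split: prod.split)
  have z0: "z k \<noteq> 0" if "k \<in> params" for k
    using that zvec_invariants(3) by (auto simp: z_def params_def zpoint_def)
  have "continuous_on params z" unfolding z_def by (intro continuous_on_zpoint continuous_intros)
  then have "continuous_map (top_of_set params) (top_of_set (- {0})) z"
    using z0 by (auto simp: continuous_map_in_subtopology)
  then show "continuous_map (top_of_set params) CP3 proj_point"
    unfolding pz by (rule continuous_map_compose[OF _ quotient_imp_continuous_map[OF q]])
  have top: "topspace CP3 = (\<lambda>z. proportional `` {z}) ` (- {0})"
    using q by (simp add: quotient_map_def)
  show "proj_point ` topspace (top_of_set params) = topspace CP3"
  proof
    show "proj_point ` topspace (top_of_set params) \<subseteq> topspace CP3" unfolding top pz using z0 by auto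
    show "topspace CP3 \<subseteq> proj_point ` topspace (top_of_set params)"
    proof
      fix C assume "C \<in> topspace CP3"
      then obtain v :: "complex^4" where v: "v \<noteq> 0" "C = proportional `` {v}" unfolding top by auto
      obtain s t l c where st: "qunit s" "qunit t" "cmod l \<le> 1" "v = c *s zvec l s t"
        using zvec_exists[OF v(1)] by metis
      \<comment> \<open>A phase is moved onto \<open>s\<close> so that \<open>lam\<close> produces
        the singular value parameter \<open>l\<close>; by \<open>zvec_qscale\<close> this only
        rescales the matrix.\<close>
      obtain r d where r: "0 \<le> r" "r \<le> 1" "cmod d = 1" "d\<^sup>2 * lam r (qscale d s) t = l"
        using lam_exists[OF st(1-3)] by metis
      have "zpoint r (qscale d s) t = zvec (lam r (qscale d s) t) (qscale d s) (qscale 1 t)"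
        by (simp add: zpoint_def qscale_def)
      also have "\<dots> = cnj d *s zvec l s t"
        unfolding zvec_qscale[OF r(3) norm_one] using r(4) by simp
      finally have zp: "zpoint r (qscale d s) t = cnj d *s zvec l s t" .
      have d0: "d \<noteq> 0" using r(3) by auto
      have c0: "c \<noteq> 0" using v(1) st(4) by auto
      have k: "(r, qscale d s, t, (1, 0)) \<in> params" using r st by (simp add: params_def qunit_qscale)
      have "v = (c / cnj d) *s zpoint r (qscale d s) t"
        unfolding zp st(4) using d0 by (simp add: vector_smult_assoc)
      moreover have "zpoint r (qscale d s) t \<noteq> 0" using z0[OF k] by (simp add: z_def)
      ultimately have "(zpoint r (qscale d s) t, v) \<in> proportional"
        using v(1) c0 d0 by (auto intro!: exI[of _ "c / cnj d"])
      then have "proj_point (r, qscale d s, t, (1, 0)) = C"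
        unfolding v(2) proj_point_def prod.case by (rule equiv_class_eq[OF equiv_proportional])
      then show "C \<in> proj_point ` topspace (top_of_set params)" using k by force
    qed
  qed
qed

text \<open>The conjugating quaternions \<open>X\<close> and \<open>X'\<close> of the two parameters
  are absorbed into the one that relates the representations, which reduces conjugacy to a common
  \<open>side_conj\<close> of both pairs.\<close>

lemma same_fibres:
  assumes k: "k \<in> params" "k' \<in> params"
  shows "conjugation_rel `` {rep_point k} = conjugation_rel `` {rep_point k'} \<longleftrightarrow> proj_point k = proj_point k'"
proof -
  obtain r s t X where k1: "k = (r, s, t, X)" by (cases k)
  obtain r' s' t' X' where k2: "k' = (r', s', t', X')" by (cases k')
  have r: "0 \<le> r" "r \<le> 1" "0 \<le> r'" "r' \<le> 1" and u: "qunit s" "qunit t" "qunit s'" "qunit t'"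
    and X: "qunit X" "qunit X'" using k by (auto simp: params_def k1 k2)
  note v = rep_point(2)[OF k(1), unfolded rep_values_def, unfolded k1 prod.case]
  note v' = rep_point(2)[OF k(2), unfolded rep_values_def, unfolded k2 prod.case]
  have "conjugation_rel `` {rep_point k} = conjugation_rel `` {rep_point k'} \<longleftrightarrow> (rep_point k, rep_point k') \<in> conjugation_rel"
    using eq_equiv_class_iff[OF equiv_conjugation_rel] rep_point(1) k by blast
  also have "\<dots> \<longleftrightarrow> (\<exists>Y. qunit Y \<and> side_conj Y r s r' s' \<and> side_conj Y r t r' t')" (is "_ \<longleftrightarrow> ?C")
  proof -
    have "(rep_point k, rep_point k') \<in> conjugation_rel \<longleftrightarrow> (\<exists>Z. qunit Z \<and>
        qconj X' (sideA r' s') = qconj Z (qconj X (sideA r s)) \<and> qconj X' (sideB r' s') = qconj Z (qconj X (sideB r s)) \<and>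
        qconj X' (sideB r' t') = qconj Z (qconj X (sideB r t)) \<and> qconj X' (sideA r' t') = qconj Z (qconj X (sideA r t)))"
      unfolding k1 k2
      by (rule conjugation_rel_iff[OF rep_point(1)[OF k(1), unfolded k1] v rep_point(1)[OF k(2), unfolded k2] v'])
    also have "\<dots> \<longleftrightarrow> ?C"
    proof -
      have 1: "P = qconj (qm (qi X') (qm Z X)) Q" if "qconj X' P = qconj Z (qconj X Q)" for P Q Z
        using arg_cong[OF that, of "qconj (qi X')"] unfolding qconj_cancel(1)[OF X(2)]
        unfolding qconj_qconj qm_assoc .
      have 2: "qconj X' (qconj Y Q) = qconj (qm X' (qm Y (qi X))) (qconj X Q)" for Y Q
        using X by (simp add: qconj_qconj qm_assoc qm_qi)
      have 3: "qunit (qm (qi X') (qm Z X))" "qunit (qm X' (qm Z (qi X)))" if "qunit Z" for Z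
        using that X by (simp_all add: qunit_qm)
      show ?thesis
      proof
        assume "\<exists>Z. qunit Z \<and>
          qconj X' (sideA r' s') = qconj Z (qconj X (sideA r s)) \<and> qconj X' (sideB r' s') = qconj Z (qconj X (sideB r s)) \<and>
          qconj X' (sideB r' t') = qconj Z (qconj X (sideB r t)) \<and> qconj X' (sideA r' t') = qconj Z (qconj X (sideA r t))"
        then obtain Z where "qunit Z"
          "qconj X' (sideA r' s') = qconj Z (qconj X (sideA r s))" "qconj X' (sideB r' s') = qconj Z (qconj X (sideB r s))"
          "qconj X' (sideB r' t') = qconj Z (qconj X (sideB r t))" "qconj X' (sideA r' t') = qconj Z (qconj X (sideA r t))"
          by blast
        then show ?C using 1 3(1) unfolding side_conj_def by (intro exI[of _ "qm (qi X') (qm Z X)"]) blast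
      next
        assume ?C
        then obtain Y where "qunit Y" "side_conj Y r s r' s'" "side_conj Y r t r' t'" by blast
        then show "\<exists>Z. qunit Z \<and>
          qconj X' (sideA r' s') = qconj Z (qconj X (sideA r s)) \<and> qconj X' (sideB r' s') = qconj Z (qconj X (sideB r s)) \<and>
          qconj X' (sideB r' t') = qconj Z (qconj X (sideB r t)) \<and> qconj X' (sideA r' t') = qconj Z (qconj X (sideA r t))"
          using 2 3(2) unfolding side_conj_def by (intro exI[of _ "qm X' (qm Y (qi X))"]) simp
      qed
    qed
    finally show ?thesis .
  qed
  also have "\<dots> \<longleftrightarrow> (\<exists>c. zpoint r' s' t' = c *s zpoint r s t)"
    using zpoint_conj_invariant[OF u r] zpoint_fibre[OF u r] by metis
  also have "\<dots> \<longleftrightarrow> proj_point k = proj_point k'"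
  proof -
    have nz: "zpoint r s t \<noteq> 0" "zpoint r' s' t' \<noteq> 0" using u zvec_invariants(3) by (simp_all add: zpoint_def)
    then have "proj_point k = proj_point k' \<longleftrightarrow> (zpoint r s t, zpoint r' s' t') \<in> proportional"
      unfolding k1 k2 proj_point_def prod.case by (intro eq_equiv_class_iff[OF equiv_proportional]) auto
    also have "\<dots> \<longleftrightarrow> (\<exists>c. zpoint r' s' t' = c *s zpoint r s t)"
    proof
      assume "\<exists>c. zpoint r' s' t' = c *s zpoint r s t"
      then obtain c where c: "zpoint r' s' t' = c *s zpoint r s t" by blast
      then have "c \<noteq> 0" using nz(2) by auto
      then show "(zpoint r s t, zpoint r' s' t') \<in> proportional" using c nz by blast
    qed blast
    finally show ?thesis by blast
  qed
  finally show ?thesis .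
qed

theorem theorem2:
  shows "char_variety_F2 homeomorphic_space CP3"
proof (rule quotient_maps_homeomorphic)
  show "quotient_map (top_of_set params) char_variety_F2 ((\<lambda>\<rho>. conjugation_rel `` {\<rho>}) \<circ> rep_point)"
    unfolding char_variety_F2_def
    by (rule quotient_map_compose[OF rep_point_quotient_map quotient_map_quotient_topology])
  show "quotient_map (top_of_set params) CP3 proj_point" by (rule proj_point_quotient_map)
  show "((\<lambda>\<rho>. conjugation_rel `` {\<rho>}) \<circ> rep_point) k = ((\<lambda>\<rho>. conjugation_rel `` {\<rho>}) \<circ> rep_point) k' \<longleftrightarrow>
      proj_point k = proj_point k'" if "k \<in> topspace (top_of_set params)" "k' \<in> topspace (top_of_set params)" for k k'
    using same_fibres that by simp
qed

end
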